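(* Let $\rho$ be the localized density described in the context. For every $\mu\in(0,4/3)$ there is a constant $c>0$ (depending only on $\mu$ and on the quantities listed in the context) such that $$\int_{\mathbb R^4}\rho^{3/2}(x,t)\Big\{\int_{\mathbb R^3}\frac{\big|\log|x-y|\big|^\mu+1}{|x-y|}\,\rho(y,t)\,dy\Big\}\,dx\,dt\le c .$$
   Context: $\Omega\subset\mathbb R^3$ is a bounded domain with $C^2$ boundary, $T>0$, $Q_T=\Omega\times(0,T)$, $\nu_1>0$, $\nu_1+\nu_2\ge0$, $\mathbb S=\mathbb S(\mathbf u_\varepsilon)=\nu_1(\nabla\mathbf u_\varepsilon+\nabla\mathbf u_\varepsilon^\top)+\nu_2\,\mathrm{div}\,\mathbf u_\varepsilon\,\mathbb I$, $\mathbf f\in L^\infty(Q_T)$, $m>1$, $\varepsilon\in(0,1]$, and $P_\varepsilon$ denotes the function $P_\varepsilon(x,t)=1+\varepsilon\varrho_\varepsilon(x,t)^m$. The pair $\varrho_\varepsilon\ge0$, $\mathbf u_\varepsilon$ on $Q_T$ satisfies $$\|\varrho_\varepsilon^{3/2}P_\varepsilon\|_{L^\infty(0,T;L^1(\Omega))}+\|\varrho_\varepsilon|\mathbf u_\varepsilon|^2\|_{L^\infty(0,T;L^1(\Omega))}+\|\mathbf u_\varepsilon\|_{L^2(0,T;W^{1,2}(\Omega))}\le E$$ and, for all $\boldsymbol\xi\in C_0^\infty(Q_T;\mathbb R^3)$, $\psi\in C_0^\infty(Q_T)$, $$\int_{Q_T}\varrho_\varepsilon\mathbf u_\varepsilon\cdot\partial_t\boldsymbol\xi\,dxdt+\int_{Q_T}\big(\varrho_\varepsilon\mathbf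 u_\varepsilon\otimes\mathbf u_\varepsilon+\varrho_\varepsilon^{3/2}P_\varepsilon\mathbb I-\mathbb S\big):\nabla\boldsymbol\xi\,dxdt+\int_{Q_T}\varrho_\varepsilon\mathbf f\cdot\boldsymbol\xi\,dxdt=0,$$ $$\int_{Q_T}\big(\varrho_\varepsilon\partial_t\psi+\varrho_\varepsilon\mathbf u_\varepsilon\cdot\nabla\psi\big)\,dxdt=0.$$ Fix a compact set $K\subset Q_T$ and a nonnegative $\lambda\in C_0^\infty(\mathbb R^4)$ with $\mathrm{supp}\,\lambda\subset Q_T$ and $\lambda=1$ in a neighborhood of $K$. Set $\rho=\lambda^4\varrho_\varepsilon$, $\mathbf v=\lambda\mathbf u_\varepsilon$, all functions being extended by zero to $\mathbb R^4=\mathbb R^3\times\mathbb R$. Constants $c$ depend only on $E$, $\Omega$, $T$, $\lambda$, $\nu_1,\nu_2$, $\|\mathbf f\|_{L^\infty(Q_T)}$ and the parameters indicated; they are independent of $\varepsilon$ and of the solution. *)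

theory Defs
  imports "HOL-Analysis.Analysis" "HOL-Probability.Essential_Supremum"
begin

type_synonym R3 = "real^3"
type_synonym R4 = "(real^3) \<times> real"

text \<open>Functions of class \<open>C\<^sup>k\<close> on an open set: all iterated directional derivatives of
  order at most \<open>k\<close> exist and are continuous.\<close>

primrec Ck_on :: "nat \<Rightarrow> 'a::euclidean_space set \<Rightarrow> ('a \<Rightarrow> 'b::real_normed_vector) \<Rightarrow> bool" where
  "Ck_on 0 S f \<longleftrightarrow> continuous_on S f"
| "Ck_on (Suc k) S f \<longleftrightarrow>
     (\<forall>x\<in>S. f differentiable (at x)) \<and>
     (\<forall>v. Ck_on k S (\<lambda>x. frechet_derivative f (at x) v))"

definition smooth_on :: "'a::euclidean_space set \<Rightarrow> ('a \<Rightarrow> 'b::real_normed_vector) \<Rightarrow> bool" where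
  "smooth_on S f \<longleftrightarrow> (\<forall>k. Ck_on k S f)"

definition support :: "('a::topological_space \<Rightarrow> 'b::zero) \<Rightarrow> 'a set" where
  "support f = closure {x. f x \<noteq> 0}"

text \<open>The space \<open>C\<^sub>0\<^sup>\<infinity>(U)\<close>, its elements being extended by zero to the whole space.\<close>

definition test_function :: "'a::euclidean_space set \<Rightarrow> ('a \<Rightarrow> 'b::real_normed_vector) \<Rightarrow> bool" where
  "test_function U \<phi> \<longleftrightarrow> smooth_on UNIV \<phi> \<and> compact (support \<phi>) \<and> support \<phi> \<subseteq> U"

text \<open>After a rotation or reflection \<open>A\<close> of the coordinate axes, the set lies near each of its
  boundary points strictly above the graph of a \<open>C\<^sup>2\<close> function.\<close>

definition C2_boundary :: "R3 set \<Rightarrow> bool" where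
  "C2_boundary \<Omega> \<longleftrightarrow>
     (\<forall>x0 \<in> frontier \<Omega>. \<exists>r>0. \<exists>(A :: R3 \<Rightarrow> R3) (\<gamma> :: real^2 \<Rightarrow> real).
        orthogonal_transformation A \<and> Ck_on 2 UNIV \<gamma> \<and>
        \<Omega> \<inter> ball x0 r = {x \<in> ball x0 r. A x $ 3 > \<gamma> (vector [A x $ 1, A x $ 2])})"

definition bounded_C2_domain :: "R3 set \<Rightarrow> bool" where
  "bounded_C2_domain \<Omega> \<longleftrightarrow>
     open \<Omega> \<and> connected \<Omega> \<and> \<Omega> \<noteq> {} \<and> bounded \<Omega> \<and> C2_boundary \<Omega>"

abbreviation cylinder :: "R3 set \<Rightarrow> real \<Rightarrow> R4 set" where
  "cylinder \<Omega> T \<equiv> \<Omega> \<times> {0<..<T}"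

definition zero_ext :: "'a set \<Rightarrow> ('a \<Rightarrow> 'b::zero) \<Rightarrow> 'a \<Rightarrow> 'b" where
  "zero_ext S g x = (if x \<in> S then g x else 0)"


definition dt :: "(R4 \<Rightarrow> 'b::real_normed_vector) \<Rightarrow> R4 \<Rightarrow> 'b" where
  "dt g z = frechet_derivative g (at z) (0, 1)"

definition grad_x :: "(R4 \<Rightarrow> real) \<Rightarrow> R4 \<Rightarrow> R3" where
  "grad_x g z = (\<chi> j. frechet_derivative g (at z) (axis j 1, 0))"

text \<open>Row \<open>i\<close>, column \<open>j\<close> of a gradient is the \<open>j\<close>-th derivative of the \<open>i\<close>-th component.\<close>

definition Grad_x :: "(R4 \<Rightarrow> R3) \<Rightarrow> R4 \<Rightarrow> real^3^3" where
  "Grad_x g z = (\<chi> i j. frechet_derivative g (at z) (axis j 1, 0) $ i)"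

definition tensor :: "R3 \<Rightarrow> R3 \<Rightarrow> real^3^3" where
  "tensor a b = (\<chi> i j. a $ i * b $ j)"

definition locally_integrable :: "R3 set \<Rightarrow> (R3 \<Rightarrow> 'b::euclidean_space) \<Rightarrow> bool" where
  "locally_integrable \<Omega> g \<longleftrightarrow> (\<forall>C. compact C \<and> C \<subseteq> \<Omega> \<longrightarrow> set_integrable lebesgue C g)"

definition weak_gradient :: "R3 set \<Rightarrow> (R3 \<Rightarrow> R3) \<Rightarrow> (R3 \<Rightarrow> real^3^3) \<Rightarrow> bool" where
  "weak_gradient \<Omega> w G \<longleftrightarrow>
     locally_integrable \<Omega> w \<and> locally_integrable \<Omega> G \<and>
     (\<forall>\<phi> :: R3 \<Rightarrow> real. test_function \<Omega> \<phi> \<longrightarrow>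
        (\<forall>i j. (\<integral>x. w x $ i * frechet_derivative \<phi> (at x) (axis j 1) \<partial>lebesgue_on \<Omega>)
             = - (\<integral>x. G x $ i $ j * \<phi> x \<partial>lebesgue_on \<Omega>)))"

text \<open>\<open>Du\<close> is the spatial weak gradient of \<open>u\<close> on the space-time cylinder; it is determined by
  \<open>u\<close> up to a null set. Since the dependence on \<open>t\<close> is jointly measurable, finiteness of
  \<open>norm_L2_W12 \<Omega> T u Du\<close> below then says that \<open>u\<close> belongs to \<open>L\<^sup>2(0,T;W\<^sup>1\<^sup>,\<^sup>2(\<Omega>))\<close>.\<close>

definition spatial_weak_gradient ::
    "R3 set \<Rightarrow> real \<Rightarrow> (R4 \<Rightarrow> R3) \<Rightarrow> (R4 \<Rightarrow> real^3^3) \<Rightarrow> bool" where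
  "spatial_weak_gradient \<Omega> T u Du \<longleftrightarrow>
     u \<in> borel_measurable (lebesgue_on (cylinder \<Omega> T)) \<and>
     Du \<in> borel_measurable (lebesgue_on (cylinder \<Omega> T)) \<and>
     (AE t in lebesgue_on {0<..<T}. weak_gradient \<Omega> (\<lambda>x. u (x, t)) (\<lambda>x. Du (x, t)))"


definition norm_Linf :: "R4 set \<Rightarrow> (R4 \<Rightarrow> 'b::real_normed_vector) \<Rightarrow> ennreal" where
  "norm_Linf Q g = esssup (lebesgue_on Q) (\<lambda>z. ennreal (norm (g z)))"

definition norm_Linf_L1 :: "R3 set \<Rightarrow> real \<Rightarrow> (R4 \<Rightarrow> real) \<Rightarrow> ennreal" where
  "norm_Linf_L1 \<Omega> T g =
     esssup (lebesgue_on {0<..<T}) (\<lambda>t. \<integral>\<^sup>+x. ennreal \<bar>g (x, t)\<bar> \<partial>lebesgue_on \<Omega>)"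

definition ennsqrt :: "ennreal \<Rightarrow> ennreal" where
  "ennsqrt a = (if a = \<infinity> then \<infinity> else ennreal (sqrt (enn2real a)))"

definition norm_L2_W12 ::
    "R3 set \<Rightarrow> real \<Rightarrow> (R4 \<Rightarrow> R3) \<Rightarrow> (R4 \<Rightarrow> real^3^3) \<Rightarrow> ennreal" where
  "norm_L2_W12 \<Omega> T u Du =
     ennsqrt (\<integral>\<^sup>+t. (\<integral>\<^sup>+x. ennreal ((norm (u (x, t)))\<^sup>2 + (norm (Du (x, t)))\<^sup>2)
                     \<partial>lebesgue_on \<Omega>) \<partial>lebesgue_on {0<..<T})"


definition stress :: "real \<Rightarrow> real \<Rightarrow> real^3^3 \<Rightarrow> real^3^3" where
  "stress \<nu>1 \<nu>2 D = \<nu>1 *\<^sub>R (D + transpose D) + (\<nu>2 * trace D) *\<^sub>R mat 1"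

definition P_eps :: "real \<Rightarrow> real \<Rightarrow> (R4 \<Rightarrow> real) \<Rightarrow> R4 \<Rightarrow> real" where
  "P_eps m \<epsilon> \<rho> z = 1 + \<epsilon> * \<rho> z powr m"

text \<open>On \<open>real^3^3\<close> the inner product is the contraction \<open>A : B\<close>. All integrands below are
  integrable as soon as the energy norms are finite.\<close>

definition momentum_equation ::
    "R3 set \<Rightarrow> real \<Rightarrow> real \<Rightarrow> real \<Rightarrow> real \<Rightarrow> real \<Rightarrow> (R4 \<Rightarrow> R3) \<Rightarrow>
     (R4 \<Rightarrow> real) \<Rightarrow> (R4 \<Rightarrow> R3) \<Rightarrow> (R4 \<Rightarrow> real^3^3) \<Rightarrow> bool" where
  "momentum_equation \<Omega> T \<nu>1 \<nu>2 m \<epsilon> f \<rho> u Du \<longleftrightarrow>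
     (\<forall>\<xi> :: R4 \<Rightarrow> R3. test_function (cylinder \<Omega> T) \<xi> \<longrightarrow>
        (\<integral>z. \<rho> z * (u z \<bullet> dt \<xi> z) \<partial>lebesgue_on (cylinder \<Omega> T))
      + (\<integral>z. (\<rho> z *\<^sub>R tensor (u z) (u z)
               + (\<rho> z powr (3/2) * P_eps m \<epsilon> \<rho> z) *\<^sub>R mat 1
               - stress \<nu>1 \<nu>2 (Du z)) \<bullet> Grad_x \<xi> z \<partial>lebesgue_on (cylinder \<Omega> T))
      + (\<integral>z. \<rho> z * (f z \<bullet> \<xi> z) \<partial>lebesgue_on (cylinder \<Omega> T)) = 0)"

definition continuity_equation ::
    "R3 set \<Rightarrow> real \<Rightarrow> (R4 \<Rightarrow> real) \<Rightarrow> (R4 \<Rightarrow> R3) \<Rightarrow> bool" where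
  "continuity_equation \<Omega> T \<rho> u \<longleftrightarrow>
     (\<forall>\<psi> :: R4 \<Rightarrow> real. test_function (cylinder \<Omega> T) \<psi> \<longrightarrow>
        (\<integral>z. \<rho> z * dt \<psi> z + \<rho> z * (u z \<bullet> grad_x \<psi> z) \<partial>lebesgue_on (cylinder \<Omega> T)) = 0)"

definition energy_bound ::
    "R3 set \<Rightarrow> real \<Rightarrow> real \<Rightarrow> real \<Rightarrow> real \<Rightarrow> (R4 \<Rightarrow> real) \<Rightarrow> (R4 \<Rightarrow> R3) \<Rightarrow>
     (R4 \<Rightarrow> real^3^3) \<Rightarrow> bool" where
  "energy_bound \<Omega> T m \<epsilon> E \<rho> u Du \<longleftrightarrow>
     norm_Linf_L1 \<Omega> T (\<lambda>z. \<rho> z powr (3/2) * P_eps m \<epsilon> \<rho> z)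
     + norm_Linf_L1 \<Omega> T (\<lambda>z. \<rho> z * (norm (u z))\<^sup>2)
     + norm_L2_W12 \<Omega> T u Du \<le> ennreal E"

definition localized_density :: "R3 set \<Rightarrow> real \<Rightarrow> (R4 \<Rightarrow> real) \<Rightarrow> (R4 \<Rightarrow> real) \<Rightarrow> R4 \<Rightarrow> real" where
  "localized_density \<Omega> T lam \<rho>\<epsilon> = zero_ext (cylinder \<Omega> T) (\<lambda>z. lam z ^ 4 * \<rho>\<epsilon> z)"

end

theory Submission
  imports Defs "HOL-Probability.Distributions"
begin

text \<open>
  Put \<open>L(q) = ln (e^4 + 1/q)\<close> and \<open>k\<^sub>b(q) = L(q)^b q^(-1/2)\<close>, and for \<open>d > 0\<close> let
  \<open>K(w) = k\<^sub>\<mu>(d\<^sup>2 + |w|\<^sup>2) w\<close>. The proof doubles the variables, \<open>z = (x,t)\<close> and \<open>z' = (y,s)\<close>, with a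
  Gaussian \<open>\<eta>((t - s)/h)\<close> in time: the momentum equation at \<open>z\<close> is tested with \<open>\<lambda>\<^sup>2(z) \<eta> K(x - y)\<close> and
  integrated against \<open>(\<lambda>\<^sup>2\<rho>)(z')\<close>; the continuity equation at \<open>z'\<close> is tested with
  \<open>\<lambda>\<^sup>2(z') \<eta> u(z) \<bullet> K(x - y)\<close> and integrated against \<open>(\<lambda>\<^sup>2\<rho>)(z)\<close>. In the sum the terms with \<open>\<eta>'\<close> cancel.
  After symmetrization in \<open>z\<close> and \<open>z'\<close> the convective terms form the quadratic form of \<open>DK\<close> at
  \<open>u(z) - u(z')\<close>, whose negative part is of lower order, at most \<open>2\<mu> k\<^bsub>\<mu>-1\<^esub> |u(z) - u(z')|\<^sup>2\<close>, while
  the pressure \<open>p\<close> contributes at least \<open>k\<^sub>\<mu> (p(z) \<rho>(z') + p(z') \<rho>(z))\<close>; the summand \<open>e^4\<close> makes \<open>L \<ge> 4\<close>,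
  which yields the latter bound. The negative part is absorbed by
  \<open>\<rho>U\<^sup>2 k\<^bsub>\<mu>-1\<^esub> \<le> \<delta> \<rho>^(3/2) k\<^sub>\<mu> + C\<^sub>\<delta> (\<rho>U\<^sup>2)^(2/3) U\<^sup>2 k\<^bsub>\<mu>-5/3\<^esub>\<close>, where the cube
  \<open>k\<^bsub>\<mu>-5/3\<^esub>^3 = L^(3\<mu>-5) q^(-3/2)\<close> is integrable near the origin, uniformly in \<open>d\<close>, because \<open>\<mu> < 4/3\<close>.
  What remains is controlled by the energy and by the Sobolev embedding of \<open>W\<^sup>1\<^sup>,\<^sup>2\<close> into \<open>L\<^sup>6\<close> applied to
  \<open>\<lambda>u(\<cdot>,t)\<close>. Finally \<open>h \<rightarrow> 0\<close> and \<open>d \<rightarrow> 0\<close>, by continuity of translations in \<open>L\<^sup>1\<close> and Fatou's lemma.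
\<close>

section \<open>Calculus of continuously differentiable functions\<close>

text \<open>Testing the momentum equation with the convolution of K and
  \<open>\<lambda>\<^sup>2 \<rho>\<close> is not allowed, because \<open>\<rho>\<close> has no
  regularity. Doubling removes this obstacle: while one point is tested the other is frozen, so
  \<open>\<rho>(z')\<close> and \<open>u(z)\<close> enter only as constants, and every test function
  is an explicit smooth function times the cutoff. The price is the form of the estimates: each
  remainder must be a quantity integrable at one point times a quantity whose spatial integral at
  the other point is bounded uniformly in time; the Gaussian then contributes exactly one factor
  \<open>h\<close>, which is divided out. This dictates the exponents. Under Young's inequality with
  3/2 and 3, \<open>\<rho>^(3/2)\<close> is dual to the cube of the kernel; the same pair, as
  Hoelder exponents in space, matches the kinetic energy in L^1 with the Sobolev space L^6. In
  dimension three the cubed kernel has the borderline singularity |w|^(-3), so the power of the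
  logarithm decides. The parameters \<open>m\<close> and \<open>\<epsilon>\<close> enter only
  through the pressure, of which the lower bound \<open>\<rho>^(3/2)\<close> and the energy bound
  are used; this makes the constants uniform.\<close>

lemma Ck_on_SucD:
  fixes f :: "'a::euclidean_space \<Rightarrow> 'b::real_normed_vector"
  shows "Ck_on (Suc k) UNIV f \<Longrightarrow> Ck_on k UNIV f"
proof (induction k arbitrary: f)
  case 0
  then show ?case
    by (auto intro!: continuous_at_imp_continuous_on differentiable_imp_continuous_within)
next
  case (Suc k)
  from Suc.prems have d: "f differentiable (at x)" for x by simp
  from Suc.prems have "Ck_on (Suc k) UNIV (\<lambda>x. frechet_derivative f (at x) v)" for v
    by (metis Ck_on.simps(2))
  with Suc.IH d show ?case by simp
qed

text \<open>Uniqueness of the derivative identifies any candidate \<open>D x\<close> with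
  \<open>frechet_derivative f (at x)\<close>. The closure lemmas below can thus quote the product or
  chain rule for \<open>D\<close> directly.\<close>

lemma Ck_on_SucI:
  fixes f :: "'a::euclidean_space \<Rightarrow> 'b::real_normed_vector"
  assumes "\<And>x. (f has_derivative D x) (at x)" and "\<And>v. Ck_on k UNIV (\<lambda>x. D x v)"
  shows "Ck_on (Suc k) UNIV f"
proof -
  have "D x = frechet_derivative f (at x)" for x
    by (rule frechet_derivative_at[OF assms(1)])
  with assms show ?thesis
    by (auto simp: differentiable_def)
qed

lemma Ck_on_Suc_deriv:
  fixes f :: "'a::euclidean_space \<Rightarrow> 'b::real_normed_vector"
  assumes "Ck_on (Suc k) UNIV f"
  shows "(f has_derivative frechet_derivative f (at x)) (at x)"
    and "Ck_on k UNIV (\<lambda>x. frechet_derivative f (at x) v)"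
  using assms by (auto simp: frechet_derivative_works[symmetric])

lemma Ck_on_const: "Ck_on k UNIV (\<lambda>x::'a::euclidean_space. c::'b::real_normed_vector)"
proof (induction k arbitrary: c)
  case (Suc k)
  show ?case by (rule Ck_on_SucI[where D="\<lambda>_ _. 0"]) (auto intro: Suc)
qed auto

lemma Ck_on_linear:
  fixes f :: "'a::euclidean_space \<Rightarrow> 'b::real_normed_vector"
  assumes "bounded_linear f"
  shows "Ck_on k UNIV f"
proof (cases k)
  case 0
  then show ?thesis using assms by (simp add: linear_continuous_on)
next
  case (Suc n)
  show ?thesis unfolding Suc
    by (rule Ck_on_SucI[where D="\<lambda>_. f"])
       (auto intro: Ck_on_const bounded_linear_imp_has_derivative assms)
qed

lemma Ck_on_add:
  fixes f g :: "'a::euclidean_space \<Rightarrow> 'b::real_normed_vector"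
  assumes "Ck_on k UNIV f" "Ck_on k UNIV g"
  shows "Ck_on k UNIV (\<lambda>x. f x + g x)"
  using assms
proof (induction k arbitrary: f g)
  case 0
  then show ?case by (auto intro: continuous_on_add)
next
  case (Suc k)
  show ?case
    by (rule Ck_on_SucI[OF has_derivative_add[OF Ck_on_Suc_deriv(1)[OF Suc.prems(1)]
          Ck_on_Suc_deriv(1)[OF Suc.prems(2)]]])
       (intro Suc.IH Ck_on_Suc_deriv(2)[OF Suc.prems(1)] Ck_on_Suc_deriv(2)[OF Suc.prems(2)])
qed

text \<open>The derivative of a bilinear product is a sum of two products of the same kind, one
  factor differentiated and the other merely lowered by \<open>Ck_on_SucD\<close>; so one induction
  covers \<open>*\<close>, \<open>*\<^sub>R\<close> and the inner product.\<close>

lemma Ck_on_bilinear: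
  fixes f :: "'a::euclidean_space \<Rightarrow> 'b::real_normed_vector" and g :: "'a \<Rightarrow> 'c::real_normed_vector"
    and h :: "'b \<Rightarrow> 'c \<Rightarrow> 'd::real_normed_vector"
  assumes h: "bounded_bilinear h" and "Ck_on k UNIV f" "Ck_on k UNIV g"
  shows "Ck_on k UNIV (\<lambda>x. h (f x) (g x))"
  using assms(2,3)
proof (induction k arbitrary: f g)
  case 0
  then show ?case by (auto intro: bounded_bilinear.continuous_on[OF h])
next
  case (Suc k)
  show ?case
    by (rule Ck_on_SucI[OF bounded_bilinear.FDERIV[OF h Ck_on_Suc_deriv(1)[OF Suc.prems(1)]
          Ck_on_Suc_deriv(1)[OF Suc.prems(2)]]])
       (intro Ck_on_add Suc.IH Ck_on_Suc_deriv(2)[OF Suc.prems(1)]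
          Ck_on_Suc_deriv(2)[OF Suc.prems(2)] Ck_on_SucD[OF Suc.prems(1)] Ck_on_SucD[OF Suc.prems(2)])
qed

lemmas Ck_on_mult = Ck_on_bilinear[OF bounded_bilinear_mult]
  and Ck_on_scaleR = Ck_on_bilinear[OF bounded_bilinear_scaleR]
  and Ck_on_inner = Ck_on_bilinear[OF bounded_bilinear_inner]

lemma Ck_on_diff:
  fixes f g :: "'a::euclidean_space \<Rightarrow> 'b::real_normed_vector"
  assumes "Ck_on k UNIV f" "Ck_on k UNIV g"
  shows "Ck_on k UNIV (\<lambda>x. f x - g x)"
  using Ck_on_add[OF assms(1) Ck_on_scaleR[OF Ck_on_const[of k "-1"] assms(2)]] by simp

lemma Ck_on_exp:
  fixes f :: "'a::euclidean_space \<Rightarrow> real"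
  assumes "Ck_on k UNIV f"
  shows "Ck_on k UNIV (\<lambda>x. exp (f x))"
  using assms
proof (induction k arbitrary: f)
  case 0
  then show ?case by (auto intro: continuous_on_exp)
next
  case (Suc k)
  show ?case
    by (rule Ck_on_SucI[OF has_derivative_exp[OF Ck_on_Suc_deriv(1)[OF Suc.prems]]])
       (intro Ck_on_mult Suc.IH Ck_on_Suc_deriv(2)[OF Suc.prems] Ck_on_SucD[OF Suc.prems])
qed

text \<open>The exponent is generalized in the induction because differentiation replaces
  \<open>a\<close> by \<open>a - 1\<close>.\<close>

lemma Ck_on_powr:
  fixes f :: "'a::euclidean_space \<Rightarrow> real"
  assumes "Ck_on k UNIV f" and pos: "\<And>x. f x > 0"
  shows "Ck_on k UNIV (\<lambda>x. f x powr a)"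
  using assms(1)
proof (induction k arbitrary: a)
  case 0
  then show ?case using pos by (auto intro!: continuous_on_powr simp: less_imp_neq[OF pos, symmetric])
next
  case (Suc k)
  have "((\<lambda>x. f x powr a) has_derivative (\<lambda>v. (a * f x powr (a - 1)) * frechet_derivative f (at x) v)) (at x)" for x
    using has_derivative_compose[OF Ck_on_Suc_deriv(1)[OF Suc.prems], of "\<lambda>y. y powr a" "\<lambda>y. (a * f x powr (a - 1)) * y" x]
      has_real_derivative_powr[OF pos[of x], of a]
    by (simp add: has_field_derivative_def)
  then show ?case
    by (rule Ck_on_SucI)
       (intro Ck_on_mult Ck_on_const Suc.IH Ck_on_Suc_deriv(2)[OF Suc.prems] Ck_on_SucD[OF Suc.prems])
qed

text \<open>One differentiation turns the logarithm into the power -1, already treated, so a case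
  distinction replaces an induction.\<close>

lemma Ck_on_ln:
  fixes f :: "'a::euclidean_space \<Rightarrow> real"
  assumes "Ck_on k UNIV f" and pos: "\<And>x. f x > 0"
  shows "Ck_on k UNIV (\<lambda>x. ln (f x))"
proof (cases k)
  case 0
  then show ?thesis using assms by (auto intro!: continuous_on_ln simp: less_imp_neq[OF pos, symmetric])
next
  case (Suc n)
  note f = assms(1)[unfolded Suc]
  have "((\<lambda>x. ln (f x)) has_derivative (\<lambda>v. f x powr (-1) * frechet_derivative f (at x) v)) (at x)" for x
    using has_derivative_ln[OF pos Ck_on_Suc_deriv(1)[OF f], of x] pos[of x]
    by (simp add: powr_minus_divide divide_inverse mult.commute)
  then show ?thesis unfolding Suc
    by (rule Ck_on_SucI)
       (intro Ck_on_mult Ck_on_powr pos Ck_on_Suc_deriv(2)[OF f] Ck_on_SucD[OF f])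
qed

section \<open>Logarithmically corrected kernels\<close>

definition lgw :: "real \<Rightarrow> real" where
  "lgw q = ln (exp 4 + 1 / q)"

definition ker :: "real \<Rightarrow> real \<Rightarrow> real" where
  "ker b q = lgw q powr b * q powr (-1/2)"

text \<open>The derivative of \<open>ker b\<close> in \<open>q\<close>. The first term
  differentiates the power, the second the logarithm, where one power of the logarithm is lost and
  \<open>ker (b - 1)\<close> appears.\<close>

definition dker :: "real \<Rightarrow> real \<Rightarrow> real" where
  "dker b q = - ker b q / (2 * q) - b * ker (b - 1) q / (q * (exp 4 * q + 1))"

definition cubker :: "real \<Rightarrow> real \<Rightarrow> real" where
  "cubker \<mu> q = lgw q powr (3 * \<mu> - 5) * q powr (-3/2)"

lemma lgw_ge: "q > 0 \<Longrightarrow> lgw q \<ge> 4"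
  unfolding lgw_def by (subst ln_ge_iff) (auto intro: add_pos_pos)

lemma lgw_pos: "q > 0 \<Longrightarrow> lgw q > 0"
  using lgw_ge[of q] by simp

lemma lgw_ge_minus_ln: "q > 0 \<Longrightarrow> lgw q \<ge> - ln q"
proof -
  assume q: "q > 0"
  have "ln (1 / q) \<le> ln (exp 4 + 1 / q)"
    using q by (subst ln_le_cancel_iff) (auto intro: add_pos_pos)
  then show ?thesis using q by (simp add: lgw_def ln_div)
qed

lemma lgw_antimono: "0 < p \<Longrightarrow> p \<le> q \<Longrightarrow> lgw q \<le> lgw p"
  unfolding lgw_def by (subst ln_le_cancel_iff) (auto intro: add_pos_pos simp: frac_le)

lemma lgw_deriv:
  assumes "q > 0"
  shows "(lgw has_real_derivative (- 1 / (q * (exp 4 * q + 1)))) (at q)"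
proof -
  have p: "exp 4 + 1 / q > 0" using assms by (simp add: add_pos_pos)
  have "(lgw has_real_derivative ((- 1 / q^2) / (exp 4 + 1 / q))) (at q)"
    unfolding lgw_def using assms p
    by (auto intro!: derivative_eq_intros simp: power2_eq_square)
  moreover have "(- 1 / q^2) / (exp 4 + 1 / q) = - 1 / (q * (exp 4 * q + 1))"
    using assms p by (simp add: field_simps power2_eq_square)
  ultimately show ?thesis by simp
qed

lemma ker_pos: "q > 0 \<Longrightarrow> ker b q > 0"
  using lgw_pos[of q] by (simp add: ker_def)

lemma ker_deriv:
  assumes "q > 0"
  shows "(ker b has_real_derivative dker b q) (at q)"
proof -
  have "((\<lambda>q. lgw q powr b) has_real_derivative (b * lgw q powr (b - 1)) * (- 1 / (q * (exp 4 * q + 1)))) (at q)"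
    by (rule DERIV_chain2[OF has_real_derivative_powr lgw_deriv]) (use assms lgw_pos in auto)
  moreover have "((\<lambda>q. q powr (-1/2)) has_real_derivative (-1/2) * q powr (-1/2 - 1)) (at q)"
    by (rule has_real_derivative_powr[OF assms])
  ultimately have "(ker b has_real_derivative
     (b * lgw q powr (b - 1)) * (- 1 / (q * (exp 4 * q + 1))) * q powr (-1/2)
      + ((-1/2) * q powr (-1/2 - 1)) * lgw q powr b) (at q)"
    unfolding ker_def by (rule DERIV_mult)
  moreover have "q powr (-1/2 - 1) = q powr (-1/2) / q"
    using assms by (subst powr_diff) simp
  ultimately show ?thesis
    by (simp add: dker_def ker_def mult_ac add.commute)
qed

text \<open>One extra logarithm is worth at least a factor 4. In \<open>ker_trace\<close> this has
  to beat \<open>2 * \<mu>\<close>, which is below 8/3.\<close>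

lemma ker_lower_le:
  assumes "q > 0"
  shows "4 * ker (b - 1) q \<le> ker b q"
proof -
  have "lgw q powr b = lgw q powr (b - 1) * lgw q"
    using lgw_pos[OF assms] by (simp add: powr_diff)
  moreover have "lgw q powr (b - 1) * 4 \<le> lgw q powr (b - 1) * lgw q"
    by (rule mult_left_mono) (use lgw_ge[OF assms] in auto)
  ultimately have "4 * lgw q powr (b - 1) \<le> lgw q powr b" by linarith
  then have "(4 * lgw q powr (b - 1)) * q powr (-1/2) \<le> lgw q powr b * q powr (-1/2)"
    by (rule mult_right_mono) simp
  then show ?thesis unfolding ker_def by (simp only: mult.assoc)
qed

text \<open>Here \<open>s\<close> stands for |w|^2 while \<open>q\<close> is d^2 + |w|^2, so
  \<open>s / q\<close> and its quotient by \<open>exp 4 * q + 1\<close> are at most 1.\<close>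

lemma dker_bounds:
  assumes "q > 0" "0 < \<mu>" "0 \<le> s" "s \<le> q"
  shows "- ker \<mu> q - 2 * \<mu> * ker (\<mu> - 1) q \<le> 2 * dker \<mu> q * s" "dker \<mu> q \<le> 0"
proof -
  have D: "2 * dker \<mu> q * s = - ker \<mu> q * (s / q) - 2 * \<mu> * ker (\<mu> - 1) q * ((s / q) / (exp 4 * q + 1))"
    using assms unfolding dker_def by (simp add: field_simps)
  have 1: "s / q \<le> 1" using assms by simp
  have 2: "(s / q) / (exp 4 * q + 1) \<le> 1"
  proof -
    have "(s / q) / (exp 4 * q + 1) \<le> 1 / 1"
      using assms 1 by (intro frac_le) auto
    then show ?thesis by simp
  qed
  have "ker \<mu> q * (s / q) \<le> ker \<mu> q * 1" 
    by (intro mult_left_mono 1 less_imp_le[OF ker_pos] assms)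
  moreover have "2 * \<mu> * ker (\<mu> - 1) q * ((s / q) / (exp 4 * q + 1)) \<le> 2 * \<mu> * ker (\<mu> - 1) q * 1"
    using ker_pos[of q "\<mu> - 1"] assms by (intro mult_left_mono 2) auto
  ultimately show "- ker \<mu> q - 2 * \<mu> * ker (\<mu> - 1) q \<le> 2 * dker \<mu> q * s"
    unfolding D by linarith
  show "dker \<mu> q \<le> 0"
    using ker_pos[of q "\<mu> - 1"] ker_pos[of q \<mu>] assms unfolding dker_def
    by (smt (verit, best) divide_nonneg_pos exp_gt_zero mult_nonneg_nonneg mult_pos_pos divide_minus_left)
qed

text \<open>For the pure power q^(-1/2) the form is |v|^2 - (z.v)^2 / q up to a positive factor,
  nonnegative by Cauchy-Schwarz since |z|^2 is at most \<open>q\<close>. Only the derivative of the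
  logarithm leaves a negative remainder, one logarithm weaker.\<close>

lemma ker_quadratic_form:
  fixes z v :: "'a::real_inner"
  assumes "q > 0" "0 < \<mu>" "z \<bullet> z \<le> q"
  shows "ker \<mu> q * (v \<bullet> v) + 2 * dker \<mu> q * (z \<bullet> v)\<^sup>2 \<ge> - 2 * \<mu> * ker (\<mu> - 1) q * (v \<bullet> v)"
proof -
  have "(z \<bullet> v)\<^sup>2 \<le> (z \<bullet> z) * (v \<bullet> v)" by (rule Cauchy_Schwarz_ineq)
  then have "2 * dker \<mu> q * (z \<bullet> v)\<^sup>2 \<ge> 2 * dker \<mu> q * ((z \<bullet> z) * (v \<bullet> v))"
    using dker_bounds(2)[OF assms(1,2), of "z \<bullet> z"] assms by (intro mult_left_mono_neg) auto
  also have "2 * dker \<mu> q * ((z \<bullet> z) * (v \<bullet> v)) = (2 * dker \<mu> q * (z \<bullet> z)) * (v \<bullet> v)" by simp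
  also have "\<dots> \<ge> (- ker \<mu> q - 2 * \<mu> * ker (\<mu> - 1) q) * (v \<bullet> v)"
    using dker_bounds(1)[OF assms(1,2), of "z \<bullet> z"] assms by (intro mult_right_mono) auto
  finally show ?thesis by (simp add: algebra_simps)
qed

text \<open>The left side is the divergence of the vector field, the factor of the pressure. Of the
  three copies of \<open>ker \<mu> q\<close> the power costs at most one, and the logarithm at most
  another because \<open>2 * \<mu> < 4\<close>.\<close>

lemma ker_trace:
  assumes "q > 0" "0 < \<mu>" "\<mu> < 4/3" "0 \<le> s" "s \<le> q"
  shows "3 * ker \<mu> q + 2 * dker \<mu> q * s \<ge> ker \<mu> q" "2 * \<bar>dker \<mu> q\<bar> * s \<le> 2 * ker \<mu> q"
proof -
  have "2 * \<mu> * ker (\<mu> - 1) q \<le> 4 * ker (\<mu> - 1) q"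
    using assms ker_pos[of q "\<mu> - 1"] by (intro mult_right_mono) auto
  then have a: "2 * \<mu> * ker (\<mu> - 1) q \<le> ker \<mu> q" using ker_lower_le[OF assms(1), of \<mu>] by linarith
  with dker_bounds[OF assms(1,2,4,5)]
  show "3 * ker \<mu> q + 2 * dker \<mu> q * s \<ge> ker \<mu> q" "2 * \<bar>dker \<mu> q\<bar> * s \<le> 2 * ker \<mu> q" 
    by (auto simp: abs_if)
qed

text \<open>Comparing \<open>U\<^sup>2\<close> with \<open>e \<surd>r L\<close> decides which of the two terms on the right absorbs the left one.\<close>

lemma ker_interpolation:
  assumes "q > 0" "r \<ge> 0" "U \<ge> 0" "e > 0"
  shows "r * U\<^sup>2 * ker (\<mu> - 1) q \<le> e * r powr (3/2) * ker \<mu> q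
           + e powr (-2/3) * ((r * U\<^sup>2) powr (2/3) * U\<^sup>2) * ker (\<mu> - 5/3) q"
proof -
  define L where "L = lgw q"
  have L: "L > 0" unfolding L_def by (rule lgw_pos[OF assms(1)])
  \<comment> \<open>All three kernels contain the factor \<open>ker (\<mu> - 1) q\<close>; dividing
    by it leaves the scalar inequality \<open>main\<close> in \<open>r\<close>, \<open>U\<close> and
    \<open>L\<close>.\<close>
  have k: "ker \<mu> q = ker (\<mu> - 1) q * L" "ker (\<mu> - 5/3) q = ker (\<mu> - 1) q * L powr (-2/3)"
  proof -
    have "L powr (\<mu> - 1) * L = L powr \<mu>"
      using L by (simp add: powr_diff)
    then show "ker \<mu> q = ker (\<mu> - 1) q * L"
      unfolding ker_def L_def[symmetric] by (metis mult.assoc mult.commute)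
    have "L powr (\<mu> - 1) * L powr (-2/3) = L powr (\<mu> - 5/3)"
      by (simp add: powr_add[symmetric])
    then show "ker (\<mu> - 5/3) q = ker (\<mu> - 1) q * L powr (-2/3)"
      unfolding ker_def L_def[symmetric] by (metis mult.assoc mult.commute)
  qed
  have main: "r * U\<^sup>2 \<le> e * r powr (3/2) * L + e powr (-2/3) * ((r * U\<^sup>2) powr (2/3) * U\<^sup>2) * L powr (-2/3)"
  proof (cases "r = 0 \<or> U = 0")
    case True then show ?thesis using assms L by auto
  next
    case False
    then have r: "r > 0" and U: "U > 0" using assms by auto
    show ?thesis
    proof (cases "U\<^sup>2 \<le> e * r powr (1/2) * L")
      case True
      have "r * U\<^sup>2 \<le> r * (e * r powr (1/2) * L)" using True r by (intro mult_left_mono) auto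
      also have "\<dots> = e * (r powr 1 * r powr (1/2)) * L" using r by simp
      also have "\<dots> = e * r powr (3/2) * L" by (subst powr_add[symmetric]) simp
      finally have "r * U\<^sup>2 \<le> e * r powr (3/2) * L" .
      moreover have "0 \<le> e powr (-2/3) * ((r * U\<^sup>2) powr (2/3) * U\<^sup>2) * L powr (-2/3)"
        by simp
      ultimately show ?thesis by linarith
    next
      case False
      then have "(e * r powr (1/2) * L) powr (2/3) \<le> (U\<^sup>2) powr (2/3)"
        using assms L r by (intro powr_mono2) auto
      then have 1: "e powr (2/3) * r powr (1/3) * L powr (2/3) \<le> (U\<^sup>2) powr (2/3)"
        using assms L r by (simp add: powr_mult powr_powr)
      \<comment> \<open>With the cube root of \<open>U\<^sup>2\<close> as variable, the powers of
        \<open>U\<close> that occur become the integer powers 2 and 3 of \<open>A\<close>.\<close>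
      define A where "A = (U\<^sup>2) powr (1/3)"
      have A: "(U\<^sup>2) powr (2/3) = A^2" "U\<^sup>2 = A^3" "A > 0"
      proof -
        show "(U\<^sup>2) powr (2/3) = A^2" unfolding A_def power2_eq_square using U
          by (subst powr_add[symmetric]) simp
        have "A ^ 3 = ((U\<^sup>2) powr (1/3)) powr 3"
          unfolding A_def using U by (subst powr_numeral) auto
        also have "\<dots> = U\<^sup>2" using U by (simp add: powr_powr)
        finally show "U\<^sup>2 = A^3" by simp
        show "A > 0" unfolding A_def using U by simp
      qed
      have r3: "r = r powr (2/3) * r powr (1/3)" using r by (simp add: powr_add[symmetric])
      have inv: "e powr (2/3) * e powr (-2/3) = 1" "L powr (2/3) * L powr (-2/3) = 1"
        using assms L by (simp_all add: powr_add[symmetric])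
      have "r powr (1/3) = (e powr (2/3) * r powr (1/3) * L powr (2/3)) * (e powr (-2/3) * L powr (-2/3))"
      proof -
        have "(e powr (2/3) * r powr (1/3) * L powr (2/3)) * (e powr (-2/3) * L powr (-2/3))
            = (e powr (2/3) * e powr (-2/3)) * (L powr (2/3) * L powr (-2/3)) * r powr (1/3)"
          by (simp only: mult_ac)
        then show ?thesis unfolding inv by simp
      qed
      also have "\<dots> \<le> A^2 * (e powr (-2/3) * L powr (-2/3))"
        by (intro mult_right_mono 1[unfolded A(1)]) auto
      finally have 2: "r powr (1/3) \<le> A^2 * (e powr (-2/3) * L powr (-2/3))" .
      have "r * U\<^sup>2 = (r powr (2/3) * r powr (1/3)) * A^3"
        unfolding r3[symmetric] A(2) ..
      also have "\<dots> = (r powr (2/3) * A^3) * r powr (1/3)"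
        by (simp only: mult_ac)
      also have "\<dots> \<le> (r powr (2/3) * A^3) * (A^2 * (e powr (-2/3) * L powr (-2/3)))"
        using 2 A(3) by (intro mult_left_mono) auto
      also have "\<dots> = e powr (-2/3) * ((r powr (2/3) * A^2) * A^3) * L powr (-2/3)"
        by (simp add: mult_ac)
      also have "\<dots> = e powr (-2/3) * ((r * U\<^sup>2) powr (2/3) * U\<^sup>2) * L powr (-2/3)"
        using r U by (simp only: powr_mult A(1)[symmetric] A(2)[symmetric])
      finally show ?thesis using assms L by (smt (verit) mult_nonneg_nonneg powr_ge_zero)
    qed
  qed
  have "r * U\<^sup>2 * ker (\<mu> - 1) q \<le> (e * r powr (3/2) * L + e powr (-2/3) * ((r * U\<^sup>2) powr (2/3) * U\<^sup>2) * L powr (-2/3)) * ker (\<mu> - 1) q"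
    by (intro mult_right_mono main less_imp_le[OF ker_pos] assms)
  then show ?thesis unfolding k by (simp add: algebra_simps)
qed

section \<open>The cubed kernel: monotonicity, domination of other kernels, integral over
  balls\<close>

lemma cubker_pos: "q > 0 \<Longrightarrow> cubker \<mu> q > 0"
  using lgw_pos[of q] by (simp add: cubker_def)

lemma ker_cubed: "q > 0 \<Longrightarrow> ker (\<mu> - 5/3) q ^ 3 = cubker \<mu> q"
proof -
  assume q: "q > 0"
  have "ker (\<mu> - 5/3) q ^ 3 = ker (\<mu> - 5/3) q powr 3"
    by (rule powr_numeral[OF less_imp_le[OF ker_pos[OF q]], symmetric])
  also have "\<dots> = cubker \<mu> q"
    unfolding ker_def cubker_def using lgw_pos[OF q] q
    by (simp add: powr_mult powr_powr algebra_simps)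
  finally show ?thesis .
qed

text \<open>Monotonicity is not evident, since the logarithm carries a negative power and that
  factor increases with \<open>q\<close>. Part of the power of \<open>q\<close> compensates:
  q^(3/10) times the logarithm is nondecreasing, and after this factor is split off the remaining
  exponent of \<open>q\<close> is still negative.\<close>

lemma cubker_antimono:
  assumes "0 < p" "p \<le> q" "0 < \<mu>" "\<mu> < 4/3"
  shows "cubker \<mu> q \<le> cubker \<mu> p"
proof -
  \<comment> \<open>The exponent 3/10 meets two demands: 3/10 * 4 exceeds 1, which with
    \<open>lgw q \<ge> 4\<close> makes the derivative nonnegative, and 3/10 * 5 equals 3/2, so that
    \<open>3/10 * s - 3/2\<close> is negative for \<open>s < 5\<close>.\<close>
  define G where "G = (\<lambda>q::real. q powr (3/10) * lgw q)"
  have mono: "G p \<le> G q"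
  proof (rule DERIV_nonneg_imp_nondecreasing[OF assms(2)])
    fix x assume "p \<le> x" "x \<le> q"
    then have x: "x > 0" using assms by simp
    have "(G has_real_derivative (3/10 * x powr (3/10 - 1)) * lgw x
         + (- 1 / (x * (exp 4 * x + 1))) * x powr (3/10)) (at x)"
      unfolding G_def by (rule DERIV_mult[OF has_real_derivative_powr[OF x] lgw_deriv[OF x]])
    moreover have "x powr (3/10 - 1) = x powr (3/10) / x" using x by (subst powr_diff) simp
    moreover have "exp 4 * x + 1 > 0" using x by (simp add: add_pos_pos)
    then have "3/10 * (x powr (3/10) / x) * lgw x + (- 1 / (x * (exp 4 * x + 1))) * x powr (3/10)
       = x powr (3/10) / x * (3/10 * lgw x - 1 / (exp 4 * x + 1))"
      using x by (simp add: divide_simps) (simp add: algebra_simps)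
    ultimately have "(G has_real_derivative x powr (3/10) / x * (3/10 * lgw x - 1 / (exp 4 * x + 1))) (at x)"
      by (simp only: )
    moreover have "1 / (exp 4 * x + 1) \<le> 1 / 1" using x by (intro frac_le) auto
    then have "x powr (3/10) / x * (3/10 * lgw x - 1 / (exp 4 * x + 1)) \<ge> 0"
      using lgw_ge[OF x] x by (intro mult_nonneg_nonneg) auto
    ultimately show "\<exists>y. (G has_real_derivative y) (at x) \<and> y \<ge> 0" by blast
  qed
  define s where "s = 5 - 3 * \<mu>"
  have s: "0 < s" "s < 5" unfolding s_def using assms by auto
  have eq: "cubker \<mu> x = G x powr (- s) * x powr (3/10 * s - 3/2)" if "x > 0" for x
    unfolding cubker_def G_def s_def using that lgw_pos[OF that]
    by (simp add: powr_mult powr_powr powr_add[symmetric] algebra_simps)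
  have Gp: "0 < G p" unfolding G_def using assms lgw_pos[of p] by simp
  have "G q powr (- s) \<le> G p powr (- s)"
    using mono Gp s by (intro powr_mono2') auto
  moreover have "q powr (3/10 * s - 3/2) \<le> p powr (3/10 * s - 3/2)"
    using assms s by (intro powr_mono2') auto
  ultimately show ?thesis using assms by (simp add: eq mult_mono)
qed

lemma lgw_power_le_powr:
  assumes "Q > 0"
  shows "\<exists>C>0. \<forall>q. 0 < q \<and> q \<le> Q \<longrightarrow> lgw q powr 5 \<le> C * q powr (-3/4)"
proof (intro exI conjI allI impI)
  define M where "M = exp 4 * Q + 1"
  \<comment> \<open>A logarithm is bounded by any positive power; 3/20 is chosen because its fifth
    multiple is 3/4.\<close>
  define s :: real where "s = 3/20"
  have M: "M > 0" unfolding M_def using assms by (simp add: add_pos_pos)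
  show "M powr (3/4) / s powr 5 > 0" using M by (simp add: s_def)
  fix q assume q: "0 < q \<and> q \<le> Q"
  have a: "exp 4 + 1 / q \<le> M / q"
    using q unfolding M_def by (simp add: field_simps mult_left_mono)
  have a0: "exp 4 + 1 / q > 1"
    using q by (smt (verit) divide_nonneg_pos one_less_exp_iff)
  have "lgw q \<le> (exp 4 + 1 / q) powr s / s"
    unfolding lgw_def using a0 by (intro ln_powr_bound) (auto simp: s_def)
  also have "\<dots> \<le> (M / q) powr s / s"
    using a a0 by (intro divide_right_mono powr_mono2) (auto simp: s_def)
  finally have "lgw q powr 5 \<le> ((M / q) powr s / s) powr 5"
    using lgw_pos[of q] q by (intro powr_mono2) auto
  also have "\<dots> = (M / q) powr (3/4) / s powr 5"
  proof -
    have "((M / q) powr s / s) powr 5 = ((M / q) powr s) powr 5 / s powr 5"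
      by (rule powr_divide)
    also have "((M / q) powr s) powr 5 = (M / q) powr (3/4)"
      unfolding powr_powr s_def by simp
    finally show ?thesis .
  qed
  also have "\<dots> = M powr (3/4) / s powr 5 * q powr (-3/4)"
    using M q by (simp add: powr_divide powr_minus field_simps)
  finally show "lgw q powr 5 \<le> M powr (3/4) / s powr 5 * q powr (-3/4)" .
qed

text \<open>Young's inequality with exponents 3 and 3/2 produces the cube of |K| and the power 3/2
  of \<open>ker \<mu>\<close>. Both are less singular than q^(-3/2) by a power of \<open>q\<close>,
  which pays for the missing logarithms, so the single majorant \<open>cubker\<close> serves for all
  terms.\<close>

lemma ker_le_cubker:
  assumes "Q > 0" "0 < \<mu>" 
  shows "\<exists>C>0. \<forall>q. 0 < q \<and> q \<le> Q \<longrightarrow>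
     lgw q powr (3 * \<mu>) \<le> C * cubker \<mu> q \<and> ker \<mu> q powr (3/2) \<le> C * cubker \<mu> q"
proof -
  obtain C where C: "C > 0" "\<And>q. 0 < q \<Longrightarrow> q \<le> Q \<Longrightarrow> lgw q powr 5 \<le> C * q powr (-3/4)"
    using lgw_power_le_powr[OF assms(1)] by blast
  show ?thesis
  proof (intro exI conjI allI impI)
    show "C * (1 + Q powr (3/4)) > 0" using C assms by (simp add: add_pos_nonneg)
    fix q assume q: "0 < q \<and> q \<le> Q"
    have L: "lgw q \<ge> 1" "lgw q > 0" using lgw_ge[of q] q by auto
    have s: "lgw q powr (3 * \<mu>) = lgw q powr (3 * \<mu> - 5) * lgw q powr 5"
      by (simp add: powr_add[symmetric])
    have le: "lgw q powr (3 * \<mu>) \<le> C * lgw q powr (3 * \<mu> - 5) * q powr (-3/4)"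
      unfolding s using C(2)[of q] q mult_left_mono[of "lgw q powr 5" "C * q powr (-3/4)" "lgw q powr (3 * \<mu> - 5)"]
      by (simp add: mult_ac)
    have p: "q powr (-3/4) * q powr (-3/4) = q powr (-3/2)"
      by (simp add: powr_add[symmetric])
    have "q powr (-3/4) = q powr (3/4) * q powr (-3/2)" by (simp add: powr_add[symmetric])
    also have "\<dots> \<le> Q powr (3/4) * q powr (-3/2)"
      using q by (intro mult_right_mono powr_mono2) auto
    finally have "q powr (-3/4) \<le> Q powr (3/4) * q powr (-3/2)" .
    then have "C * lgw q powr (3 * \<mu> - 5) * q powr (-3/4) \<le> C * lgw q powr (3 * \<mu> - 5) * (Q powr (3/4) * q powr (-3/2))"
      using C(1) by (intro mult_left_mono) auto
    also have "\<dots> = C * Q powr (3/4) * cubker \<mu> q"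
      unfolding cubker_def by (simp add: mult_ac)
    also have "\<dots> \<le> C * (1 + Q powr (3/4)) * cubker \<mu> q"
      using C(1) cubker_pos[of q \<mu>] q by (intro mult_right_mono) auto
    finally show "lgw q powr (3 * \<mu>) \<le> C * (1 + Q powr (3/4)) * cubker \<mu> q" using le by linarith
    have "ker \<mu> q powr (3/2) = lgw q powr (3/2 * \<mu>) * q powr (-3/4)"
      unfolding ker_def using q L by (simp add: powr_mult powr_powr algebra_simps)
    also have "\<dots> \<le> lgw q powr (3 * \<mu>) * q powr (-3/4)"
      using L assms by (intro mult_right_mono powr_mono) auto
    also have "\<dots> \<le> C * lgw q powr (3 * \<mu> - 5) * q powr (-3/4) * q powr (-3/4)"
      using le by (intro mult_right_mono) auto
    also have "\<dots> = C * cubker \<mu> q" unfolding cubker_def mult.assoc p by simp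
    also have "\<dots> \<le> C * (1 + Q powr (3/4)) * cubker \<mu> q"
      using C(1) cubker_pos[of q \<mu>] q by (intro mult_right_mono) auto
    finally show "ker \<mu> q powr (3/2) \<le> C * (1 + Q powr (3/4)) * cubker \<mu> q" .
  qed
qed

text \<open>Connects the kernel of the theorem with \<open>ker \<mu>\<close> at
  \<open>d = 0\<close>. For small \<open>r\<close> the quantity \<open>lgw (r\<^sup>2)\<close>
  controls -ln r; for the others |ln R| enters the constant.\<close>

lemma log_kernel_le_ker:
  assumes "R > 0" "0 < \<mu>"
  shows "\<exists>C>0. \<forall>r. 0 < r \<and> r \<le> R \<longrightarrow> (\<bar>ln r\<bar> powr \<mu> + 1) / r \<le> C * ker \<mu> (r\<^sup>2)"
proof (intro exI conjI allI impI)
  define M where "M = 1 + \<bar>ln R\<bar>"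
  show "M powr \<mu> + 1 > 0" by (simp add: add_nonneg_pos)
  fix r assume r: "0 < r \<and> r \<le> R"
  have r2: "r\<^sup>2 > 0" using r by simp
  have L: "lgw (r\<^sup>2) \<ge> 4" by (rule lgw_ge[OF r2])
  have "- ln r \<le> M * lgw (r\<^sup>2)"
  proof -
    have "- 2 * ln r \<le> lgw (r\<^sup>2)" using lgw_ge_minus_ln[OF r2] r by (simp add: ln_realpow)
    moreover have "1 * lgw (r\<^sup>2) \<le> M * lgw (r\<^sup>2)" unfolding M_def using L by (intro mult_right_mono) auto
    ultimately show ?thesis using L by linarith
  qed
  moreover have "ln r \<le> M * lgw (r\<^sup>2)"
  proof -
    have "ln r \<le> ln R" using r by simp
    also have "\<dots> \<le> M * 1" unfolding M_def by simp
    also have "\<dots> \<le> M * lgw (r\<^sup>2)" unfolding M_def using L by (intro mult_left_mono) auto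
    finally show ?thesis .
  qed
  ultimately have "\<bar>ln r\<bar> powr \<mu> \<le> (M * lgw (r\<^sup>2)) powr \<mu>"
    using assms by (intro powr_mono2) auto
  also have "\<dots> = M powr \<mu> * lgw (r\<^sup>2) powr \<mu>" using L by (simp add: powr_mult M_def)
  finally have 1: "\<bar>ln r\<bar> powr \<mu> \<le> M powr \<mu> * lgw (r\<^sup>2) powr \<mu>" .
  have 2: "1 \<le> lgw (r\<^sup>2) powr \<mu>" using L assms by (intro ge_one_powr_ge_zero) auto
  have "(\<bar>ln r\<bar> powr \<mu> + 1) / r \<le> ((M powr \<mu> + 1) * lgw (r\<^sup>2) powr \<mu>) / r"
    using 1 2 r by (intro divide_right_mono) (auto simp: algebra_simps)
  also have "\<dots> = (M powr \<mu> + 1) * ker \<mu> (r\<^sup>2)"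
  proof -
    have "r\<^sup>2 powr (-1/2) = (r powr 2) powr (-1/2)" using r by simp
    also have "\<dots> = 1 / r" using r by (simp add: powr_powr powr_minus_divide)
    finally show ?thesis unfolding ker_def by simp
  qed
  finally show "(\<bar>ln r\<bar> powr \<mu> + 1) / r \<le> (M powr \<mu> + 1) * ker \<mu> (r\<^sup>2)" .
qed

text \<open>Dyadic decomposition: on the k-th shell the volume cancels q^(-3/2) up to a constant,
  and the logarithm is at least of order k + 1. What remains is the sum of (k + 1)^(3\<mu> - 5),
  convergent because the exponent is below -1. As \<open>cubker\<close> decreases, adding
  \<open>d\<^sup>2\<close> only helps, so the bound is uniform in \<open>d\<close>.\<close>

lemma cubker_integral_ball:
  assumes "R \<ge> 1" "0 < \<mu>" "\<mu> < 4/3"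
  shows "\<exists>C>0. \<forall>d::real. (\<integral>\<^sup>+z. ennreal (cubker \<mu> (d\<^sup>2 + z \<bullet> z)) * indicator (ball 0 R) (z::real^3) \<partial>lborel) \<le> ennreal C"
proof -
  define p where "p = 5 - 3 * \<mu>"
  have p: "p > 1" unfolding p_def using assms by simp
  \<comment> \<open>This \<open>c\<close> gives \<open>lgw q \<ge> (k + 1) * c\<close> on every
    shell. If (k + 1) ln 2 is at least 2 ln R, then -ln q is large enough and
    \<open>c \<le> 1/2\<close> suffices; otherwise k + 1 is at most 4 ln R, and
    \<open>c * ln R \<le> 1\<close> together with \<open>lgw q \<ge> 4\<close> suffices.\<close>
  define c where "c = 1 / (2 + ln R)"
  have lnR: "ln R \<ge> 0" using assms by simp
  have c: "c > 0" unfolding c_def using lnR by simp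
  define V where "V = unit_ball_vol (real 3)"
  have V: "V > 0" unfolding V_def by (simp add: unit_ball_vol_pos)
  define r where "r = (\<lambda>k::nat. R / 2 ^ k)"
  have r: "r k > 0" for k unfolding r_def using assms by simp
  define a where "a = (\<lambda>k::nat. 8 * V * (c powr (- p) * real (Suc k) powr (- p)))"
  have dyadic: "cubker \<mu> ((r (Suc k))\<^sup>2) * (V * r k ^ 3) \<le> a k" for k
  proof -
    define q where "q = (r (Suc k))\<^sup>2"
    have q: "q > 0" unfolding q_def using r[of "Suc k"] by simp
    have lnq: "ln q = 2 * ln R - 2 * real (Suc k) * ln 2"
    proof -
      have "ln q = 2 * ln (R / 2 ^ Suc k)"
        unfolding q_def using r[of "Suc k"] unfolding r_def by (subst ln_realpow) auto
      also have "ln (R / 2 ^ Suc k) = ln R - ln (2 ^ Suc k)"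
        using assms by (simp add: ln_div)
      also have "ln (2 ^ Suc k :: real) = real (Suc k) * ln 2"
        by (rule ln_realpow)
      finally show ?thesis by (simp only: right_diff_distrib mult.assoc)
    qed
    have "lgw q \<ge> real (Suc k) * c"
    proof (cases "2 * ln R \<le> real (Suc k) * ln 2")
      case True
      have "c \<le> 1/2" unfolding c_def using lnR by (intro divide_left_mono) auto
      moreover have "ln (2::real) \<ge> 1/2" using ln2_ge_two_thirds by simp
      ultimately have "real (Suc k) * c \<le> real (Suc k) * ln 2" by (intro mult_left_mono) auto
      also have "\<dots> \<le> - ln q" using True unfolding lnq by linarith
      also have "\<dots> \<le> lgw q" by (rule lgw_ge_minus_ln[OF q])
      finally show ?thesis .
    next
      case False
      have *: "m \<le> 4 * a" if "m * (1/2) \<le> m * b" "\<not> 2 * a \<le> m * b" for m a b :: real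
        using that by linarith
      have "real (Suc k) * (1/2) \<le> real (Suc k) * ln 2" using ln2_ge_two_thirds by (intro mult_left_mono) auto
      then have "real (Suc k) \<le> 4 * ln R" using False by (rule *)
      then have "real (Suc k) * c \<le> 4 * (ln R * c)" using c by (simp add: mult_right_mono flip: mult.assoc)
      also have "ln R * c \<le> 1" unfolding c_def using lnR by simp
      finally show ?thesis using lgw_ge[OF q] by linarith
    qed
    then have "lgw q powr (- p) \<le> (real (Suc k) * c) powr (- p)"
      using p c by (intro powr_mono2') auto
    also have "\<dots> = c powr (- p) * real (Suc k) powr (- p)" using c by (simp add: powr_mult)
    finally have 1: "lgw q powr (- p) \<le> c powr (- p) * real (Suc k) powr (- p)" .
    have "q powr (-3/2) = (r (Suc k) powr 2) powr (-3/2)" unfolding q_def using r[of "Suc k"] by simp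
    also have "\<dots> = r (Suc k) powr (-3)" by (simp add: powr_powr)
    also have "\<dots> = 1 / r (Suc k) ^ 3"
      using r[of "Suc k"] by (subst powr_minus_divide) simp
    finally have "q powr (-3/2) * r k ^ 3 = 8"
      using assms unfolding r_def by (simp add: power_divide field_simps power_mult_distrib)
    then have "cubker \<mu> q * (V * r k ^ 3) = 8 * V * lgw q powr (- p)"
      unfolding cubker_def p_def by (simp add: field_simps)
    also have "\<dots> \<le> a k" unfolding a_def using 1 V by (intro mult_left_mono) auto
    finally show ?thesis unfolding q_def .
  qed
  have sum: "summable a"
  proof -
    have "summable (\<lambda>k. real k powr (- p))" using p by (simp add: summable_real_powr_iff)
    then have "summable (\<lambda>k. real (Suc k) powr (- p))" by (subst summable_Suc_iff)
    then show ?thesis unfolding a_def by (intro summable_mult)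
  qed
  have a0: "a k \<ge> 0" for k unfolding a_def using V by simp
  show ?thesis
  proof (intro exI conjI allI)
    show "suminf a + 1 > 0" using suminf_nonneg[OF sum a0] by simp
    fix d :: real
    \<comment> \<open>The origin lies in no shell; it is discarded later as a null set.\<close>
    have pw: "ennreal (cubker \<mu> (d\<^sup>2 + z \<bullet> z)) * indicator (ball 0 R) z
         \<le> (\<Sum>k. ennreal (cubker \<mu> ((r (Suc k))\<^sup>2)) * indicator (ball 0 (r k)) z)"
      if z: "z \<noteq> 0" for z :: "real^3"
    proof (cases "z \<in> ball 0 R")
      case True
      define P where "P = (\<lambda>k::nat. r k \<le> norm z)"
      have "(\<lambda>k. R * (1/2) ^ k) \<longlonglongrightarrow> R * 0"
        by (intro tendsto_intros LIMSEQ_power_zero) auto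
      then have "eventually (\<lambda>k. R * (1/2) ^ k < norm z) sequentially"
        using z by (intro order_tendstoD(2)) auto
      then obtain k0 where "P k0"
        unfolding P_def r_def eventually_sequentially
        by (metis less_imp_le order_refl power_one_over times_divide_eq_right mult_1_right)
      moreover have "\<not> P 0" unfolding P_def r_def using True by simp
      \<comment> \<open>The radii decrease from above |z| to below it, so two consecutive ones
        bracket |z|.\<close>
      ultimately have "\<exists>k. \<not> P k \<and> P (Suc k)"
      proof (rule_tac ccontr)
        assume P: "P k0" "\<not> P 0" "\<nexists>k. \<not> P k \<and> P (Suc k)"
        have "\<not> P j" for j by (induction j) (use P in auto)
        with P(1) show False by blast
      qed
      then obtain k where k: "\<not> P k" "P (Suc k)" by blast
      have zk: "z \<in> ball 0 (r k)" and zk2: "(r (Suc k))\<^sup>2 \<le> d\<^sup>2 + z \<bullet> z"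
        using k power_mono[of "r (Suc k)" "norm z" 2] r[of "Suc k"]
        unfolding P_def by (auto simp: power2_norm_eq_inner[symmetric] add_increasing)
      have "ennreal (cubker \<mu> (d\<^sup>2 + z \<bullet> z)) * indicator (ball 0 R) z \<le> ennreal (cubker \<mu> ((r (Suc k))\<^sup>2)) * indicator (ball 0 (r k)) z"
        using cubker_antimono[OF _ zk2 assms(2,3)] r[of "Suc k"] True zk by (simp add: ennreal_leI)
      also have "\<dots> \<le> (\<Sum>k. ennreal (cubker \<mu> ((r (Suc k))\<^sup>2)) * indicator (ball 0 (r k)) z)"
        using sum_le_suminf[OF summableI, of "{k}" "\<lambda>k. ennreal (cubker \<mu> ((r (Suc k))\<^sup>2)) * indicator (ball 0 (r k)) z"]
        by (simp del: sum_mult_indicator)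
      finally show ?thesis .
    qed simp
    have "(\<integral>\<^sup>+z. ennreal (cubker \<mu> (d\<^sup>2 + z \<bullet> z)) * indicator (ball 0 R) (z::real^3) \<partial>lborel)
        \<le> (\<integral>\<^sup>+z. (\<Sum>k. ennreal (cubker \<mu> ((r (Suc k))\<^sup>2)) * indicator (ball 0 (r k)) (z::real^3)) \<partial>lborel)"
      using AE_lborel_singleton[of "0::real^3"] by (intro nn_integral_mono_AE) (auto intro: pw)
    also have "\<dots> = (\<Sum>k. ennreal (cubker \<mu> ((r (Suc k))\<^sup>2)) * emeasure lborel (ball (0::real^3) (r k)))"
    proof -
      have "(\<lambda>z::real^3. ennreal (cubker \<mu> ((r (Suc k))\<^sup>2)) * indicator (ball 0 (r k)) z) \<in> borel_measurable lborel" for k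
        by (intro borel_measurable_times_ennreal borel_measurable_const borel_measurable_indicator) simp
      then show ?thesis
        by (subst nn_integral_suminf) (auto intro!: suminf_cong nn_integral_cmult_indicator)
    qed
    also have "\<dots> = (\<Sum>k. ennreal (cubker \<mu> ((r (Suc k))\<^sup>2) * (V * r k ^ 3)))"
    proof (intro suminf_cong)
      fix k
      have "emeasure lborel (ball (0::real^3) (r k)) = ennreal (V * r k ^ 3)"
        using r[of k] by (subst emeasure_ball) (auto simp: V_def)
      then show "ennreal (cubker \<mu> ((r (Suc k))\<^sup>2)) * emeasure lborel (ball (0::real^3) (r k))
          = ennreal (cubker \<mu> ((r (Suc k))\<^sup>2) * (V * r k ^ 3))"
        using cubker_pos[of "(r (Suc k))\<^sup>2" \<mu>] r[of "Suc k"] by (simp add: ennreal_mult' less_imp_le)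
    qed
    also have "\<dots> \<le> (\<Sum>k. ennreal (a k))"
      by (intro suminf_le ennreal_leI dyadic) auto
    also have "\<dots> = ennreal (suminf a)" by (rule suminf_ennreal2[OF a0 sum])
    also have "\<dots> \<le> ennreal (suminf a + 1)" by (intro ennreal_leI) simp
    finally show "(\<integral>\<^sup>+z. ennreal (cubker \<mu> (d\<^sup>2 + z \<bullet> z)) * indicator (ball 0 R) (z::real^3) \<partial>lborel) \<le> ennreal (suminf a + 1)" .
  qed
qed

section \<open>Approximation in the mean\<close>

lemma lborel_translate_integral:
  fixes f :: "'a::euclidean_space \<Rightarrow> real"
  shows "(\<integral>x. f (x + h) \<partial>lborel) = (\<integral>x. f x \<partial>lborel)"
    and "integrable lborel f \<Longrightarrow> integrable lborel (\<lambda>x. f (x + h))"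
proof -
  have d: "distr lborel borel ((+) h) = (lborel :: 'a measure)" by (rule lborel_distr_plus)
  show "(\<integral>x. f (x + h) \<partial>lborel) = (\<integral>x. f x \<partial>lborel)"
  proof (cases "f \<in> borel_measurable borel")
    case True
    have "(\<integral>x. f x \<partial>lborel) = (\<integral>x. f x \<partial>distr lborel borel ((+) h))" by (simp only: d)
    also have "\<dots> = (\<integral>x. f (h + x) \<partial>lborel)" using True by (subst integral_distr) auto
    finally show ?thesis by (simp add: add.commute)
  next
    \<comment> \<open>If \<open>f\<close> is not measurable, neither is its translate, and both
      integrals take the default value 0.\<close>
    case False
    have "(\<lambda>x. f (x + h)) \<notin> borel_measurable borel"
    proof
      assume "(\<lambda>x. f (x + h)) \<in> borel_measurable borel"
      then have "(\<lambda>x. f (x + h)) \<circ> (\<lambda>x. x - h) \<in> borel_measurable borel"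
        by (intro measurable_comp[of _ borel borel]) auto
      with False show False by (simp add: o_def)
    qed
    with False have "\<not> integrable lborel (\<lambda>x. f (x + h))" "\<not> integrable lborel f"
      by (auto dest!: borel_measurable_integrable)
    then show ?thesis by (simp add: not_integrable_integral_eq)
  qed
  assume "integrable lborel f"
  then have "integrable (distr lborel borel ((+) h)) f" by (simp only: d)
  then have "integrable lborel (\<lambda>x. f (h + x))" by (rule integrable_distr[rotated]) auto
  then show "integrable lborel (\<lambda>x. f (x + h))" by (simp add: add.commute)
qed

lemma continuous_compact_support_translation:
  fixes g :: "'a::euclidean_space \<Rightarrow> real"
  assumes c: "continuous_on UNIV g" and s: "\<And>x. norm x > M \<Longrightarrow> g x = 0"
    and b: "\<And>x. \<bar>g x\<bar> \<le> B" and h: "h \<longlonglongrightarrow> 0"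
  shows "(\<lambda>n. \<integral>x. \<bar>g (x + h n) - g x\<bar> \<partial>lborel) \<longlonglongrightarrow> 0"
proof -
  \<comment> \<open>Shifts of norm at most 1 keep the shifted supports in the ball of radius
    \<open>M + 1\<close>, whose indicator provides the dominating function.\<close>
  obtain n0 where n0: "\<And>n. n \<ge> n0 \<Longrightarrow> norm (h n) \<le> 1"
  proof -
    have "eventually (\<lambda>n. norm (h n) < 1) sequentially"
      using tendsto_norm[OF h] by (intro order_tendstoD(2)) auto
    then show ?thesis using that unfolding eventually_sequentially by (metis less_imp_le)
  qed
  have B: "B \<ge> 0" using b[of 0] by linarith
  have [measurable]: "g \<in> borel_measurable borel" by (rule borel_measurable_continuous_onI[OF c])
  have "(\<lambda>n. \<integral>x. \<bar>g (x + h (n + n0)) - g x\<bar> \<partial>lborel) \<longlonglongrightarrow> (\<integral>x. 0 \<partial>(lborel :: 'a measure))"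
  proof (rule integral_dominated_convergence[where w="\<lambda>x. (2 * B) * indicator (cball 0 (M + 1)) x"])
    show "integrable lborel (\<lambda>x::'a. (2 * B) * indicator (cball 0 (M + 1)) x)"
      by (intro integrable_mult_right integrable_real_indicator)
         (auto simp: emeasure_bounded_finite[unfolded infinity_ennreal_def])
    show "AE x in lborel. (\<lambda>n. \<bar>g (x + h (n + n0)) - g x\<bar>) \<longlonglongrightarrow> 0"
    proof (rule AE_I2)
      fix x :: 'a
      have "(\<lambda>n. x + h (n + n0)) \<longlonglongrightarrow> x + 0"
        by (intro tendsto_add tendsto_const LIMSEQ_ignore_initial_segment h)
      then have "(\<lambda>n. g (x + h (n + n0))) \<longlonglongrightarrow> g (x + 0)"
        by (rule continuous_on_tendsto_compose[OF c]) auto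
      then have "(\<lambda>n. \<bar>g (x + h (n + n0)) - g x\<bar>) \<longlonglongrightarrow> \<bar>g x - g x\<bar>"
        by (intro tendsto_intros) simp
      then show "(\<lambda>n. \<bar>g (x + h (n + n0)) - g x\<bar>) \<longlonglongrightarrow> 0" by simp
    qed
    show "AE x in lborel. norm \<bar>g (x + h (n + n0)) - g x\<bar> \<le> (2 * B) * indicator (cball 0 (M + 1)) x" for n
    proof (rule AE_I2)
      fix x :: 'a
      show "norm \<bar>g (x + h (n + n0)) - g x\<bar> \<le> (2 * B) * indicator (cball 0 (M + 1)) x"
      proof (cases "norm x \<le> M + 1")
        case True
        then show ?thesis using b[of "x + h (n + n0)"] b[of x] by simp
      next
        case False
        have "norm x \<le> norm (x + h (n + n0)) + norm (h (n + n0))"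
          by (metis add_diff_cancel_right' norm_triangle_ineq4)
        then have "norm (x + h (n + n0)) > M" using n0[of "n + n0"] False by simp
        then show ?thesis using False s by simp
      qed
    qed
  qed auto
  then have "(\<lambda>n. \<integral>x. \<bar>g (x + h (n + n0)) - g x\<bar> \<partial>lborel) \<longlonglongrightarrow> 0" by simp
  then show ?thesis by (rule LIMSEQ_offset)
qed

text \<open>Measurability gives continuous functions converging to \<open>f\<close> almost
  everywhere, but without domination. Hence \<open>f\<close> is first truncated in space by
  \<open>chi\<close> and in value by \<open>clip\<close>, which costs little in L^1; the same
  truncation applied to the continuous functions makes them uniformly bounded on a fixed ball, so
  dominated convergence applies.\<close>

lemma L1_approx_continuous:
  fixes f :: "'a::euclidean_space \<Rightarrow> real"
  assumes f: "integrable lborel f" and e: "e > 0"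
  shows "\<exists>g M B. continuous_on UNIV g \<and> (\<forall>x. norm x > M \<longrightarrow> g x = 0) \<and> (\<forall>x. \<bar>g x\<bar> \<le> B)
           \<and> integrable lborel g \<and> (\<integral>x. \<bar>g x - f x\<bar> \<partial>lborel) < e"
proof -
  have [measurable]: "f \<in> borel_measurable borel" using f by auto
  have "f measurable_on UNIV"
    by (rule lebesgue_measurable_imp_measurable_on)
       (auto intro!: measurable_completion)
  then obtain N g where N: "negligible N" and g: "\<And>n. continuous_on UNIV (g n)"
    and lim: "\<And>x. x \<notin> N \<Longrightarrow> (\<lambda>n. g n x) \<longlonglongrightarrow> f x"
    unfolding measurable_on_def by auto
  have AE_N: "AE x in lborel. x \<notin> N"
  proof -
    have "N \<in> null_sets lebesgue" using N by (simp add: negligible_iff_null_sets)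
    then obtain N' where "N' \<in> null_sets lborel" "N \<subseteq> N'"
      by (meson null_sets_completion_iff2)
    then show ?thesis by (auto intro: AE_I')
  qed
  define chi where "chi = (\<lambda>k::nat. \<lambda>x::'a. max 0 (min 1 (real k + 1 - norm x)))"
  define clip where "clip = (\<lambda>k::nat. \<lambda>y::real. max (- real k) (min (real k) y))"
  have chi: "0 \<le> chi k x" "chi k x \<le> 1" "norm x \<le> real k \<Longrightarrow> chi k x = 1" "norm x > real k + 1 \<Longrightarrow> chi k x = 0" for k x
    unfolding chi_def by auto
  have clip: "\<bar>clip k y\<bar> \<le> \<bar>y\<bar>" "\<bar>clip k y\<bar> \<le> real k" "\<bar>y\<bar> \<le> real k \<Longrightarrow> clip k y = y" for k y
    unfolding clip_def by auto
  have cont_chi: "continuous_on UNIV (chi k)" for k unfolding chi_def by (intro continuous_intros)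
  have cont_clip: "continuous_on S u \<Longrightarrow> continuous_on S (\<lambda>x. clip k (u x))" for S :: "'a set" and u k
    unfolding clip_def by (intro continuous_intros)
  define F where "F = (\<lambda>k x. chi k x * clip k (f x))"
  have [measurable]: "chi k \<in> borel_measurable borel" for k by (rule borel_measurable_continuous_onI[OF cont_chi])
  have [measurable]: "clip k \<in> borel_measurable borel" for k unfolding clip_def by measurable
  have [measurable]: "g n \<in> borel_measurable borel" for n by (rule borel_measurable_continuous_onI[OF g])
  have absF: "\<bar>F k x\<bar> \<le> \<bar>f x\<bar>" for k x
  proof -
    have "\<bar>F k x\<bar> = chi k x * \<bar>clip k (f x)\<bar>" unfolding F_def by (simp add: abs_mult chi)
    also have "\<dots> \<le> 1 * \<bar>f x\<bar>" by (intro mult_mono chi clip) auto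
    finally show ?thesis by simp
  qed
  have "(\<lambda>k. \<integral>x. \<bar>F k x - f x\<bar> \<partial>lborel) \<longlonglongrightarrow> (\<integral>x. 0 \<partial>(lborel :: 'a measure))"
  proof (rule integral_dominated_convergence[where w="\<lambda>x. 2 * \<bar>f x\<bar>"])
    show "AE x in lborel. (\<lambda>k. \<bar>F k x - f x\<bar>) \<longlonglongrightarrow> 0"
    proof (rule AE_I2, rule tendsto_eventually)
      fix x
      obtain k0 :: nat where k0: "real k0 \<ge> max \<bar>f x\<bar> (norm x)" using real_arch_simple by blast
      have "\<bar>F k x - f x\<bar> = 0" if "k \<ge> k0" for k
      proof -
        have "\<bar>f x\<bar> \<le> real k" "norm x \<le> real k" using k0 that by linarith+
        then show ?thesis by (simp add: F_def chi clip)
      qed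
      then show "eventually (\<lambda>k. \<bar>F k x - f x\<bar> = 0) sequentially"
        by (auto simp: eventually_sequentially)
    qed
    show "AE x in lborel. norm \<bar>F k x - f x\<bar> \<le> 2 * \<bar>f x\<bar>" for k
      using absF by (intro AE_I2) (smt (verit) real_norm_def)
  qed (use f in \<open>auto simp: F_def intro!: borel_measurable_abs\<close>)
  then have "eventually (\<lambda>k. (\<integral>x. \<bar>F k x - f x\<bar> \<partial>lborel) < e/2) sequentially"
    using e by (intro order_tendstoD(2)) auto
  then obtain k where k: "(\<integral>x. \<bar>F k x - f x\<bar> \<partial>lborel) < e/2"
    by (auto simp: eventually_sequentially)
  define G where "G = (\<lambda>n x. chi k x * clip k (g n x))"
  have Fm[measurable]: "F k \<in> borel_measurable borel" unfolding F_def by measurable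
  have Gm[measurable]: "G n \<in> borel_measurable borel" for n unfolding G_def by measurable
  have bnd: "\<bar>chi k x * clip k y\<bar> \<le> real k * indicator (cball 0 (real k + 1)) x" for x y
  proof (cases "norm x \<le> real k + 1")
    case True
    have "\<bar>chi k x * clip k y\<bar> = chi k x * \<bar>clip k y\<bar>" by (simp add: abs_mult chi)
    also have "\<dots> \<le> 1 * real k" by (intro mult_mono chi clip) auto
    finally show ?thesis using True by simp
  qed (simp add: chi)
  have ind: "integrable lborel (\<lambda>x::'a. real k * indicator (cball 0 (real k + 1)) x)"
    by (intro integrable_mult_right integrable_real_indicator) (auto simp: emeasure_bounded_finite[unfolded infinity_ennreal_def])
  have intG: "integrable lborel (G n)" for n
    by (rule Bochner_Integration.integrable_bound[OF ind]) (auto simp: G_def intro!: AE_I2 order_trans[OF bnd])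
  have intF: "integrable lborel (F k)"
    by (rule Bochner_Integration.integrable_bound[OF f]) (auto simp: absF)
  have "(\<lambda>n. \<integral>x. \<bar>G n x - F k x\<bar> \<partial>lborel) \<longlonglongrightarrow> (\<integral>x. 0 \<partial>(lborel :: 'a measure))"
  proof (rule integral_dominated_convergence[where w="\<lambda>x. 2 * (real k * indicator (cball 0 (real k + 1)) x)"])
    show "AE x in lborel. (\<lambda>n. \<bar>G n x - F k x\<bar>) \<longlonglongrightarrow> 0"
      using AE_N
    proof eventually_elim
      case (elim x)
      have "(\<lambda>n. \<bar>chi k x * clip k (g n x) - F k x\<bar>) \<longlonglongrightarrow> \<bar>chi k x * clip k (f x) - F k x\<bar>"
        unfolding clip_def by (intro tendsto_intros lim elim)
      then show ?case unfolding G_def F_def by simp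
    qed
    show "AE x in lborel. norm \<bar>G n x - F k x\<bar> \<le> 2 * (real k * indicator (cball 0 (real k + 1)) x)" for n
    proof (rule AE_I2)
      fix x
      show "norm \<bar>G n x - F k x\<bar> \<le> 2 * (real k * indicator (cball 0 (real k + 1)) x)"
        using bnd[of x "g n x"] bnd[of x "f x"] unfolding G_def F_def by (smt (verit) real_norm_def)
    qed
    show "integrable lborel (\<lambda>x::'a. 2 * (real k * indicator (cball 0 (real k + 1)) x))"
      by (intro integrable_mult_right[OF ind])
  qed auto
  then have "eventually (\<lambda>n. (\<integral>x. \<bar>G n x - F k x\<bar> \<partial>lborel) < e/2) sequentially"
    using e by (intro order_tendstoD(2)) auto
  then obtain n where n: "(\<integral>x. \<bar>G n x - F k x\<bar> \<partial>lborel) < e/2"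
    by (auto simp: eventually_sequentially)
  show ?thesis
  proof (intro exI conjI allI impI)
    show "continuous_on UNIV (G n)" unfolding G_def by (intro continuous_on_mult cont_chi cont_clip g)
    show "G n x = 0" if "norm x > real k + 1" for x using that by (simp add: G_def chi)
    show "\<bar>G n x\<bar> \<le> real k" for x 
      unfolding G_def by (rule order_trans[OF bnd]) (simp add: indicator_def)
    show "integrable lborel (G n)" by (rule intG)
    have "(\<integral>x. \<bar>G n x - f x\<bar> \<partial>lborel) \<le> (\<integral>x. \<bar>G n x - F k x\<bar> + \<bar>F k x - f x\<bar> \<partial>lborel)"
      using intG intF f by (intro integral_mono) auto
    also have "\<dots> = (\<integral>x. \<bar>G n x - F k x\<bar> \<partial>lborel) + (\<integral>x. \<bar>F k x - f x\<bar> \<partial>lborel)"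
      using intG intF f by (intro Bochner_Integration.integral_add) auto
    finally show "(\<integral>x. \<bar>G n x - f x\<bar> \<partial>lborel) < e" using n k by linarith
  qed
qed

lemma L1_translation_continuous:
  fixes f :: "'a::euclidean_space \<Rightarrow> real"
  assumes f: "integrable lborel f" and h: "h \<longlonglongrightarrow> 0"
  shows "(\<lambda>n. \<integral>x. \<bar>f (x + h n) - f x\<bar> \<partial>lborel) \<longlonglongrightarrow> 0"
proof (rule LIMSEQ_I)
  fix e :: real assume e: "e > 0"
  then obtain g M B where g: "continuous_on UNIV g" "\<And>x. norm x > M \<Longrightarrow> g x = 0" "\<And>x. \<bar>g x\<bar> \<le> B"
    and gi: "integrable lborel g" and ge: "(\<integral>x. \<bar>g x - f x\<bar> \<partial>lborel) < e/3"
    using L1_approx_continuous[OF f, of "e/3"] by auto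
  have "(\<lambda>n. \<integral>x. \<bar>g (x + h n) - g x\<bar> \<partial>lborel) \<longlonglongrightarrow> 0"
    by (rule continuous_compact_support_translation[OF g h])
  then obtain n0 where n0: "\<And>n. n \<ge> n0 \<Longrightarrow> (\<integral>x. \<bar>g (x + h n) - g x\<bar> \<partial>lborel) < e/3"
    using order_tendstoD(2)[of _ 0 sequentially "e/3"] e by (auto simp: eventually_sequentially)
  show "\<exists>no. \<forall>n\<ge>no. norm ((\<integral>x. \<bar>f (x + h n) - f x\<bar> \<partial>lborel) - 0) < e"
  proof (intro exI allI impI)
    fix n assume n: "n \<ge> n0"
    note i = lborel_translate_integral(2)
    have "(\<integral>x. \<bar>f (x + h n) - f x\<bar> \<partial>lborel)
        \<le> (\<integral>x. (\<bar>g (x + h n) - f (x + h n)\<bar> + \<bar>g (x + h n) - g x\<bar>) + \<bar>g x - f x\<bar> \<partial>lborel)"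
      using f gi i[OF f] i[OF gi] by (intro integral_mono) auto
    also have "\<dots> = (\<integral>x. \<bar>g (x + h n) - f (x + h n)\<bar> \<partial>lborel) + (\<integral>x. \<bar>g (x + h n) - g x\<bar> \<partial>lborel)
         + (\<integral>x. \<bar>g x - f x\<bar> \<partial>lborel)"
      using f gi i[OF f] i[OF gi] by simp
    also have "(\<integral>x. \<bar>g (x + h n) - f (x + h n)\<bar> \<partial>lborel) = (\<integral>x. \<bar>g x - f x\<bar> \<partial>lborel)"
      by (rule lborel_translate_integral(1))
    finally have "(\<integral>x. \<bar>f (x + h n) - f x\<bar> \<partial>lborel) < e" using ge n0[OF n] by linarith
    moreover have "(\<integral>x. \<bar>f (x + h n) - f x\<bar> \<partial>lborel) \<ge> 0" by simp
    ultimately show "norm ((\<integral>x. \<bar>f (x + h n) - f x\<bar> \<partial>lborel) - 0) < e" by simp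
  qed
qed

text \<open>The linear map \<open>T\<close> lets one statement serve twice: with the identity for
  mollification in space, and with \<tau> mapped to (0, \<tau>) for averaging in time. Convergence
  is stated on the product space so that a subsequence converges for almost every pair.\<close>

lemma L1_mollify:
  fixes f :: "'a::euclidean_space \<Rightarrow> real" and \<phi> :: "'b::euclidean_space \<Rightarrow> real" and T :: "'b \<Rightarrow> 'a"
  assumes f: "integrable lborel f" and \<phi>: "integrable lborel \<phi>" and \<phi>0: "\<And>z. \<phi> z \<ge> 0"
    and T: "bounded_linear T" and e: "\<epsilon> \<longlonglongrightarrow> 0"
  shows "integrable (lborel \<Otimes>\<^sub>M lborel) (\<lambda>(x, z). (f (x + \<epsilon> n *\<^sub>R T z) - f x) * \<phi> z)"
    and "(\<lambda>n. \<integral>p. norm (case p of (x, z) \<Rightarrow> (f (x + \<epsilon> n *\<^sub>R T z) - f x) * \<phi> z) \<partial>(lborel \<Otimes>\<^sub>M lborel)) \<longlonglongrightarrow> 0"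
proof -
  have [measurable]: "f \<in> borel_measurable borel" "\<phi> \<in> borel_measurable borel" using f \<phi> by auto
  have [measurable]: "T \<in> borel_measurable borel"
    by (intro borel_measurable_continuous_onI linear_continuous_on T)
  note i = lborel_translate_integral
  have intx: "integrable lborel (\<lambda>x. \<bar>f (x + h) - f x\<bar>)" for h using f i(2)[OF f] by auto
  have om_le: "(\<integral>x. \<bar>f (x + h) - f x\<bar> \<partial>lborel) \<le> 2 * (\<integral>x. \<bar>f x\<bar> \<partial>lborel)" for h
  proof -
    have "(\<integral>x. \<bar>f (x + h) - f x\<bar> \<partial>lborel) \<le> (\<integral>x. \<bar>f (x + h)\<bar> + \<bar>f x\<bar> \<partial>lborel)"
      using f i(2)[OF f] by (intro integral_mono) auto
    also have "\<dots> = (\<integral>x. \<bar>f (x + h)\<bar> \<partial>lborel) + (\<integral>x. \<bar>f x\<bar> \<partial>lborel)"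
      using f i(2)[OF f] by simp
    also have "(\<integral>x. \<bar>f (x + h)\<bar> \<partial>lborel) = (\<integral>x. \<bar>f x\<bar> \<partial>lborel)" by (rule i(1))
    finally show ?thesis by simp
  qed
  \<comment> \<open>The L^1 modulus of continuity of \<open>f\<close> along the shift: it is at most
    twice the L^1 norm of \<open>f\<close> and tends to 0 for each \<open>z\<close>, so its integral
    against \<phi> tends to 0 by dominated convergence.\<close>
  define \<omega> where "\<omega> = (\<lambda>n z. \<integral>x. \<bar>f (x + \<epsilon> n *\<^sub>R T z) - f x\<bar> \<partial>lborel)"
  have om_m[measurable]: "\<omega> n \<in> borel_measurable borel" for n
  proof -
    have "(\<lambda>z. \<integral>x. \<bar>f (x + \<epsilon> n *\<^sub>R T z) - f x\<bar> \<partial>lborel) \<in> borel_measurable lborel"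
      by measurable
    then show ?thesis unfolding \<omega>_def by simp
  qed
  have om0: "\<omega> n z \<ge> 0" for n z unfolding \<omega>_def by simp
  have intom: "integrable lborel (\<lambda>z. \<omega> n z * \<phi> z)" for n
    by (rule Bochner_Integration.integrable_bound[OF integrable_mult_right[OF \<phi>, of "2 * (\<integral>x. \<bar>f x\<bar> \<partial>lborel)"]])
       (auto simp: abs_mult om0 \<phi>0 \<omega>_def intro!: mult_right_mono om_le)
  have eqn: "(\<integral>\<^sup>+p. ennreal (norm (case p of (x, z) \<Rightarrow> (f (x + \<epsilon> n *\<^sub>R T z) - f x) * \<phi> z)) \<partial>(lborel \<Otimes>\<^sub>M lborel))
     = ennreal (\<integral>z. \<omega> n z * \<phi> z \<partial>lborel)" for n
  proof -
    have "(\<integral>\<^sup>+p. ennreal (norm (case p of (x, z) \<Rightarrow> (f (x + \<epsilon> n *\<^sub>R T z) - f x) * \<phi> z)) \<partial>(lborel \<Otimes>\<^sub>M lborel))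
      = (\<integral>\<^sup>+z. \<integral>\<^sup>+x. ennreal (norm ((f (x + \<epsilon> n *\<^sub>R T z) - f x) * \<phi> z)) \<partial>lborel \<partial>lborel)"
    proof -
      define H where "H = (\<lambda>p. ennreal (norm (case p of (x, z) \<Rightarrow> (f (x + \<epsilon> n *\<^sub>R T z) - f x) * \<phi> z)))"
      have [measurable]: "H \<in> borel_measurable (lborel \<Otimes>\<^sub>M lborel)" unfolding H_def by measurable
      have "(\<integral>\<^sup>+p. H p \<partial>(lborel \<Otimes>\<^sub>M lborel)) = (\<integral>\<^sup>+x. \<integral>\<^sup>+z. H (x, z) \<partial>lborel \<partial>lborel)"
        by (rule lborel.nn_integral_fst[symmetric]) measurable
      also have "\<dots> = (\<integral>\<^sup>+z. \<integral>\<^sup>+x. H (x, z) \<partial>lborel \<partial>lborel)"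
        by (rule lborel_pair.Fubini[symmetric]) measurable
      finally show ?thesis by (simp add: H_def)
    qed
    also have "\<dots> = (\<integral>\<^sup>+z. ennreal (\<omega> n z * \<phi> z) \<partial>lborel)"
    proof (intro nn_integral_cong)
      fix z
      have "(\<integral>\<^sup>+x. ennreal (norm ((f (x + \<epsilon> n *\<^sub>R T z) - f x) * \<phi> z)) \<partial>lborel)
          = (\<integral>\<^sup>+x. ennreal (\<bar>f (x + \<epsilon> n *\<^sub>R T z) - f x\<bar>) * ennreal (\<phi> z) \<partial>lborel)"
        by (intro nn_integral_cong) (simp add: abs_mult \<phi>0 ennreal_mult)
      also have "\<dots> = (\<integral>\<^sup>+x. ennreal (\<bar>f (x + \<epsilon> n *\<^sub>R T z) - f x\<bar>) \<partial>lborel) * ennreal (\<phi> z)"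
        by (rule nn_integral_multc) auto
      also have "(\<integral>\<^sup>+x. ennreal (\<bar>f (x + \<epsilon> n *\<^sub>R T z) - f x\<bar>) \<partial>lborel) = ennreal (\<omega> n z)"
        unfolding \<omega>_def by (rule nn_integral_eq_integral[OF intx]) auto
      finally show "(\<integral>\<^sup>+x. ennreal (norm ((f (x + \<epsilon> n *\<^sub>R T z) - f x) * \<phi> z)) \<partial>lborel) = ennreal (\<omega> n z * \<phi> z)"
        by (simp add: om0 \<phi>0 ennreal_mult)
    qed
    also have "\<dots> = ennreal (\<integral>z. \<omega> n z * \<phi> z \<partial>lborel)"
      by (rule nn_integral_eq_integral[OF intom]) (auto simp: om0 \<phi>0)
    finally show ?thesis .
  qed
  show int: "integrable (lborel \<Otimes>\<^sub>M lborel) (\<lambda>(x, z). (f (x + \<epsilon> n *\<^sub>R T z) - f x) * \<phi> z)" for n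
  proof (rule integrableI_bounded)
    show "(\<lambda>(x, z). (f (x + \<epsilon> n *\<^sub>R T z) - f x) * \<phi> z) \<in> borel_measurable (lborel \<Otimes>\<^sub>M lborel)" by measurable
    show "(\<integral>\<^sup>+p. ennreal (norm (case p of (x, z) \<Rightarrow> (f (x + \<epsilon> n *\<^sub>R T z) - f x) * \<phi> z)) \<partial>(lborel \<Otimes>\<^sub>M lborel)) < \<infinity>"
      unfolding eqn by simp
  qed
  have "(\<lambda>n. \<integral>z. \<omega> n z * \<phi> z \<partial>lborel) \<longlonglongrightarrow> (\<integral>z. 0 \<partial>(lborel :: 'b measure))"
  proof (rule integral_dominated_convergence[OF _ _ integrable_mult_right[OF \<phi>, of "2 * (\<integral>x. \<bar>f x\<bar> \<partial>lborel)"]])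
    show "AE z in lborel. (\<lambda>n. \<omega> n z * \<phi> z) \<longlonglongrightarrow> 0"
    proof (rule AE_I2)
      fix z
      have "(\<lambda>n. \<epsilon> n *\<^sub>R T z) \<longlonglongrightarrow> 0 *\<^sub>R T z" by (intro tendsto_intros e)
      then have "(\<lambda>n. \<omega> n z) \<longlonglongrightarrow> 0"
        unfolding \<omega>_def using L1_translation_continuous[OF f, of "\<lambda>n. \<epsilon> n *\<^sub>R T z"] by simp
      then show "(\<lambda>n. \<omega> n z * \<phi> z) \<longlonglongrightarrow> 0" by (rule tendsto_mult_left_zero)
    qed
    show "AE z in lborel. norm (\<omega> n z * \<phi> z) \<le> 2 * (\<integral>x. \<bar>f x\<bar> \<partial>lborel) * \<phi> z" for n
      by (intro AE_I2) (auto simp: abs_mult om0 \<phi>0 \<omega>_def intro!: mult_right_mono om_le)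
  qed auto
  moreover have "(\<integral>p. norm (case p of (x, z) \<Rightarrow> (f (x + \<epsilon> n *\<^sub>R T z) - f x) * \<phi> z) \<partial>(lborel \<Otimes>\<^sub>M lborel))
     = (\<integral>z. \<omega> n z * \<phi> z \<partial>lborel)" for n
  proof -
    have "ennreal (\<integral>p. norm (case p of (x, z) \<Rightarrow> (f (x + \<epsilon> n *\<^sub>R T z) - f x) * \<phi> z) \<partial>(lborel \<Otimes>\<^sub>M lborel))
        = ennreal (\<integral>z. \<omega> n z * \<phi> z \<partial>lborel)"
      using eqn[of n] nn_integral_eq_integral[OF integrable_norm[OF int[of n]]] by simp
    then show ?thesis by (simp add: om0 \<phi>0)
  qed
  ultimately show "(\<lambda>n. \<integral>p. norm (case p of (x, z) \<Rightarrow> (f (x + \<epsilon> n *\<^sub>R T z) - f x) * \<phi> z) \<partial>(lborel \<Otimes>\<^sub>M lborel)) \<longlonglongrightarrow> 0"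
    by simp
qed

section \<open>The Loomis--Whitney and Gagliardo--Nirenberg inequalities\<close>

definition vec3 :: "real \<Rightarrow> real \<Rightarrow> real \<Rightarrow> real^3" where
  "vec3 a b c = a *\<^sub>R axis 1 1 + b *\<^sub>R axis 2 1 + c *\<^sub>R axis 3 1"

lemma vec3_nth [simp]: "vec3 a b c $ 1 = a" "vec3 a b c $ 2 = b" "vec3 a b c $ 3 = c"
  by (simp_all add: vec3_def axis_def)

lemma vec3_shift:
  "vec3 a b c + s *\<^sub>R axis 1 1 = vec3 (a + s) b c"
  "vec3 a b c + s *\<^sub>R axis 2 1 = vec3 a (b + s) c"
  "vec3 a b c + s *\<^sub>R axis 3 1 = vec3 a b (c + s)"
  by (simp_all add: vec3_def algebra_simps)

lemma vec3_measurable [measurable]: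
  assumes [measurable]: "f \<in> borel_measurable M" "g \<in> borel_measurable M" "h \<in> borel_measurable M"
  shows "(\<lambda>x. vec3 (f x) (g x) (h x)) \<in> borel_measurable M"
  unfolding vec3_def by measurable

lemma prod_Basis_3: "(\<Prod>b\<in>Basis. f ((u::real^3) \<bullet> b)) = f (u $ 1) * f (u $ 2) * (f (u $ 3) :: 'a::comm_monoid_mult)"
proof -
  have B: "(Basis :: (real^3) set) = (\<lambda>i. axis i 1) ` (UNIV :: 3 set)" by (auto simp: Basis_vec_def)
  have "(\<Prod>b\<in>Basis. f (u \<bullet> b)) = (\<Prod>i\<in>(UNIV :: 3 set). f (u \<bullet> axis i 1))"
    unfolding B by (rule prod.reindex[unfolded o_def]) (auto simp: inj_on_def axis_eq_axis)
  also have "\<dots> = f (u $ 1) * f (u $ 2) * f (u $ 3)"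
    unfolding UNIV_3 by (simp add: inner_axis mult.assoc)
  finally show ?thesis .
qed

text \<open>Lebesgue measure on \<open>real^3\<close> as a triple product, which integration along
  coordinate lines requires; agreement on boxes suffices.\<close>

lemma lborel_vec3:
  "(lborel :: (real^3) measure) = distr (lborel \<Otimes>\<^sub>M (lborel \<Otimes>\<^sub>M lborel)) borel (\<lambda>(a, b, c). vec3 a b c)"
proof (rule lborel_eqI)
  fix l u :: "real^3" assume le: "\<And>b. b \<in> Basis \<Longrightarrow> l \<bullet> b \<le> u \<bullet> b"
  have le': "l $ i \<le> u $ i" for i using le[of "axis i 1"] by (simp add: inner_axis)
  have "(\<lambda>(a, b, c). vec3 a b c) -` box l u = {l $ 1<..<u $ 1} \<times> ({l $ 2<..<u $ 2} \<times> {l $ 3<..<u $ 3})"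
    by (auto simp: mem_box_cart forall_3)
  then have "emeasure (distr (lborel \<Otimes>\<^sub>M (lborel \<Otimes>\<^sub>M lborel)) borel (\<lambda>(a, b, c). vec3 a b c)) (box l u)
     = emeasure (lborel \<Otimes>\<^sub>M (lborel \<Otimes>\<^sub>M lborel)) ({l $ 1<..<u $ 1} \<times> ({l $ 2<..<u $ 2} \<times> {l $ 3<..<u $ 3}))"
    by (subst emeasure_distr) (auto simp: space_pair_measure)
  also have "\<dots> = ennreal (u $ 1 - l $ 1) * (ennreal (u $ 2 - l $ 2) * ennreal (u $ 3 - l $ 3))"
    using le' by (simp add: lborel.emeasure_pair_measure_Times
        sigma_finite_measure.emeasure_pair_measure_Times[OF sigma_finite_pair_measure[OF lborel.sigma_finite_measure_axioms lborel.sigma_finite_measure_axioms]])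
  also have "\<dots> = ennreal (\<Prod>b\<in>Basis. (u - l) \<bullet> b)"
    using le' by (subst prod_Basis_3) (simp add: ennreal_mult'' mult.assoc)
  finally show "emeasure (distr (lborel \<Otimes>\<^sub>M (lborel \<Otimes>\<^sub>M lborel)) borel (\<lambda>(a, b, c). vec3 a b c)) (box l u)
     = ennreal (\<Prod>b\<in>Basis. (u - l) \<bullet> b)" .
qed simp

text \<open>The innermost variable is \<open>a\<close>, \<open>b\<close> and \<open>c\<close> in
  turn; these are the orders in which the three factors of \<open>Loomis_Whitney\<close>
  arise.\<close>

lemma nn_integral_vec3:
  assumes [measurable]: "f \<in> borel_measurable (borel :: (real^3) measure)"
  shows "(\<integral>\<^sup>+x. f x \<partial>lborel) = (\<integral>\<^sup>+b. \<integral>\<^sup>+c. \<integral>\<^sup>+a. f (vec3 a b c) \<partial>lborel \<partial>lborel \<partial>lborel)" (is ?A)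
    and "(\<integral>\<^sup>+x. f x \<partial>lborel) = (\<integral>\<^sup>+c. \<integral>\<^sup>+a. \<integral>\<^sup>+b. f (vec3 a b c) \<partial>lborel \<partial>lborel \<partial>lborel)" (is ?B)
    and "(\<integral>\<^sup>+x. f x \<partial>lborel) = (\<integral>\<^sup>+b. \<integral>\<^sup>+a. \<integral>\<^sup>+c. f (vec3 a b c) \<partial>lborel \<partial>lborel \<partial>lborel)" (is ?C)
proof -
  have "(\<integral>\<^sup>+x. f x \<partial>lborel) = (\<integral>\<^sup>+(a, b, c). f (vec3 a b c) \<partial>(lborel \<Otimes>\<^sub>M (lborel \<Otimes>\<^sub>M lborel)))"
    by (subst lborel_vec3, subst nn_integral_distr) (auto simp: case_prod_unfold)
  also have "\<dots> = (\<integral>\<^sup>+a. \<integral>\<^sup>+p. (case p of (b, c) \<Rightarrow> f (vec3 a b c)) \<partial>(lborel \<Otimes>\<^sub>M lborel) \<partial>lborel)"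
    by (subst sigma_finite_measure.nn_integral_fst[symmetric, OF sigma_finite_pair_measure[OF lborel.sigma_finite_measure_axioms lborel.sigma_finite_measure_axioms]])
       (auto simp: case_prod_unfold)
  also have "\<dots> = (\<integral>\<^sup>+a. \<integral>\<^sup>+b. \<integral>\<^sup>+c. f (vec3 a b c) \<partial>lborel \<partial>lborel \<partial>lborel)"
    by (intro nn_integral_cong, subst lborel.nn_integral_fst[symmetric]) auto
  finally have abc: "(\<integral>\<^sup>+x. f x \<partial>lborel) = (\<integral>\<^sup>+a. \<integral>\<^sup>+b. \<integral>\<^sup>+c. f (vec3 a b c) \<partial>lborel \<partial>lborel \<partial>lborel)" .
  also have "\<dots> = (\<integral>\<^sup>+b. \<integral>\<^sup>+a. \<integral>\<^sup>+c. f (vec3 a b c) \<partial>lborel \<partial>lborel \<partial>lborel)"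
    by (rule lborel_pair.Fubini') measurable
  finally show C: ?C .
  also have "\<dots> = (\<integral>\<^sup>+b. \<integral>\<^sup>+c. \<integral>\<^sup>+a. f (vec3 a b c) \<partial>lborel \<partial>lborel \<partial>lborel)"
    by (intro nn_integral_cong lborel_pair.Fubini') measurable
  finally show A: ?A .
  also have "\<dots> = (\<integral>\<^sup>+c. \<integral>\<^sup>+b. \<integral>\<^sup>+a. f (vec3 a b c) \<partial>lborel \<partial>lborel \<partial>lborel)"
    by (rule lborel_pair.Fubini') measurable
  also have "\<dots> = (\<integral>\<^sup>+c. \<integral>\<^sup>+a. \<integral>\<^sup>+b. f (vec3 a b c) \<partial>lborel \<partial>lborel \<partial>lborel)"
    by (intro nn_integral_cong lborel_pair.Fubini') measurable
  finally show ?B .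
qed

text \<open>Estimate one factor \<open>w\<close> by each of \<open>p\<close>, \<open>q\<close> and
  \<open>r\<close>. Cauchy-Schwarz in (b, c) separates \<open>p\<close> from the integral
  \<open>J\<close> of \<open>q * r\<close> over \<open>a\<close>; Cauchy-Schwarz in \<open>a\<close>
  then bounds \<open>J\<^sup>2\<close> by a function of \<open>c\<close> times a function of
  \<open>b\<close>, and these integrate separately.\<close>

lemma Loomis_Whitney:
  fixes w :: "real \<Rightarrow> real \<Rightarrow> real \<Rightarrow> ennreal" and p q r :: "real \<Rightarrow> real \<Rightarrow> ennreal"
  assumes [measurable]: "(\<lambda>(a, b, c). w a b c) \<in> borel_measurable borel" "(\<lambda>(b, c). p b c) \<in> borel_measurable borel"
     "(\<lambda>(a, c). q a c) \<in> borel_measurable borel" "(\<lambda>(a, b). r a b) \<in> borel_measurable borel"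
    and le: "\<And>a b c. w a b c \<le> p b c" "\<And>a b c. w a b c \<le> q a c" "\<And>a b c. w a b c \<le> r a b"
  shows "(\<integral>\<^sup>+b. \<integral>\<^sup>+c. \<integral>\<^sup>+a. (w a b c)^3 \<partial>lborel \<partial>lborel \<partial>lborel)\<^sup>2
     \<le> (\<integral>\<^sup>+b. \<integral>\<^sup>+c. (p b c)\<^sup>2 \<partial>lborel \<partial>lborel) * (\<integral>\<^sup>+c. \<integral>\<^sup>+a. (q a c)\<^sup>2 \<partial>lborel \<partial>lborel)
        * (\<integral>\<^sup>+b. \<integral>\<^sup>+a. (r a b)\<^sup>2 \<partial>lborel \<partial>lborel)"
proof -
  define J where "J = (\<lambda>b c. \<integral>\<^sup>+a. q a c * r a b \<partial>lborel)"
  have pm[measurable]: "(\<lambda>x. p (f x) (g x)) \<in> borel_measurable M"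
    if "f \<in> borel_measurable M" "g \<in> borel_measurable M" for M and f g :: "'z \<Rightarrow> real"
    using measurable_compose[OF borel_measurable_Pair[OF that] assms(2)] by simp
  have qm[measurable]: "(\<lambda>x. q (f x) (g x)) \<in> borel_measurable M"
    if "f \<in> borel_measurable M" "g \<in> borel_measurable M" for M and f g :: "'z \<Rightarrow> real"
    using measurable_compose[OF borel_measurable_Pair[OF that] assms(3)] by simp
  have rm[measurable]: "(\<lambda>x. r (f x) (g x)) \<in> borel_measurable M"
    if "f \<in> borel_measurable M" "g \<in> borel_measurable M" for M and f g :: "'z \<Rightarrow> real"
    using measurable_compose[OF borel_measurable_Pair[OF that] assms(4)] by simp
  have Jm[measurable]: "(\<lambda>p. J (fst p) (snd p)) \<in> borel_measurable (lborel \<Otimes>\<^sub>M lborel)"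
    unfolding J_def by measurable
  have w3: "(w a b c)^3 \<le> p b c * (q a c * r a b)" for a b c
  proof -
    have "(w a b c)^3 = w a b c * (w a b c * w a b c)" by (simp add: power3_eq_cube mult.assoc)
    also have "\<dots> \<le> p b c * (q a c * r a b)" by (intro mult_mono le) auto
    finally show ?thesis .
  qed
  have "(\<integral>\<^sup>+b. \<integral>\<^sup>+c. \<integral>\<^sup>+a. (w a b c)^3 \<partial>lborel \<partial>lborel \<partial>lborel)
      \<le> (\<integral>\<^sup>+b. \<integral>\<^sup>+c. \<integral>\<^sup>+a. p b c * (q a c * r a b) \<partial>lborel \<partial>lborel \<partial>lborel)"
    by (intro nn_integral_mono w3)
  also have "\<dots> = (\<integral>\<^sup>+b. \<integral>\<^sup>+c. p b c * J b c \<partial>lborel \<partial>lborel)"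
    unfolding J_def by (intro nn_integral_cong nn_integral_cmult) measurable
  also have "\<dots> = (\<integral>\<^sup>+x. p (fst x) (snd x) * J (fst x) (snd x) \<partial>(lborel \<Otimes>\<^sub>M lborel))"
    by (subst lborel.nn_integral_fst[symmetric]) auto
  finally have "(\<integral>\<^sup>+b. \<integral>\<^sup>+c. \<integral>\<^sup>+a. (w a b c)^3 \<partial>lborel \<partial>lborel \<partial>lborel)\<^sup>2
      \<le> (\<integral>\<^sup>+x. p (fst x) (snd x) * J (fst x) (snd x) \<partial>(lborel \<Otimes>\<^sub>M lborel))\<^sup>2"
    by (intro power_mono) auto
  also have "\<dots> \<le> (\<integral>\<^sup>+x. (p (fst x) (snd x))\<^sup>2 \<partial>(lborel \<Otimes>\<^sub>M lborel)) * (\<integral>\<^sup>+x. (J (fst x) (snd x))\<^sup>2 \<partial>(lborel \<Otimes>\<^sub>M lborel))"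
    by (rule Cauchy_Schwarz_nn_integral) measurable
  also have "(\<integral>\<^sup>+x. (p (fst x) (snd x))\<^sup>2 \<partial>(lborel \<Otimes>\<^sub>M lborel)) = (\<integral>\<^sup>+b. \<integral>\<^sup>+c. (p b c)\<^sup>2 \<partial>lborel \<partial>lborel)"
    by (subst lborel.nn_integral_fst[symmetric]) auto
  also have "(\<integral>\<^sup>+x. (J (fst x) (snd x))\<^sup>2 \<partial>(lborel \<Otimes>\<^sub>M lborel)) = (\<integral>\<^sup>+b. \<integral>\<^sup>+c. (J b c)\<^sup>2 \<partial>lborel \<partial>lborel)"
    by (subst lborel.nn_integral_fst[symmetric]) auto
  also have "\<dots> \<le> (\<integral>\<^sup>+b. \<integral>\<^sup>+c. (\<integral>\<^sup>+a. (q a c)\<^sup>2 \<partial>lborel) * (\<integral>\<^sup>+a. (r a b)\<^sup>2 \<partial>lborel) \<partial>lborel \<partial>lborel)"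
    unfolding J_def by (intro nn_integral_mono Cauchy_Schwarz_nn_integral) measurable
  also have "\<dots> = (\<integral>\<^sup>+b. (\<integral>\<^sup>+c. \<integral>\<^sup>+a. (q a c)\<^sup>2 \<partial>lborel \<partial>lborel) * (\<integral>\<^sup>+a. (r a b)\<^sup>2 \<partial>lborel) \<partial>lborel)"
    by (intro nn_integral_cong nn_integral_multc) measurable
  also have "\<dots> = (\<integral>\<^sup>+c. \<integral>\<^sup>+a. (q a c)\<^sup>2 \<partial>lborel \<partial>lborel) * (\<integral>\<^sup>+b. \<integral>\<^sup>+a. (r a b)\<^sup>2 \<partial>lborel \<partial>lborel)"
    by (intro nn_integral_cmult) measurable
  finally show ?thesis by (simp add: mult.assoc mult_left_mono)
qed

lemma ennsqrt_power2: "(ennsqrt a)\<^sup>2 = a"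
  unfolding ennsqrt_def by (cases a) (auto simp: ennreal_power infinity_ennreal_def)

lemma ennsqrt_measurable [measurable]: "ennsqrt \<in> borel_measurable borel"
  unfolding ennsqrt_def[abs_def] by measurable

lemma le_ennsqrt: "a \<ge> 0 \<Longrightarrow> ennreal (a\<^sup>2) \<le> P \<Longrightarrow> ennreal a \<le> ennsqrt P"
proof -
  assume a: "a \<ge> 0" and le: "ennreal (a\<^sup>2) \<le> P"
  show ?thesis
  proof (cases P)
    case (real x)
    then have "a\<^sup>2 \<le> x" using le by (simp add: ennreal_le_iff)
    then have "a \<le> sqrt x" by (simp add: a real_le_rsqrt)
    then show ?thesis using real by (simp add: ennsqrt_def ennreal_leI infinity_ennreal_def)
  qed (simp add: ennsqrt_def infinity_ennreal_def)
qed

text \<open>The hypothesis \<open>line\<close> is the fundamental theorem of calculus for V^4.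
  \<open>Loomis_Whitney\<close> with w = V^2 bounds m^2, for m the integral of V^6, by 64 times the
  product of the integrals \<open>A j\<close> of |V|^3 |G j|; by Cauchy-Schwarz each
  \<open>(A j)\<^sup>2\<close> is at most m B. Squaring gives m^4 at most 64^2 m^3 B^3. Boundedness
  and integrability of \<open>V\<close> make m finite, so m^3 cancels.\<close>

lemma Gagliardo_Nirenberg_lines:
  fixes V :: "real^3 \<Rightarrow> real" and G :: "3 \<Rightarrow> real^3 \<Rightarrow> real"
  assumes [measurable]: "V \<in> borel_measurable borel" "\<And>j. G j \<in> borel_measurable borel"
    and bnd: "\<And>x. \<bar>V x\<bar> \<le> M" and L1: "(\<integral>\<^sup>+x. ennreal \<bar>V x\<bar> \<partial>lborel) < \<infinity>"
    and line: "\<And>j x. ennreal (V x ^ 4) \<le> 4 * (\<integral>\<^sup>+s. ennreal (\<bar>V (x + s *\<^sub>R axis j 1)\<bar> ^ 3 * \<bar>G j (x + s *\<^sub>R axis j 1)\<bar>) \<partial>lborel)"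
    and B: "\<And>j. (\<integral>\<^sup>+x. ennreal ((G j x)\<^sup>2) \<partial>lborel) \<le> ennreal B"
  shows "(\<integral>\<^sup>+x. ennreal (V x ^ 6) \<partial>lborel) \<le> 4096 * (ennreal B)^3"
proof -
  define F where "F = (\<lambda>j x. ennreal (\<bar>V x\<bar> ^ 3 * \<bar>G j x\<bar>))"
  have [measurable]: "F j \<in> borel_measurable borel" for j unfolding F_def by measurable
  have Fa: "ennreal (\<bar>V x\<bar> ^ 3 * \<bar>G j x\<bar>) = F j x" for j x unfolding F_def ..
  define A where "A = (\<lambda>j. \<integral>\<^sup>+x. F j x \<partial>lborel)"
  define m where "m = (\<integral>\<^sup>+x. ennreal (V x ^ 6) \<partial>lborel)"
  have shift: "(\<integral>\<^sup>+s. h (a + s) \<partial>lborel) = (\<integral>\<^sup>+s. h s \<partial>lborel)" if [measurable]: "h \<in> borel_measurable borel" for h :: "real \<Rightarrow> ennreal" and a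
    using nn_integral_real_affine[of h 1 a] by simp
  have l1: "ennreal (V (vec3 a b c) ^ 4) \<le> 4 * (\<integral>\<^sup>+s. F 1 (vec3 s b c) \<partial>lborel)" for a b c
    using line[of "vec3 a b c" 1, unfolded vec3_shift Fa] shift[of "\<lambda>s. F 1 (vec3 s b c)" a] by simp
  have l2: "ennreal (V (vec3 a b c) ^ 4) \<le> 4 * (\<integral>\<^sup>+s. F 2 (vec3 a s c) \<partial>lborel)" for a b c
    using line[of "vec3 a b c" 2, unfolded vec3_shift Fa] shift[of "\<lambda>s. F 2 (vec3 a s c)" b] by simp
  have l3: "ennreal (V (vec3 a b c) ^ 4) \<le> 4 * (\<integral>\<^sup>+s. F 3 (vec3 a b s) \<partial>lborel)" for a b c
    using line[of "vec3 a b c" 3, unfolded vec3_shift Fa] shift[of "\<lambda>s. F 3 (vec3 a b s)" c] by simp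
  have sq: "ennreal (V x ^ 2) \<le> ennsqrt P" if "ennreal (V x ^ 4) \<le> P" for x P
    using that by (intro le_ennsqrt) auto
  have "(\<integral>\<^sup>+b. \<integral>\<^sup>+c. \<integral>\<^sup>+a. (ennreal (V (vec3 a b c) ^ 2))^3 \<partial>lborel \<partial>lborel \<partial>lborel)\<^sup>2
     \<le> (\<integral>\<^sup>+b. \<integral>\<^sup>+c. (ennsqrt (4 * (\<integral>\<^sup>+s. F 1 (vec3 s b c) \<partial>lborel)))\<^sup>2 \<partial>lborel \<partial>lborel)
       * (\<integral>\<^sup>+c. \<integral>\<^sup>+a. (ennsqrt (4 * (\<integral>\<^sup>+s. F 2 (vec3 a s c) \<partial>lborel)))\<^sup>2 \<partial>lborel \<partial>lborel)
       * (\<integral>\<^sup>+b. \<integral>\<^sup>+a. (ennsqrt (4 * (\<integral>\<^sup>+s. F 3 (vec3 a b s) \<partial>lborel)))\<^sup>2 \<partial>lborel \<partial>lborel)"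
    by (rule Loomis_Whitney) (auto intro!: sq l1 l2 l3 simp: borel_prod[symmetric] case_prod_unfold)
  also have "(\<integral>\<^sup>+b. \<integral>\<^sup>+c. (ennsqrt (4 * (\<integral>\<^sup>+s. F 1 (vec3 s b c) \<partial>lborel)))\<^sup>2 \<partial>lborel \<partial>lborel) = 4 * A 1"
    unfolding A_def ennsqrt_power2 nn_integral_vec3(1)[of "F 1", simplified]
    by (simp add: nn_integral_cmult)
  also have "(\<integral>\<^sup>+c. \<integral>\<^sup>+a. (ennsqrt (4 * (\<integral>\<^sup>+s. F 2 (vec3 a s c) \<partial>lborel)))\<^sup>2 \<partial>lborel \<partial>lborel) = 4 * A 2"
    unfolding A_def ennsqrt_power2 nn_integral_vec3(2)[of "F 2", simplified]
    by (simp add: nn_integral_cmult)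
  also have "(\<integral>\<^sup>+b. \<integral>\<^sup>+a. (ennsqrt (4 * (\<integral>\<^sup>+s. F 3 (vec3 a b s) \<partial>lborel)))\<^sup>2 \<partial>lborel \<partial>lborel) = 4 * A 3"
    unfolding A_def ennsqrt_power2 nn_integral_vec3(3)[of "F 3", simplified]
    by (simp add: nn_integral_cmult)
  also have "(\<integral>\<^sup>+b. \<integral>\<^sup>+c. \<integral>\<^sup>+a. (ennreal (V (vec3 a b c) ^ 2))^3 \<partial>lborel \<partial>lborel \<partial>lborel) = m"
    unfolding m_def by (subst nn_integral_vec3(1)) (auto simp: ennreal_power)
  finally have m2: "m\<^sup>2 \<le> 4 * A 1 * (4 * A 2) * (4 * A 3)" .
  have A2: "(A j)\<^sup>2 \<le> m * ennreal B" for j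
  proof -
    have "(A j)\<^sup>2 = (\<integral>\<^sup>+x. ennreal (\<bar>V x\<bar> ^ 3) * ennreal \<bar>G j x\<bar> \<partial>lborel)\<^sup>2"
      unfolding A_def F_def by (simp add: ennreal_mult)
    also have "\<dots> \<le> (\<integral>\<^sup>+x. (ennreal (\<bar>V x\<bar> ^ 3))\<^sup>2 \<partial>lborel) * (\<integral>\<^sup>+x. (ennreal \<bar>G j x\<bar>)\<^sup>2 \<partial>lborel)"
      by (rule Cauchy_Schwarz_nn_integral) measurable
    also have "\<dots> = m * (\<integral>\<^sup>+x. ennreal ((G j x)\<^sup>2) \<partial>lborel)"
      unfolding m_def by (simp add: ennreal_power flip: power_mult)
    also have "\<dots> \<le> m * ennreal B" by (intro mult_left_mono B) auto
    finally show ?thesis .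
  qed
  have mfin: "m < \<infinity>"
  proof -
    have "m \<le> (\<integral>\<^sup>+x. ennreal (M^5) * ennreal \<bar>V x\<bar> \<partial>lborel)"
      unfolding m_def
    proof (intro nn_integral_mono)
      fix x
      have "V x ^ 6 = \<bar>V x\<bar>^5 * \<bar>V x\<bar>"
      proof -
        have "\<bar>V x\<bar>^6 = \<bar>V x\<bar>^5 * \<bar>V x\<bar>" by (simp add: eval_nat_numeral)
        then show ?thesis by (simp add: power_even_abs)
      qed
      also have "\<dots> \<le> M^5 * \<bar>V x\<bar>" using bnd[of x] by (intro mult_right_mono power_mono) auto
      finally have "V x ^ 6 \<le> M^5 * \<bar>V x\<bar>" .
      moreover have "M \<ge> 0" using bnd[of 0] by linarith
      ultimately show "ennreal (V x ^ 6) \<le> ennreal (M^5) * ennreal \<bar>V x\<bar>"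
        by (simp add: ennreal_mult'[symmetric] ennreal_leI)
    qed
    also have "\<dots> = ennreal (M^5) * (\<integral>\<^sup>+x. ennreal \<bar>V x\<bar> \<partial>lborel)" by (rule nn_integral_cmult) measurable
    also have "\<dots> < \<infinity>" using L1 by (simp add: ennreal_mult_less_top)
    finally show ?thesis .
  qed
  have "m^4 = (m\<^sup>2)\<^sup>2" by simp
  also have "\<dots> \<le> (4 * A 1 * (4 * A 2) * (4 * A 3))\<^sup>2" by (intro power_mono m2) auto
  also have "\<dots> = 4096 * ((A 1)\<^sup>2 * (A 2)\<^sup>2 * (A 3)\<^sup>2)"
    by (simp add: power_mult_distrib mult_ac)
  also have "\<dots> \<le> 4096 * ((m * ennreal B) * (m * ennreal B) * (m * ennreal B))"
    by (intro mult_left_mono mult_mono A2) auto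
  also have "\<dots> = m^3 * (4096 * (ennreal B)^3)" by (simp add: power3_eq_cube mult_ac)
  finally have "m^3 * m \<le> m^3 * (4096 * (ennreal B)^3)" by (simp add: power4_eq_xxxx power3_eq_cube mult_ac)
  show ?thesis unfolding m_def[symmetric]
  proof (cases "m = 0")
    case False
    have "m^3 \<noteq> 0" "m^3 \<noteq> top" using False mfin by (auto simp: power_eq_top_ennreal_iff)
    then show "m \<le> 4096 * (ennreal B)^3"
      using \<open>m^3 * m \<le> m^3 * (4096 * (ennreal B)^3)\<close> by (subst (asm) ennreal_mult_le_mult_iff) auto
  qed simp
qed

section \<open>Mollification and the Sobolev inequality\<close>

definition gs :: "'a::euclidean_space \<Rightarrow> real" where
  "gs z = exp (- (z \<bullet> z))"

text \<open>Mollification without normalization: the limit is \<open>gmass\<close> times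
  \<open>v\<close>, and these factors cancel at the end of \<open>Sobolev_L6\<close>. The Gaussian
  is explicit and smooth; its tails do no harm because the test functions built from it carry a
  compactly supported factor.\<close>

definition mol :: "real \<Rightarrow> ('a::euclidean_space \<Rightarrow> real) \<Rightarrow> 'a \<Rightarrow> real" where
  "mol d v x = (\<integral>z. v (x + d *\<^sub>R z) * gs z \<partial>lborel)"

lemma gs_pos [simp]: "gs z > 0" and gs_nonneg [simp]: "gs z \<ge> 0" and gs_le_1: "gs z \<le> 1"
  and gs_minus [simp]: "gs (- z) = gs z"
  by (simp_all add: gs_def)

lemma gs_measurable [measurable]: "gs \<in> borel_measurable borel"
  unfolding gs_def[abs_def] by measurable

lemma gs_integrable: "integrable lborel (gs :: 'a::euclidean_space \<Rightarrow> real)"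
proof (rule integrableI_nonneg)
  define I where "I = (\<integral>\<^sup>+t. ennreal (exp (- (t::real)\<^sup>2)) \<partial>lborel)"
  have "(\<lambda>t. exp (- (t::real)\<^sup>2)) = (\<lambda>t. sqrt pi * normal_density 0 (1 / sqrt 2) t)"
    by (auto simp: normal_density_def power_divide)
  then have "integrable lborel (\<lambda>t. exp (- (t::real)\<^sup>2))"
    using integrable_normal_density[of "1 / sqrt 2" 0] by simp
  then have I: "I < \<infinity>" unfolding I_def by (simp add: integrable_iff_bounded)
  have "(\<integral>\<^sup>+z. ennreal (gs (z::'a)) \<partial>lborel) = (\<integral>\<^sup>+z. (\<Prod>b\<in>Basis. ennreal (exp (- ((z::'a) \<bullet> b)\<^sup>2))) \<partial>lborel)"
  proof (intro nn_integral_cong)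
    fix z :: 'a
    have "z \<bullet> z = (\<Sum>b\<in>Basis. (z \<bullet> b)\<^sup>2)" by (subst euclidean_inner) (simp add: power2_eq_square)
    then show "ennreal (gs z) = (\<Prod>b\<in>Basis. ennreal (exp (- (z \<bullet> b)\<^sup>2)))"
      by (simp add: gs_def sum_negf[symmetric] exp_sum prod_ennreal)
  qed
  also have "\<dots> = (\<Prod>b\<in>(Basis::'a set). I)"
    unfolding I_def by (rule nn_integral_lborel_prod) auto
  also have "\<dots> < \<infinity>" using I by (simp add: power_less_top_ennreal)
  finally show "(\<integral>\<^sup>+z. ennreal (gs (z::'a)) \<partial>lborel) < \<infinity>" .
qed auto

definition gmass :: "'a::euclidean_space itself \<Rightarrow> real" where
  "gmass _ = (\<integral>z. gs (z::'a) \<partial>lborel)"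

lemma gmass_nn: "(\<integral>\<^sup>+z. ennreal (gs (z::'a::euclidean_space)) \<partial>lborel) = ennreal (gmass TYPE('a))"
  unfolding gmass_def by (rule nn_integral_eq_integral[OF gs_integrable]) auto

lemma gmass_pos: "gmass TYPE('a::euclidean_space) > 0"
proof -
  have "gmass TYPE('a) \<ge> 0" unfolding gmass_def by simp
  moreover have "gmass TYPE('a) \<noteq> 0"
  proof
    assume "gmass TYPE('a) = 0"
    then have "(\<integral>\<^sup>+z. ennreal (gs (z::'a)) \<partial>lborel) = 0" by (simp add: gmass_nn)
    then have "AE z in lborel. ennreal (gs (z::'a)) = 0" by (subst (asm) nn_integral_0_iff_AE) auto
    then have "AE z in (lborel :: 'a measure). False" by eventually_elim (metis ennreal_eq_zero_iff gs_nonneg gs_pos less_irrefl)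
    then show False using AE_iff_measurable[of UNIV "lborel::'a measure" "\<lambda>_. False"] emeasure_lborel_UNIV[where 'a='a]
      by auto
  qed
  ultimately show ?thesis by linarith
qed

lemma gs_has_derivative: "(gs has_derivative (\<lambda>h. - 2 * (w \<bullet> h) * gs w)) (at w)"
  unfolding gs_def[abs_def] by (auto intro!: derivative_eq_intros simp: inner_commute)

lemma gs_Lipschitz: "\<bar>gs w - gs w'\<bar> \<le> 2 * norm (w - w')"
proof -
  have "norm (gs w - gs w') \<le> 2 * norm (w - w')"
  proof (rule differentiable_bound[of UNIV])
    fix x :: 'a
    show "(gs has_derivative (\<lambda>h. - 2 * (x \<bullet> h) * gs x)) (at x within UNIV)"
      by (rule gs_has_derivative)
    show "onorm (\<lambda>h. - 2 * (x \<bullet> h) * gs x) \<le> 2"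
    proof (rule onorm_bound)
      fix h :: 'a
      have "norm x \<le> 1 + (norm x)\<^sup>2" using zero_le_power2[of "norm x - 1/2"] by (simp add: power2_eq_square algebra_simps)
      also have "\<dots> \<le> exp ((norm x)\<^sup>2)" by (rule exp_ge_add_one_self)
      finally have "norm x * gs x \<le> 1"
        by (simp add: gs_def power2_norm_eq_inner exp_minus field_simps)
      then have "(norm x * gs x) * norm h \<le> 1 * norm h" by (rule mult_right_mono) simp
      moreover have "\<bar>x \<bullet> h\<bar> * gs x \<le> (norm x * norm h) * gs x"
        by (intro mult_right_mono Cauchy_Schwarz_ineq2) simp
      moreover have "(norm x * norm h) * gs x = (norm x * gs x) * norm h" by simp
      ultimately have "\<bar>x \<bullet> h\<bar> * gs x \<le> norm h" by linarith
      then show "norm (- 2 * (x \<bullet> h) * gs x) \<le> 2 * norm h"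
        by (simp add: abs_mult)
    qed simp
  qed auto
  then show ?thesis by simp
qed

text \<open>This crude decay is enough both for vanishing at infinity along lines and for bounding
  \<open>norm w * gs w\<close>.\<close>

lemma gs_le_inverse: "gs w \<le> 2 / (1 + norm w)"
proof -
  have "1 + norm w \<le> 2 * (1 + (norm w)\<^sup>2)"
  proof -
    have *: "1 + n \<le> 2 * (1 + a)" if "n \<le> a + 1/4" "0 \<le> a" for n a :: real
      using that by simp
    have "norm w \<le> norm w * norm w + 1/4"
      using zero_le_power2[of "norm w - 1/2"] unfolding power2_diff by (simp add: power2_eq_square)
    moreover have "0 \<le> norm w * norm w" by simp
    ultimately show ?thesis unfolding power2_eq_square by (rule *)
  qed
  also have "\<dots> \<le> 2 * exp ((norm w)\<^sup>2)" by (intro mult_left_mono exp_ge_add_one_self) simp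
  finally have "(1 + norm w) * exp (- (norm w)\<^sup>2) \<le> 2 * exp ((norm w)\<^sup>2) * exp (- (norm w)\<^sup>2)"
    by (rule mult_right_mono) simp
  then have "(1 + norm w) * gs w \<le> 2"
    by (simp add: gs_def power2_norm_eq_inner exp_minus_inverse mult.assoc)
  then show ?thesis by (simp add: field_simps add_pos_nonneg)
qed

text \<open>The substitution y = x + d z moves the dependence on \<open>x\<close> from the merely
  integrable \<open>v\<close> to the Gaussian, from which regularity in \<open>x\<close> can be read
  off.\<close>

lemma mol_kernel:
  fixes v :: "'a::euclidean_space \<Rightarrow> real"
  assumes d: "d > 0" and [measurable]: "v \<in> borel_measurable borel"
  shows "mol d v x = (\<integral>y. v y * gs ((x - y) /\<^sub>R d) \<partial>lborel) / d ^ DIM('a)"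
proof -
  define F where "F = (\<lambda>y. v y * gs ((x - y) /\<^sub>R d))"
  have [measurable]: "F \<in> borel_measurable borel" unfolding F_def by measurable
  have "(\<integral>y. F y \<partial>lborel) = (\<integral>y. F y \<partial>density (distr lborel borel (\<lambda>z. x + d *\<^sub>R z)) (\<lambda>_. \<bar>d\<bar>^DIM('a)))"
    using lborel_affine[of d x] d by simp
  also have "\<dots> = (\<integral>y. d ^ DIM('a) * F y \<partial>distr lborel borel (\<lambda>z. x + d *\<^sub>R z))"
    using d by (subst integral_density) auto
  also have "\<dots> = (\<integral>z. d ^ DIM('a) * F (x + d *\<^sub>R z) \<partial>lborel)"
    by (subst integral_distr) auto
  also have "\<dots> = d ^ DIM('a) * mol d v x"
    unfolding mol_def F_def using d by simp
  finally show ?thesis unfolding F_def using d by (simp add: field_simps)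
qed

context
  fixes v :: "'a::euclidean_space \<Rightarrow> real" and d :: real
  assumes v: "integrable lborel v" and d: "d > 0"
begin

lemma v_m [measurable]: "v \<in> borel_measurable borel" using v by auto

lemma int_gs: "integrable lborel (\<lambda>y. v y * gs ((x - y) /\<^sub>R d))"
  by (rule Bochner_Integration.integrable_bound[OF v])
     (auto simp: abs_mult gs_le_1 mult_left_le)

lemma mol_bounded: "\<bar>mol d v x\<bar> \<le> (\<integral>y. \<bar>v y\<bar> \<partial>lborel) / d ^ DIM('a)"
proof -
  have "\<bar>\<integral>y. v y * gs ((x - y) /\<^sub>R d) \<partial>lborel\<bar> \<le> (\<integral>y. \<bar>v y * gs ((x - y) /\<^sub>R d)\<bar> \<partial>lborel)"
    by (rule integral_abs_bound)
  also have "\<dots> \<le> (\<integral>y. \<bar>v y\<bar> \<partial>lborel)"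
    by (intro integral_mono integrable_abs int_gs v) (auto simp: abs_mult gs_le_1 mult_left_le)
  finally show ?thesis unfolding mol_kernel[OF d v_m] using d by (simp add: divide_right_mono abs_divide)
qed

lemma mol_Lipschitz: "\<bar>mol d v x - mol d v x'\<bar> \<le> (\<integral>y. \<bar>v y\<bar> \<partial>lborel) * (2 / d) / d ^ DIM('a) * norm (x - x')"
proof -
  have "\<bar>(\<integral>y. v y * gs ((x - y) /\<^sub>R d) \<partial>lborel) - (\<integral>y. v y * gs ((x' - y) /\<^sub>R d) \<partial>lborel)\<bar>
     = \<bar>\<integral>y. v y * gs ((x - y) /\<^sub>R d) - v y * gs ((x' - y) /\<^sub>R d) \<partial>lborel\<bar>"
    by (subst Bochner_Integration.integral_diff[OF int_gs int_gs]) simp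
  also have "\<dots> \<le> (\<integral>y. \<bar>v y * gs ((x - y) /\<^sub>R d) - v y * gs ((x' - y) /\<^sub>R d)\<bar> \<partial>lborel)"
    by (rule integral_abs_bound)
  also have "\<dots> \<le> (\<integral>y. \<bar>v y\<bar> * (2 / d * norm (x - x')) \<partial>lborel)"
  proof (intro integral_mono)
    fix y
    have "\<bar>gs ((x - y) /\<^sub>R d) - gs ((x' - y) /\<^sub>R d)\<bar> \<le> 2 * norm ((x - y) /\<^sub>R d - (x' - y) /\<^sub>R d)"
      by (rule gs_Lipschitz)
    also have "(x - y) /\<^sub>R d - (x' - y) /\<^sub>R d = (x - x') /\<^sub>R d" by (simp add: algebra_simps)
    also have "2 * norm ((x - x') /\<^sub>R d) = 2 / d * norm (x - x')" using d by (simp add: divide_inverse)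
    finally have "\<bar>v y\<bar> * \<bar>gs ((x - y) /\<^sub>R d) - gs ((x' - y) /\<^sub>R d)\<bar> \<le> \<bar>v y\<bar> * (2 / d * norm (x - x'))"
      by (rule mult_left_mono) simp
    then show "\<bar>v y * gs ((x - y) /\<^sub>R d) - v y * gs ((x' - y) /\<^sub>R d)\<bar> \<le> \<bar>v y\<bar> * (2 / d * norm (x - x'))"
      by (simp only: right_diff_distrib[symmetric] abs_mult)
  qed (use v int_gs in auto)
  also have "\<dots> = (\<integral>y. \<bar>v y\<bar> \<partial>lborel) * (2 / d * norm (x - x'))" by simp
  finally have "\<bar>(\<integral>y. v y * gs ((x - y) /\<^sub>R d) \<partial>lborel) - (\<integral>y. v y * gs ((x' - y) /\<^sub>R d) \<partial>lborel)\<bar> / d ^ DIM('a)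
      \<le> (\<integral>y. \<bar>v y\<bar> \<partial>lborel) * (2 / d * norm (x - x')) / d ^ DIM('a)"
    using d by (intro divide_right_mono) auto
  then show ?thesis
    unfolding mol_kernel[OF d v_m] using d by (simp add: diff_divide_distrib[symmetric] abs_divide)
qed

lemma mol_continuous: "continuous_on UNIV (mol d v)"
proof -
  define L where "L = (\<integral>y. \<bar>v y\<bar> \<partial>lborel) * (2 / d) / d ^ DIM('a)"
  have "L-lipschitz_on UNIV (mol d v)"
    by (rule lipschitz_onI) (use mol_Lipschitz d in \<open>auto simp: L_def dist_real_def dist_norm\<close>)
  then show ?thesis by (rule lipschitz_on_continuous_on)
qed

lemma mol_measurable: "mol d v \<in> borel_measurable borel"
  by (rule borel_measurable_continuous_onI[OF mol_continuous])

lemma mol_line_derivative: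
  shows "((\<lambda>s. mol d v (x + s *\<^sub>R e)) has_real_derivative
     (\<integral>y. v y * (- 2 * ((x + s *\<^sub>R e - y) \<bullet> e) / d\<^sup>2 * gs ((x + s *\<^sub>R e - y) /\<^sub>R d)) \<partial>lborel) / d ^ DIM('a)) (at s)"
proof -
  define k where "k = (\<lambda>s y. gs ((x + s *\<^sub>R e - y) /\<^sub>R d))"
  define k' where "k' = (\<lambda>s y. - 2 * ((x + s *\<^sub>R e - y) \<bullet> e) / d\<^sup>2 * gs ((x + s *\<^sub>R e - y) /\<^sub>R d))"
  define H where "H = (\<lambda>s. \<integral>y. v y * k s y \<partial>lborel)"
  have kd: "((\<lambda>s. k s y) has_real_derivative k' s y) (at s)" for y
  proof -
    have "((\<lambda>s. (x + s *\<^sub>R e - y) /\<^sub>R d) has_derivative (\<lambda>h. (h *\<^sub>R e) /\<^sub>R d)) (at s)"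
      by (auto intro!: derivative_eq_intros)
    from has_derivative_compose[OF this gs_has_derivative]
    have "((\<lambda>s. gs ((x + s *\<^sub>R e - y) /\<^sub>R d)) has_derivative
        (\<lambda>h. - 2 * (((x + s *\<^sub>R e - y) /\<^sub>R d) \<bullet> ((h *\<^sub>R e) /\<^sub>R d)) * gs ((x + s *\<^sub>R e - y) /\<^sub>R d))) (at s)" .
    moreover have "- 2 * ((w /\<^sub>R d) \<bullet> ((h *\<^sub>R e) /\<^sub>R d)) * c = (- 2 * (w \<bullet> e) / d\<^sup>2 * c) * h" for w h c
      by (simp add: power2_eq_square divide_inverse)
    ultimately show ?thesis unfolding has_field_derivative_def k_def k'_def by (simp only: )
  qed
  \<comment> \<open>The Lipschitz bound of the Gaussian dominates the difference quotients, which
    justifies differentiation under the integral.\<close>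
  have kL: "\<bar>k t y - k s y\<bar> \<le> 2 / d * norm e * \<bar>t - s\<bar>" for t y
  proof -
    have "\<bar>k t y - k s y\<bar> \<le> 2 * norm ((x + t *\<^sub>R e - y) /\<^sub>R d - (x + s *\<^sub>R e - y) /\<^sub>R d)"
      unfolding k_def by (rule gs_Lipschitz)
    also have "(x + t *\<^sub>R e - y) /\<^sub>R d - (x + s *\<^sub>R e - y) /\<^sub>R d = ((t - s) / d) *\<^sub>R e"
    proof -
      have "(x + t *\<^sub>R e - y) - (x + s *\<^sub>R e - y) = (t - s) *\<^sub>R e" by (simp add: algebra_simps)
      then show ?thesis unfolding scaleR_diff_right[symmetric] by (simp add: divide_inverse mult.commute)
    qed
    also have "2 * norm (((t - s) / d) *\<^sub>R e) = 2 / d * norm e * \<bar>t - s\<bar>" using d by simp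
    finally show ?thesis .
  qed
  have int: "integrable lborel (\<lambda>y. v y * k t y)" for t unfolding k_def by (rule int_gs)
  have [measurable]: "(\<lambda>y. k t y) \<in> borel_measurable borel" "(\<lambda>y. k' t y) \<in> borel_measurable borel" for t
    unfolding k_def k'_def by measurable
  have "(H has_real_derivative (\<integral>y. v y * k' s y \<partial>lborel)) (at s)"
    unfolding has_field_derivative_iff tendsto_at_iff_sequentially o_def
  proof (intro allI impI)
    fix X :: "nat \<Rightarrow> real" assume X: "\<forall>i. X i \<in> UNIV - {s}" "X \<longlonglongrightarrow> s"
    have "(\<lambda>i. \<integral>y. v y * ((k (X i) y - k s y) / (X i - s)) \<partial>lborel) \<longlonglongrightarrow> (\<integral>y. v y * k' s y \<partial>lborel)"
    proof (rule integral_dominated_convergence[where w="\<lambda>y. \<bar>v y\<bar> * (2 / d * norm e)"])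
      show "integrable lborel (\<lambda>y. \<bar>v y\<bar> * (2 / d * norm e))" using v by auto
      show "AE y in lborel. (\<lambda>i. v y * ((k (X i) y - k s y) / (X i - s))) \<longlonglongrightarrow> v y * k' s y"
      proof (intro AE_I2 tendsto_mult tendsto_const)
        fix y
        show "(\<lambda>i. (k (X i) y - k s y) / (X i - s)) \<longlonglongrightarrow> k' s y"
          using kd[of y] X unfolding has_field_derivative_iff tendsto_at_iff_sequentially o_def by auto
      qed
      show "AE y in lborel. norm (v y * ((k (X i) y - k s y) / (X i - s))) \<le> \<bar>v y\<bar> * (2 / d * norm e)" for i
      proof (intro AE_I2)
        fix y
        have "\<bar>(k (X i) y - k s y) / (X i - s)\<bar> \<le> 2 / d * norm e"
          using kL[of "X i" y] X(1)[rule_format, of i] by (auto simp: abs_divide pos_divide_le_eq)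
        then show "norm (v y * ((k (X i) y - k s y) / (X i - s))) \<le> \<bar>v y\<bar> * (2 / d * norm e)"
          unfolding real_norm_def abs_mult by (intro mult_left_mono) auto
      qed
    qed auto
    moreover have "(\<integral>y. v y * ((k (X i) y - k s y) / (X i - s)) \<partial>lborel) = (H (X i) - H s) / (X i - s)" for i
    proof -
      have "(\<integral>y. v y * ((k (X i) y - k s y) / (X i - s)) \<partial>lborel) = (\<integral>y. (v y * k (X i) y - v y * k s y) / (X i - s) \<partial>lborel)"
        by (simp add: right_diff_distrib)
      then show ?thesis unfolding H_def by (simp add: Bochner_Integration.integral_diff[OF int int])
    qed
    ultimately show "(\<lambda>i. (H (X i) - H s) / (X i - s)) \<longlonglongrightarrow> (\<integral>y. v y * k' s y \<partial>lborel)" by (simp only: )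
  qed
  then have "((\<lambda>s. H s / d ^ DIM('a)) has_real_derivative (\<integral>y. v y * k' s y \<partial>lborel) / d ^ DIM('a)) (at s)"
    by (rule DERIV_cdivide)
  moreover have "(\<lambda>s. mol d v (x + s *\<^sub>R e)) = (\<lambda>s. H s / d ^ DIM('a))"
    unfolding mol_kernel[OF d v_m] H_def k_def by simp
  ultimately show ?thesis unfolding k'_def by simp
qed

text \<open>Removes the boundary term when the fundamental theorem is used along a line starting at
  minus infinity.\<close>

lemma mol_vanishes_at_infinity:
  assumes e: "norm e = 1"
  shows "(\<lambda>N. mol d v (x - real N *\<^sub>R e)) \<longlonglongrightarrow> 0"
proof -
  have "(\<lambda>N. \<integral>y. v y * gs ((x - real N *\<^sub>R e - y) /\<^sub>R d) \<partial>lborel) \<longlonglongrightarrow> (\<integral>y. 0 \<partial>(lborel :: 'a measure))"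
  proof (rule integral_dominated_convergence[where w="\<lambda>y. \<bar>v y\<bar>"])
    show "AE y in lborel. (\<lambda>N. v y * gs ((x - real N *\<^sub>R e - y) /\<^sub>R d)) \<longlonglongrightarrow> 0"
    proof (intro AE_I2 tendsto_mult_right_zero)
      fix y
      define c where "c = norm (x - y) / d"
      have "filterlim (\<lambda>N. (1 / d) * real N) at_top sequentially"
        using d by (intro filterlim_tendsto_pos_mult_at_top[OF tendsto_const _ filterlim_real_sequentially]) auto
      then have "filterlim (\<lambda>N. (1 - c) + (1 / d) * real N) at_top sequentially"
        by (rule filterlim_tendsto_add_at_top[OF tendsto_const])
      then have lim: "(\<lambda>N. 2 / ((1 - c) + (1 / d) * real N)) \<longlonglongrightarrow> 0"
        by (intro tendsto_divide_0[OF tendsto_const] filterlim_at_top_imp_at_infinity)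
      have ev: "eventually (\<lambda>N. (1 - c) + (1 / d) * real N > 0) sequentially"
        using \<open>filterlim (\<lambda>N. (1 - c) + (1 / d) * real N) at_top sequentially\<close>
        by (simp add: filterlim_at_top_dense)
      show "(\<lambda>N. gs ((x - real N *\<^sub>R e - y) /\<^sub>R d)) \<longlonglongrightarrow> 0"
      proof (rule tendsto_sandwich[OF _ _ tendsto_const lim])
        show "eventually (\<lambda>N. gs ((x - real N *\<^sub>R e - y) /\<^sub>R d) \<le> 2 / ((1 - c) + (1 / d) * real N)) sequentially"
          using ev
        proof eventually_elim
          case (elim N)
          have "real N = norm (real N *\<^sub>R e)" using e by simp
          also have "\<dots> \<le> norm (x - y) + norm (x - real N *\<^sub>R e - y)"
            using norm_triangle_ineq4[of "x - y" "x - real N *\<^sub>R e - y"] by (simp add: algebra_simps)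
          finally have "real N / d \<le> c + norm ((x - real N *\<^sub>R e - y) /\<^sub>R d)"
          proof -
            have *: "norm ((x - real N *\<^sub>R e - y) /\<^sub>R d) = norm (x - real N *\<^sub>R e - y) / d"
              using d by (simp add: divide_inverse mult.commute)
            assume "real N \<le> norm (x - y) + norm (x - real N *\<^sub>R e - y)"
            then have "real N / d \<le> (norm (x - y) + norm (x - real N *\<^sub>R e - y)) / d"
              using d by (intro divide_right_mono) auto
            then show ?thesis unfolding * c_def by (simp add: add_divide_distrib)
          qed
          then have "(1 - c) + (1 / d) * real N \<le> 1 + norm ((x - real N *\<^sub>R e - y) /\<^sub>R d)" by simp
          then have "2 / (1 + norm ((x - real N *\<^sub>R e - y) /\<^sub>R d)) \<le> 2 / ((1 - c) + (1 / d) * real N)"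
            using elim by (intro divide_left_mono) (auto intro!: mult_pos_pos add_pos_nonneg)
          then show ?case using gs_le_inverse[of "(x - real N *\<^sub>R e - y) /\<^sub>R d"] by linarith
        qed
      qed auto
    qed
    show "AE y in lborel. norm (v y * gs ((x - real N *\<^sub>R e - y) /\<^sub>R d)) \<le> \<bar>v y\<bar>" for N
      by (auto simp: abs_mult gs_le_1 mult_left_le)
  qed (use v in auto)
  then have "(\<lambda>N. (\<integral>y. v y * gs ((x - real N *\<^sub>R e - y) /\<^sub>R d) \<partial>lborel) / d ^ DIM('a)) \<longlonglongrightarrow> 0 / d ^ DIM('a)"
    by (intro tendsto_divide tendsto_const) (use d in auto)
  then show ?thesis unfolding mol_kernel[OF d v_m] by simp
qed

lemma mol_nn_le: "ennreal \<bar>mol d v x\<bar> \<le> (\<integral>\<^sup>+z. ennreal (\<bar>v (x + d *\<^sub>R z)\<bar> * gs z) \<partial>lborel)"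
proof (cases "integrable lborel (\<lambda>z. v (x + d *\<^sub>R z) * gs z)")
  case True
  then show ?thesis using integral_norm_bound_ennreal[OF True] by (simp add: mol_def abs_mult)
qed (simp add: mol_def not_integrable_integral_eq)

end

declare v_m [measurable del]

section \<open>Mollification in L^1 and L^2, convergence almost everywhere, and the Sobolev
  inequality\<close>

lemma nn_integral_lborel_translate:
  fixes f :: "'a::euclidean_space \<Rightarrow> ennreal"
  assumes [measurable]: "f \<in> borel_measurable borel"
  shows "(\<integral>\<^sup>+x. f (x + h) \<partial>lborel) = (\<integral>\<^sup>+x. f x \<partial>lborel)"
proof -
  have "(\<integral>\<^sup>+x. f x \<partial>lborel) = (\<integral>\<^sup>+x. f x \<partial>distr lborel borel ((+) h))" by (simp only: lborel_distr_plus)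
  also have "\<dots> = (\<integral>\<^sup>+x. f (h + x) \<partial>lborel)" by (subst nn_integral_distr) auto
  finally show ?thesis by (simp add: add.commute)
qed

lemma nn_integral_mollify:
  fixes f :: "'a::euclidean_space \<Rightarrow> real"
  assumes [measurable]: "f \<in> borel_measurable borel" and f0: "\<And>x. f x \<ge> 0"
  shows "(\<integral>\<^sup>+x. \<integral>\<^sup>+z. ennreal (f (x + d *\<^sub>R z) * gs z) \<partial>lborel \<partial>lborel) = ennreal (gmass TYPE('a)) * (\<integral>\<^sup>+x. ennreal (f x) \<partial>lborel)"
proof -
  have "(\<integral>\<^sup>+x. \<integral>\<^sup>+z. ennreal (f (x + d *\<^sub>R z) * gs z) \<partial>lborel \<partial>lborel)
      = (\<integral>\<^sup>+z. \<integral>\<^sup>+x. ennreal (f (x + d *\<^sub>R z) * gs z) \<partial>lborel \<partial>lborel)"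
    by (rule lborel_pair.Fubini') measurable
  also have "\<dots> = (\<integral>\<^sup>+z. \<integral>\<^sup>+x. ennreal (f (x + d *\<^sub>R z)) * ennreal (gs z) \<partial>lborel \<partial>lborel)"
    by (simp add: ennreal_mult f0)
  also have "\<dots> = (\<integral>\<^sup>+z. (\<integral>\<^sup>+x. ennreal (f (x + d *\<^sub>R z)) \<partial>lborel) * ennreal (gs z) \<partial>lborel)"
    by (intro nn_integral_cong nn_integral_multc) measurable
  also have "\<dots> = (\<integral>\<^sup>+z. (\<integral>\<^sup>+x. ennreal (f x) \<partial>lborel) * ennreal (gs (z::'a)) \<partial>lborel)"
    by (intro nn_integral_cong arg_cong2[where f="(*)"] refl nn_integral_lborel_translate) measurable
  also have "\<dots> = (\<integral>\<^sup>+x. ennreal (f x) \<partial>lborel) * ennreal (gmass TYPE('a))"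
    by (subst nn_integral_cmult) (auto simp: gmass_nn)
  finally show ?thesis by (simp add: mult.commute)
qed

lemma mol_L1:
  assumes v: "integrable lborel (v :: 'a::euclidean_space \<Rightarrow> real)" and d: "d > 0"
  shows "(\<integral>\<^sup>+x. ennreal \<bar>mol d v x\<bar> \<partial>lborel) < \<infinity>"
proof -
  have [measurable]: "v \<in> borel_measurable borel" using v by auto
  have "(\<integral>\<^sup>+x. ennreal \<bar>mol d v x\<bar> \<partial>lborel) \<le> (\<integral>\<^sup>+x. \<integral>\<^sup>+z. ennreal (\<bar>v (x + d *\<^sub>R z)\<bar> * gs z) \<partial>lborel \<partial>lborel)"
    by (intro nn_integral_mono mol_nn_le v d)
  also have "\<dots> = ennreal (gmass TYPE('a)) * (\<integral>\<^sup>+x. ennreal \<bar>v x\<bar> \<partial>lborel)"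
    by (rule nn_integral_mollify) auto
  also have "\<dots> < \<infinity>"
  proof -
    have "(\<integral>\<^sup>+x. ennreal \<bar>v x\<bar> \<partial>lborel) < \<infinity>" using v unfolding integrable_iff_bounded by simp
    then show ?thesis by (simp add: ennreal_mult_less_top)
  qed
  finally show ?thesis .
qed

lemma mol_L2:
  assumes v: "integrable lborel (v :: 'a::euclidean_space \<Rightarrow> real)" and d: "d > 0"
  shows "(\<integral>\<^sup>+x. ennreal ((mol d v x)\<^sup>2) \<partial>lborel) \<le> (ennreal (gmass TYPE('a)))\<^sup>2 * (\<integral>\<^sup>+x. ennreal ((v x)\<^sup>2) \<partial>lborel)"
proof -
  have [measurable]: "v \<in> borel_measurable borel" using v by auto
  have pw: "ennreal ((mol d v x)\<^sup>2) \<le> (\<integral>\<^sup>+z. ennreal ((v (x + d *\<^sub>R z))\<^sup>2 * gs z) \<partial>lborel) * ennreal (gmass TYPE('a))" for x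
  proof -
    have "ennreal ((mol d v x)\<^sup>2) = (ennreal \<bar>mol d v x\<bar>)\<^sup>2" by (simp add: ennreal_power)
    also have "\<dots> \<le> (\<integral>\<^sup>+z. ennreal (\<bar>v (x + d *\<^sub>R z)\<bar> * gs z) \<partial>lborel)\<^sup>2"
      by (intro power_mono mol_nn_le v d) auto
    \<comment> \<open>Splitting the weight into two square roots makes Cauchy-Schwarz act as
      Jensen's inequality for the Gaussian measure; its total mass is the extra factor.\<close>
    also have "\<dots> = (\<integral>\<^sup>+z. ennreal (\<bar>v (x + d *\<^sub>R z)\<bar> * sqrt (gs z)) * ennreal (sqrt (gs z)) \<partial>lborel)\<^sup>2"
      by (intro arg_cong[where f="\<lambda>x. x\<^sup>2"] nn_integral_cong) (simp add: ennreal_mult[symmetric] mult.assoc)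
    also have "\<dots> \<le> (\<integral>\<^sup>+z. (ennreal (\<bar>v (x + d *\<^sub>R z)\<bar> * sqrt (gs z)))\<^sup>2 \<partial>lborel) * (\<integral>\<^sup>+z. (ennreal (sqrt (gs (z::'a))))\<^sup>2 \<partial>lborel)"
      by (rule Cauchy_Schwarz_nn_integral) measurable
    also have "\<dots> = (\<integral>\<^sup>+z. ennreal ((v (x + d *\<^sub>R z))\<^sup>2 * gs z) \<partial>lborel) * ennreal (gmass TYPE('a))"
      by (simp add: ennreal_power power_mult_distrib gmass_nn)
    finally show ?thesis .
  qed
  have "(\<integral>\<^sup>+x. ennreal ((mol d v x)\<^sup>2) \<partial>lborel)
     \<le> (\<integral>\<^sup>+x. (\<integral>\<^sup>+z. ennreal ((v (x + d *\<^sub>R z))\<^sup>2 * gs z) \<partial>lborel) * ennreal (gmass TYPE('a)) \<partial>lborel)"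
    by (intro nn_integral_mono pw)
  also have "\<dots> = (\<integral>\<^sup>+x. (\<integral>\<^sup>+z. ennreal ((v (x + d *\<^sub>R z))\<^sup>2 * gs z) \<partial>lborel) \<partial>lborel) * ennreal (gmass TYPE('a))"
    by (rule nn_integral_multc) measurable
  also have "\<dots> = (ennreal (gmass TYPE('a)))\<^sup>2 * (\<integral>\<^sup>+x. ennreal ((v x)\<^sup>2) \<partial>lborel)"
    by (subst nn_integral_mollify) (auto simp: power2_eq_square mult_ac)
  finally show ?thesis .
qed

text \<open>Mollifications converge in L^1, hence almost everywhere along a subsequence, which is
  what Fatou's lemma in \<open>Sobolev_L6\<close> asks for.\<close>

lemma mol_subseq_AE:
  fixes v :: "'a::euclidean_space \<Rightarrow> real"
  assumes v: "integrable lborel v" and d: "\<And>n. d n > 0" "d \<longlonglongrightarrow> 0"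
  shows "\<exists>r::nat\<Rightarrow>nat. strict_mono r \<and> (AE x in lborel. (\<lambda>n. mol (d (r n)) v x) \<longlonglongrightarrow> gmass TYPE('a) * v x)"
proof -
  have [measurable]: "v \<in> borel_measurable borel" using v by auto
  note m = L1_mollify[OF v gs_integrable[where 'a='a] gs_nonneg bounded_linear_ident d(2)]
  define u where "u = (\<lambda>n x. \<integral>z. (v (x + d n *\<^sub>R z) - v x) * gs z \<partial>lborel)"
  have iu: "integrable lborel (u n)" for n
    unfolding u_def using lborel_pair.integrable_fst'[OF m(1)[of n]] by simp
  have ae: "AE x in lborel. u n x = mol (d n) v x - gmass TYPE('a) * v x" for n
    using lborel_pair.AE_integrable_fst'[OF m(1)[of n]]
  proof eventually_elim
    case (elim x)
    then have 1: "integrable lborel (\<lambda>z. (v (x + d n *\<^sub>R z) - v x) * gs z)" by simp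
    have 2: "integrable lborel (\<lambda>z. v x * gs (z::'a))" using gs_integrable[where 'a='a] by auto
    have "integrable lborel (\<lambda>z. (v (x + d n *\<^sub>R z) - v x) * gs z + v x * gs z)"
      by (rule Bochner_Integration.integrable_add[OF 1 2])
    then have 3: "integrable lborel (\<lambda>z. v (x + d n *\<^sub>R z) * gs z)" by (simp add: algebra_simps)
    have "u n x = (\<integral>z. v (x + d n *\<^sub>R z) * gs z - v x * gs z \<partial>lborel)" unfolding u_def by (simp add: left_diff_distrib)
    also have "\<dots> = mol (d n) v x - gmass TYPE('a) * v x"
      unfolding mol_def gmass_def using 2 3 by (subst Bochner_Integration.integral_diff) auto
    finally show ?case .
  qed
  have le: "(\<integral>x. norm (u n x) \<partial>lborel) \<le> (\<integral>p. norm (case p of (x, z) \<Rightarrow> (v (x + d n *\<^sub>R z) - v x) * gs z) \<partial>(lborel \<Otimes>\<^sub>M lborel))" for n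
  proof -
    note in' = integrable_norm[OF m(1)[of n]]
    have "(\<integral>x. norm (u n x) \<partial>lborel) \<le> (\<integral>x. (\<integral>z. norm ((v (x + d n *\<^sub>R z) - v x) * gs z) \<partial>lborel) \<partial>lborel)"
    proof (rule integral_mono)
      show "integrable lborel (\<lambda>x. norm (u n x))" using iu by auto
      show "integrable lborel (\<lambda>x. \<integral>z. norm ((v (x + d n *\<^sub>R z) - v x) * gs z) \<partial>lborel)"
        using lborel_pair.integrable_fst'[OF in'] by simp
      show "norm (u n x) \<le> (\<integral>z. norm ((v (x + d n *\<^sub>R z) - v x) * gs z) \<partial>lborel)" for x
        unfolding u_def by (rule integral_norm_bound)
    qed
    also have "\<dots> = (\<integral>p. norm (case p of (x, z) \<Rightarrow> (v (x + d n *\<^sub>R z) - v x) * gs z) \<partial>(lborel \<Otimes>\<^sub>M lborel))"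
      using lborel_pair.integral_fst'[OF in'] by simp
    finally show ?thesis .
  qed
  have "(\<lambda>n. \<integral>x. norm (u n x) \<partial>lborel) \<longlonglongrightarrow> 0"
  proof (rule tendsto_sandwich[OF _ _ tendsto_const m(2)])
    show "eventually (\<lambda>n. (\<integral>x. norm (u n x) \<partial>lborel) \<le> (\<integral>p. norm (case p of (x, z) \<Rightarrow> (v (x + d n *\<^sub>R z) - v x) * gs z) \<partial>(lborel \<Otimes>\<^sub>M lborel))) sequentially"
      by (intro always_eventually allI le)
  qed simp
  from tendsto_L1_AE_subseq[OF iu this]
  obtain r :: "nat \<Rightarrow> nat" where r: "strict_mono r" "AE x in lborel. (\<lambda>n. u (r n) x) \<longlonglongrightarrow> 0" by auto
  have "AE x in lborel. \<forall>n. u n x = mol (d n) v x - gmass TYPE('a) * v x"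
    using ae by (simp add: AE_all_countable)
  with r(2) have "AE x in lborel. (\<lambda>n. mol (d (r n)) v x) \<longlonglongrightarrow> gmass TYPE('a) * v x"
  proof eventually_elim
    case (elim x)
    have "(\<lambda>n. u (r n) x + gmass TYPE('a) * v x) \<longlonglongrightarrow> 0 + gmass TYPE('a) * v x"
      by (intro tendsto_add elim tendsto_const)
    then show ?case using elim(2) by simp
  qed
  with r(1) show ?thesis by auto
qed

text \<open>The hypothesis \<open>weak\<close> tests the weak derivative against Gaussians only; it
  says that the j-th partial derivative of \<open>mol d v\<close> is \<open>mol d (g j)\<close>. The
  inequality is proved for the mollification, whose gradient bound gains the factor
  \<open>c\<^sup>2\<close>, and passes to the limit by Fatou's lemma; the resulting
  \<open>c ^ 6\<close> stands on both sides.\<close>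

theorem Sobolev_L6:
  fixes v :: "real^3 \<Rightarrow> real" and g :: "3 \<Rightarrow> real^3 \<Rightarrow> real"
  assumes v: "integrable lborel v" and g: "\<And>j. integrable lborel (g j)"
    and weak: "\<And>d x j. d > 0 \<Longrightarrow>
      (\<integral>y. v y * (- 2 * ((x - y) $ j) / d\<^sup>2 * gs ((x - y) /\<^sub>R d)) \<partial>lborel) = (\<integral>y. g j y * gs ((x - y) /\<^sub>R d) \<partial>lborel)"
    and B: "\<And>j. (\<integral>\<^sup>+x. ennreal ((g j x)\<^sup>2) \<partial>lborel) \<le> ennreal B" and B0: "B \<ge> 0"
  shows "(\<integral>\<^sup>+x. ennreal (v x ^ 6) \<partial>lborel) \<le> ennreal (4096 * B^3)"
proof -
  define c where "c = gmass TYPE(real^3)"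
  have c: "c > 0" unfolding c_def by (rule gmass_pos)
  have vm[measurable]: "v \<in> borel_measurable borel" using v by auto
  have gm[measurable]: "g j \<in> borel_measurable borel" for j using g[of j] by auto
  have main: "(\<integral>\<^sup>+x. ennreal (mol d v x ^ 6) \<partial>lborel) \<le> ennreal (c ^ 6) * ennreal (4096 * B^3)" if d: "d > 0" for d
  proof -
    have "(\<integral>\<^sup>+x. ennreal (mol d v x ^ 6) \<partial>lborel) \<le> 4096 * (ennreal (c\<^sup>2 * B))^3"
    proof (rule Gagliardo_Nirenberg_lines)
      show "mol d v \<in> borel_measurable borel" by (rule mol_measurable[OF v d])
      show "mol d (g j) \<in> borel_measurable borel" for j by (rule mol_measurable[OF g d])
      show "\<bar>mol d v x\<bar> \<le> (\<integral>y. \<bar>v y\<bar> \<partial>lborel) / d ^ DIM(real^3)" for x by (rule mol_bounded[OF v d])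
      show "(\<integral>\<^sup>+x. ennreal \<bar>mol d v x\<bar> \<partial>lborel) < \<infinity>" by (rule mol_L1[OF v d])
      show "(\<integral>\<^sup>+x. ennreal ((mol d (g j) x)\<^sup>2) \<partial>lborel) \<le> ennreal (c\<^sup>2 * B)" for j
      proof -
        have "(\<integral>\<^sup>+x. ennreal ((mol d (g j) x)\<^sup>2) \<partial>lborel) \<le> (ennreal c)\<^sup>2 * (\<integral>\<^sup>+x. ennreal ((g j x)\<^sup>2) \<partial>lborel)"
          unfolding c_def by (rule mol_L2[OF g d])
        also have "\<dots> \<le> (ennreal c)\<^sup>2 * ennreal B" by (intro mult_left_mono B) auto
        finally show ?thesis using c B0 by (simp add: ennreal_power ennreal_mult)
      qed
      fix j x
      define e :: "real^3" where "e = axis j 1"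
      have e: "norm e = 1" unfolding e_def by simp
      define V where "V = (\<lambda>s. mol d v (x + s *\<^sub>R e))"
      define G where "G = (\<lambda>s. mol d (g j) (x + s *\<^sub>R e))"
      have VG: "(V has_real_derivative G s) (at s)" for s
      proof -
        have ej: "w \<bullet> e = w $ j" for w by (simp add: e_def inner_axis)
        have "(V has_real_derivative (\<integral>y. g j y * gs ((x + s *\<^sub>R e - y) /\<^sub>R d) \<partial>lborel) / d ^ DIM(real^3)) (at s)"
          using mol_line_derivative[OF v d, of x e s] unfolding V_def ej weak[OF d] .
        then show ?thesis unfolding G_def mol_kernel[OF d gm] .
      qed
      have Gc: "isCont G s" for s
        unfolding G_def
        by (rule isCont_o2[OF _ continuous_on_interior[OF mol_continuous[OF g d]]]) (auto intro!: continuous_intros)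
      have V4: "((\<lambda>s. V s ^ 4) has_real_derivative 4 * V s ^ 3 * G s) (at s)" for s
        using VG[of s] by (auto intro!: derivative_eq_intros)
      have Vc: "isCont V s" for s using VG DERIV_isCont by blast
      define I where "I = (\<integral>\<^sup>+s. ennreal (\<bar>V s\<bar> ^ 3 * \<bar>G s\<bar>) \<partial>lborel)"
      have Vm[measurable]: "V \<in> borel_measurable borel" and Gm[measurable]: "G \<in> borel_measurable borel"
        using Vc Gc by (auto intro!: borel_measurable_continuous_onI simp: continuous_on_eq_continuous_at)
      \<comment> \<open>The fundamental theorem is applied on the bounded interval from -N to 0; the
        boundary term stays until N tends to infinity.\<close>
      have N: "ennreal (V 0 ^ 4) \<le> 4 * I + ennreal (V (- real N) ^ 4)" for N
      proof -
        have fi: "has_bochner_integral lborel (\<lambda>s. (4 * V s ^ 3 * G s) * indicator {- real N..0} s) (V 0 ^ 4 - V (- real N) ^ 4)"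
          by (rule has_bochner_integral_FTC_Icc_real) (auto intro!: V4 continuous_intros Vc Gc)
        have "ennreal (norm (\<integral>s. (4 * V s ^ 3 * G s) * indicator {- real N..0} s \<partial>lborel))
            \<le> (\<integral>\<^sup>+s. ennreal (norm ((4 * V s ^ 3 * G s) * indicator {- real N..0} s)) \<partial>lborel)"
          by (rule integral_norm_bound_ennreal) (use fi in \<open>auto simp: has_bochner_integral_iff\<close>)
        also have "\<dots> \<le> (\<integral>\<^sup>+s. 4 * ennreal (\<bar>V s\<bar> ^ 3 * \<bar>G s\<bar>) \<partial>lborel)"
        proof (intro nn_integral_mono)
          fix s
          have "norm ((4 * V s ^ 3 * G s) * indicator {- real N..0} s) \<le> 4 * (\<bar>V s\<bar> ^ 3 * \<bar>G s\<bar>)"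
            by (auto simp: abs_mult power_abs indicator_def)
          then have "ennreal (norm ((4 * V s ^ 3 * G s) * indicator {- real N..0} s)) \<le> ennreal (4 * (\<bar>V s\<bar> ^ 3 * \<bar>G s\<bar>))"
            by (rule ennreal_leI)
          also have "\<dots> = 4 * ennreal (\<bar>V s\<bar> ^ 3 * \<bar>G s\<bar>)" by (subst ennreal_mult) auto
          finally show "ennreal (norm ((4 * V s ^ 3 * G s) * indicator {- real N..0} s)) \<le> 4 * ennreal (\<bar>V s\<bar> ^ 3 * \<bar>G s\<bar>)" .
        qed
        also have "\<dots> = 4 * I" unfolding I_def by (rule nn_integral_cmult) measurable
        finally have 1: "ennreal \<bar>V 0 ^ 4 - V (- real N) ^ 4\<bar> \<le> 4 * I"
          using fi by (simp add: has_bochner_integral_iff)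
        have "ennreal (V 0 ^ 4) \<le> ennreal (\<bar>V 0 ^ 4 - V (- real N) ^ 4\<bar> + V (- real N) ^ 4)"
          by (intro ennreal_leI) linarith
        also have "\<dots> = ennreal \<bar>V 0 ^ 4 - V (- real N) ^ 4\<bar> + ennreal (V (- real N) ^ 4)"
          by (intro ennreal_plus) auto
        also have "\<dots> \<le> 4 * I + ennreal (V (- real N) ^ 4)" by (intro add_right_mono 1)
        finally show ?thesis .
      qed
      have "(\<lambda>N. V (- real N)) \<longlonglongrightarrow> 0"
        using mol_vanishes_at_infinity[OF v d e, of x] unfolding V_def by simp
      then have "(\<lambda>N. V (- real N) ^ 4) \<longlonglongrightarrow> 0 ^ 4" by (rule tendsto_power)
      then have "(\<lambda>N. 4 * I + ennreal (V (- real N) ^ 4)) \<longlonglongrightarrow> 4 * I + ennreal 0"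
        by (intro tendsto_add tendsto_const tendsto_ennrealI) simp
      then have "ennreal (V 0 ^ 4) \<le> 4 * I + ennreal 0"
        by (rule LIMSEQ_le_const) (use N in auto)
      then show "ennreal (mol d v x ^ 4)
         \<le> 4 * (\<integral>\<^sup>+s. ennreal (\<bar>mol d v (x + s *\<^sub>R axis j 1)\<bar> ^ 3 * \<bar>mol d (g j) (x + s *\<^sub>R axis j 1)\<bar>) \<partial>lborel)"
        unfolding I_def V_def G_def e_def by simp
    qed
    also have "4096 * (ennreal (c\<^sup>2 * B))^3 = ennreal (4096 * (c\<^sup>2 * B)^3)"
    proof -
      have "4096 * (ennreal X)^3 = ennreal (4096 * X^3)" if "X \<ge> 0" for X
        using that by (simp add: ennreal_power ennreal_mult)
      then show ?thesis using c B0 by simp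
    qed
    also have "4096 * (c\<^sup>2 * B)^3 = c ^ 6 * (4096 * B^3)" by (simp add: power_mult_distrib)
    also have "ennreal \<dots> = ennreal (c ^ 6) * ennreal (4096 * B^3)" using c B0 by (intro ennreal_mult) auto
    finally show ?thesis .
  qed
  have dn: "(\<lambda>n. 1 / real (Suc n)) \<longlonglongrightarrow> 0" by (rule LIMSEQ_Suc[OF lim_1_over_n])
  obtain r :: "nat \<Rightarrow> nat" where r: "AE x in lborel. (\<lambda>n. mol (1 / real (Suc (r n))) v x) \<longlonglongrightarrow> c * v x"
    using mol_subseq_AE[OF v _ dn] unfolding c_def by auto
  have mm[measurable]: "mol (1 / real (Suc n)) v \<in> borel_measurable borel" for n
    by (rule mol_measurable[OF v]) simp
  have "ennreal (c ^ 6) * (\<integral>\<^sup>+x. ennreal (v x ^ 6) \<partial>lborel) = (\<integral>\<^sup>+x. ennreal (c ^ 6) * ennreal (v x ^ 6) \<partial>lborel)"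
    by (rule nn_integral_cmult[symmetric]) measurable
  also have "\<dots> = (\<integral>\<^sup>+x. liminf (\<lambda>n. ennreal (mol (1 / real (Suc (r n))) v x ^ 6)) \<partial>lborel)"
    using r
  proof (intro nn_integral_cong_AE, eventually_elim)
    case (elim x)
    have "(\<lambda>n. ennreal (mol (1 / real (Suc (r n))) v x ^ 6)) \<longlonglongrightarrow> ennreal ((c * v x) ^ 6)"
      by (intro tendsto_ennrealI tendsto_power elim)
    then show ?case using c by (simp add: lim_imp_Liminf power_mult_distrib ennreal_mult)
  qed
  also have "\<dots> \<le> liminf (\<lambda>n. \<integral>\<^sup>+x. ennreal (mol (1 / real (Suc (r n))) v x ^ 6) \<partial>lborel)"
    by (rule nn_integral_liminf) measurable
  also have "\<dots> \<le> limsup (\<lambda>n. \<integral>\<^sup>+x. ennreal (mol (1 / real (Suc (r n))) v x ^ 6) \<partial>lborel)"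
    by (rule Liminf_le_Limsup) simp
  also have "\<dots> \<le> ennreal (c ^ 6) * ennreal (4096 * B^3)"
    by (intro Limsup_bounded always_eventually allI main) simp
  finally show ?thesis
    using c by (subst (asm) ennreal_mult_le_mult_iff) auto
qed

section \<open>Test functions and the localized Sobolev inequality\<close>

lemma test_function_scaleR:
  fixes \<phi> :: "'a::euclidean_space \<Rightarrow> real" and \<psi> :: "'a \<Rightarrow> 'b::real_normed_vector"
  assumes \<phi>: "test_function U \<phi>" and \<psi>: "smooth_on UNIV \<psi>"
  shows "test_function U (\<lambda>x. \<phi> x *\<^sub>R \<psi> x)"
proof -
  have "support (\<lambda>x. \<phi> x *\<^sub>R \<psi> x) \<subseteq> support \<phi>"
    unfolding support_def by (intro closure_mono) auto
  moreover have "closed (support (\<lambda>x. \<phi> x *\<^sub>R \<psi> x))" unfolding support_def by simp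
  ultimately show ?thesis
    using \<phi> \<psi> unfolding test_function_def smooth_on_def
    by (auto intro: Ck_on_scaleR compact_Int_closed[of "support \<phi>" "support (\<lambda>x. \<phi> x *\<^sub>R \<psi> x)", THEN back_subst[of compact]])
qed

lemma test_function_Ck: "test_function U \<phi> \<Longrightarrow> Ck_on k UNIV \<phi>"
  by (simp add: test_function_def smooth_on_def)

lemma test_function_zero: "test_function U \<phi> \<Longrightarrow> x \<notin> U \<Longrightarrow> \<phi> x = 0"
  using closure_subset[of "{x. \<phi> x \<noteq> 0}"] by (auto simp: test_function_def support_def)

lemma test_function_deriv:
  assumes "test_function U \<phi>"
  shows "(\<phi> has_derivative frechet_derivative \<phi> (at x)) (at x)"
    and "continuous_on UNIV (\<lambda>x. frechet_derivative \<phi> (at x) v)"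
  using Ck_on_Suc_deriv(1)[OF test_function_Ck[OF assms]] Ck_on_Suc_deriv(2)[of 0, OF test_function_Ck[OF assms]] by auto

lemma test_function_continuous: "test_function U \<phi> \<Longrightarrow> continuous_on UNIV \<phi>"
  using test_function_Ck[of U \<phi> 0] by simp

lemma test_function_deriv_zero:
  assumes "test_function U \<phi>" "x \<notin> support \<phi>"
  shows "frechet_derivative \<phi> (at x) = (\<lambda>_. 0)"
proof -
  have "open (- support \<phi>)" unfolding support_def by (intro open_Compl closed_closure)
  moreover have "\<phi> y = 0" if "y \<in> - support \<phi>" for y
    using that closure_subset[of "{x. \<phi> x \<noteq> 0}"] by (auto simp: support_def)
  ultimately have "(\<phi> has_derivative (\<lambda>_. 0)) (at x)"
    using assms(2) by (intro has_derivative_transform_within_open[OF has_derivative_const[of 0]]) auto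
  then show ?thesis by (rule frechet_derivative_at[symmetric])
qed

lemma test_function_bounded:
  fixes \<phi> :: "'a::euclidean_space \<Rightarrow> 'b::real_normed_vector"
  assumes "test_function U \<phi>"
  shows "\<exists>M>0. (\<forall>x. norm (\<phi> x) \<le> M) \<and> (\<forall>x. norm (frechet_derivative \<phi> (at x) v) \<le> M)"
proof -
  have c: "compact (support \<phi>)" using assms by (simp add: test_function_def)
  have "compact (\<phi> ` support \<phi>)"
    by (intro compact_continuous_image c continuous_on_subset[OF test_function_continuous[OF assms]]) simp
  then obtain M1 where M1: "\<And>x. x \<in> support \<phi> \<Longrightarrow> norm (\<phi> x) \<le> M1"
    by (meson bounded_iff compact_imp_bounded imageI)
  have "compact ((\<lambda>x. frechet_derivative \<phi> (at x) v) ` support \<phi>)"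
    by (intro compact_continuous_image c continuous_on_subset[OF test_function_deriv(2)[OF assms]]) simp
  then obtain M2 where M2: "\<And>x. x \<in> support \<phi> \<Longrightarrow> norm (frechet_derivative \<phi> (at x) v) \<le> M2"
    by (meson bounded_iff compact_imp_bounded imageI)
  have z: "\<phi> x = 0" if "x \<notin> support \<phi>" for x
    using that closure_subset[of "{x. \<phi> x \<noteq> 0}"] by (auto simp: support_def)
  show ?thesis
  proof (intro exI[of _ "1 + \<bar>M1\<bar> + \<bar>M2\<bar>"] conjI allI)
    show "norm (\<phi> x) \<le> 1 + \<bar>M1\<bar> + \<bar>M2\<bar>" for x
      using M1[of x] z[of x] by (cases "x \<in> support \<phi>") auto
    show "norm (frechet_derivative \<phi> (at x) v) \<le> 1 + \<bar>M1\<bar> + \<bar>M2\<bar>" for x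
      using M2[of x] test_function_deriv_zero[OF assms, of x] by (cases "x \<in> support \<phi>") auto
  qed simp
qed

lemma Ck_on_uminus: "Ck_on k UNIV f \<Longrightarrow> Ck_on k UNIV (\<lambda>x. - f x)"
  for f :: "'a::euclidean_space \<Rightarrow> 'b::real_normed_vector"
  using Ck_on_diff[OF Ck_on_const[of k 0]] by simp

lemma Ck_on_gs:
  fixes f :: "'a::euclidean_space \<Rightarrow> 'b::euclidean_space"
  assumes "Ck_on k UNIV f"
  shows "Ck_on k UNIV (\<lambda>y. gs (f y))"
  unfolding gs_def by (intro Ck_on_exp Ck_on_uminus Ck_on_inner assms)

lemma Ck_on_affine: "Ck_on k UNIV (\<lambda>y::'a::euclidean_space. (x - y) /\<^sub>R d)"
  by (intro Ck_on_scaleR Ck_on_const Ck_on_diff Ck_on_linear[OF bounded_linear_ident])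

lemma norm_gs_le: "norm w * gs w \<le> 2"
proof -
  have "norm w * gs w \<le> (1 + norm w) * gs w" by (intro mult_right_mono) auto
  also have "\<dots> \<le> (1 + norm w) * (2 / (1 + norm w))"
    by (intro mult_left_mono gs_le_inverse) auto
  also have "\<dots> = 2"
  proof -
    have "1 + norm w \<noteq> 0" using norm_ge_zero[of w] by linarith
    then have "(1 + norm w) * 2 / (1 + norm w) = 2" by (rule nonzero_mult_div_cancel_left)
    then show ?thesis by (simp only: times_divide_eq_right)
  qed
  finally show ?thesis .
qed

text \<open>The constant 9 = 3^2 is that of the convexity inequality for the cube, applied to the
  three squared components.\<close>

lemma norm_power6_le: "norm (a :: real^3) ^ 6 \<le> 9 * (\<Sum>i\<in>UNIV. (a $ i) ^ 6)"
proof -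
  have conv: "(x + y + z) ^ 3 \<le> 9 * (x ^ 3 + y ^ 3 + z ^ 3)" if "x \<ge> 0" "y \<ge> 0" "z \<ge> 0" for x y z :: real
  proof -
    have key: "s * s * t + s * t * t \<le> s ^ 3 + t ^ 3" if "s \<ge> 0" "t \<ge> 0" for s t :: real
    proof -
      have "0 \<le> (s + t) * (s - t)\<^sup>2" using that by simp
      also have "\<dots> = s ^ 3 + t ^ 3 - (s * s * t + s * t * t)"
        by (simp add: power2_eq_square power3_eq_cube algebra_simps)
      finally show ?thesis by simp
    qed
    have t: "6 * (x * y * z) \<le> (x * x * y + x * y * y) + (y * y * z + y * z * z) + (x * x * z + x * z * z)"
    proof -
      have "0 \<le> x * (y - z)\<^sup>2 + y * (x - z)\<^sup>2 + z * (x - y)\<^sup>2" using that by simp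
      then show ?thesis by (simp add: power2_eq_square algebra_simps)
    qed
    have "(x + y + z) ^ 3 = x ^ 3 + y ^ 3 + z ^ 3 + 3 * ((x * x * y + x * y * y) + (y * y * z + y * z * z) + (x * x * z + x * z * z)) + 6 * (x * y * z)"
      by (simp add: power3_eq_cube algebra_simps)
    moreover have "T \<le> 9 * (p + q + r)"
      if "T = p + q + r + 3 * (a + b + c) + 6 * m" "6 * m \<le> a + b + c" "a \<le> p + q" "b \<le> q + r" "c \<le> p + r"
      for T p q r a b c m :: real
      using that by simp
    ultimately show ?thesis using t key[OF that(1,2)] key[OF that(2,3)] key[OF that(1,3)] by blast
  qed
  have "norm a ^ 6 = ((norm a)\<^sup>2) ^ 3" by simp
  also have "(norm a)\<^sup>2 = (a $ 1)\<^sup>2 + (a $ 2)\<^sup>2 + (a $ 3)\<^sup>2"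
    unfolding power2_norm_eq_inner inner_vec_def sum_3 by (simp add: power2_eq_square)
  also have "\<dots> ^ 3 \<le> 9 * (((a $ 1)\<^sup>2) ^ 3 + ((a $ 2)\<^sup>2) ^ 3 + ((a $ 3)\<^sup>2) ^ 3)"
    by (intro conv) auto
  finally show ?thesis unfolding sum_3 by simp
qed

lemma component_power2_le: "((a :: real^3) $ i)\<^sup>2 \<le> (norm a)\<^sup>2" "((A :: real^3^3) $ i $ j)\<^sup>2 \<le> (norm A)\<^sup>2"
proof -
  have c: "(norm (a $ i))\<^sup>2 \<le> (norm a)\<^sup>2" for a :: "('b::real_normed_vector)^3" and i
    by (intro power_mono Finite_Cartesian_Product.norm_nth_le) auto
  show "(a $ i)\<^sup>2 \<le> (norm a)\<^sup>2" using c[of a i] by simp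
  show "(A $ i $ j)\<^sup>2 \<le> (norm A)\<^sup>2" using order_trans[OF c[of "A $ i" j] c[of A i]] by simp
qed

text \<open>After multiplication by the cutoff, each component of \<open>w\<close> lives on the
  whole space and \<open>Sobolev_L6\<close> applies. The product rule for the weak gradient comes
  from testing with the cutoff times a Gaussian, which is admissible although the Gaussian alone is
  not. The constant is 9 * 3 * 4096 * 2^3: nine from \<open>norm_power6_le\<close>, three
  components, and \<open>2 * \<Lambda>\<^sup>2 * J\<close> cubed.\<close>

theorem Sobolev_local:
  fixes w :: "real^3 \<Rightarrow> real^3" and G :: "real^3 \<Rightarrow> real^3^3" and \<phi> :: "real^3 \<Rightarrow> real"
  assumes \<Omega>: "open \<Omega>" "bounded \<Omega>" and \<phi>: "test_function \<Omega> \<phi>"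
    and Lam: "\<And>x. \<bar>\<phi> x\<bar> \<le> \<Lambda>" "\<And>x j. \<bar>frechet_derivative \<phi> (at x) (axis j 1)\<bar> \<le> \<Lambda>"
    and wm[measurable]: "w \<in> borel_measurable borel" and Gm[measurable]: "G \<in> borel_measurable borel"
    and J: "(\<integral>\<^sup>+x. ennreal ((norm (w x))\<^sup>2 + (norm (G x))\<^sup>2) * indicator \<Omega> x \<partial>lborel) \<le> ennreal J" "J \<ge> 0"
    and weak: "\<And>\<psi> i j. test_function \<Omega> \<psi> \<Longrightarrow>
        (\<integral>x. indicator \<Omega> x * (w x $ i * frechet_derivative \<psi> (at x) (axis j 1)) \<partial>lborel)
        = - (\<integral>x. indicator \<Omega> x * (G x $ i $ j * \<psi> x) \<partial>lborel)"
  shows "(\<integral>\<^sup>+x. ennreal (norm (\<phi> x *\<^sub>R w x) ^ 6) \<partial>lborel) \<le> ennreal (884736 * \<Lambda>^6 * J^3)"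
proof -
  have Lam0: "\<Lambda> \<ge> 0" using Lam(1)[of 0] by linarith
  have [measurable]: "\<Omega> \<in> sets borel" using \<Omega> by simp
  have [measurable]: "\<phi> \<in> borel_measurable borel"
    by (intro borel_measurable_continuous_onI test_function_continuous[OF \<phi>])
  define D where "D = (\<lambda>j x. frechet_derivative \<phi> (at x) (axis j 1))"
  have Dm[measurable]: "D j \<in> borel_measurable borel" for j
    unfolding D_def by (intro borel_measurable_continuous_onI test_function_deriv[OF \<phi>])
  have D: "\<bar>D j x\<bar> \<le> \<Lambda>" for j x unfolding D_def by (rule Lam(2))
  have vecm[measurable]: "(\<lambda>x. w x $ i) \<in> borel_measurable borel" for i
    by (rule measurable_compose[OF wm]) (intro borel_measurable_continuous_onI continuous_intros)
  have matm[measurable]: "(\<lambda>x. G x $ i $ j) \<in> borel_measurable borel" for i j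
    by (rule measurable_compose[OF Gm]) (intro borel_measurable_continuous_onI continuous_intros)
  have off: "\<phi> x = 0" "D j x = 0" if "x \<notin> \<Omega>" for x j
  proof -
    show "\<phi> x = 0" by (rule test_function_zero[OF \<phi> that])
    have "x \<notin> support \<phi>" using that \<phi> by (auto simp: test_function_def)
    then show "D j x = 0" unfolding D_def by (simp add: test_function_deriv_zero[OF \<phi>])
  qed
  define E where "E = (\<lambda>x. (norm (w x))\<^sup>2 + (norm (G x))\<^sup>2)"
  have E0: "E x \<ge> 0" for x by (simp add: E_def)
  have Em[measurable]: "E \<in> borel_measurable borel" unfolding E_def by measurable
  have intE: "integrable lborel (\<lambda>x. E x * indicator \<Omega> x)"
  proof (rule integrableI_nonneg)
    have "(\<integral>\<^sup>+x. ennreal (E x * indicator \<Omega> x) \<partial>lborel) = (\<integral>\<^sup>+x. ennreal (E x) * indicator \<Omega> x \<partial>lborel)"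
      by (intro nn_integral_cong) (simp add: indicator_def)
    also have "\<dots> \<le> ennreal J" unfolding E_def by (rule J)
    also have "\<dots> < \<infinity>" by simp
    finally show "(\<integral>\<^sup>+x. ennreal (E x * indicator \<Omega> x) \<partial>lborel) < \<infinity>" .
  qed (auto simp: E0)
  have int1: "integrable lborel (indicator \<Omega> :: _ \<Rightarrow> real)"
    using emeasure_bounded_finite[OF \<Omega>(2)] by (intro integrable_real_indicator) auto
  have dom: "integrable lborel h" if [measurable]: "h \<in> borel_measurable borel"
    and "\<And>x. \<bar>h x\<bar> \<le> C * ((1 + E x) * indicator \<Omega> x)" for h C
  proof (rule Bochner_Integration.integrable_bound)
    have "integrable lborel (\<lambda>x. indicator \<Omega> x + E x * indicator \<Omega> x :: real)"
      by (intro Bochner_Integration.integrable_add int1 intE)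
    then have "integrable lborel (\<lambda>x. (1 + E x) * indicator \<Omega> x :: real)"
      by (simp add: distrib_right)
    then show "integrable lborel (\<lambda>x. C * ((1 + E x) * indicator \<Omega> x))" by simp
    show "AE x in lborel. norm (h x) \<le> norm (C * ((1 + E x) * indicator \<Omega> x))"
      using order_trans[OF that(2) abs_ge_self] by (intro AE_I2) simp
  qed simp
  have wle: "\<bar>w x $ i\<bar> \<le> 1 + E x" "\<bar>G x $ i $ j\<bar> \<le> 1 + E x" for x i j
  proof -
    have sq: "\<bar>t\<bar> \<le> 1 + t\<^sup>2" for t :: real
      using zero_le_power2[of "\<bar>t\<bar> - 1"] unfolding power2_diff by simp
    show "\<bar>w x $ i\<bar> \<le> 1 + E x" using sq[of "w x $ i"] component_power2_le(1)[of "w x" i] unfolding E_def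
      by (smt (verit) zero_le_power2)
    show "\<bar>G x $ i $ j\<bar> \<le> 1 + E x" using sq[of "G x $ i $ j"] component_power2_le(2)[of "G x" i j] unfolding E_def
      by (smt (verit) zero_le_power2)
  qed
  have comp: "(\<integral>\<^sup>+x. ennreal ((\<phi> x * w x $ i) ^ 6) \<partial>lborel) \<le> ennreal (4096 * (2 * \<Lambda>\<^sup>2 * J)^3)" for i
  proof (rule Sobolev_L6)
    define v where "v = (\<lambda>x. \<phi> x * w x $ i)"
    \<comment> \<open>The weak partial derivatives of \<open>v\<close> predicted by the product
      rule.\<close>
    define g where "g = (\<lambda>j x. D j x * w x $ i + \<phi> x * G x $ i $ j)"
    have [measurable]: "v \<in> borel_measurable borel" "g j \<in> borel_measurable borel" for j
      unfolding v_def g_def by measurable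
    have vb: "\<bar>v x * t\<bar> \<le> (\<Lambda> * \<bar>T\<bar>) * ((1 + E x) * indicator \<Omega> x)" if "\<bar>t\<bar> \<le> T" for x t T
    proof (cases "x \<in> \<Omega>")
      case True
      have "\<bar>v x * t\<bar> = (\<bar>\<phi> x\<bar> * \<bar>t\<bar>) * \<bar>w x $ i\<bar>" unfolding v_def by (simp add: abs_mult)
      also have "\<dots> \<le> (\<Lambda> * \<bar>T\<bar>) * (1 + E x)" using that Lam0 by (intro mult_mono Lam wle) auto
      finally show ?thesis using True by simp
    qed (simp add: v_def off)
    have gb: "\<bar>D j x * w x $ i * t\<bar> \<le> (\<Lambda> * \<bar>T\<bar>) * ((1 + E x) * indicator \<Omega> x)"
      "\<bar>\<phi> x * G x $ i $ j * t\<bar> \<le> (\<Lambda> * \<bar>T\<bar>) * ((1 + E x) * indicator \<Omega> x)" if "\<bar>t\<bar> \<le> T" for x j t T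
    proof -
      show "\<bar>D j x * w x $ i * t\<bar> \<le> (\<Lambda> * \<bar>T\<bar>) * ((1 + E x) * indicator \<Omega> x)"
      proof (cases "x \<in> \<Omega>")
        case True
        have "\<bar>D j x * w x $ i * t\<bar> = (\<bar>D j x\<bar> * \<bar>t\<bar>) * \<bar>w x $ i\<bar>" by (simp add: abs_mult)
        also have "\<dots> \<le> (\<Lambda> * \<bar>T\<bar>) * (1 + E x)" using that Lam0 by (intro mult_mono D wle) auto
        finally show ?thesis using True by simp
      qed (simp add: off)
      show "\<bar>\<phi> x * G x $ i $ j * t\<bar> \<le> (\<Lambda> * \<bar>T\<bar>) * ((1 + E x) * indicator \<Omega> x)"
      proof (cases "x \<in> \<Omega>")
        case True
        have "\<bar>\<phi> x * G x $ i $ j * t\<bar> = (\<bar>\<phi> x\<bar> * \<bar>t\<bar>) * \<bar>G x $ i $ j\<bar>" by (simp add: abs_mult)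
        also have "\<dots> \<le> (\<Lambda> * \<bar>T\<bar>) * (1 + E x)" using that Lam0 by (intro mult_mono Lam wle) auto
        finally show ?thesis using True by simp
      qed (simp add: off)
    qed
    show "integrable lborel (\<lambda>x. \<phi> x * w x $ i)"
      using dom[of v, OF _ vb[of 1 1, simplified]] unfolding v_def by simp
    have ig: "integrable lborel (\<lambda>x. D j x * w x $ i)" "integrable lborel (\<lambda>x. \<phi> x * G x $ i $ j)" for j
      using dom[OF _ gb(1)[of 1 1, where j=j, simplified]] dom[OF _ gb(2)[of 1 1, where j=j, simplified]] by simp_all
    show "integrable lborel (\<lambda>x. D j x * w x $ i + \<phi> x * G x $ i $ j)" for j
      by (intro Bochner_Integration.integrable_add ig)
    show "(\<integral>\<^sup>+x. ennreal ((D j x * w x $ i + \<phi> x * G x $ i $ j)\<^sup>2) \<partial>lborel) \<le> ennreal (2 * \<Lambda>\<^sup>2 * J)" for j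
    proof -
      have pw: "(D j x * w x $ i + \<phi> x * G x $ i $ j)\<^sup>2 \<le> 2 * \<Lambda>\<^sup>2 * (E x * indicator \<Omega> x)" for x
      proof (cases "x \<in> \<Omega>")
        case True
        have "(D j x * w x $ i + \<phi> x * G x $ i $ j)\<^sup>2 \<le> 2 * ((D j x * w x $ i)\<^sup>2 + (\<phi> x * G x $ i $ j)\<^sup>2)"
          using sum_squares_bound[of "D j x * w x $ i" "\<phi> x * G x $ i $ j"] by (simp add: power2_sum)
        also have "\<dots> = 2 * ((D j x)\<^sup>2 * (w x $ i)\<^sup>2 + (\<phi> x)\<^sup>2 * (G x $ i $ j)\<^sup>2)" by (simp add: power_mult_distrib)
        also have "\<dots> \<le> 2 * (\<Lambda>\<^sup>2 * (norm (w x))\<^sup>2 + \<Lambda>\<^sup>2 * (norm (G x))\<^sup>2)"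
          using D[of j x] Lam(1)[of x] component_power2_le(1)[of "w x" i] component_power2_le(2)[of "G x" i j]
          by (intro mult_left_mono add_mono mult_mono) (auto simp: abs_le_square_iff[symmetric] Lam0)
        finally show ?thesis using True by (simp add: E_def algebra_simps)
      qed (simp add: off)
      have "(\<integral>\<^sup>+x. ennreal ((D j x * w x $ i + \<phi> x * G x $ i $ j)\<^sup>2) \<partial>lborel)
         \<le> (\<integral>\<^sup>+x. ennreal (2 * \<Lambda>\<^sup>2) * (ennreal (E x) * indicator \<Omega> x) \<partial>lborel)"
      proof (intro nn_integral_mono)
        fix x
        have "ennreal ((D j x * w x $ i + \<phi> x * G x $ i $ j)\<^sup>2) \<le> ennreal (2 * \<Lambda>\<^sup>2 * (E x * indicator \<Omega> x))"
          by (rule ennreal_leI[OF pw])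
        also have "\<dots> = ennreal (2 * \<Lambda>\<^sup>2) * (ennreal (E x) * indicator \<Omega> x)"
          by (subst ennreal_mult) (auto simp: E0 indicator_def)
        finally show "ennreal ((D j x * w x $ i + \<phi> x * G x $ i $ j)\<^sup>2) \<le> ennreal (2 * \<Lambda>\<^sup>2) * (ennreal (E x) * indicator \<Omega> x)" .
      qed
      also have "\<dots> = ennreal (2 * \<Lambda>\<^sup>2) * (\<integral>\<^sup>+x. ennreal (E x) * indicator \<Omega> x \<partial>lborel)"
        by (rule nn_integral_cmult) measurable
      also have "\<dots> \<le> ennreal (2 * \<Lambda>\<^sup>2) * ennreal J"
        unfolding E_def by (intro mult_left_mono J) auto
      also have "\<dots> = ennreal (2 * \<Lambda>\<^sup>2 * J)" using J(2) by (subst ennreal_mult) auto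
      finally show ?thesis .
    qed
    show "2 * \<Lambda>\<^sup>2 * J \<ge> 0" using J(2) by simp
    fix d :: real and x :: "real^3" and j :: 3 assume d: "d > 0"
    define k where "k = (\<lambda>y. gs ((x - y) /\<^sub>R d))"
    \<comment> \<open>The j-th derivative of the Gaussian in \<open>x\<close>, hence minus its j-th
      derivative in \<open>y\<close>; this is the sign in \<open>dtest\<close>.\<close>
    define l where "l = (\<lambda>y. - 2 * ((x - y) $ j) / d\<^sup>2 * gs ((x - y) /\<^sub>R d))"
    have kb: "\<bar>k y\<bar> \<le> 1" for y unfolding k_def by (simp add: gs_le_1)
    have lb: "\<bar>l y\<bar> \<le> 4 / d" for y
    proof -
      have "\<bar>(x - y) $ j\<bar> / d \<le> norm ((x - y) /\<^sub>R d)"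
        using d component_le_norm_cart[of "x - y" j] by (simp add: divide_inverse mult.commute mult_left_mono)
      then have "\<bar>(x - y) $ j\<bar> / d * gs ((x - y) /\<^sub>R d) \<le> norm ((x - y) /\<^sub>R d) * gs ((x - y) /\<^sub>R d)"
        by (rule mult_right_mono) simp
      also have "\<dots> \<le> 2" by (rule norm_gs_le)
      finally have *: "(2 / d) * (\<bar>(x - y) $ j\<bar> / d * gs ((x - y) /\<^sub>R d)) \<le> (2 / d) * 2"
        using d by (intro mult_left_mono) auto
      have "\<bar>l y\<bar> = (2 / d) * (\<bar>(x - y) $ j\<bar> / d * gs ((x - y) /\<^sub>R d))"
        unfolding l_def using d by (simp add: abs_mult abs_divide power2_eq_square del: vector_minus_component)
      with * show ?thesis by simp
    qed
    have km[measurable]: "k \<in> borel_measurable borel" unfolding k_def by measurable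
    have lm[measurable]: "l \<in> borel_measurable borel"
    proof -
      have "continuous_on UNIV (\<lambda>y. (x - y) $ j)" by (intro continuous_intros)
      then have [measurable]: "(\<lambda>y. (x - y) $ j) \<in> borel_measurable borel" by (rule borel_measurable_continuous_onI)
      show ?thesis unfolding l_def by measurable
    qed
    have kd: "(k has_derivative (\<lambda>h. - 2 * (((x - y) /\<^sub>R d) \<bullet> ((- h) /\<^sub>R d)) * gs ((x - y) /\<^sub>R d))) (at y)" for y
    proof -
      have "((\<lambda>y. (x - y) /\<^sub>R d) has_derivative (\<lambda>h. (- h) /\<^sub>R d)) (at y)"
        by (auto intro!: derivative_eq_intros)
      from has_derivative_compose[OF this gs_has_derivative] show ?thesis unfolding k_def .
    qed
    have test: "test_function \<Omega> (\<lambda>y. \<phi> y * k y)"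
      using test_function_scaleR[OF \<phi>, of k] unfolding k_def smooth_on_def
      by (simp add: Ck_on_gs Ck_on_affine)
    have dtest: "frechet_derivative (\<lambda>y. \<phi> y * k y) (at y) (axis j 1) = D j y * k y - \<phi> y * l y" for y
    proof -
      have "((\<lambda>y. \<phi> y * k y) has_derivative
        (\<lambda>h. \<phi> y * (- 2 * (((x - y) /\<^sub>R d) \<bullet> ((- h) /\<^sub>R d)) * gs ((x - y) /\<^sub>R d)) + frechet_derivative \<phi> (at y) h * k y)) (at y)"
        by (rule has_derivative_mult[OF test_function_deriv(1)[OF \<phi>] kd])
      then have "frechet_derivative (\<lambda>y. \<phi> y * k y) (at y) (axis j 1) =
        \<phi> y * (- 2 * (((x - y) /\<^sub>R d) \<bullet> ((- axis j 1) /\<^sub>R d)) * gs ((x - y) /\<^sub>R d)) + frechet_derivative \<phi> (at y) (axis j 1) * k y"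
        by (simp only: frechet_derivative_at[symmetric])
      moreover have "- 2 * (((x - y) /\<^sub>R d) \<bullet> ((- axis j 1) /\<^sub>R d)) * gs ((x - y) /\<^sub>R d) = - l y"
        unfolding l_def by (simp add: inner_axis power2_eq_square divide_inverse del: vector_minus_component)
      ultimately show ?thesis unfolding D_def by simp
    qed
    have i1: "integrable lborel (\<lambda>y. D j y * w y $ i * k y)"
      by (rule dom[OF _ gb(1)[OF kb, where j=j]]) measurable
    have i2: "integrable lborel (\<lambda>y. \<phi> y * G y $ i $ j * k y)"
      by (rule dom[OF _ gb(2)[OF kb, where j=j]]) measurable
    have i3: "integrable lborel (\<lambda>y. v y * l y)"
      by (rule dom[OF _ vb[OF lb]]) measurable
    have "(\<integral>y. indicator \<Omega> y * (w y $ i * frechet_derivative (\<lambda>y. \<phi> y * k y) (at y) (axis j 1)) \<partial>lborel)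
       = (\<integral>y. D j y * w y $ i * k y - v y * l y \<partial>lborel)"
      by (intro Bochner_Integration.integral_cong) (auto simp: dtest v_def indicator_def off algebra_simps)
    also have "\<dots> = (\<integral>y. D j y * w y $ i * k y \<partial>lborel) - (\<integral>y. v y * l y \<partial>lborel)"
      by (rule Bochner_Integration.integral_diff[OF i1 i3])
    finally have 1: "(\<integral>y. indicator \<Omega> y * (w y $ i * frechet_derivative (\<lambda>y. \<phi> y * k y) (at y) (axis j 1)) \<partial>lborel)
       = (\<integral>y. D j y * w y $ i * k y \<partial>lborel) - (\<integral>y. v y * l y \<partial>lborel)" .
    have 2: "(\<integral>y. indicator \<Omega> y * (G y $ i $ j * (\<phi> y * k y)) \<partial>lborel) = (\<integral>y. \<phi> y * G y $ i $ j * k y \<partial>lborel)"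
      by (intro Bochner_Integration.integral_cong) (auto simp: indicator_def off)
    have "(\<integral>y. v y * l y \<partial>lborel) = (\<integral>y. D j y * w y $ i * k y \<partial>lborel) + (\<integral>y. \<phi> y * G y $ i $ j * k y \<partial>lborel)"
      using weak[OF test, of i j] unfolding 1 2 by linarith
    also have "\<dots> = (\<integral>y. (D j y * w y $ i + \<phi> y * G y $ i $ j) * k y \<partial>lborel)"
      by (subst Bochner_Integration.integral_add[symmetric, OF i1 i2]) (simp add: distrib_right)
    finally show "(\<integral>y. \<phi> y * w y $ i * (- 2 * (x - y) $ j / d\<^sup>2 * gs ((x - y) /\<^sub>R d)) \<partial>lborel)
       = (\<integral>y. (D j y * w y $ i + \<phi> y * G y $ i $ j) * gs ((x - y) /\<^sub>R d) \<partial>lborel)"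
      unfolding v_def l_def k_def .
  qed
  have "(\<integral>\<^sup>+x. ennreal (norm (\<phi> x *\<^sub>R w x) ^ 6) \<partial>lborel)
      \<le> (\<integral>\<^sup>+x. 9 * (\<Sum>i\<in>UNIV. ennreal ((\<phi> x * w x $ i) ^ 6)) \<partial>lborel)"
  proof (intro nn_integral_mono)
    fix x
    have "ennreal (norm (\<phi> x *\<^sub>R w x) ^ 6) \<le> ennreal (9 * (\<Sum>i\<in>UNIV. (\<phi> x * w x $ i) ^ 6))"
      using norm_power6_le[of "\<phi> x *\<^sub>R w x"] by (intro ennreal_leI) simp
    also have "\<dots> = 9 * (\<Sum>i\<in>UNIV. ennreal ((\<phi> x * w x $ i) ^ 6))"
      by (subst ennreal_mult) (auto simp: sum_nonneg)
    finally show "ennreal (norm (\<phi> x *\<^sub>R w x) ^ 6) \<le> 9 * (\<Sum>i\<in>UNIV. ennreal ((\<phi> x * w x $ i) ^ 6))" .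
  qed
  also have "\<dots> = 9 * (\<Sum>i\<in>UNIV. (\<integral>\<^sup>+x. ennreal ((\<phi> x * w x $ i) ^ 6) \<partial>lborel))"
  proof -
    have "(\<integral>\<^sup>+x. 9 * (\<Sum>i\<in>UNIV. ennreal ((\<phi> x * w x $ i) ^ 6)) \<partial>lborel)
        = 9 * (\<integral>\<^sup>+x. (\<Sum>i\<in>UNIV. ennreal ((\<phi> x * w x $ i) ^ 6)) \<partial>lborel)"
      by (rule nn_integral_cmult) measurable
    also have "(\<integral>\<^sup>+x. (\<Sum>i\<in>UNIV. ennreal ((\<phi> x * w x $ i) ^ 6)) \<partial>lborel)
        = (\<Sum>i\<in>UNIV. (\<integral>\<^sup>+x. ennreal ((\<phi> x * w x $ i) ^ 6) \<partial>lborel))"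
      by (rule nn_integral_sum) measurable
    finally show ?thesis .
  qed
  also have "\<dots> \<le> 9 * (\<Sum>i\<in>(UNIV::3 set). ennreal (4096 * (2 * \<Lambda>\<^sup>2 * J)^3))"
    by (intro mult_left_mono sum_mono comp) auto
  also have "\<dots> = ennreal (9 * (\<Sum>i\<in>(UNIV::3 set). 4096 * (2 * \<Lambda>\<^sup>2 * J)^3))"
  proof -
    have "9 * (\<Sum>i\<in>(UNIV::3 set). ennreal X) = ennreal (9 * (\<Sum>i\<in>(UNIV::3 set). X))" if "X \<ge> 0" for X
      using that by (simp add: ennreal_mult)
    then show ?thesis using J(2) by simp
  qed
  also have "9 * (\<Sum>i\<in>(UNIV::3 set). 4096 * (2 * \<Lambda>\<^sup>2 * J)^3) = 884736 * \<Lambda>^6 * J^3"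
    by (simp add: power_mult_distrib)
  finally show ?thesis .
qed

section \<open>The symmetrized two-point inequality\<close>

lemma tensor_inner: "tensor a b \<bullet> tensor c d = (a \<bullet> c) * (b \<bullet> d)"
  by (simp add: tensor_def inner_vec_def sum_product sum_distrib_left mult_ac) (rule sum.swap)

lemma norm_tensor: "norm (tensor a b) = norm a * norm b"
proof -
  have "(norm (tensor a b))\<^sup>2 = (norm a * norm b)\<^sup>2"
    unfolding power2_norm_eq_inner power_mult_distrib by (simp add: tensor_inner)
  then show ?thesis by simp
qed

lemma mat1_inner_tensor: "mat 1 \<bullet> tensor a b = a \<bullet> b"
  by (simp add: tensor_def inner_vec_def mat_def if_distrib[of "\<lambda>x. x * _"] cong: if_cong)

lemma mat1_inner_mat1: "(mat 1 :: real^3^3) \<bullet> mat 1 = 3"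
  by (simp add: inner_vec_def mat_def if_distrib[of "\<lambda>x. x * _"] cong: if_cong)

definition Kvec :: "real \<Rightarrow> real \<Rightarrow> R3 \<Rightarrow> R3" where
  "Kvec \<mu> q z = ker \<mu> q *\<^sub>R z"

text \<open>The Jacobian of the vector field at \<open>z\<close> when \<open>q\<close> equals d^2 +
  |z|^2. Keeping \<open>q\<close> as a separate argument, the pointwise estimates need only
  \<open>z \<bullet> z \<le> q\<close>.\<close>

definition Kmat :: "real \<Rightarrow> real \<Rightarrow> R3 \<Rightarrow> real^3^3" where
  "Kmat \<mu> q z = ker \<mu> q *\<^sub>R mat 1 + (2 * dker \<mu> q) *\<^sub>R tensor z z"

lemma Kmat_inner:
  "Kmat \<mu> q z \<bullet> tensor a b = ker \<mu> q * (a \<bullet> b) + 2 * dker \<mu> q * ((z \<bullet> a) * (z \<bullet> b))"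
  "Kmat \<mu> q z \<bullet> mat 1 = 3 * ker \<mu> q + 2 * dker \<mu> q * (z \<bullet> z)"
  by (simp_all add: Kmat_def inner_add_left tensor_inner mat1_inner_tensor mat1_inner_mat1
      inner_commute[of "tensor _ _" "mat 1"])

text \<open>The length of \<open>z\<close> cancels q^(-1/2), so the field itself is only
  logarithmically singular.\<close>

lemma norm_Kvec:
  assumes "q > 0" "z \<bullet> z \<le> q"
  shows "norm (Kvec \<mu> q z) \<le> lgw q powr \<mu>"
proof -
  have "norm z = sqrt (z \<bullet> z)" by (simp add: norm_eq_sqrt_inner)
  also have "\<dots> \<le> sqrt q" using assms by simp
  also have "\<dots> = q powr (1/2)" using assms by (simp add: powr_half_sqrt)
  finally have "q powr (-1/2) * norm z \<le> q powr (-1/2) * q powr (1/2)" by (intro mult_left_mono) auto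
  also have "\<dots> = 1" using assms by (simp add: powr_add[symmetric])
  finally have "lgw q powr \<mu> * (q powr (-1/2) * norm z) \<le> lgw q powr \<mu> * 1" by (intro mult_left_mono) auto
  then show ?thesis unfolding Kvec_def ker_def by (simp add: abs_mult mult.assoc)
qed

lemma norm_Kmat:
  assumes "q > 0" "0 < \<mu>" "\<mu> < 4/3" "z \<bullet> z \<le> q"
  shows "norm (Kmat \<mu> q z) \<le> 4 * ker \<mu> q"
proof -
  have m1: "norm (mat 1 :: real^3^3) \<le> 2"
  proof -
    have "(norm (mat 1 :: real^3^3))\<^sup>2 \<le> 2\<^sup>2" unfolding power2_norm_eq_inner mat1_inner_mat1 by simp
    then show ?thesis by (rule power2_le_imp_le) simp
  qed
  have "norm (Kmat \<mu> q z) \<le> norm (ker \<mu> q *\<^sub>R (mat 1 :: real^3^3)) + norm ((2 * dker \<mu> q) *\<^sub>R tensor z z)"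
    unfolding Kmat_def by (rule norm_triangle_ineq)
  also have "norm (ker \<mu> q *\<^sub>R (mat 1 :: real^3^3)) \<le> ker \<mu> q * 2"
    using ker_pos[OF assms(1), of \<mu>] m1 by (simp add: mult_left_mono)
  also have "norm ((2 * dker \<mu> q) *\<^sub>R tensor z z) = 2 * \<bar>dker \<mu> q\<bar> * (z \<bullet> z)"
    by (simp add: norm_tensor abs_mult power2_norm_eq_inner[symmetric] power2_eq_square)
  also have "\<dots> \<le> 2 * ker \<mu> q" by (rule ker_trace(2)[OF assms(1-3) _ assms(4)]) simp
  finally show ?thesis by simp
qed

lemma norm_stress_le: "norm (stress \<nu>1 \<nu>2 D) \<le> (2 * \<bar>\<nu>1\<bar> + 4 * \<bar>\<nu>2\<bar>) * norm D"
proof -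
  \<comment> \<open>The norm of the identity matrix is \<open>sqrt 3\<close>, rounded up to 2 as in
    \<open>norm_Kmat\<close>.\<close>
  have tr: "\<bar>trace D\<bar> \<le> 2 * norm D" and m1: "norm (mat 1 :: real^3^3) \<le> 2"
  proof -
    have "(norm (mat 1 :: real^3^3))\<^sup>2 \<le> 2\<^sup>2" unfolding power2_norm_eq_inner mat1_inner_mat1 by simp
    then show m1: "norm (mat 1 :: real^3^3) \<le> 2" by (rule power2_le_imp_le) simp
    have "trace D = mat 1 \<bullet> D"
      by (simp add: trace_def inner_vec_def mat_def if_distrib[of "\<lambda>x. x * _"] cong: if_cong)
    then have "\<bar>trace D\<bar> \<le> norm (mat 1 :: real^3^3) * norm D" using Cauchy_Schwarz_ineq2 by metis
    also have "\<dots> \<le> 2 * norm D" by (intro mult_right_mono m1) simp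
    finally show "\<bar>trace D\<bar> \<le> 2 * norm D" .
  qed
  have nt: "norm (transpose D) = norm D"
    unfolding norm_eq_sqrt_inner by (simp add: inner_vec_def transpose_def) (rule sum.swap)
  have "norm (stress \<nu>1 \<nu>2 D) \<le> norm (\<nu>1 *\<^sub>R (D + transpose D)) + norm ((\<nu>2 * trace D) *\<^sub>R (mat 1 :: real^3^3))"
    unfolding stress_def by (rule norm_triangle_ineq)
  also have "norm (\<nu>1 *\<^sub>R (D + transpose D)) \<le> \<bar>\<nu>1\<bar> * (2 * norm D)"
    using norm_triangle_ineq[of D "transpose D"] by (simp add: nt mult_left_mono)
  also have "norm ((\<nu>2 * trace D) *\<^sub>R (mat 1 :: real^3^3)) = (\<bar>\<nu>2\<bar> * \<bar>trace D\<bar>) * norm (mat 1 :: real^3^3)"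
    by (simp add: abs_mult)
  also have "\<dots> \<le> (\<bar>\<nu>2\<bar> * (2 * norm D)) * 2"
    by (intro mult_mono mult_left_mono tr m1) auto
  finally show ?thesis by (simp add: algebra_simps)
qed

text \<open>The integrand obtained by adding the two tested equations, without the time kernel;
  primed quantities belong to the second space-time point.\<close>

definition dbl :: "real \<Rightarrow> real \<Rightarrow> R3 \<Rightarrow> real \<Rightarrow> real \<Rightarrow> R3 \<Rightarrow> real \<Rightarrow> real \<Rightarrow> R3 \<Rightarrow> real^3^3 \<Rightarrow> R3 \<Rightarrow>
    real \<Rightarrow> real \<Rightarrow> R3 \<Rightarrow> real \<Rightarrow> R3 \<Rightarrow> real" where
  "dbl \<mu> q z W Wt N r p u S f W' Wt' N' r' u' =
     W' * r' * (r * (u \<bullet> Kvec \<mu> q z) * Wt + r * ((u \<bullet> Kvec \<mu> q z) * (u \<bullet> N)) + W * r * (Kmat \<mu> q z \<bullet> tensor u u)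
        + p * (Kvec \<mu> q z \<bullet> N) + W * p * (Kmat \<mu> q z \<bullet> mat 1) - S \<bullet> tensor (Kvec \<mu> q z) N - W * (S \<bullet> Kmat \<mu> q z)
        + W * r * (f \<bullet> Kvec \<mu> q z))
     + W * r * r' * ((u \<bullet> Kvec \<mu> q z) * Wt' + (u' \<bullet> N') * (u \<bullet> Kvec \<mu> q z) - W' * (Kmat \<mu> q z \<bullet> tensor u u'))"

text \<open>What is left of \<open>dbl\<close> without the pressure times the trace of
  \<open>Kmat\<close> and the two convective terms with \<open>Kmat\<close>: derivatives of the
  cutoff, stress and force. These terms have no sign and are estimated in absolute value.\<close>

definition dbl_low :: "real \<Rightarrow> real \<Rightarrow> R3 \<Rightarrow> real \<Rightarrow> real \<Rightarrow> R3 \<Rightarrow> real \<Rightarrow> real \<Rightarrow> R3 \<Rightarrow> real^3^3 \<Rightarrow> R3 \<Rightarrow>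
    real \<Rightarrow> real \<Rightarrow> R3 \<Rightarrow> real \<Rightarrow> R3 \<Rightarrow> real" where
  "dbl_low \<mu> q z W Wt N r p u S f W' Wt' N' r' u' =
     W' * r' * (r * (u \<bullet> Kvec \<mu> q z) * Wt + r * ((u \<bullet> Kvec \<mu> q z) * (u \<bullet> N))
        + p * (Kvec \<mu> q z \<bullet> N) - S \<bullet> tensor (Kvec \<mu> q z) N - W * (S \<bullet> Kmat \<mu> q z)
        + W * r * (f \<bullet> Kvec \<mu> q z))
     + W * r * r' * ((u \<bullet> Kvec \<mu> q z) * Wt' + (u' \<bullet> N') * (u \<bullet> Kvec \<mu> q z))"

text \<open>Young's inequality with constants 1, so that comparing \<open>a\<close> with the square
  of \<open>b\<close> replaces a convexity argument. The exponents fit the available bounds on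
  \<open>\<rho> powr (3/2)\<close> and on the cubed kernel.\<close>

lemma Young_3_2:
  assumes "a \<ge> 0" "b \<ge> (0::real)"
  shows "a * b \<le> a powr (3/2) + b powr 3"
proof (cases "a \<le> b powr 2")
  case True
  have "a * b \<le> b powr 2 * b" using True assms by (intro mult_right_mono) auto
  also have "\<dots> = b powr 3" using assms by (cases "b = 0") (auto simp: power2_eq_square power3_eq_cube)
  finally show ?thesis by (simp add: add_increasing)
next
  case False
  have "b = (b powr 2) powr (1/2)" using assms by (simp add: powr_powr)
  also have "\<dots> \<le> a powr (1/2)" using False assms by (intro powr_mono2) auto
  finally have "a * b \<le> a * a powr (1/2)" using assms by (intro mult_left_mono) auto
  also have "\<dots> = a powr (3/2)" using assms by (cases "a = 0") (auto simp: powr_mult_base)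
  finally show ?thesis by (simp add: add_increasing2)
qed

lemma le_one_plus_powr:
  assumes "r \<ge> (0::real)"
  shows "r \<le> 1 + r powr (3/2)"
  using Young_3_2[OF assms, of 1] by simp

text \<open>Each term is bounded by an energy density at one point times \<open>th\<close> or
  \<open>th'\<close>, the majorant of the kernel plus the pressure at the other point. Terms with
  \<open>Kvec\<close> use that r' |K| is at most r'^(3/2) + |K|^3, hence at most \<open>th\<close>.
  The stress against \<open>Kmat\<close> is more singular and is treated in
  \<open>gk\<close>.\<close>

lemma dbl_low_bound:
  assumes \<mu>: "0 < \<mu>" "\<mu> < 4/3" and q: "q > 0" "z \<bullet> z \<le> q"
    and C: "C \<ge> 1" "lgw q powr (3 * \<mu>) \<le> C * cubker \<mu> q" "ker \<mu> q powr (3/2) \<le> C * cubker \<mu> q"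
    and W: "\<bar>W\<bar> \<le> M" "\<bar>W'\<bar> \<le> M" "\<bar>Wt\<bar> \<le> M" "\<bar>Wt'\<bar> \<le> M" "norm N \<le> M" "norm N' \<le> M"
    and r: "r \<ge> 0" "r' \<ge> 0" "r powr (3/2) \<le> p" "r' powr (3/2) \<le> p'"
    and S: "norm S \<le> s1 * g" "g \<ge> 0" "s1 \<ge> 0" and f: "norm f \<le> F"
  shows "\<bar>dbl_low \<mu> q z W Wt N r p u S f W' Wt' N' r' u'\<bar> \<le> M\<^sup>2 * (6 + F + 5 * s1) *
     ((1 + p + r * (norm u)\<^sup>2 + g\<^sup>2) * (C * cubker \<mu> q + 1 + p') + (1 + p' + r' * (norm u')\<^sup>2 + g'\<^sup>2) * (C * cubker \<mu> q + 1 + p))"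
proof -
  define l where "l = lgw q powr \<mu>"
  define k where "k = ker \<mu> q"
  define U where "U = norm u"
  define U' where "U' = norm u'"
  define x where "x = C * cubker \<mu> q"
  define a where "a = 1 + p + r * U\<^sup>2 + g\<^sup>2"
  define a' where "a' = 1 + p' + r' * U'\<^sup>2 + g'\<^sup>2"
  define th where "th = x + 1 + p'"
  define th' where "th' = x + 1 + p"
  have l0: "l \<ge> 0" unfolding l_def by simp
  have k0: "k \<ge> 0" unfolding k_def using ker_pos[OF q(1), of \<mu>] by simp
  have U0: "U \<ge> 0" "U' \<ge> 0" unfolding U_def U'_def by auto
  have M0: "M \<ge> 0" using W(1) by linarith
  have F0: "F \<ge> 0" using f norm_ge_zero[of f] by linarith
  have p0: "p \<ge> 0" "p' \<ge> 0" using r by (meson order_trans powr_ge_zero)+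
  have x0: "x \<ge> 0" unfolding x_def using cubker_pos[OF q(1), of \<mu>] C(1) by simp
  have rU2: "r * U\<^sup>2 \<ge> 0" "r' * U'\<^sup>2 \<ge> 0" using r by auto
  have a: "a \<ge> 1" "a' \<ge> 1" "p \<le> a" "p' \<le> a'" "r * U\<^sup>2 \<le> a" "r' * U'\<^sup>2 \<le> a'" "g\<^sup>2 \<le> a"
    unfolding a_def a'_def using p0 rU2 by auto
  have th: "th \<ge> 1" "th' \<ge> 1" unfolding th_def th'_def using x0 p0 by auto
  have rle: "r \<le> 1 + p" "r' \<le> 1 + p'" using le_one_plus_powr[OF r(1)] le_one_plus_powr[OF r(2)] r by auto
  have ra: "r \<le> a" unfolding a_def using rle(1) rU2(1) zero_le_power2[of g] by linarith
  have sq: "t \<le> 1 + t\<^sup>2" for t :: real using zero_le_power2[of "t - 1/2"] unfolding power2_diff by (simp add: power2_eq_square)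
  have rU: "r * U \<le> a"
  proof -
    have "r * U \<le> r * (1 + U\<^sup>2)" using sq[of U] r by (intro mult_left_mono) auto
    also have "\<dots> = r + r * U\<^sup>2" by (simp add: algebra_simps)
    also have "\<dots> \<le> a" unfolding a_def using rle(1) zero_le_power2[of g] by linarith
    finally show ?thesis .
  qed
  have ga: "g \<le> a" unfolding a_def using sq[of g] p0 rU2 by linarith
  have l3: "l powr 3 \<le> x" unfolding l_def x_def using C(2) by (simp add: powr_powr mult.commute)
  have rl: "r' * l \<le> th" unfolding th_def using Young_3_2[OF r(2) l0] l3 r(4) by linarith
  have rl': "r * l \<le> th'" unfolding th'_def using Young_3_2[OF r(1) l0] l3 r(3) by linarith
  have k32: "k powr (3/2) \<le> x" unfolding k_def x_def by (rule C(3))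
  \<comment> \<open>Here \<open>g\<close> is only square integrable and \<open>k\<close> is more
    singular than |K|. With r' = s^2, g s is at most g^2 + s^2. The part with g^2 leaves k s,
    bounded by k^(3/2) + s^3 and so by \<open>th\<close>; the other part is s^3 = r'^(3/2), at most
    p', times \<open>k\<close>, at most \<open>th'\<close>.\<close>
  have gk: "r' * (g * k) \<le> a * th + a' * th'"
  proof -
    define s where "s = sqrt r'"
    have s: "s \<ge> 0" "r' = s * s" unfolding s_def using r by auto
    have s3: "s powr 3 = r' powr (3/2)"
      unfolding s_def using r(2) by (simp add: powr_half_sqrt[symmetric] powr_powr)
    have r15: "r' * s = r' powr (3/2)" 
    proof (cases "r' = 0")
      case False
      then show ?thesis unfolding s_def using r(2)
        by (simp add: powr_half_sqrt[symmetric] powr_mult_base)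
    qed simp
    have "g * s * s \<le> (g\<^sup>2 + s\<^sup>2) * s"
    proof -
      have "g * s \<le> g\<^sup>2 + s\<^sup>2" using sum_squares_bound[of g s] mult_nonneg_nonneg[OF S(2) s(1)] by linarith
      then show ?thesis using s by (intro mult_right_mono) auto
    qed
    then have "g * s * s * k \<le> (g\<^sup>2 + s\<^sup>2) * s * k" by (rule mult_right_mono[OF _ k0])
    then have "r' * (g * k) \<le> g\<^sup>2 * (k * s) + (r' * s) * k"
      unfolding s(2) by (simp add: power2_eq_square algebra_simps)
    also have "g\<^sup>2 * (k * s) \<le> g\<^sup>2 * th"
    proof (intro mult_left_mono)
      show "k * s \<le> th" unfolding th_def using Young_3_2[OF k0 s(1)] k32 s3 r(4) by linarith
    qed simp
    also have "g\<^sup>2 * th \<le> a * th" using a th by (intro mult_right_mono) auto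
    also have "(r' * s) * k \<le> a' * th'"
    proof (intro mult_mono)
      show "r' * s \<le> a'" unfolding r15 using r(4) a by linarith
      show "k \<le> th'" unfolding th'_def using le_one_plus_powr[OF k0] k32 p0 by linarith
    qed (use a k0 in auto)
    finally show ?thesis by simp
  qed
  have uK: "\<bar>u \<bullet> Kvec \<mu> q z\<bar> \<le> U * l"
  proof -
    have "\<bar>u \<bullet> Kvec \<mu> q z\<bar> \<le> norm u * norm (Kvec \<mu> q z)" by (rule Cauchy_Schwarz_ineq2)
    also have "\<dots> \<le> U * l" unfolding U_def l_def by (intro mult_left_mono norm_Kvec q) auto
    finally show ?thesis .
  qed
  have M2: "M * M = M\<^sup>2" by (simp add: power2_eq_square)
  define Y where "Y = a * th"
  define Y' where "Y' = a' * th'"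
  have Y0: "Y \<ge> 0" "Y' \<ge> 0" unfolding Y_def Y'_def using a th by auto
  have m4: "\<bar>c1 * c2 * e1 * e2\<bar> \<le> M\<^sup>2 * (E1 * E2)"
    if "\<bar>c1\<bar> \<le> M" "\<bar>c2\<bar> \<le> M" "\<bar>e1\<bar> \<le> E1" "\<bar>e2\<bar> \<le> E2" for c1 c2 e1 e2 E1 E2
  proof -
    have "\<bar>c1 * c2 * e1 * e2\<bar> = (\<bar>c1\<bar> * \<bar>c2\<bar>) * (\<bar>e1\<bar> * \<bar>e2\<bar>)" by (simp add: abs_mult)
    also have "\<dots> \<le> (M * M) * (E1 * E2)"
      using that M0 by (intro mult_mono) auto
    finally show ?thesis by (simp add: M2)
  qed
  have dotN: "\<bar>w \<bullet> N\<bar> \<le> norm w * M" "\<bar>w \<bullet> N'\<bar> \<le> norm w * M" for w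
    using order_trans[OF Cauchy_Schwarz_ineq2 mult_left_mono[OF W(5) norm_ge_zero]]
      order_trans[OF Cauchy_Schwarz_ineq2 mult_left_mono[OF W(6) norm_ge_zero]] by auto
  have lle: "norm (Kvec \<mu> q z) \<le> l" unfolding l_def by (rule norm_Kvec[OF q])
  have base: "r' * l * b \<le> Y" if "b \<le> a" "b \<ge> 0" for b
  proof -
    have "r' * l * b \<le> th * a" using rl that th by (intro mult_mono) auto
    then show ?thesis unfolding Y_def by (simp add: mult.commute)
  qed
  have T1: "\<bar>W' * r' * (r * (u \<bullet> Kvec \<mu> q z) * Wt)\<bar> \<le> M\<^sup>2 * Y"
  proof -
    have "\<bar>W' * Wt * (r' * r) * (u \<bullet> Kvec \<mu> q z)\<bar> \<le> M\<^sup>2 * ((r' * r) * (U * l))"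
      by (rule m4) (use W uK r in auto)
    also have "(r' * r) * (U * l) = r' * l * (r * U)" by simp
    also have "M\<^sup>2 * \<dots> \<le> M\<^sup>2 * Y" by (intro mult_left_mono base rU) (use r U0 in auto)
    finally show ?thesis by (simp add: mult_ac)
  qed
  have T2: "\<bar>W' * r' * (r * ((u \<bullet> Kvec \<mu> q z) * (u \<bullet> N)))\<bar> \<le> M\<^sup>2 * Y"
  proof -
    have "\<bar>W' * r' * (r * ((u \<bullet> Kvec \<mu> q z) * (u \<bullet> N)))\<bar> = (\<bar>W'\<bar> * \<bar>u \<bullet> N\<bar>) * ((r' * r) * \<bar>u \<bullet> Kvec \<mu> q z\<bar>)"
      using r by (simp add: abs_mult)
    also have "\<dots> \<le> (M * (U * M)) * ((r' * r) * (U * l))"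
      using W dotN(1)[of u] uK r M0 U0 unfolding U_def[symmetric] by (intro mult_mono mult_left_mono) auto
    also have "\<dots> = M\<^sup>2 * (r' * l * (r * U\<^sup>2))" by (simp add: power2_eq_square)
    also have "\<dots> \<le> M\<^sup>2 * Y" by (intro mult_left_mono base a) (use rU2 in auto)
    finally show ?thesis .
  qed
  have T3: "\<bar>W' * r' * (p * (Kvec \<mu> q z \<bullet> N))\<bar> \<le> M\<^sup>2 * Y"
  proof -
    have KN: "\<bar>Kvec \<mu> q z \<bullet> N\<bar> \<le> l * M"
      using dotN(1)[of "Kvec \<mu> q z"] mult_right_mono[OF lle M0] by linarith
    have "\<bar>W' * r' * (p * (Kvec \<mu> q z \<bullet> N))\<bar> = \<bar>W'\<bar> * ((r' * p) * \<bar>Kvec \<mu> q z \<bullet> N\<bar>)"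
      using r p0 by (simp add: abs_mult)
    also have "\<dots> \<le> M * ((r' * p) * (l * M))"
      using W KN r p0 M0 by (intro mult_mono mult_left_mono) auto
    also have "\<dots> = M\<^sup>2 * (r' * l * p)" by (simp add: power2_eq_square)
    also have "\<dots> \<le> M\<^sup>2 * Y" by (intro mult_left_mono base a) (use p0 in auto)
    finally show ?thesis .
  qed
  have T4: "\<bar>W' * r' * (S \<bullet> tensor (Kvec \<mu> q z) N)\<bar> \<le> s1 * (M\<^sup>2 * Y)"
  proof -
    have "\<bar>S \<bullet> tensor (Kvec \<mu> q z) N\<bar> \<le> norm S * (norm (Kvec \<mu> q z) * norm N)"
      using Cauchy_Schwarz_ineq2[of S "tensor (Kvec \<mu> q z) N"] by (simp add: norm_tensor)
    also have "\<dots> \<le> (s1 * g) * (l * M)" using S lle W M0 l0 by (intro mult_mono) auto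
    finally have SN: "\<bar>S \<bullet> tensor (Kvec \<mu> q z) N\<bar> \<le> (s1 * g) * (l * M)" .
    have "\<bar>W' * r' * (S \<bullet> tensor (Kvec \<mu> q z) N)\<bar> = \<bar>W'\<bar> * (r' * \<bar>S \<bullet> tensor (Kvec \<mu> q z) N\<bar>)"
      using r by (simp add: abs_mult)
    also have "\<dots> \<le> M * (r' * ((s1 * g) * (l * M)))"
      using W SN r M0 by (intro mult_mono mult_left_mono) auto
    also have "\<dots> = s1 * (M\<^sup>2 * (r' * l * g))" by (simp add: power2_eq_square)
    also have "\<dots> \<le> s1 * (M\<^sup>2 * Y)" by (intro mult_left_mono base ga) (use S in auto)
    finally show ?thesis .
  qed
  have T5: "\<bar>W' * r' * (W * (S \<bullet> Kmat \<mu> q z))\<bar> \<le> 4 * s1 * (M\<^sup>2 * (Y + Y'))"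
  proof -
    have "\<bar>S \<bullet> Kmat \<mu> q z\<bar> \<le> norm S * norm (Kmat \<mu> q z)" by (rule Cauchy_Schwarz_ineq2)
    also have "\<dots> \<le> (s1 * g) * (4 * k)"
      unfolding k_def using S norm_Kmat[OF q(1) \<mu> q(2)] by (intro mult_mono) auto
    finally have SK: "\<bar>S \<bullet> Kmat \<mu> q z\<bar> \<le> (s1 * g) * (4 * k)" .
    have "\<bar>W' * r' * (W * (S \<bullet> Kmat \<mu> q z))\<bar> = (\<bar>W'\<bar> * \<bar>W\<bar>) * (r' * \<bar>S \<bullet> Kmat \<mu> q z\<bar>)"
      using r by (simp add: abs_mult)
    also have "\<dots> \<le> (M * M) * (r' * ((s1 * g) * (4 * k)))"
      using W SK r M0 by (intro mult_mono mult_left_mono) auto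
    also have "\<dots> = 4 * s1 * (M\<^sup>2 * (r' * (g * k)))" by (simp add: power2_eq_square)
    also have "\<dots> \<le> 4 * s1 * (M\<^sup>2 * (Y + Y'))"
      unfolding Y_def Y'_def using S gk by (intro mult_left_mono) auto
    finally show ?thesis .
  qed
  have T6: "\<bar>W' * r' * (W * r * (f \<bullet> Kvec \<mu> q z))\<bar> \<le> F * (M\<^sup>2 * Y)"
  proof -
    have "\<bar>f \<bullet> Kvec \<mu> q z\<bar> \<le> norm f * norm (Kvec \<mu> q z)" by (rule Cauchy_Schwarz_ineq2)
    also have "\<dots> \<le> F * l" using f lle F0 by (intro mult_mono) auto
    finally have fK: "\<bar>f \<bullet> Kvec \<mu> q z\<bar> \<le> F * l" .
    have "\<bar>W' * W * (r' * r) * (f \<bullet> Kvec \<mu> q z)\<bar> \<le> M\<^sup>2 * ((r' * r) * (F * l))"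
      by (rule m4) (use W fK r in auto)
    also have "\<dots> = F * (M\<^sup>2 * (r' * l * r))" by simp
    also have "\<dots> \<le> F * (M\<^sup>2 * Y)" by (intro mult_left_mono base ra) (use F0 r in auto)
    finally show ?thesis by (simp add: mult_ac)
  qed
  have T7: "\<bar>W * r * r' * ((u \<bullet> Kvec \<mu> q z) * Wt')\<bar> \<le> M\<^sup>2 * Y"
  proof -
    have "\<bar>W * Wt' * (r' * r) * (u \<bullet> Kvec \<mu> q z)\<bar> \<le> M\<^sup>2 * ((r' * r) * (U * l))"
      by (rule m4) (use W uK r in auto)
    also have "(r' * r) * (U * l) = r' * l * (r * U)" by simp
    also have "M\<^sup>2 * \<dots> \<le> M\<^sup>2 * Y" by (intro mult_left_mono base rU) (use r U0 in auto)
    finally show ?thesis by (simp add: mult_ac)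
  qed
  have T8: "\<bar>W * r * r' * ((u' \<bullet> N') * (u \<bullet> Kvec \<mu> q z))\<bar> \<le> M\<^sup>2 * (Y + Y')"
  proof -
    have "\<bar>W * r * r' * ((u' \<bullet> N') * (u \<bullet> Kvec \<mu> q z))\<bar> = (\<bar>W\<bar> * \<bar>u' \<bullet> N'\<bar>) * ((r * r') * \<bar>u \<bullet> Kvec \<mu> q z\<bar>)"
      using r by (simp add: abs_mult)
    also have "\<dots> \<le> (M * (U' * M)) * ((r * r') * (U * l))"
      using W dotN(2)[of u'] uK r M0 U0 unfolding U'_def[symmetric] by (intro mult_mono mult_left_mono) auto
    also have "\<dots> = M\<^sup>2 * ((r * r' * l) * (U * U'))" by (simp add: power2_eq_square)
    \<comment> \<open>After the split each square joins its own density to form a kinetic energy,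
      and the remaining density is paired with the bound \<open>l\<close> of |K|.\<close>
    also have "\<dots> \<le> M\<^sup>2 * ((r * r' * l) * (U\<^sup>2 + U'\<^sup>2))"
    proof (intro mult_left_mono)
      show "U * U' \<le> U\<^sup>2 + U'\<^sup>2" using sum_squares_bound[of U U'] mult_nonneg_nonneg[OF U0] by linarith
    qed (use r l0 in auto)
    also have "(r * r' * l) * (U\<^sup>2 + U'\<^sup>2) = r' * l * (r * U\<^sup>2) + (r' * U'\<^sup>2) * (r * l)"
      by (simp add: algebra_simps)
    also have "M\<^sup>2 * \<dots> \<le> M\<^sup>2 * (Y + Y')"
    proof (intro mult_left_mono add_mono base a)
      show "(r' * U'\<^sup>2) * (r * l) \<le> Y'"
        unfolding Y'_def using a rl' r l0 by (intro mult_mono) auto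
    qed (use rU2 in auto)
    finally show ?thesis .
  qed
  define P where "P = M\<^sup>2 * Y"
  define P' where "P' = M\<^sup>2 * Y'"
  have P0: "P \<ge> 0" "P' \<ge> 0" unfolding P_def P'_def using Y0 by auto
  have PP: "M\<^sup>2 * (Y + Y') = P + P'" unfolding P_def P'_def by (simp add: algebra_simps)
  have "dbl_low \<mu> q z W Wt N r p u S f W' Wt' N' r' u' =
     W' * r' * (r * (u \<bullet> Kvec \<mu> q z) * Wt) + W' * r' * (r * ((u \<bullet> Kvec \<mu> q z) * (u \<bullet> N)))
      + W' * r' * (p * (Kvec \<mu> q z \<bullet> N)) - W' * r' * (S \<bullet> tensor (Kvec \<mu> q z) N)
      - W' * r' * (W * (S \<bullet> Kmat \<mu> q z)) + W' * r' * (W * r * (f \<bullet> Kvec \<mu> q z))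
      + W * r * r' * ((u \<bullet> Kvec \<mu> q z) * Wt') + W * r * r' * ((u' \<bullet> N') * (u \<bullet> Kvec \<mu> q z))"
    unfolding dbl_low_def by (simp only: distrib_left right_diff_distrib add.assoc)
  moreover have "\<bar>a1 + a2 + a3 - a4 - a5 + a6 + a7 + a8\<bar> \<le> b1 + b2 + b3 + b4 + b5 + b6 + b7 + b8"
    if "\<bar>a1\<bar> \<le> b1" "\<bar>a2\<bar> \<le> b2" "\<bar>a3\<bar> \<le> b3" "\<bar>a4\<bar> \<le> b4" "\<bar>a5\<bar> \<le> b5" "\<bar>a6\<bar> \<le> b6" "\<bar>a7\<bar> \<le> b7" "\<bar>a8\<bar> \<le> b8"
    for a1 a2 a3 a4 a5 a6 a7 a8 b1 b2 b3 b4 b5 b6 b7 b8 :: real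
    using that unfolding abs_le_iff by (intro conjI) linarith+
  note this[OF T1 T2 T3 T4 T5 T6 T7 T8]
  ultimately have "\<bar>dbl_low \<mu> q z W Wt N r p u S f W' Wt' N' r' u'\<bar> \<le>
      P + P + P + s1 * P + 4 * s1 * (P + P') + F * P + P + (P + P')"
    unfolding P_def[symmetric] PP by (simp only: )
  also have "\<dots> \<le> (6 + F + 5 * s1) * (P + P')"
    using P0 F0 S(3) mult_nonneg_nonneg[OF F0 P0(2)] mult_nonneg_nonneg[OF S(3) P0(2)] by (simp add: algebra_simps)
  also have "\<dots> = M\<^sup>2 * (6 + F + 5 * s1) * (a * th + a' * th')"
    unfolding P_def P'_def Y_def Y'_def by (simp add: algebra_simps)
  finally show ?thesis unfolding a_def a'_def th_def th'_def x_def U_def U'_def .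
qed

text \<open>Since \<open>Kmat\<close> is even in \<open>z\<close>, adding the two orders completes a
  square: the convective terms become the form of \<open>Kmat\<close> at \<open>u - u'\<close>, and
  the pressure multiplies the trace. Half of the trace term absorbs the negative part of the form;
  the other half is the main term on the left.\<close>

lemma dbl_symmetrized_lower_bound:
  assumes \<mu>: "0 < \<mu>" "\<mu> < 4/3" and q: "q > 0" "z \<bullet> z \<le> q"
    and C: "C \<ge> 1" "lgw q powr (3 * \<mu>) \<le> C * cubker \<mu> q" "ker \<mu> q powr (3/2) \<le> C * cubker \<mu> q"
    and W: "W = lam\<^sup>2" "W' = lam'\<^sup>2" "\<bar>W\<bar> \<le> M" "\<bar>W'\<bar> \<le> M" "\<bar>Wt\<bar> \<le> M" "\<bar>Wt'\<bar> \<le> M" "norm N \<le> M" "norm N' \<le> M"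
    and r: "r \<ge> 0" "r' \<ge> 0" "r powr (3/2) \<le> p" "r' powr (3/2) \<le> p'"
    and S: "norm S \<le> s1 * g" "g \<ge> 0" "norm S' \<le> s1 * g'" "g' \<ge> 0" "s1 \<ge> 0" and f: "norm f \<le> F" "norm f' \<le> F"
    and a: "a = 1 + p + r * (norm u)\<^sup>2 + g\<^sup>2 + (r * (norm u)\<^sup>2) powr (2/3) * (norm (lam *\<^sub>R u))\<^sup>2"
      "a' = 1 + p' + r' * (norm u')\<^sup>2 + g'\<^sup>2 + (r' * (norm u')\<^sup>2) powr (2/3) * (norm (lam' *\<^sub>R u'))\<^sup>2"
    and c: "c = 2 * (M\<^sup>2 * (6 + F + 5 * s1)) + 16 * (1 / 8) powr (- 2 / 3) * M * (\<mu> + 1)\<^sup>2"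
  shows "W * W' * ker \<mu> q * (p * r' + p' * r) / 2
      - c * (a * (C * cubker \<mu> q + 1 + p') + a' * (C * cubker \<mu> q + 1 + p))
     \<le> dbl \<mu> q z W Wt N r p u S f W' Wt' N' r' u' + dbl \<mu> q (- z) W' Wt' N' r' p' u' S' f' W Wt N r u"
proof -
  define k where "k = ker \<mu> q"
  define k1 where "k1 = ker (\<mu> - 1) q"
  define k3 where "k3 = ker (\<mu> - 5/3) q"
  define x where "x = C * cubker \<mu> q"
  have k0: "k \<ge> 0" "k1 \<ge> 0" "k3 \<ge> 0" unfolding k_def k1_def k3_def using ker_pos[OF q(1)] less_imp_le by auto
  have x0: "x \<ge> 0" unfolding x_def using cubker_pos[OF q(1), of \<mu>] C(1) by simp
  have M0: "M \<ge> 0" using W(3) by linarith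
  have W0: "W \<ge> 0" "W' \<ge> 0" unfolding W by auto
  have WM: "W \<le> M" "W' \<le> M" using W by auto
  have F0: "F \<ge> 0" using f(1) norm_ge_zero[of f] by linarith
  have p0: "p \<ge> 0" "p' \<ge> 0" using r by (meson order_trans powr_ge_zero)+
  define b where "b = (r * (norm u)\<^sup>2) powr (2/3) * (norm (lam *\<^sub>R u))\<^sup>2"
  define b' where "b' = (r' * (norm u')\<^sup>2) powr (2/3) * (norm (lam' *\<^sub>R u'))\<^sup>2"
  have b0: "b \<ge> 0" "b' \<ge> 0" unfolding b_def b'_def by auto
  define th where "th = x + 1 + p'"
  define th' where "th' = x + 1 + p"
  have th0: "th \<ge> 0" "th' \<ge> 0" unfolding th_def th'_def using x0 p0 by auto
  define Y where "Y = a * th + a' * th'"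
  define cL where "cL = M\<^sup>2 * (6 + F + 5 * s1)"
  have cL0: "cL \<ge> 0" unfolding cL_def using F0 S by auto
  have a0: "a \<ge> 0" "a' \<ge> 0" unfolding a b_def[symmetric] b'_def[symmetric] using p0 r b0 by auto
  have Y0: "Y \<ge> 0" unfolding Y_def using a0 th0 by auto
  have A1: "1 + p + r * (norm u)\<^sup>2 + g\<^sup>2 \<le> a" "1 + p' + r' * (norm u')\<^sup>2 + g'\<^sup>2 \<le> a'"
    unfolding a b_def[symmetric] b'_def[symmetric] using b0 by auto
  note A2 = mult_right_mono[OF A1(1) th0(1)] mult_right_mono[OF A1(2) th0(2)]
  have low: "\<bar>dbl_low \<mu> q z W Wt N r p u S f W' Wt' N' r' u'\<bar> \<le> cL * Y"
  proof -
    have "\<bar>dbl_low \<mu> q z W Wt N r p u S f W' Wt' N' r' u'\<bar> \<le> cL *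
     ((1 + p + r * (norm u)\<^sup>2 + g\<^sup>2) * th + (1 + p' + r' * (norm u')\<^sup>2 + g'\<^sup>2) * th')"
      unfolding cL_def th_def th'_def x_def
      by (rule dbl_low_bound[OF \<mu> q C W(3-8) r S(1,2,5) f(1)])
    also have "\<dots> \<le> cL * Y"
      unfolding Y_def by (rule mult_left_mono[OF add_mono[OF A2] cL0])
    finally show ?thesis .
  qed
  have low': "\<bar>dbl_low \<mu> q (- z) W' Wt' N' r' p' u' S' f' W Wt N r u\<bar> \<le> cL * Y"
  proof -
    have "\<bar>dbl_low \<mu> q (- z) W' Wt' N' r' p' u' S' f' W Wt N r u\<bar> \<le> cL *
     ((1 + p' + r' * (norm u')\<^sup>2 + g'\<^sup>2) * th' + (1 + p + r * (norm u)\<^sup>2 + g\<^sup>2) * th)"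
      unfolding cL_def th_def th'_def x_def
      by (rule dbl_low_bound[OF \<mu> q(1) _ C W(4,3,6,5,8,7) r(2,1,4,3) S(3,4,5) f(2)]) (use q in simp)
    also have "\<dots> \<le> cL * Y"
      unfolding Y_def by (subst add.commute) (rule mult_left_mono[OF add_mono[OF A2] cL0])
    finally show ?thesis .
  qed
  define tr where "tr = Kmat \<mu> q z \<bullet> mat 1"
  have tr: "tr \<ge> k" unfolding tr_def k_def Kmat_inner by (rule ker_trace(1)[OF q(1) \<mu> _ q(2)]) simp
  have Km_even: "Kmat \<mu> q (- z) = Kmat \<mu> q z" by (simp add: Kmat_def tensor_def)
  define Qf where "Qf = k * ((u - u') \<bullet> (u - u')) + 2 * dker \<mu> q * (z \<bullet> (u - u'))\<^sup>2"
  have split: "dbl \<mu> q z W Wt N r p u S f W' Wt' N' r' u' + dbl \<mu> q (- z) W' Wt' N' r' p' u' S' f' W Wt N r u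
     = dbl_low \<mu> q z W Wt N r p u S f W' Wt' N' r' u' + dbl_low \<mu> q (- z) W' Wt' N' r' p' u' S' f' W Wt N r u
      + W * W' * (p * r' + p' * r) * tr + W * W' * (r * r') * Qf"
  proof -
    have Q: "Qf = (Kmat \<mu> q z \<bullet> tensor u u - Kmat \<mu> q z \<bullet> tensor u u') + (Kmat \<mu> q z \<bullet> tensor u' u' - Kmat \<mu> q z \<bullet> tensor u' u)"
      unfolding Qf_def Kmat_inner k_def
      by (simp add: inner_diff_left inner_diff_right power2_eq_square inner_commute algebra_simps)
    show ?thesis unfolding dbl_def dbl_low_def Km_even Q tr_def[symmetric]
      by (simp add: algebra_simps)
  qed
  \<comment> \<open>With this \<open>e\<close> the factor \<open>4 * \<mu> * e\<close> equals 1/2,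
    so exactly half of the pressure term is spent on absorption.\<close>
  define e :: real where "e = 1 / (8 * \<mu>)"
  have e0: "e > 0" unfolding e_def using \<mu> by simp
  define ce where "ce = e powr (-2/3)"
  have ce0: "ce \<ge> 0" unfolding ce_def by simp
  have Qlow: "Qf \<ge> - 4 * \<mu> * k1 * ((norm u)\<^sup>2 + (norm u')\<^sup>2)"
  proof -
    have "Qf \<ge> - 2 * \<mu> * k1 * ((u - u') \<bullet> (u - u'))"
      unfolding Qf_def k_def k1_def by (rule ker_quadratic_form[OF q(1) \<mu>(1) q(2)])
    moreover have "(u - u') \<bullet> (u - u') \<le> 2 * ((norm u)\<^sup>2 + (norm u')\<^sup>2)"
    proof -
      have "0 \<le> (u + u') \<bullet> (u + u')" by simp
      then show ?thesis unfolding power2_norm_eq_inner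
        by (simp add: inner_add_left inner_add_right inner_diff_left inner_diff_right inner_commute)
    qed
    then have "(2 * \<mu> * k1) * ((u - u') \<bullet> (u - u')) \<le> (2 * \<mu> * k1) * (2 * ((norm u)\<^sup>2 + (norm u')\<^sup>2))"
      using \<mu> k0 by (intro mult_left_mono) auto
    moreover have "(2 * \<mu> * k1) * (2 * ((norm u)\<^sup>2 + (norm u')\<^sup>2)) = 4 * \<mu> * k1 * ((norm u)\<^sup>2 + (norm u')\<^sup>2)"
      by simp
    ultimately show ?thesis by linarith
  qed
  \<comment> \<open>Young's inequality pairs the density with the kernel whose cube is
    \<open>cubker \<mu>\<close>.\<close>
  have k3x: "s * k3 \<le> P + 1 + x" if "s \<ge> 0" "s powr (3/2) \<le> P" for s P
  proof -
    have "k3 powr 3 = cubker \<mu> q"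
      unfolding k3_def using ker_cubed[OF q(1), of \<mu>] ker_pos[OF q(1), of "\<mu> - 5/3"] by simp
    also have "\<dots> \<le> x" unfolding x_def using C(1) cubker_pos[OF q(1), of \<mu>] by (simp add: mult_le_cancel_right1)
    finally show ?thesis using Young_3_2[OF that(1) k0(3)] that(2) by linarith
  qed
  \<comment> \<open>Stated for generic quantities because it is applied once at each of the two
    points.\<close>
  have bad: "W * W' * (r * r') * (4 * \<mu> * k1 * (norm u)\<^sup>2) \<le> W * W' * k * (p * r') / 2 + 4 * \<mu> * ce * M * (b * th)"
    if "W \<ge> 0" "W' \<ge> 0" "W = lam\<^sup>2" "W' \<le> M" "r \<ge> 0" "r' \<ge> 0" "r powr (3/2) \<le> p" "r' powr (3/2) \<le> p'"
      "b = (r * (norm u)\<^sup>2) powr (2/3) * (norm (lam *\<^sub>R u))\<^sup>2" "b \<ge> 0" "th = x + 1 + p'"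
    for W W' r r' p p' b th lam and u :: R3
  proof -
    have I: "r * (norm u)\<^sup>2 * k1 \<le> e * r powr (3/2) * k + ce * ((r * (norm u)\<^sup>2) powr (2/3) * (norm u)\<^sup>2) * k3"
      unfolding k_def k1_def k3_def ce_def by (rule ker_interpolation[OF q(1) that(5) norm_ge_zero e0])
    have "e * r powr (3/2) * k \<le> e * p * k" using that e0 k0 by (intro mult_right_mono mult_left_mono) auto
    with I have "r * (norm u)\<^sup>2 * k1 \<le> e * p * k + ce * ((r * (norm u)\<^sup>2) powr (2/3) * (norm u)\<^sup>2) * k3" by linarith
    then have "(4 * \<mu> * (W * W' * r')) * (r * (norm u)\<^sup>2 * k1)
       \<le> (4 * \<mu> * (W * W' * r')) * (e * p * k + ce * ((r * (norm u)\<^sup>2) powr (2/3) * (norm u)\<^sup>2) * k3)"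
      using that \<mu> by (intro mult_left_mono) auto
    also have "\<dots> = (4 * \<mu> * e) * (W * W' * k * (p * r')) + 4 * \<mu> * ce * (W' * ((r' * k3) * ((r * (norm u)\<^sup>2) powr (2/3) * (W * (norm u)\<^sup>2))))"
      by (simp add: algebra_simps)
    also have "4 * \<mu> * e = 1 / 2" unfolding e_def using \<mu> by simp
    \<comment> \<open>The weight \<open>lam\<^sup>2\<close> turns |u|^2 into |lam u|^2, the quantity
      that the localized Sobolev inequality controls.\<close>
    also have "(r * (norm u)\<^sup>2) powr (2/3) * (W * (norm u)\<^sup>2) = b" unfolding that by (simp add: power_mult_distrib)
    also have "1 / 2 * (W * W' * k * (p * r')) + 4 * \<mu> * ce * (W' * ((r' * k3) * b))
        \<le> 1 / 2 * (W * W' * k * (p * r')) + 4 * \<mu> * ce * (M * (th * b))"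
    proof -
      have 1: "r' * k3 \<le> th" using k3x[OF that(6,8)] that(11) by linarith
      have 2: "r' * k3 * b \<le> th * b" by (rule mult_right_mono[OF 1 that(10)])
      have 3: "0 \<le> r' * k3 * b" by (intro mult_nonneg_nonneg that k0)
      have 4: "W' * (r' * k3 * b) \<le> M * (th * b)" by (rule mult_mono[OF that(4) 2 M0 3])
      have 5: "0 \<le> 4 * \<mu> * ce" using \<mu> ce0 by simp
      show ?thesis by (rule add_left_mono[OF mult_left_mono[OF 4 5]])
    qed
    finally have *: "4 * \<mu> * (W * W' * r') * (r * (norm u)\<^sup>2 * k1) \<le> 1 / 2 * (W * W' * k * (p * r')) + 4 * \<mu> * ce * (M * (th * b))" .
    have "W * W' * (r * r') * (4 * \<mu> * k1 * (norm u)\<^sup>2) = 4 * \<mu> * (W * W' * r') * (r * (norm u)\<^sup>2 * k1)"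
      by (simp only: mult_ac)
    moreover have "1 / 2 * (W * W' * k * (p * r')) = W * W' * k * (p * r') / 2" by simp
    moreover have "4 * \<mu> * ce * (M * (th * b)) = 4 * \<mu> * ce * M * (b * th)" by (simp only: mult_ac)
    ultimately show ?thesis using * by (simp only: )
  qed
  have B1: "W * W' * (r * r') * (4 * \<mu> * k1 * (norm u)\<^sup>2) \<le> W * W' * k * (p * r') / 2 + 4 * \<mu> * ce * M * (b * th)"
    by (rule bad[OF W0 W(1) WM(2) r b_def b0(1) th_def])
  have B2: "W' * W * (r' * r) * (4 * \<mu> * k1 * (norm u')\<^sup>2) \<le> W' * W * k * (p' * r) / 2 + 4 * \<mu> * ce * M * (b' * th')"
    by (rule bad[OF W0(2,1) W(2) WM(1) r(2,1,4,3) b'_def b0(2) th'_def])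
  have bY: "b * th + b' * th' \<le> Y"
    unfolding Y_def a b_def[symmetric] b'_def[symmetric] using th0 p0 r by (intro add_mono mult_right_mono) auto
  \<comment> \<open>Accounts for the second summand of \<open>c\<close>: e^(-2/3) is (8
    \<mu>)^(2/3), and \<mu>^(2/3) is at most \<mu> + 1.\<close>
  have ce_le: "4 * \<mu> * ce \<le> 16 * (1 / 8) powr (- 2 / 3) * (\<mu> + 1)\<^sup>2"
  proof -
    have "e powr (-2/3) = (1/8) powr (-2/3) * (1 / \<mu>) powr (-2/3)"
      unfolding e_def by (simp add: powr_divide powr_mult)
    also have "(1 / \<mu>) powr (-2/3) = \<mu> powr (2/3)" using \<mu> by (simp add: powr_divide powr_minus_divide)
    also have "\<mu> powr (2/3) \<le> (\<mu> + 1) powr 1"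
      using \<mu> by (intro order_trans[OF powr_mono2[of "2/3" \<mu> "\<mu> + 1"] powr_mono]) auto
    finally have "ce \<le> (1/8) powr (-2/3) * (\<mu> + 1)" unfolding ce_def using \<mu> by (simp add: mult_left_mono)
    then have "4 * \<mu> * ce \<le> 4 * (\<mu> + 1) * ((1/8) powr (-2/3) * (\<mu> + 1))"
      using \<mu> ce0 by (intro mult_mono) auto
    also have "\<dots> = 4 * ((1/8) powr (-2/3) * (\<mu> + 1)\<^sup>2)" by (simp add: power2_eq_square)
    also have "\<dots> \<le> 16 * ((1/8) powr (-2/3) * (\<mu> + 1)\<^sup>2)" by (intro mult_right_mono) auto
    finally show ?thesis by (simp add: mult_ac)
  qed
  have quad: "W * W' * (r * r') * Qf \<ge> - (W * W' * k * (p * r' + p' * r) / 2) - 16 * (1 / 8) powr (- 2 / 3) * M * (\<mu> + 1)\<^sup>2 * Y"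
  proof -
    have "W * W' * (r * r') * (- 4 * \<mu> * k1 * ((norm u)\<^sup>2 + (norm u')\<^sup>2)) \<le> W * W' * (r * r') * Qf"
      using Qlow W0 r by (intro mult_left_mono) auto
    moreover have "W * W' * (r * r') * (- 4 * \<mu> * k1 * ((norm u)\<^sup>2 + (norm u')\<^sup>2))
       = - (W * W' * (r * r') * (4 * \<mu> * k1 * (norm u)\<^sup>2)) - W' * W * (r' * r) * (4 * \<mu> * k1 * (norm u')\<^sup>2)"
      by (simp add: algebra_simps)
    moreover have "4 * \<mu> * ce * M * (b * th) + 4 * \<mu> * ce * M * (b' * th') \<le> 16 * (1 / 8) powr (- 2 / 3) * M * (\<mu> + 1)\<^sup>2 * Y"
    proof -
      have "4 * \<mu> * ce * M * (b * th) + 4 * \<mu> * ce * M * (b' * th') = (4 * \<mu> * ce) * (M * (b * th + b' * th'))"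
        by (simp add: algebra_simps)
      also have "\<dots> \<le> (16 * (1 / 8) powr (- 2 / 3) * (\<mu> + 1)\<^sup>2) * (M * Y)"
      proof (rule mult_mono[OF ce_le mult_left_mono[OF bY M0]])
        show "0 \<le> M * (b * th + b' * th')"
          by (intro mult_nonneg_nonneg add_nonneg_nonneg M0 b0 th0)
      qed simp
      finally show ?thesis by (simp add: mult_ac)
    qed
    moreover have "W * W' * k * (p * r' + p' * r) / 2 = W * W' * k * (p * r') / 2 + W' * W * k * (p' * r) / 2"
      by (simp add: algebra_simps add_divide_distrib)
    ultimately show ?thesis using B1 B2 by linarith
  qed
  have trp: "W * W' * (p * r' + p' * r) * tr \<ge> W * W' * k * (p * r' + p' * r)"
  proof -
    have "W * W' * (p * r' + p' * r) * k \<le> W * W' * (p * r' + p' * r) * tr"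
      using tr W0 p0 r by (intro mult_left_mono) auto
    then show ?thesis by (simp add: mult_ac)
  qed
  have cY: "c * Y = cL * Y + cL * Y + 16 * (1 / 8) powr (- 2 / 3) * M * (\<mu> + 1)\<^sup>2 * Y"
    unfolding c cL_def by (simp add: algebra_simps)
  have "W * W' * k * (p * r' + p' * r) / 2 - c * Y
     \<le> dbl \<mu> q z W Wt N r p u S f W' Wt' N' r' u' + dbl \<mu> q (- z) W' Wt' N' r' p' u' S' f' W Wt N r u"
    unfolding split cY using low low' quad trp by linarith
  then show ?thesis unfolding k_def Y_def th_def th'_def x_def .
qed

section \<open>The two-point test functions\<close>

definition Kd :: "real \<Rightarrow> real \<Rightarrow> R3 \<Rightarrow> R3" where
  "Kd \<mu> d w = Kvec \<mu> (d\<^sup>2 + w \<bullet> w) w"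

lemma qd_pos: "d > 0 \<Longrightarrow> d\<^sup>2 + (w::R3) \<bullet> w > 0" and qd_ge: "w \<bullet> w \<le> d\<^sup>2 + (w::R3) \<bullet> w" "d\<^sup>2 \<le> d\<^sup>2 + (w::R3) \<bullet> w"
  by (auto intro: add_pos_nonneg)

lemma Ck_on_ker:
  fixes f :: "'a::euclidean_space \<Rightarrow> real"
  assumes "Ck_on k UNIV f" and pos: "\<And>x. f x > 0"
  shows "Ck_on k UNIV (\<lambda>x. ker b (f x))"
proof -
  \<comment> \<open>The reciprocal inside the logarithm is written as a power -1, to which
    \<open>Ck_on_powr\<close> applies.\<close>
  have "Ck_on k UNIV (\<lambda>x. (ln (exp 4 + f x powr (-1))) powr b * f x powr (-1/2))"
  proof (intro Ck_on_mult Ck_on_powr Ck_on_ln Ck_on_add Ck_on_const assms)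
    fix x
    show "exp 4 + f x powr (-1) > 0" by (simp add: add_pos_nonneg)
    show "ln (exp 4 + f x powr (-1)) > 0"
      using lgw_pos[OF pos[of x]] pos[of x] by (simp add: lgw_def powr_minus_divide)
  qed
  moreover have "(\<lambda>x. (ln (exp 4 + f x powr (-1))) powr b * f x powr (-1/2)) = (\<lambda>x. ker b (f x))"
  proof
    fix x show "(ln (exp 4 + f x powr (-1))) powr b * f x powr (-1/2) = ker b (f x)"
      using pos[of x] by (simp add: ker_def lgw_def powr_minus_divide)
  qed
  ultimately show ?thesis by simp
qed

lemma Ck_on_Kd:
  fixes f :: "'a::euclidean_space \<Rightarrow> R3"
  assumes "Ck_on k UNIV f" and "d > 0"
  shows "Ck_on k UNIV (\<lambda>x. Kd \<mu> d (f x))"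
  unfolding Kd_def Kvec_def
  by (intro Ck_on_scaleR Ck_on_ker Ck_on_add Ck_on_const Ck_on_inner assms qd_pos)

lemma Kd_has_derivative:
  assumes d: "d > 0"
  shows "(Kd \<mu> d has_derivative (\<lambda>h. ker \<mu> (d\<^sup>2 + w \<bullet> w) *\<^sub>R h + (2 * dker \<mu> (d\<^sup>2 + w \<bullet> w) * (w \<bullet> h)) *\<^sub>R w)) (at w)"
proof -
  have "((\<lambda>w. d\<^sup>2 + w \<bullet> w) has_derivative (\<lambda>h. 2 * (w \<bullet> h))) (at w)"
    by (auto intro!: derivative_eq_intros simp: inner_commute)
  moreover have "(ker \<mu> has_derivative (\<lambda>t. dker \<mu> (d\<^sup>2 + w \<bullet> w) * t)) (at (d\<^sup>2 + w \<bullet> w))"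
    using ker_deriv[OF qd_pos[OF d], of \<mu> w] by (simp add: has_field_derivative_def)
  ultimately have "((\<lambda>w. ker \<mu> (d\<^sup>2 + w \<bullet> w)) has_derivative (\<lambda>h. dker \<mu> (d\<^sup>2 + w \<bullet> w) * (2 * (w \<bullet> h)))) (at w)"
    by (rule has_derivative_compose)
  from has_derivative_scaleR[OF this has_derivative_ident]
  show ?thesis unfolding Kd_def[abs_def] Kvec_def
    by (rule has_derivative_eq_rhs) (simp add: fun_eq_iff mult_ac)
qed

text \<open>The derivative of the time kernel \<open>gs (\<tau> / h)\<close> in \<tau>.\<close>

definition etad :: "real \<Rightarrow> real \<Rightarrow> real" where
  "etad h \<tau> = - 2 * \<tau> / h\<^sup>2 * gs (\<tau> / h)"

lemma gs_scaled_deriv: "((\<lambda>\<tau>. gs (\<tau> / h)) has_derivative (\<lambda>v. etad h \<tau> * v)) (at (\<tau>::real))"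
proof -
  have "((\<lambda>\<tau>. \<tau> / h) has_derivative (\<lambda>v. v / h)) (at \<tau>)"
    by (cases "h = 0") (auto intro!: derivative_eq_intros)
  from has_derivative_compose[OF this gs_has_derivative]
  show ?thesis by (rule has_derivative_eq_rhs) (simp add: etad_def fun_eq_iff power2_eq_square)
qed

lemma Ck_on_gs_scaled:
  fixes f :: "'a::euclidean_space \<Rightarrow> real"
  assumes "Ck_on k UNIV f"
  shows "Ck_on k UNIV (\<lambda>x. gs (f x / h))"
  unfolding divide_inverse by (intro Ck_on_gs Ck_on_mult Ck_on_const assms)

lemma Ck_on_fst_snd: "Ck_on k UNIV (fst :: R4 \<Rightarrow> R3)" "Ck_on k UNIV (snd :: R4 \<Rightarrow> real)"
  by (intro Ck_on_linear bounded_linear_fst bounded_linear_snd)+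

lemma test_function_square: "test_function U lam \<Longrightarrow> test_function U (\<lambda>z. (lam z)\<^sup>2)"
  for lam :: "'a::euclidean_space \<Rightarrow> real"
  using test_function_scaleR[of U lam lam] by (simp add: test_function_def power2_eq_square)

definition mtest :: "real \<Rightarrow> real \<Rightarrow> real \<Rightarrow> (R4 \<Rightarrow> real) \<Rightarrow> R4 \<Rightarrow> R4 \<Rightarrow> R3" where
  "mtest \<mu> d h W z' z = W z *\<^sub>R (gs ((snd z - snd z') / h) *\<^sub>R Kd \<mu> d (fst z - fst z'))"

text \<open>The velocity at \<open>z\<close> enters as a constant vector \<open>c\<close>, so this
  is a smooth function of \<open>z'\<close> although \<open>u\<close> is not smooth.\<close>

definition ctest :: "real \<Rightarrow> real \<Rightarrow> real \<Rightarrow> (R4 \<Rightarrow> real) \<Rightarrow> R3 \<Rightarrow> R4 \<Rightarrow> R4 \<Rightarrow> real" where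
  "ctest \<mu> d h W c z z' = W z' * (gs ((snd z - snd z') / h) * (c \<bullet> Kd \<mu> d (fst z - fst z')))"

context
  fixes W :: "R4 \<Rightarrow> real" and U :: "R4 set" and d :: real
  assumes W: "test_function U W" and d: "d > 0"
begin

lemma mtest_test: "test_function U (mtest \<mu> d h W z')"
  unfolding mtest_def smooth_on_def[abs_def]
  by (intro test_function_scaleR W) (auto simp: smooth_on_def intro!: Ck_on_scaleR Ck_on_gs_scaled Ck_on_Kd Ck_on_diff Ck_on_fst_snd Ck_on_const d)

lemma ctest_test: "test_function U (ctest \<mu> d h W c z)"
proof -
  have "smooth_on UNIV (\<lambda>z'. gs ((snd z - snd z') / h) * (c \<bullet> Kd \<mu> d (fst z - fst z')))"
    unfolding smooth_on_def
    by (auto intro!: Ck_on_mult Ck_on_inner Ck_on_gs_scaled Ck_on_Kd Ck_on_diff Ck_on_fst_snd Ck_on_const d)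
  from test_function_scaleR[OF W this] show ?thesis unfolding ctest_def[abs_def] by simp
qed

lemma mtest_deriv:
  "frechet_derivative (mtest \<mu> d h W z') (at z) v =
     W z *\<^sub>R (gs ((snd z - snd z') / h) *\<^sub>R (ker \<mu> (d\<^sup>2 + (fst z - fst z') \<bullet> (fst z - fst z')) *\<^sub>R fst v
        + (2 * dker \<mu> (d\<^sup>2 + (fst z - fst z') \<bullet> (fst z - fst z')) * ((fst z - fst z') \<bullet> fst v)) *\<^sub>R (fst z - fst z'))
        + (etad h (snd z - snd z') * snd v) *\<^sub>R Kd \<mu> d (fst z - fst z'))
      + frechet_derivative W (at z) v *\<^sub>R (gs ((snd z - snd z') / h) *\<^sub>R Kd \<mu> d (fst z - fst z'))"
proof -
  have 1: "((\<lambda>z. gs ((snd z - snd z') / h)) has_derivative (\<lambda>v. etad h (snd z - snd z') * snd v)) (at z)"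
    by (rule has_derivative_compose[OF _ gs_scaled_deriv]) (auto intro!: derivative_eq_intros)
  have 2: "((\<lambda>z. Kd \<mu> d (fst z - fst z')) has_derivative (\<lambda>v. ker \<mu> (d\<^sup>2 + (fst z - fst z') \<bullet> (fst z - fst z')) *\<^sub>R fst v
        + (2 * dker \<mu> (d\<^sup>2 + (fst z - fst z') \<bullet> (fst z - fst z')) * ((fst z - fst z') \<bullet> fst v)) *\<^sub>R (fst z - fst z'))) (at z)"
    by (rule has_derivative_compose[OF _ Kd_has_derivative[OF d]]) (auto intro!: derivative_eq_intros)
  show ?thesis unfolding mtest_def[abs_def]
    by (subst frechet_derivative_at[OF has_derivative_scaleR[OF test_function_deriv(1)[OF W] has_derivative_scaleR[OF 1 2]], symmetric]) simp
qed

lemma ctest_deriv: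
  "frechet_derivative (ctest \<mu> d h W c z) (at z') v =
     W z' * (gs ((snd z - snd z') / h) * (c \<bullet> - (ker \<mu> (d\<^sup>2 + (fst z - fst z') \<bullet> (fst z - fst z')) *\<^sub>R fst v
        + (2 * dker \<mu> (d\<^sup>2 + (fst z - fst z') \<bullet> (fst z - fst z')) * ((fst z - fst z') \<bullet> fst v)) *\<^sub>R (fst z - fst z')))
        - (etad h (snd z - snd z') * snd v) * (c \<bullet> Kd \<mu> d (fst z - fst z')))
      + frechet_derivative W (at z') v * (gs ((snd z - snd z') / h) * (c \<bullet> Kd \<mu> d (fst z - fst z')))"
proof -
  have 1: "((\<lambda>z'. gs ((snd z - snd z') / h)) has_derivative (\<lambda>v. - (etad h (snd z - snd z') * snd v))) (at z')"
  proof -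
    have "((\<lambda>z'. snd z - snd z') has_derivative (\<lambda>v. - snd v)) (at z')" by (auto intro!: derivative_eq_intros)
    from has_derivative_compose[OF this gs_scaled_deriv] show ?thesis by simp
  qed
  have 2: "((\<lambda>z'. c \<bullet> Kd \<mu> d (fst z - fst z')) has_derivative (\<lambda>v. c \<bullet> - (ker \<mu> (d\<^sup>2 + (fst z - fst z') \<bullet> (fst z - fst z')) *\<^sub>R fst v
        + (2 * dker \<mu> (d\<^sup>2 + (fst z - fst z') \<bullet> (fst z - fst z')) * ((fst z - fst z') \<bullet> fst v)) *\<^sub>R (fst z - fst z')))) (at z')"
  proof -
    have "((\<lambda>z'. fst z - fst z') has_derivative (\<lambda>v. - fst v)) (at z')" by (auto intro!: derivative_eq_intros)
    from has_derivative_inner_right[OF has_derivative_compose[OF this Kd_has_derivative[OF d]], of c]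
    show ?thesis by (rule has_derivative_eq_rhs) (simp add: fun_eq_iff inner_add_right inner_diff_right)
  qed
  show ?thesis unfolding ctest_def[abs_def]
    by (subst frechet_derivative_at[OF has_derivative_mult[OF test_function_deriv(1)[OF W] has_derivative_mult[OF 1 2]], symmetric]) simp
qed

lemma mtest_dt:
  "dt (mtest \<mu> d h W z') z = (dt W z * gs ((snd z - snd z') / h) + W z * etad h (snd z - snd z')) *\<^sub>R Kd \<mu> d (fst z - fst z')"
  unfolding dt_def mtest_deriv by (simp add: algebra_simps)

lemma mtest_Grad:
  "Grad_x (mtest \<mu> d h W z') z = gs ((snd z - snd z') / h) *\<^sub>R (tensor (Kd \<mu> d (fst z - fst z')) (grad_x W z)
     + W z *\<^sub>R Kmat \<mu> (d\<^sup>2 + (fst z - fst z') \<bullet> (fst z - fst z')) (fst z - fst z'))"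
proof -
  define w where "w = fst z - fst z'"
  define q where "q = d\<^sup>2 + w \<bullet> w"
  define e where "e = gs ((snd z - snd z') / h)"
  have ax: "axis j (1::real) $ i = (if i = j then 1 else 0)" for i j :: 3 by (simp add: axis_def)
  show ?thesis
    unfolding Grad_x_def mtest_deriv w_def[symmetric] q_def[symmetric] e_def[symmetric]
    by (simp add: vec_eq_iff tensor_def grad_x_def Kmat_def mat_def inner_axis ax algebra_simps)
qed

lemma ctest_dt:
  "dt (ctest \<mu> d h W c z) z' = (dt W z' * gs ((snd z - snd z') / h) - W z' * etad h (snd z - snd z')) * (c \<bullet> Kd \<mu> d (fst z - fst z'))"
  unfolding dt_def ctest_deriv by (simp add: algebra_simps)

lemma ctest_grad:
  "v \<bullet> grad_x (ctest \<mu> d h W c z) z' = gs ((snd z - snd z') / h) * ((v \<bullet> grad_x W z') * (c \<bullet> Kd \<mu> d (fst z - fst z'))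
     - W z' * (Kmat \<mu> (d\<^sup>2 + (fst z - fst z') \<bullet> (fst z - fst z')) (fst z - fst z') \<bullet> tensor c v))"
proof -
  define w where "w = fst z - fst z'"
  define q where "q = d\<^sup>2 + w \<bullet> w"
  define e where "e = gs ((snd z - snd z') / h)"
  have g: "grad_x (ctest \<mu> d h W c z) z' = (e * (c \<bullet> Kd \<mu> d w)) *\<^sub>R grad_x W z'
      - (W z' * e) *\<^sub>R (ker \<mu> q *\<^sub>R c + (2 * dker \<mu> q * (c \<bullet> w)) *\<^sub>R w)"
    unfolding grad_x_def ctest_deriv w_def[symmetric] q_def[symmetric] e_def[symmetric]
    by (simp add: vec_eq_iff inner_axis inner_add_right algebra_simps)
  show ?thesis unfolding g w_def[symmetric] q_def[symmetric] e_def[symmetric] Kmat_inner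
    by (simp add: inner_diff_right inner_add_right inner_commute algebra_simps)
qed

end

section \<open>Quantities controlled by the energy\<close>

lemma nn_integral_R4:
  assumes [measurable]: "f \<in> borel_measurable (borel :: R4 measure)"
  shows "(\<integral>\<^sup>+z. f z \<partial>lborel) = (\<integral>\<^sup>+t. \<integral>\<^sup>+x. f (x, t) \<partial>lborel \<partial>lborel)"
    and "(\<integral>\<^sup>+z. f z \<partial>lborel) = (\<integral>\<^sup>+x. \<integral>\<^sup>+t. f (x, t) \<partial>lborel \<partial>lborel)"
proof -
  have [measurable]: "f \<in> borel_measurable (lborel \<Otimes>\<^sub>M lborel)" by (simp add: lborel_prod)
  have "(\<integral>\<^sup>+z. f z \<partial>lborel) = (\<integral>\<^sup>+z. f z \<partial>(lborel \<Otimes>\<^sub>M lborel))" by (simp add: lborel_prod)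
  also have "\<dots> = (\<integral>\<^sup>+x. \<integral>\<^sup>+t. f (x, t) \<partial>lborel \<partial>lborel)" by (rule lborel.nn_integral_fst[symmetric]) measurable
  finally show *: "(\<integral>\<^sup>+z. f z \<partial>lborel) = (\<integral>\<^sup>+x. \<integral>\<^sup>+t. f (x, t) \<partial>lborel \<partial>lborel)" .
  show "(\<integral>\<^sup>+z. f z \<partial>lborel) = (\<integral>\<^sup>+t. \<integral>\<^sup>+x. f (x, t) \<partial>lborel \<partial>lborel)"
    unfolding * by (rule lborel_pair.Fubini[symmetric]) measurable
qed

text \<open>Gives integrability over pairs of points, and thereby Fubini, from a majorant that is a
  product of integrable functions.\<close>

lemma integrable_product_bound:
  fixes F :: "'a::euclidean_space \<times> 'b::euclidean_space \<Rightarrow> real"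
  assumes f: "integrable lborel f" "\<And>x. f x \<ge> 0" and g: "integrable lborel g" "\<And>y. g y \<ge> 0"
    and F: "F \<in> borel_measurable (lborel \<Otimes>\<^sub>M lborel)" and le: "\<And>x y. \<bar>F (x, y)\<bar> \<le> C * (f x * g y)"
  shows "integrable (lborel \<Otimes>\<^sub>M lborel) F"
proof (rule integrableI_bounded[OF F])
  have [measurable]: "f \<in> borel_measurable borel" "g \<in> borel_measurable borel" using f g by auto
  have [measurable]: "F \<in> borel_measurable (borel \<Otimes>\<^sub>M borel)" using F by simp
  have "(\<integral>\<^sup>+p. ennreal (norm (F p)) \<partial>(lborel \<Otimes>\<^sub>M lborel)) = (\<integral>\<^sup>+x. \<integral>\<^sup>+y. ennreal (norm (F (x, y))) \<partial>lborel \<partial>lborel)"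
    by (intro lborel.nn_integral_fst[symmetric]) measurable
  also have "\<dots> \<le> (\<integral>\<^sup>+x. \<integral>\<^sup>+y. (ennreal \<bar>C\<bar> * ennreal (f x)) * ennreal (g y) \<partial>lborel \<partial>lborel)"
  proof (intro nn_integral_mono)
    fix x y
    have "norm (F (x, y)) \<le> \<bar>C\<bar> * f x * g y"
      using le[of x y] mult_right_mono[OF abs_ge_self[of C] mult_nonneg_nonneg[OF f(2)[of x] g(2)[of y]]]
      by (simp add: mult.assoc)
    then have "ennreal (norm (F (x, y))) \<le> ennreal (\<bar>C\<bar> * f x * g y)" by (rule ennreal_leI)
    also have "\<dots> = (ennreal \<bar>C\<bar> * ennreal (f x)) * ennreal (g y)"
      using f g by (simp add: ennreal_mult)
    finally show "ennreal (norm (F (x, y))) \<le> (ennreal \<bar>C\<bar> * ennreal (f x)) * ennreal (g y)" .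
  qed
  also have "\<dots> = (\<integral>\<^sup>+x. (ennreal \<bar>C\<bar> * ennreal (f x)) * (\<integral>\<^sup>+y. ennreal (g y) \<partial>lborel) \<partial>lborel)"
    by (intro nn_integral_cong nn_integral_cmult) measurable
  also have "\<dots> = (\<integral>\<^sup>+x. ennreal \<bar>C\<bar> * ennreal (f x) \<partial>lborel) * (\<integral>\<^sup>+y. ennreal (g y) \<partial>lborel)"
    by (rule nn_integral_multc) measurable
  also have "\<dots> = ennreal \<bar>C\<bar> * ennreal (integral\<^sup>L lborel f) * ennreal (integral\<^sup>L lborel g)"
    using f g by (subst nn_integral_cmult) (auto simp: nn_integral_eq_integral)
  also have "\<dots> < \<infinity>" by (simp add: ennreal_mult_less_top)
  finally show "(\<integral>\<^sup>+p. ennreal (norm (F p)) \<partial>(lborel \<Otimes>\<^sub>M lborel)) < \<infinity>" .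
qed

lemma tensor_measurable [measurable]:
  assumes [measurable]: "f \<in> borel_measurable M" "g \<in> borel_measurable M"
  shows "(\<lambda>x. tensor (f x) (g x)) \<in> borel_measurable M"
proof -
  have "continuous_on UNIV (\<lambda>p :: R3 \<times> R3. tensor (fst p) (snd p))"
    unfolding tensor_def by (intro continuous_intros continuous_on_vec_lambda continuous_on_component)
  then have "(\<lambda>p :: R3 \<times> R3. tensor (fst p) (snd p)) \<in> borel_measurable borel"
    by (rule borel_measurable_continuous_onI)
  from measurable_compose[OF borel_measurable_Pair[OF assms] this] show ?thesis by simp
qed

lemma lgw_measurable [measurable]: "lgw \<in> borel_measurable borel"
  unfolding lgw_def[abs_def] by measurable

lemma ker_measurable [measurable]: "ker b \<in> borel_measurable borel"
  unfolding ker_def[abs_def] by measurable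

lemma dker_measurable [measurable]: "dker b \<in> borel_measurable borel"
  unfolding dker_def[abs_def] by measurable

lemma cubker_measurable [measurable]: "cubker b \<in> borel_measurable borel"
  unfolding cubker_def[abs_def] by measurable

lemma Kd_measurable [measurable]: "Kd \<mu> d \<in> borel_measurable borel"
  unfolding Kd_def[abs_def] Kvec_def by measurable

lemma etad_measurable [measurable]: "etad h \<in> borel_measurable borel"
  unfolding etad_def[abs_def] by measurable

lemma Kmat_measurable [measurable]:
  assumes [measurable]: "f \<in> borel_measurable M" "g \<in> borel_measurable M"
  shows "(\<lambda>x. Kmat \<mu> (f x) (g x)) \<in> borel_measurable M"
  unfolding Kmat_def by measurable

text \<open>A solution reduced to the properties that the estimate uses. All data are Borel on the
  whole space-time, \<open>\<rho>\<close>, \<open>p\<close>, \<open>u\<close> and \<open>G\<close>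
  vanish off the cylinder, and the bounds on \<open>\<rho>\<close>, \<open>f\<close> and
  \<open>S\<close> hold everywhere. The pressure \<open>p\<close> is an independent function, so
  \<open>m\<close> and \<open>\<epsilon>\<close> no longer occur.\<close>

locale weak_flow =
  fixes \<Omega> :: "R3 set" and T E F s1 :: real and lam :: "R4 \<Rightarrow> real"
    and \<rho> p :: "R4 \<Rightarrow> real" and u f :: "R4 \<Rightarrow> R3" and S G :: "R4 \<Rightarrow> real^3^3"
  assumes \<Omega>: "open \<Omega>" "bounded \<Omega>" and T: "T > 0" and E: "E \<ge> 0" and s1: "s1 \<ge> 0"
    and lam: "test_function (cylinder \<Omega> T) lam"
    and m [measurable]: "\<rho> \<in> borel_measurable borel" "p \<in> borel_measurable borel" "u \<in> borel_measurable borel"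
      "f \<in> borel_measurable borel" "S \<in> borel_measurable borel" "G \<in> borel_measurable borel"
    and off: "\<And>z. z \<notin> cylinder \<Omega> T \<Longrightarrow> \<rho> z = 0 \<and> p z = 0 \<and> u z = 0 \<and> G z = 0"
    and rho: "\<And>z. \<rho> z \<ge> 0" "\<And>z. \<rho> z powr (3/2) \<le> p z"
    and f: "\<And>z. norm (f z) \<le> F" and S: "\<And>z. norm (S z) \<le> s1 * norm (G z)"
    and pE: "AE t in lborel. (\<integral>\<^sup>+x. ennreal (p (x, t)) \<partial>lborel) \<le> ennreal E"
    and kE: "AE t in lborel. (\<integral>\<^sup>+x. ennreal (\<rho> (x, t) * (norm (u (x, t)))\<^sup>2) \<partial>lborel) \<le> ennreal E"
    and wE: "(\<integral>\<^sup>+z. ennreal ((norm (u z))\<^sup>2 + (norm (G z))\<^sup>2) \<partial>lborel) \<le> ennreal (E\<^sup>2)"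
    and weak: "AE t in lborel. t \<in> {0<..<T} \<longrightarrow> (\<forall>\<psi> i j. test_function \<Omega> \<psi> \<longrightarrow>
        (\<integral>x. indicator \<Omega> x * (u (x, t) $ i * frechet_derivative \<psi> (at x) (axis j 1)) \<partial>lborel)
        = - (\<integral>x. indicator \<Omega> x * (G (x, t) $ i $ j * \<psi> x) \<partial>lborel))"
    and momentum: "\<And>\<xi>. test_function (cylinder \<Omega> T) \<xi> \<Longrightarrow>
        (\<integral>z. \<rho> z * (u z \<bullet> dt \<xi> z) \<partial>lborel)
      + (\<integral>z. (\<rho> z *\<^sub>R tensor (u z) (u z) + p z *\<^sub>R mat 1 - S z) \<bullet> Grad_x \<xi> z \<partial>lborel)
      + (\<integral>z. \<rho> z * (f z \<bullet> \<xi> z) \<partial>lborel) = 0"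
    and continuity: "\<And>\<psi>. test_function (cylinder \<Omega> T) \<psi> \<Longrightarrow>
        (\<integral>z. \<rho> z * dt \<psi> z + \<rho> z * (u z \<bullet> grad_x \<psi> z) \<partial>lborel) = 0"
begin

definition Q where "Q = cylinder \<Omega> T"

lemma Q_borel [measurable]: "Q \<in> sets borel"
  unfolding Q_def using \<Omega> by (intro borel_open open_Times) auto

lemma off_Q: "z \<notin> Q \<Longrightarrow> \<rho> z = 0 \<and> p z = 0 \<and> u z = 0 \<and> G z = 0"
  using off unfolding Q_def by blast

lemma p_nonneg: "p z \<ge> 0"
  using rho(2)[of z] by (meson order_trans powr_ge_zero)

definition vol where "vol = measure lborel \<Omega>"

lemma vol: "emeasure lborel \<Omega> = ennreal vol" "vol \<ge> 0"
  unfolding vol_def using emeasure_bounded_finite[OF \<Omega>(2)] by (auto simp: emeasure_eq_ennreal_measure)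

text \<open>The energy density. The summand 1 lets it dominate the lower powers
  \<open>\<rho>\<close>, \<open>\<rho> * norm u\<close> and \<open>norm G\<close> as well.\<close>

definition en :: "R4 \<Rightarrow> real" where
  "en z = indicator Q z * (1 + p z + \<rho> z * (norm (u z))\<^sup>2 + (norm (u z))\<^sup>2 + (norm (G z))\<^sup>2)"

lemma en_measurable [measurable]: "en \<in> borel_measurable borel"
  unfolding en_def[abs_def] by measurable

lemma en_nonneg: "en z \<ge> 0"
  unfolding en_def using p_nonneg[of z] rho(1)[of z] by simp

lemma nn_slice_bound:
  assumes [measurable]: "g \<in> borel_measurable borel" and "\<And>z. z \<notin> Q \<Longrightarrow> g z = 0"
    and "AE t in lborel. (\<integral>\<^sup>+x. g (x, t) \<partial>lborel) \<le> B"
  shows "(\<integral>\<^sup>+z. g z \<partial>lborel) \<le> B * ennreal T"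
proof -
  have "(\<integral>\<^sup>+z. g z \<partial>lborel) = (\<integral>\<^sup>+t. \<integral>\<^sup>+x. g (x, t) \<partial>lborel \<partial>lborel)" by (rule nn_integral_R4) measurable
  also have "\<dots> \<le> (\<integral>\<^sup>+t. B * indicator {0<..<T} t \<partial>lborel)"
    using assms(3)
  proof (intro nn_integral_mono_AE, eventually_elim)
    case (elim t)
    show ?case
    proof (cases "t \<in> {0<..<T}")
      case False
      then have "g (x, t) = 0" for x by (intro assms(2)) (auto simp: Q_def)
      then show ?thesis by simp
    qed (use elim in simp)
  qed
  also have "\<dots> = B * ennreal T" using T by (subst nn_integral_cmult_indicator) auto
  finally show ?thesis .
qed

lemma slice_vol: "(\<integral>\<^sup>+x. indicator Q (x, t) \<partial>lborel) \<le> ennreal vol"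
proof -
  have "(\<integral>\<^sup>+x. indicator Q (x, t) \<partial>lborel) \<le> (\<integral>\<^sup>+x. indicator \<Omega> x \<partial>lborel)"
    by (intro nn_integral_mono) (auto simp: indicator_def Q_def)
  also have "\<dots> = ennreal vol" using \<Omega> by (simp add: vol)
  finally show ?thesis .
qed

lemma en_integral: "(\<integral>\<^sup>+z. ennreal (en z) \<partial>lborel) \<le> ennreal (vol * T + E * T + E * T + E\<^sup>2)"
proof -
  have "(\<integral>\<^sup>+z. ennreal (en z) \<partial>lborel) \<le> (\<integral>\<^sup>+z. (indicator Q z + ennreal (p z)) + (ennreal (\<rho> z * (norm (u z))\<^sup>2) + ennreal ((norm (u z))\<^sup>2 + (norm (G z))\<^sup>2)) \<partial>lborel)"
  proof (intro nn_integral_mono)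
    fix z :: R4
    have "en z \<le> indicator Q z + p z + (\<rho> z * (norm (u z))\<^sup>2 + ((norm (u z))\<^sup>2 + (norm (G z))\<^sup>2))"
      unfolding en_def using p_nonneg[of z] rho(1)[of z] by (simp add: indicator_def)
    then have "ennreal (en z) \<le> ennreal (indicator Q z + p z + (\<rho> z * (norm (u z))\<^sup>2 + ((norm (u z))\<^sup>2 + (norm (G z))\<^sup>2)))"
      by (rule ennreal_leI)
    also have "\<dots> = (indicator Q z + ennreal (p z)) + (ennreal (\<rho> z * (norm (u z))\<^sup>2) + ennreal ((norm (u z))\<^sup>2 + (norm (G z))\<^sup>2))"
      using p_nonneg[of z] rho(1)[of z] by (simp add: ennreal_plus[symmetric] ennreal_indicator[symmetric] del: ennreal_plus)
    finally show "ennreal (en z) \<le> (indicator Q z + ennreal (p z)) + (ennreal (\<rho> z * (norm (u z))\<^sup>2) + ennreal ((norm (u z))\<^sup>2 + (norm (G z))\<^sup>2))" .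
  qed
  also have "\<dots> = (\<integral>\<^sup>+z. indicator Q z \<partial>lborel) + (\<integral>\<^sup>+z. ennreal (p z) \<partial>lborel)
      + ((\<integral>\<^sup>+z. ennreal (\<rho> z * (norm (u z))\<^sup>2) \<partial>lborel) + (\<integral>\<^sup>+z. ennreal ((norm (u z))\<^sup>2 + (norm (G z))\<^sup>2) \<partial>lborel))"
    by (subst nn_integral_add, measurable)+
  also have "\<dots> \<le> ennreal vol * ennreal T + ennreal E * ennreal T + (ennreal E * ennreal T + ennreal (E\<^sup>2))"
    by (intro add_mono nn_slice_bound wE) (auto simp: off_Q slice_vol intro: pE kE)
  also have "\<dots> = ennreal (vol * T + E * T + E * T + E\<^sup>2)"
  proof -
    have "ennreal a + ennreal b + (ennreal b + ennreal c) = ennreal (a + b + b + c)"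
      if "a \<ge> 0" "b \<ge> 0" "c \<ge> 0" for a b c
      using that by (simp only: ennreal_plus[symmetric] add_nonneg_nonneg add.assoc)
    then show ?thesis using vol(2) T E by (simp add: ennreal_mult[symmetric])
  qed
  finally show ?thesis .
qed

lemma en_integrable: "integrable lborel en"
proof (rule integrableI_nonneg)
  show "(\<integral>\<^sup>+z. ennreal (en z) \<partial>lborel) < \<infinity>" by (rule le_less_trans[OF en_integral]) simp
qed (auto simp: en_nonneg)

lemma en_dominates: "p z \<le> en z" "\<rho> z \<le> en z" "\<rho> z * norm (u z) \<le> en z" "\<rho> z * (norm (u z))\<^sup>2 \<le> en z" "norm (G z) \<le> en z"
proof -
  have "p z \<le> en z \<and> \<rho> z \<le> en z \<and> \<rho> z * norm (u z) \<le> en z \<and> \<rho> z * (norm (u z))\<^sup>2 \<le> en z \<and> norm (G z) \<le> en z"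
  proof (cases "z \<in> Q")
    case False
    then show ?thesis using off_Q[OF False] by (simp add: en_def)
  next
    case True
    define U where "U = norm (u z)"
    define g where "g = norm (G z)"
    have e: "en z = 1 + p z + \<rho> z * U\<^sup>2 + U\<^sup>2 + g\<^sup>2" using True by (simp add: en_def U_def g_def)
    have sq: "t \<le> 1 + t\<^sup>2" for t :: real using zero_le_power2[of "t - 1/2"] unfolding power2_diff by (simp add: power2_eq_square)
    have r: "\<rho> z \<le> 1 + p z" using le_one_plus_powr[OF rho(1)[of z]] rho(2)[of z] by linarith
    have rU: "\<rho> z * U\<^sup>2 \<ge> 0" using rho(1)[of z] by simp
    have "\<rho> z * U \<le> \<rho> z * (1 + U\<^sup>2)" using sq[of U] rho(1)[of z] by (intro mult_left_mono) auto
    then have "\<rho> z * U \<le> \<rho> z + \<rho> z * U\<^sup>2" by (simp add: algebra_simps)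
    then show ?thesis unfolding e U_def[symmetric] g_def[symmetric]
      using r rU p_nonneg[of z] sq[of g] zero_le_power2[of U] zero_le_power2[of g] by (intro conjI) linarith+
  qed
  then show "p z \<le> en z" "\<rho> z \<le> en z" "\<rho> z * norm (u z) \<le> en z" "\<rho> z * (norm (u z))\<^sup>2 \<le> en z" "norm (G z) \<le> en z"
    by auto
qed

end

section \<open>Time slices and the critical quantity\<close>

lemma Ck_on_compose_affine:
  fixes f :: "'b::euclidean_space \<Rightarrow> 'c::real_normed_vector" and a :: "'a::euclidean_space \<Rightarrow> 'b"
  assumes a: "\<And>x. (a has_derivative A) (at x)" and "Ck_on k UNIV f"
  shows "Ck_on k UNIV (\<lambda>x. f (a x))"
  using assms(2)
proof (induction k arbitrary: f)
  case 0
  have "continuous_on UNIV a" using a has_derivative_continuous continuous_at_imp_continuous_on by blast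
  with 0 show ?case by (auto intro: continuous_on_compose2)
next
  case (Suc k)
  show ?case
    by (rule Ck_on_SucI[OF has_derivative_compose[OF a Ck_on_Suc_deriv(1)[OF Suc.prems]]])
       (rule Suc.IH[OF Ck_on_Suc_deriv(2)[OF Suc.prems]])
qed

lemma slice_test_function:
  assumes lam: "test_function (cylinder \<Omega> T) lam"
  shows "test_function \<Omega> (\<lambda>x. lam (x, t))"
    and "frechet_derivative (\<lambda>x. lam (x, t)) (at x) v = frechet_derivative lam (at (x, t)) (v, 0)"
proof -
  have a: "((\<lambda>x. (x, t)) has_derivative (\<lambda>v. (v, 0))) (at x)" for x :: R3
    by (auto intro!: derivative_eq_intros)
  show "frechet_derivative (\<lambda>x. lam (x, t)) (at x) v = frechet_derivative lam (at (x, t)) (v, 0)"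
    by (subst frechet_derivative_at[OF has_derivative_compose[OF a test_function_deriv(1)[OF lam]], symmetric]) simp
  \<comment> \<open>The slice of the compact support: it is closed, lies in the compact projection
    of the support, and contains the support of the sliced function.\<close>
  define C where "C = (\<lambda>x. (x, t)) -` support lam"
  have cl: "closed C" unfolding C_def support_def by (intro closed_vimage continuous_intros closed_closure)
  have "compact (fst ` support lam)"
    using lam by (intro compact_continuous_image continuous_intros) (auto simp: test_function_def)
  moreover have "C \<subseteq> fst ` support lam" unfolding C_def by force
  ultimately have cp: "compact C"
    using cl by (metis compact_Int_closed inf.absorb_iff2)
  have "support (\<lambda>x. lam (x, t)) \<subseteq> C"
    unfolding support_def
  proof (rule closure_minimal[OF _ cl])
    show "{x. lam (x, t) \<noteq> 0} \<subseteq> C" unfolding C_def support_def using closure_subset by fastforce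
  qed
  moreover have "C \<subseteq> \<Omega>" unfolding C_def using lam by (auto simp: test_function_def)
  moreover have "closed (support (\<lambda>x. lam (x, t)))" unfolding support_def by simp
  ultimately have "compact (support (\<lambda>x. lam (x, t)))" "support (\<lambda>x. lam (x, t)) \<subseteq> \<Omega>"
    using cp by (metis compact_Int_closed inf.absorb_iff2, blast)
  moreover have "Ck_on k UNIV (\<lambda>x. lam (x, t))" for k
    by (rule Ck_on_compose_affine[OF a test_function_Ck[OF lam]])
  ultimately show "test_function \<Omega> (\<lambda>x. lam (x, t))" by (simp add: test_function_def smooth_on_def)
qed

lemma nn_integral_linear_combination:
  assumes [measurable]: "f \<in> borel_measurable M" "g \<in> borel_measurable M"
  shows "(\<integral>\<^sup>+x. a * f x + b * g x \<partial>M) = a * (\<integral>\<^sup>+x. f x \<partial>M) + b * (\<integral>\<^sup>+x. g x \<partial>M)"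
proof -
  have "(\<integral>\<^sup>+x. a * f x + b * g x \<partial>M) = (\<integral>\<^sup>+x. a * f x \<partial>M) + (\<integral>\<^sup>+x. b * g x \<partial>M)"
    by (rule nn_integral_add) measurable
  then show ?thesis by (simp add: nn_integral_cmult)
qed

context weak_flow
begin

text \<open>The kinetic energy \<open>\<rho> |u|\<^sup>2\<close> is bounded in time with values in
  L^1, and |lam u|^2 is integrable in time with values in L^3 by the Sobolev inequality; the powers
  2/3 and 1 are those for which the product is integrable.\<close>

definition crit :: "R4 \<Rightarrow> real" where
  "crit z = (\<rho> z * (norm (u z))\<^sup>2) powr (2/3) * (norm (lam z *\<^sub>R u z))\<^sup>2"

lemma lam_measurable [measurable]: "lam \<in> borel_measurable borel"
  by (intro borel_measurable_continuous_onI test_function_continuous[OF lam])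

lemma crit_measurable [measurable]: "crit \<in> borel_measurable borel"
  unfolding crit_def[abs_def] by measurable

lemma crit_nonneg: "crit z \<ge> 0"
  unfolding crit_def by simp

lemma crit_off: "z \<notin> Q \<Longrightarrow> crit z = 0"
  using off_Q[of z] by (simp add: crit_def)

lemma slice_measurable:
  "g \<in> borel_measurable borel \<Longrightarrow> (\<lambda>x. g (x, t)) \<in> borel_measurable (borel :: R3 measure)"
  for g :: "R4 \<Rightarrow> 'c::topological_space"
  by (rule measurable_compose[of _ _ borel]) (auto intro!: borel_measurable_continuous_onI continuous_intros)

text \<open>Weighting Young's inequality with \<open>1 + \<parallel>u(t)\<parallel>\<^sup>2\<close> in \<open>W\<^sup>1\<^sup>,\<^sup>2\<close> makes both resulting terms linear in
  that quantity, hence integrable in time.\<close>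

lemma crit_slice:
  assumes Lam: "\<And>z. \<bar>lam z\<bar> \<le> \<Lambda>" "\<And>z j. \<bar>frechet_derivative lam (at z) (axis j 1, 0)\<bar> \<le> \<Lambda>"
    and t: "t \<in> {0<..<T}"
    and J: "(\<integral>\<^sup>+x. ennreal ((norm (u (x, t)))\<^sup>2 + (norm (G (x, t)))\<^sup>2) \<partial>lborel) = ennreal J" "J \<ge> 0"
    and k: "(\<integral>\<^sup>+x. ennreal (\<rho> (x, t) * (norm (u (x, t)))\<^sup>2) \<partial>lborel) \<le> ennreal E"
    and w: "\<And>\<psi> i j. test_function \<Omega> \<psi> \<Longrightarrow>
        (\<integral>x. indicator \<Omega> x * (u (x, t) $ i * frechet_derivative \<psi> (at x) (axis j 1)) \<partial>lborel)
        = - (\<integral>x. indicator \<Omega> x * (G (x, t) $ i $ j * \<psi> x) \<partial>lborel)"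
  shows "(\<integral>\<^sup>+x. ennreal (crit (x, t)) \<partial>lborel) \<le> ennreal ((1 + J) * (E + 884736 * \<Lambda>^6))"
proof -
  have Lam0: "\<Lambda> \<ge> 0" using Lam(1)[of undefined] by linarith
  have [measurable]: "(\<lambda>x. u (x, t)) \<in> borel_measurable borel" "(\<lambda>x. \<rho> (x, t)) \<in> borel_measurable borel"
    "(\<lambda>x. G (x, t)) \<in> borel_measurable borel" "(\<lambda>x. lam (x, t)) \<in> borel_measurable borel"
    by (auto intro!: slice_measurable m lam_measurable)
  have S6: "(\<integral>\<^sup>+x. ennreal (norm (lam (x, t) *\<^sub>R u (x, t)) ^ 6) \<partial>lborel) \<le> ennreal (884736 * \<Lambda>^6 * J^3)"
  proof (rule Sobolev_local[OF \<Omega> slice_test_function(1)[OF lam]])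
    show "\<bar>lam (x, t)\<bar> \<le> \<Lambda>" for x by (rule Lam)
    show "\<bar>frechet_derivative (\<lambda>x. lam (x, t)) (at x) (axis j 1)\<bar> \<le> \<Lambda>" for x j
      unfolding slice_test_function(2)[OF lam] by (rule Lam)
    have "(\<integral>\<^sup>+x. ennreal ((norm (u (x, t)))\<^sup>2 + (norm (G (x, t)))\<^sup>2) * indicator \<Omega> x \<partial>lborel)
        \<le> (\<integral>\<^sup>+x. ennreal ((norm (u (x, t)))\<^sup>2 + (norm (G (x, t)))\<^sup>2) \<partial>lborel)"
      by (intro nn_integral_mono) (simp add: indicator_def)
    then show "(\<integral>\<^sup>+x. ennreal ((norm (u (x, t)))\<^sup>2 + (norm (G (x, t)))\<^sup>2) * indicator \<Omega> x \<partial>lborel) \<le> ennreal J"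
      using J by simp
  qed (use J w in auto)
  define \<alpha> where "\<alpha> = 1 + J"
  have al: "\<alpha> > 0" unfolding \<alpha>_def using J by simp
  have pw: "crit (x, t) \<le> \<alpha> * (\<rho> (x, t) * (norm (u (x, t)))\<^sup>2) + 1 / \<alpha>\<^sup>2 * norm (lam (x, t) *\<^sub>R u (x, t)) ^ 6" for x
  proof -
    define X where "X = \<rho> (x, t) * (norm (u (x, t)))\<^sup>2"
    define Y where "Y = (norm (lam (x, t) *\<^sub>R u (x, t)))\<^sup>2"
    have X0: "X \<ge> 0" and Y0: "Y \<ge> 0" unfolding X_def Y_def using rho by auto
    have "(\<alpha> * X) powr (2/3) * (Y / \<alpha> powr (2/3)) \<le> ((\<alpha> * X) powr (2/3)) powr (3/2) + (Y / \<alpha> powr (2/3)) powr 3"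
      using Y0 al by (intro Young_3_2) auto
    also have "((\<alpha> * X) powr (2/3)) powr (3/2) = \<alpha> * X" using X0 al by (simp add: powr_powr)
    also have "(Y / \<alpha> powr (2/3)) powr 3 = Y powr 3 / (\<alpha> powr (2/3)) powr 3" by (rule powr_divide)
    also have "(\<alpha> powr (2/3)) powr 3 = \<alpha>\<^sup>2" using al by (simp add: powr_powr)
    also have "Y powr 3 = norm (lam (x, t) *\<^sub>R u (x, t)) ^ 6" 
    proof -
      have "Y powr 3 = Y ^ 3" using Y0 by simp
      then show ?thesis unfolding Y_def by (simp only: power_mult[symmetric]) simp
    qed
    also have "(\<alpha> * X) powr (2/3) * (Y / \<alpha> powr (2/3)) = X powr (2/3) * Y"
      using X0 al by (simp add: powr_mult)
    finally show ?thesis unfolding crit_def X_def Y_def by simp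
  qed
  have "(\<integral>\<^sup>+x. ennreal (crit (x, t)) \<partial>lborel)
     \<le> (\<integral>\<^sup>+x. ennreal \<alpha> * ennreal (\<rho> (x, t) * (norm (u (x, t)))\<^sup>2) + ennreal (1 / \<alpha>\<^sup>2) * ennreal (norm (lam (x, t) *\<^sub>R u (x, t)) ^ 6) \<partial>lborel)"
  proof (intro nn_integral_mono)
    fix x
    have "ennreal (crit (x, t)) \<le> ennreal (\<alpha> * (\<rho> (x, t) * (norm (u (x, t)))\<^sup>2) + 1 / \<alpha>\<^sup>2 * norm (lam (x, t) *\<^sub>R u (x, t)) ^ 6)"
      by (rule ennreal_leI[OF pw])
    also have "\<dots> = ennreal (\<alpha> * (\<rho> (x, t) * (norm (u (x, t)))\<^sup>2)) + ennreal (1 / \<alpha>\<^sup>2 * norm (lam (x, t) *\<^sub>R u (x, t)) ^ 6)"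
      using al rho by (intro ennreal_plus) auto
    also have "\<dots> = ennreal \<alpha> * ennreal (\<rho> (x, t) * (norm (u (x, t)))\<^sup>2) + ennreal (1 / \<alpha>\<^sup>2) * ennreal (norm (lam (x, t) *\<^sub>R u (x, t)) ^ 6)"
      using al by (intro arg_cong2[where f="(+)"] ennreal_mult') auto
    finally show "ennreal (crit (x, t)) \<le> ennreal \<alpha> * ennreal (\<rho> (x, t) * (norm (u (x, t)))\<^sup>2) + ennreal (1 / \<alpha>\<^sup>2) * ennreal (norm (lam (x, t) *\<^sub>R u (x, t)) ^ 6)" .
  qed
  also have "\<dots> = ennreal \<alpha> * (\<integral>\<^sup>+x. ennreal (\<rho> (x, t) * (norm (u (x, t)))\<^sup>2) \<partial>lborel)
      + ennreal (1 / \<alpha>\<^sup>2) * (\<integral>\<^sup>+x. ennreal (norm (lam (x, t) *\<^sub>R u (x, t)) ^ 6) \<partial>lborel)"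
    by (rule nn_integral_linear_combination) measurable
  also have "\<dots> \<le> ennreal \<alpha> * ennreal E + ennreal (1 / \<alpha>\<^sup>2) * ennreal (884736 * \<Lambda>^6 * J^3)"
    by (intro add_mono mult_left_mono k S6) auto
  also have "\<dots> = ennreal (\<alpha> * E + 1 / \<alpha>\<^sup>2 * (884736 * \<Lambda>^6 * J^3))"
    using al E J Lam0 by (simp add: ennreal_mult[symmetric] ennreal_plus[symmetric] del: ennreal_plus)
  also have "\<dots> \<le> ennreal ((1 + J) * (E + 884736 * \<Lambda>^6))"
  proof (rule ennreal_leI)
    have "J^3 \<le> \<alpha>^3" unfolding \<alpha>_def using J by (intro power_mono) auto
    also have "\<alpha>^3 = \<alpha>\<^sup>2 * \<alpha>" by (simp add: power2_eq_square power3_eq_cube)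
    finally have "1 / \<alpha>\<^sup>2 * J^3 \<le> \<alpha>" using al by (simp add: field_simps)
    then have "884736 * \<Lambda>^6 * (1 / \<alpha>\<^sup>2 * J^3) \<le> 884736 * \<Lambda>^6 * \<alpha>"
      using Lam0 by (intro mult_left_mono) auto
    moreover have "884736 * \<Lambda>^6 * (1 / \<alpha>\<^sup>2 * J^3) = 1 / \<alpha>\<^sup>2 * (884736 * \<Lambda>^6 * J^3)" by (simp only: mult_ac)
    moreover have "(1 + J) * (E + 884736 * \<Lambda>^6) = \<alpha> * E + 884736 * \<Lambda>^6 * \<alpha>"
      unfolding \<alpha>_def by (simp add: algebra_simps)
    ultimately show "\<alpha> * E + 1 / \<alpha>\<^sup>2 * (884736 * \<Lambda>^6 * J^3) \<le> (1 + J) * (E + 884736 * \<Lambda>^6)" by linarith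
  qed
  finally show ?thesis .
qed

lemma crit_integral:
  assumes Lam: "\<And>z. \<bar>lam z\<bar> \<le> \<Lambda>" "\<And>z j. \<bar>frechet_derivative lam (at z) (axis j 1, 0)\<bar> \<le> \<Lambda>"
  shows "(\<integral>\<^sup>+z. ennreal (crit z) \<partial>lborel) \<le> ennreal ((T + E\<^sup>2) * (E + 884736 * \<Lambda>^6))"
proof -
  have Lam0: "\<Lambda> \<ge> 0" using Lam(1)[of undefined] by linarith
  define c where "c = E + 884736 * \<Lambda>^6"
  have c0: "c \<ge> 0" unfolding c_def using E Lam0 by simp
  define J where "J = (\<lambda>t. \<integral>\<^sup>+x. ennreal ((norm (u (x, t)))\<^sup>2 + (norm (G (x, t)))\<^sup>2) \<partial>lborel)"
  have [measurable]: "J \<in> borel_measurable borel"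
    unfolding J_def by measurable
  have Jint: "(\<integral>\<^sup>+t. J t \<partial>lborel) \<le> ennreal (E\<^sup>2)"
    using wE unfolding J_def by (subst (asm) nn_integral_R4(1)) auto
  have "AE t in lborel. J t \<noteq> \<infinity>"
    by (rule nn_integral_PInf_AE) (use Jint in \<open>auto simp: top_unique\<close>)
  then have ae: "AE t in lborel. (\<integral>\<^sup>+x. ennreal (crit (x, t)) \<partial>lborel) \<le> (indicator {0<..<T} t + J t) * ennreal c"
    using kE weak
  proof eventually_elim
    case (elim t)
    show ?case
    proof (cases "t \<in> {0<..<T}")
      case False
      then have "crit (x, t) = 0" for x by (intro crit_off) (auto simp: Q_def)
      then show ?thesis by simp
    next
      case True
      define j where "j = enn2real (J t)"
      have j: "J t = ennreal j" "j \<ge> 0" unfolding j_def using elim(1) by (auto simp: less_top)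
      have "(\<integral>\<^sup>+x. ennreal (crit (x, t)) \<partial>lborel) \<le> ennreal ((1 + j) * c)"
        unfolding c_def
        by (rule crit_slice[OF Lam True j(1)[unfolded J_def] j(2) elim(2)]) (use elim(3) True in blast)+
      also have "\<dots> = (indicator {0<..<T} t + J t) * ennreal c"
        using True j c0 by (simp add: ennreal_mult ennreal_plus)
      finally show ?thesis .
    qed
  qed
  have "(\<integral>\<^sup>+z. ennreal (crit z) \<partial>lborel) = (\<integral>\<^sup>+t. \<integral>\<^sup>+x. ennreal (crit (x, t)) \<partial>lborel \<partial>lborel)"
    by (rule nn_integral_R4) measurable
  also have "\<dots> \<le> (\<integral>\<^sup>+t. (indicator {0<..<T} t + J t) * ennreal c \<partial>lborel)"
    by (intro nn_integral_mono_AE ae)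
  also have "\<dots> = ((\<integral>\<^sup>+t. indicator {0<..<T} t \<partial>lborel) + (\<integral>\<^sup>+t. J t \<partial>lborel)) * ennreal c"
  proof -
    have "(\<integral>\<^sup>+t. (indicator {0<..<T} t + J t) * ennreal c \<partial>lborel) = (\<integral>\<^sup>+t. indicator {0<..<T} t + J t \<partial>lborel) * ennreal c"
      by (rule nn_integral_multc) measurable
    also have "(\<integral>\<^sup>+t. indicator {0<..<T} t + J t \<partial>lborel) = (\<integral>\<^sup>+t. indicator {0<..<T} t \<partial>lborel) + (\<integral>\<^sup>+t. J t \<partial>lborel)"
      by (rule nn_integral_add) measurable
    finally show ?thesis .
  qed
  also have "\<dots> \<le> (ennreal T + ennreal (E\<^sup>2)) * ennreal c"
    using T by (intro mult_right_mono add_mono Jint) auto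
  also have "\<dots> = ennreal ((T + E\<^sup>2) * c)"
    using T c0 by (simp add: ennreal_mult)
  finally show ?thesis unfolding c_def .
qed

end

section \<open>Doubling of variables\<close>

lemma ker_antimono:
  assumes "0 \<le> b" "0 < p" "p \<le> q"
  shows "ker b q \<le> ker b p"
  unfolding ker_def
proof (intro mult_mono)
  show "lgw q powr b \<le> lgw p powr b"
    using assms lgw_antimono[of p q] lgw_pos[of q] by (intro powr_mono2) auto
  show "q powr (- 1 / 2) \<le> p powr (- 1 / 2)"
    using assms by (intro powr_mono2') auto
qed auto

text \<open>For fixed \<open>d\<close> the kernels are bounded. These bounds blow up as
  \<open>d\<close> tends to 0 and serve only for integrability and Fubini.\<close>

lemma Kd_Kmat_bounded:
  assumes "0 < \<mu>" "\<mu> < 4/3" "d > 0"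
  shows "norm (Kd \<mu> d w) \<le> lgw (d\<^sup>2) powr \<mu> + 4 * ker \<mu> (d\<^sup>2)"
    and "norm (Kmat \<mu> (d\<^sup>2 + w \<bullet> w) w) \<le> lgw (d\<^sup>2) powr \<mu> + 4 * ker \<mu> (d\<^sup>2)"
proof -
  have d2: "d\<^sup>2 > 0" using assms by simp
  have "norm (Kd \<mu> d w) \<le> lgw (d\<^sup>2 + w \<bullet> w) powr \<mu>"
    unfolding Kd_def by (rule norm_Kvec[OF qd_pos[OF assms(3)] qd_ge(1)])
  also have "\<dots> \<le> lgw (d\<^sup>2) powr \<mu>"
    using lgw_antimono[OF d2, of "d\<^sup>2 + w \<bullet> w"] lgw_pos[OF qd_pos[OF assms(3)], of w] assms by (intro powr_mono2) auto
  finally show "norm (Kd \<mu> d w) \<le> lgw (d\<^sup>2) powr \<mu> + 4 * ker \<mu> (d\<^sup>2)"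
    using ker_pos[OF d2, of \<mu>] by simp
  have "norm (Kmat \<mu> (d\<^sup>2 + w \<bullet> w) w) \<le> 4 * ker \<mu> (d\<^sup>2 + w \<bullet> w)"
    by (rule norm_Kmat[OF qd_pos[OF assms(3)] assms(1,2) qd_ge(1)])
  also have "\<dots> \<le> 4 * ker \<mu> (d\<^sup>2)"
    using ker_antimono[OF _ d2, of \<mu> "d\<^sup>2 + w \<bullet> w"] assms by simp
  finally show "norm (Kmat \<mu> (d\<^sup>2 + w \<bullet> w) w) \<le> lgw (d\<^sup>2) powr \<mu> + 4 * ker \<mu> (d\<^sup>2)"
    by (simp add: add_increasing)
qed

lemma etad_bound: "h > 0 \<Longrightarrow> \<bar>etad h \<tau>\<bar> \<le> 4 / h"
proof -
  assume h: "h > 0"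
  have "\<bar>etad h \<tau>\<bar> = (2 / h) * (norm (\<tau> / h) * gs (\<tau> / h))"
    unfolding etad_def using h by (simp add: abs_mult abs_divide power2_eq_square)
  also have "\<dots> \<le> (2 / h) * 2" using h by (intro mult_left_mono norm_gs_le) auto
  finally show ?thesis by simp
qed

lemma fst_snd_R4_measurable [measurable]:
  assumes "f \<in> borel_measurable M"
  shows "(\<lambda>x. fst (f x :: R4)) \<in> borel_measurable M" "(\<lambda>x. snd (f x :: R4)) \<in> borel_measurable M"
  by (rule measurable_compose[OF assms], intro borel_measurable_continuous_onI continuous_intros)+

lemma abs_inner_le: "norm a \<le> A \<Longrightarrow> norm b \<le> B \<Longrightarrow> \<bar>a \<bullet> b\<bar> \<le> A * B"
  for a b :: "'a::real_inner"
  by (rule order_trans[OF Cauchy_Schwarz_ineq2]) (auto intro!: mult_mono order_trans[OF norm_ge_zero])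

section \<open>The doubled equations for fixed \<open>d\<close> and \<open>h\<close>\<close>

locale weak_flow_doubled = weak_flow +
  fixes \<mu> d h M :: real
  assumes \<mu>: "0 < \<mu>" "\<mu> < 4/3" and d: "d > 0" and h: "h > 0"
    and M: "\<And>z. (lam z)\<^sup>2 \<le> M" "\<And>z. \<bar>dt (\<lambda>z. (lam z)\<^sup>2) z\<bar> \<le> M" "\<And>z. norm (grad_x (\<lambda>z. (lam z)\<^sup>2) z) \<le> M"
begin

definition W where "W z = (lam z)\<^sup>2"
definition et where "et z z' = gs ((snd z - snd z') / h)" for z z' :: R4
definition qq where "qq z z' = d\<^sup>2 + (fst z - fst z') \<bullet> (fst z - fst z')" for z z' :: R4
definition Dd where "Dd z z' = dbl \<mu> (qq z z') (fst z - fst z') (W z) (dt W z) (grad_x W z) (\<rho> z) (p z) (u z) (S z) (f z)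
   (W z') (dt W z') (grad_x W z') (\<rho> z') (u z')"

lemma W_test: "test_function (cylinder \<Omega> T) W"
  unfolding W_def[abs_def] by (rule test_function_square[OF lam])

lemma W_bounds: "0 \<le> W z" "W z \<le> M" "\<bar>W z\<bar> \<le> M" "\<bar>dt W z\<bar> \<le> M" "norm (grad_x W z) \<le> M" "M \<ge> 0"
  using M[of z] zero_le_power2[of "lam z"] unfolding W_def[abs_def] by auto

lemma W_measurable [measurable]: "W \<in> borel_measurable borel" "dt W \<in> borel_measurable borel" "grad_x W \<in> borel_measurable borel"
proof -
  show "W \<in> borel_measurable borel"
    by (intro borel_measurable_continuous_onI test_function_continuous[OF W_test])
  show "dt W \<in> borel_measurable borel" unfolding dt_def[abs_def]
    by (intro borel_measurable_continuous_onI test_function_deriv(2)[OF W_test])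
  show "grad_x W \<in> borel_measurable borel" unfolding grad_x_def[abs_def]
    by (intro borel_measurable_continuous_onI continuous_on_vec_lambda test_function_deriv(2)[OF W_test])
qed

text \<open>The integrands of the weak momentum equation at \<open>z\<close> with \<open>z'\<close>
  frozen, and (in \<open>Cz\<close>) of the continuity equation at \<open>z'\<close> with
  \<open>z\<close> frozen.\<close>

definition Mz where "Mz z z' = \<rho> z * (u z \<bullet> dt (mtest \<mu> d h W z') z)
   + (\<rho> z *\<^sub>R tensor (u z) (u z) + p z *\<^sub>R mat 1 - S z) \<bullet> Grad_x (mtest \<mu> d h W z') z + \<rho> z * (f z \<bullet> mtest \<mu> d h W z' z)"
definition Cz where "Cz z z' = \<rho> z' * dt (ctest \<mu> d h W (u z) z) z' + \<rho> z' * (u z' \<bullet> grad_x (ctest \<mu> d h W (u z) z) z')"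

text \<open>The terms carrying the derivative of the time kernel cancel.\<close>

lemma doubled_identity: "W z' * \<rho> z' * Mz z z' + W z * \<rho> z * Cz z z' = et z z' * Dd z z'"
proof -
  define w where "w = fst z - fst z'"
  define K where "K = Kvec \<mu> (qq z z') w"
  define A where "A = Kmat \<mu> (qq z z') w"
  define e where "e = et z z'"
  define e' where "e' = etad h (snd z - snd z')"
  have Kd: "Kd \<mu> d w = K" unfolding Kd_def K_def qq_def w_def ..
  have dtm: "dt (mtest \<mu> d h W z') z = (dt W z * e + W z * e') *\<^sub>R K"
    unfolding mtest_dt[OF W_test d] w_def[symmetric] Kd e_def e'_def et_def ..
  have Gm: "Grad_x (mtest \<mu> d h W z') z = e *\<^sub>R (tensor K (grad_x W z) + W z *\<^sub>R A)"
    unfolding mtest_Grad[OF W_test d] w_def[symmetric] Kd e_def et_def A_def qq_def ..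
  have m: "mtest \<mu> d h W z' z = W z *\<^sub>R (e *\<^sub>R K)"
    unfolding mtest_def w_def[symmetric] Kd e_def et_def ..
  have dtc: "dt (ctest \<mu> d h W (u z) z) z' = (dt W z' * e - W z' * e') * (u z \<bullet> K)"
    unfolding ctest_dt[OF W_test d] w_def[symmetric] Kd e_def e'_def et_def ..
  have gc: "u z' \<bullet> grad_x (ctest \<mu> d h W (u z) z) z' = e * ((u z' \<bullet> grad_x W z') * (u z \<bullet> K) - W z' * (A \<bullet> tensor (u z) (u z')))"
    unfolding ctest_grad[OF W_test d] w_def[symmetric] Kd e_def et_def A_def qq_def ..
  show ?thesis
    unfolding Mz_def Cz_def dtm Gm m dtc gc Dd_def dbl_def w_def[symmetric] K_def[symmetric] A_def[symmetric] e_def[symmetric]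
    by (simp add: inner_add_left inner_diff_left inner_add_right tensor_inner mat1_inner_tensor
        inner_commute[of A] algebra_simps)
qed

text \<open>A crude common bound for the test functions and their derivatives. It depends on
  \<open>d\<close> and \<open>h\<close>, and is used for integrability only.\<close>

definition X where "X = 2 * M * (1 + 4 / h) * (1 + lgw (d\<^sup>2) powr \<mu> + 4 * ker \<mu> (d\<^sup>2))"

lemma X_nonneg: "X \<ge> 0"
  unfolding X_def using W_bounds(6) h ker_pos[of "d\<^sup>2" \<mu>] d by (intro mult_nonneg_nonneg add_nonneg_nonneg) auto

lemma et_bounds: "0 \<le> et z z'" "et z z' \<le> 1"
  unfolding et_def by (auto simp: gs_le_1)

lemma mtest_bounds:
  "norm (dt (mtest \<mu> d h W z') z) \<le> X" "norm (Grad_x (mtest \<mu> d h W z') z) \<le> X" "norm (mtest \<mu> d h W z' z) \<le> X"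
  and ctest_bounds: "\<bar>dt (ctest \<mu> d h W c z) z'\<bar> \<le> X * norm c" "\<bar>v \<bullet> grad_x (ctest \<mu> d h W c z) z'\<bar> \<le> X * (norm c * norm v)"
proof -
  define B where "B = 1 + lgw (d\<^sup>2) powr \<mu> + 4 * ker \<mu> (d\<^sup>2)"
  define H where "H = 1 + 4 / h"
  define w where "w = fst z - fst z'"
  define e where "e = gs ((snd z - snd z') / h)"
  define e' where "e' = etad h (snd z - snd z')"
  have B: "norm (Kd \<mu> d w) \<le> B" "norm (Kmat \<mu> (d\<^sup>2 + w \<bullet> w) w) \<le> B" "B \<ge> 0"
    using Kd_Kmat_bounded[OF \<mu> d, of w] ker_pos[of "d\<^sup>2" \<mu>] d unfolding B_def by (auto intro: add_nonneg_nonneg)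
  have H: "H \<ge> 1" "\<bar>e\<bar> \<le> 1" "\<bar>e'\<bar> \<le> H" "e \<ge> 0"
    using etad_bound[OF h, of "snd z - snd z'"] h unfolding H_def e_def e'_def by (auto simp: gs_le_1)
  have M0: "M \<ge> 0" by (rule W_bounds)
  have XX: "X = M * H * B + M * H * B" unfolding X_def B_def H_def by (simp add: algebra_simps)
  have MB: "M * B \<ge> 0" "M * B \<le> M * H * B"
    using M0 B(3) H(1) mult_right_mono[OF H(1), of "M * B"] by (auto simp: mult_ac)
  have MX: "M * B + M * B \<le> X" unfolding XX using MB by linarith
  have coef: "\<bar>dt W a * e + W a * e'\<bar> * B \<le> X" "\<bar>dt W a * e - W a * e'\<bar> * B \<le> X" for a
  proof -
    have 1: "\<bar>dt W a * e\<bar> \<le> M * H"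
      unfolding abs_mult using W_bounds(4)[of a] H M0 by (intro mult_mono) auto
    have 2: "\<bar>W a * e'\<bar> \<le> M * H"
      unfolding abs_mult using W_bounds(3)[of a] H M0 by (intro mult_mono) auto
    have "\<bar>dt W a * e + W a * e'\<bar> \<le> M * H + M * H" "\<bar>dt W a * e - W a * e'\<bar> \<le> M * H + M * H"
      using 1 2 by linarith+
    from this[THEN mult_right_mono, OF B(3)]
    show "\<bar>dt W a * e + W a * e'\<bar> * B \<le> X" "\<bar>dt W a * e - W a * e'\<bar> * B \<le> X"
      unfolding XX by (simp_all only: distrib_right)
  qed
  show "norm (dt (mtest \<mu> d h W z') z) \<le> X"
    unfolding mtest_dt[OF W_test d] w_def[symmetric] e_def[symmetric] e'_def[symmetric] norm_scaleR
    by (rule order_trans[OF mult_left_mono[OF B(1) abs_ge_zero] coef(1)])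
  have "norm (Grad_x (mtest \<mu> d h W z') z) \<le> 1 * (M * B + M * B)"
    unfolding mtest_Grad[OF W_test d] w_def[symmetric] e_def[symmetric] norm_scaleR
  proof (intro mult_mono H(2) order_trans[OF norm_triangle_ineq] add_mono)
    show "norm (tensor (Kd \<mu> d w) (grad_x W z)) \<le> M * B"
      unfolding norm_tensor using mult_mono[OF B(1) W_bounds(5)[of z] B(3) norm_ge_zero] by (simp add: mult.commute)
    show "norm (W z *\<^sub>R Kmat \<mu> (d\<^sup>2 + w \<bullet> w) w) \<le> M * B"
      unfolding norm_scaleR by (intro mult_mono W_bounds B M0) auto
  qed auto
  with MX show "norm (Grad_x (mtest \<mu> d h W z') z) \<le> X" by simp
  have "norm (mtest \<mu> d h W z' z) \<le> M * (1 * B)"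
    unfolding mtest_def w_def[symmetric] e_def[symmetric] norm_scaleR
    by (intro mult_mono W_bounds B H M0 mult_nonneg_nonneg) auto
  from this[unfolded mult_1] MX MB show "norm (mtest \<mu> d h W z' z) \<le> X" by linarith
  have cK: "\<bar>c \<bullet> Kd \<mu> d w\<bar> \<le> B * norm c" using abs_inner_le[OF order_refl B(1), of c] by (simp add: mult.commute)
  have "\<bar>dt (ctest \<mu> d h W c z) z'\<bar> \<le> \<bar>dt W z' * e - W z' * e'\<bar> * (B * norm c)"
    unfolding ctest_dt[OF W_test d] w_def[symmetric] e_def[symmetric] e'_def[symmetric] abs_mult
    by (intro mult_left_mono cK) auto
  also have "\<dots> \<le> X * norm c"
    using mult_right_mono[OF coef(2)[of z'] norm_ge_zero[of c]] by (simp add: mult_ac)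
  finally show "\<bar>dt (ctest \<mu> d h W c z) z'\<bar> \<le> X * norm c" .
  have "\<bar>v \<bullet> grad_x (ctest \<mu> d h W c z) z'\<bar> \<le> 1 * ((norm v * M) * (B * norm c) + M * (B * (norm c * norm v)))"
    unfolding ctest_grad[OF W_test d] w_def[symmetric] e_def[symmetric] abs_mult
  proof (intro mult_mono H(2) order_trans[OF abs_triangle_ineq4] add_mono)
    show "\<bar>(v \<bullet> grad_x W z') * (c \<bullet> Kd \<mu> d w)\<bar> \<le> (norm v * M) * (B * norm c)"
      unfolding abs_mult by (intro mult_mono cK abs_inner_le W_bounds) (use M0 in auto)
    show "\<bar>W z' * (Kmat \<mu> (d\<^sup>2 + w \<bullet> w) w \<bullet> tensor c v)\<bar> \<le> M * (B * (norm c * norm v))"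
      unfolding abs_mult by (intro mult_mono abs_inner_le B W_bounds) (use M0 in \<open>auto simp: norm_tensor\<close>)
  qed auto
  also have "\<dots> = (M * B + M * B) * (norm c * norm v)" by (simp add: algebra_simps)
  also have "\<dots> \<le> X * (norm c * norm v)" by (intro mult_right_mono MX) auto
  finally show "\<bar>v \<bullet> grad_x (ctest \<mu> d h W c z) z'\<bar> \<le> X * (norm c * norm v)" .
qed

lemma mtest_jointly_measurable [measurable]:
  assumes [measurable]: "a \<in> borel_measurable N" "b \<in> borel_measurable N"
  shows "(\<lambda>x. dt (mtest \<mu> d h W (b x)) (a x)) \<in> borel_measurable N"
    "(\<lambda>x. Grad_x (mtest \<mu> d h W (b x)) (a x)) \<in> borel_measurable N"
    "(\<lambda>x. mtest \<mu> d h W (b x) (a x)) \<in> borel_measurable N"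
  unfolding mtest_dt[OF W_test d] mtest_Grad[OF W_test d] mtest_def by measurable

text \<open>The test function depends on \<open>z\<close> through \<open>u z\<close>; in this
  explicit form joint measurability in both points can be read off.\<close>

lemma Cz_alt: "Cz z z' = \<rho> z' * ((dt W z' * gs ((snd z - snd z') / h) - W z' * etad h (snd z - snd z')) * (u z \<bullet> Kd \<mu> d (fst z - fst z')))
   + \<rho> z' * (gs ((snd z - snd z') / h) * ((u z' \<bullet> grad_x W z') * (u z \<bullet> Kd \<mu> d (fst z - fst z'))
     - W z' * (Kmat \<mu> (d\<^sup>2 + (fst z - fst z') \<bullet> (fst z - fst z')) (fst z - fst z') \<bullet> tensor (u z) (u z'))))"
  unfolding Cz_def ctest_dt[OF W_test d] ctest_grad[OF W_test d] ..

lemma Mz_measurable [measurable]: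
  assumes [measurable]: "a \<in> borel_measurable N" "b \<in> borel_measurable N"
  shows "(\<lambda>x. Mz (a x) (b x)) \<in> borel_measurable N" "(\<lambda>x. Cz (a x) (b x)) \<in> borel_measurable N"
  unfolding Mz_def Cz_alt by measurable

lemma mom_terms:
  "\<bar>\<rho> z * (u z \<bullet> dt (mtest \<mu> d h W z') z)\<bar> \<le> X * en z"
  "\<bar>(\<rho> z *\<^sub>R tensor (u z) (u z) + p z *\<^sub>R mat 1 - S z) \<bullet> Grad_x (mtest \<mu> d h W z') z\<bar> \<le> (3 + s1) * X * en z"
  "\<bar>\<rho> z * (f z \<bullet> mtest \<mu> d h W z' z)\<bar> \<le> \<bar>F\<bar> * X * en z"
proof -
  note D = en_dominates[of z]
  have "\<bar>\<rho> z * (u z \<bullet> dt (mtest \<mu> d h W z') z)\<bar> \<le> \<rho> z * (norm (u z) * X)"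
    unfolding abs_mult using rho(1)[of z] abs_inner_le[OF order_refl mtest_bounds(1)] by (simp add: mult_left_mono)
  also have "\<dots> = X * (\<rho> z * norm (u z))" by simp
  also have "\<dots> \<le> X * en z" by (intro mult_left_mono D X_nonneg)
  finally show "\<bar>\<rho> z * (u z \<bullet> dt (mtest \<mu> d h W z') z)\<bar> \<le> X * en z" .
  have m1: "norm (mat 1 :: real^3^3) \<le> 2"
  proof -
    have "(norm (mat 1 :: real^3^3))\<^sup>2 \<le> 2\<^sup>2" unfolding power2_norm_eq_inner mat1_inner_mat1 by simp
    then show ?thesis by (rule power2_le_imp_le) simp
  qed
  have "norm (\<rho> z *\<^sub>R tensor (u z) (u z) + p z *\<^sub>R mat 1 - S z) \<le> norm (\<rho> z *\<^sub>R tensor (u z) (u z)) + norm (p z *\<^sub>R (mat 1 :: real^3^3)) + norm (S z)"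
    by (intro order_trans[OF norm_triangle_ineq4] add_right_mono norm_triangle_ineq)
  also have "\<dots> \<le> \<rho> z * (norm (u z))\<^sup>2 + p z * 2 + s1 * norm (G z)"
    using rho(1)[of z] p_nonneg[of z] m1 S[of z] by (intro add_mono) (auto simp: norm_tensor power2_eq_square mult_left_mono)
  also have "\<dots> \<le> en z + en z * 2 + s1 * en z"
    using D s1 by (intro add_mono mult_left_mono mult_right_mono) auto
  finally have "norm (\<rho> z *\<^sub>R tensor (u z) (u z) + p z *\<^sub>R mat 1 - S z) \<le> (3 + s1) * en z" by (simp add: algebra_simps)
  from abs_inner_le[OF this mtest_bounds(2)]
  show "\<bar>(\<rho> z *\<^sub>R tensor (u z) (u z) + p z *\<^sub>R mat 1 - S z) \<bullet> Grad_x (mtest \<mu> d h W z') z\<bar> \<le> (3 + s1) * X * en z"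
    by (simp add: mult_ac)
  have F: "norm (f z) \<le> \<bar>F\<bar>" using f[of z] by linarith
  have "\<bar>\<rho> z * (f z \<bullet> mtest \<mu> d h W z' z)\<bar> \<le> \<rho> z * (\<bar>F\<bar> * X)"
    unfolding abs_mult using rho(1)[of z] abs_inner_le[OF F mtest_bounds(3)] by (simp add: mult_left_mono)
  also have "\<dots> \<le> en z * (\<bar>F\<bar> * X)" using X_nonneg by (intro mult_right_mono D) auto
  finally show "\<bar>\<rho> z * (f z \<bullet> mtest \<mu> d h W z' z)\<bar> \<le> \<bar>F\<bar> * X * en z" by (simp add: mult_ac)
qed

lemma Mz_integral_zero: "(\<integral>z. Mz z z' \<partial>lborel) = 0"
proof -
  have dom: "integrable lborel g" if [measurable]: "g \<in> borel_measurable borel" and "\<And>z. \<bar>g z\<bar> \<le> C * en z" for g C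
    by (rule Bochner_Integration.integrable_bound[OF integrable_mult_right[OF en_integrable, of C]])
       (use that(2) in \<open>auto intro!: AE_I2 intro: order_trans[OF _ abs_ge_self]\<close>)
  have i1: "integrable lborel (\<lambda>z. \<rho> z * (u z \<bullet> dt (mtest \<mu> d h W z') z))"
    by (rule dom[OF _ mom_terms(1)]) measurable
  have i2: "integrable lborel (\<lambda>z. (\<rho> z *\<^sub>R tensor (u z) (u z) + p z *\<^sub>R mat 1 - S z) \<bullet> Grad_x (mtest \<mu> d h W z') z)"
    by (rule dom[OF _ mom_terms(2)]) measurable
  have i3: "integrable lborel (\<lambda>z. \<rho> z * (f z \<bullet> mtest \<mu> d h W z' z))"
    by (rule dom[OF _ mom_terms(3)]) measurable
  show ?thesis unfolding Mz_def
    using momentum[OF mtest_test[OF W_test d, of \<mu> h z']] i1 i2 i3 by simp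
qed

lemma Cz_integral_zero: "(\<integral>z'. Cz z z' \<partial>lborel) = 0"
  unfolding Cz_def by (rule continuity[OF ctest_test[OF W_test d]])

text \<open>The inner integral over the tested point vanishes by the weak equation; the majorant
  \<open>en z * en z'\<close> permits the corresponding order of integration.\<close>

lemma doubled_integrals:
  "integrable (lborel \<Otimes>\<^sub>M lborel) (\<lambda>(z, z'). W z' * \<rho> z' * Mz z z')"
  "(\<integral>x. (case x of (z, z') \<Rightarrow> W z' * \<rho> z' * Mz z z') \<partial>(lborel \<Otimes>\<^sub>M lborel)) = 0"
  "integrable (lborel \<Otimes>\<^sub>M lborel) (\<lambda>(z, z'). W z * \<rho> z * Cz z z')"
  "(\<integral>x. (case x of (z, z') \<Rightarrow> W z * \<rho> z * Cz z z') \<partial>(lborel \<Otimes>\<^sub>M lborel)) = 0"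
proof -
  have M0: "M \<ge> 0" by (rule W_bounds)
  show 1: "integrable (lborel \<Otimes>\<^sub>M lborel) (\<lambda>(z, z'). W z' * \<rho> z' * Mz z z')"
  proof (rule integrable_product_bound[OF en_integrable en_nonneg en_integrable en_nonneg])
    show "(\<lambda>(z, z'). W z' * \<rho> z' * Mz z z') \<in> borel_measurable (lborel \<Otimes>\<^sub>M lborel)" by measurable
    fix z z'
    have "\<bar>Mz z z'\<bar> \<le> X * en z + (3 + s1) * X * en z + \<bar>F\<bar> * X * en z"
      unfolding Mz_def using mom_terms[of z z'] by linarith
    also have "\<dots> = (4 + s1 + \<bar>F\<bar>) * X * en z" by (simp add: algebra_simps)
    finally have Mz: "\<bar>Mz z z'\<bar> \<le> (4 + s1 + \<bar>F\<bar>) * X * en z" .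
    have "\<bar>W z' * \<rho> z'\<bar> \<le> M * en z'"
      unfolding abs_mult using rho(1)[of z'] by (intro mult_mono W_bounds) (use en_dominates[of z'] M0 in auto)
    then have "\<bar>W z' * \<rho> z' * Mz z z'\<bar> \<le> (M * en z') * ((4 + s1 + \<bar>F\<bar>) * X * en z)"
      unfolding abs_mult[of "W z' * \<rho> z'"] by (intro mult_mono Mz) (use M0 en_nonneg in auto)
    also have "\<dots> = (M * (4 + s1 + \<bar>F\<bar>) * X) * (en z * en z')" by simp
    finally show "\<bar>case (z, z') of (z, z') \<Rightarrow> W z' * \<rho> z' * Mz z z'\<bar> \<le> (M * (4 + s1 + \<bar>F\<bar>) * X) * (en z * en z')" by simp
  qed
  show "(\<integral>x. (case x of (z, z') \<Rightarrow> W z' * \<rho> z' * Mz z z') \<partial>(lborel \<Otimes>\<^sub>M lborel)) = 0"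
    using lborel_pair.integral_snd[OF 1, symmetric] by (simp add: Mz_integral_zero)
  show 2: "integrable (lborel \<Otimes>\<^sub>M lborel) (\<lambda>(z, z'). W z * \<rho> z * Cz z z')"
  proof (rule integrable_product_bound[OF en_integrable en_nonneg en_integrable en_nonneg])
    show "(\<lambda>(z, z'). W z * \<rho> z * Cz z z') \<in> borel_measurable (lborel \<Otimes>\<^sub>M lborel)" by measurable
    fix z z'
    have "\<bar>Cz z z'\<bar> \<le> \<rho> z' * (X * norm (u z)) + \<rho> z' * (X * (norm (u z) * norm (u z')))"
      unfolding Cz_def using rho(1)[of z'] ctest_bounds(1)[of "u z" z z'] ctest_bounds(2)[of "u z'" "u z" z z']
      by (intro order_trans[OF abs_triangle_ineq] add_mono) (auto simp: abs_mult mult_left_mono)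
    also have "\<dots> = X * norm (u z) * (\<rho> z' + \<rho> z' * norm (u z'))" by (simp add: algebra_simps)
    also have "\<dots> \<le> X * norm (u z) * (en z' + en z')"
      using X_nonneg by (intro mult_left_mono add_mono en_dominates) auto
    finally have C: "\<bar>Cz z z'\<bar> \<le> X * norm (u z) * (en z' + en z')" .
    have "\<bar>W z * \<rho> z * Cz z z'\<bar> \<le> (M * \<rho> z) * (X * norm (u z) * (en z' + en z'))"
      unfolding abs_mult by (intro mult_mono C W_bounds) (use M0 rho(1)[of z] in auto)
    also have "\<dots> = (2 * M * X * en z') * (\<rho> z * norm (u z))" by (simp add: algebra_simps)
    also have "\<dots> \<le> (2 * M * X * en z') * en z"
      using M0 X_nonneg en_nonneg[of z'] by (intro mult_left_mono en_dominates) auto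
    finally show "\<bar>case (z, z') of (z, z') \<Rightarrow> W z * \<rho> z * Cz z z'\<bar> \<le> (2 * M * X) * (en z * en z')" by (simp add: mult_ac)
  qed
  show "(\<integral>x. (case x of (z, z') \<Rightarrow> W z * \<rho> z * Cz z z') \<partial>(lborel \<Otimes>\<^sub>M lborel)) = 0"
    using lborel_pair.integral_fst[OF 2, symmetric] by (simp add: Cz_integral_zero)
qed

lemma Dd_integral:
  "integrable (lborel \<Otimes>\<^sub>M lborel) (\<lambda>(z, z'). et z z' * Dd z z')"
  "(\<integral>x. (case x of (z, z') \<Rightarrow> et z z' * Dd z z') \<partial>(lborel \<Otimes>\<^sub>M lborel)) = 0"
proof -
  have eq: "(\<lambda>(z, z'). et z z' * Dd z z') = (\<lambda>x. (case x of (z, z') \<Rightarrow> W z' * \<rho> z' * Mz z z') + (case x of (z, z') \<Rightarrow> W z * \<rho> z * Cz z z'))"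
    by (auto simp: fun_eq_iff doubled_identity)
  show "integrable (lborel \<Otimes>\<^sub>M lborel) (\<lambda>(z, z'). et z z' * Dd z z')"
    unfolding eq by (intro Bochner_Integration.integrable_add doubled_integrals)
  show "(\<integral>x. (case x of (z, z') \<Rightarrow> et z z' * Dd z z') \<partial>(lborel \<Otimes>\<^sub>M lborel)) = 0"
    unfolding eq by (subst Bochner_Integration.integral_add[OF doubled_integrals(1,3)]) (simp add: doubled_integrals(2,4))
qed

end

section \<open>Integration of the symmetrized inequality\<close>

lemma nn_integral_time_kernel:
  assumes h: "h > 0"
  shows "(\<integral>\<^sup>+s. ennreal (gs ((t - s) / h)) \<partial>lborel) = ennreal (h * gmass TYPE(real))"
proof -
  have [measurable]: "(\<lambda>s. gs ((t - s) / h)) \<in> borel_measurable borel" by measurable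
  have "(\<integral>\<^sup>+s. ennreal (gs ((t - s) / h)) \<partial>lborel) = ennreal \<bar>h\<bar> * (\<integral>\<^sup>+x. ennreal (gs ((t - (t + h * x)) / h)) \<partial>lborel)"
    by (rule nn_integral_real_affine) (use h in auto)
  also have "\<dots> = ennreal h * (\<integral>\<^sup>+x. ennreal (gs x) \<partial>(lborel :: real measure))"
    using h by simp
  also have "\<dots> = ennreal (h * gmass TYPE(real))"
    unfolding gmass_nn using h by (simp add: ennreal_mult' less_imp_le[OF gmass_pos])
  finally show ?thesis .
qed

text \<open>Exchanging the two points preserves the integrals, so the two halves of the main term
  add up to one copy and the two remainders to twice one remainder, while the tested equations
  integrate to zero.\<close>

lemma integral_symmetrized_comparison:
  fixes k1 k2 r1 r2 e1 e2 :: "'a \<Rightarrow> real"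
  assumes [simp]: "integrable N k1" "integrable N k2" "integrable N r1" "integrable N r2" "integrable N e1" "integrable N e2"
    and le: "\<And>x. k1 x / 2 + k2 x / 2 - c * (r1 x + r2 x) \<le> e1 x + e2 x"
    and eq: "integral\<^sup>L N k2 = integral\<^sup>L N k1" "integral\<^sup>L N r2 = integral\<^sup>L N r1" "integral\<^sup>L N e1 = 0" "integral\<^sup>L N e2 = 0"
  shows "integral\<^sup>L N k1 \<le> 2 * c * integral\<^sup>L N r1"
proof -
  have "(\<integral>x. k1 x / 2 + k2 x / 2 - c * (r1 x + r2 x) \<partial>N) \<le> (\<integral>x. e1 x + e2 x \<partial>N)"
    by (rule integral_mono) (auto intro: le)
  moreover have "(\<integral>x. k1 x / 2 + k2 x / 2 - c * (r1 x + r2 x) \<partial>N) = integral\<^sup>L N k1 - c * (2 * integral\<^sup>L N r1)"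
    by (simp add: eq)
  moreover have "(\<integral>x. e1 x + e2 x \<partial>N) = 0" by (simp add: eq)
  ultimately show ?thesis by simp
qed

locale weak_flow_estimate = weak_flow_doubled +
  fixes R C C\<kappa> \<Lambda> :: real
  assumes R: "\<And>x y. x \<in> \<Omega> \<Longrightarrow> y \<in> \<Omega> \<Longrightarrow> norm (x - y) < R" and d1: "d \<le> 1"
    and C: "C \<ge> 1" "\<And>q. 0 < q \<Longrightarrow> q \<le> 1 + R\<^sup>2 \<Longrightarrow> lgw q powr (3 * \<mu>) \<le> C * cubker \<mu> q \<and> ker \<mu> q powr (3/2) \<le> C * cubker \<mu> q"
    and C\<kappa>: "C\<kappa> \<ge> 0" "(\<integral>\<^sup>+z. ennreal (cubker \<mu> (d\<^sup>2 + z \<bullet> z)) * indicator (ball 0 R) (z::real^3) \<partial>lborel) \<le> ennreal C\<kappa>"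
    and Lam: "\<And>z. \<bar>lam z\<bar> \<le> \<Lambda>" "\<And>z j. \<bar>frechet_derivative lam (at z) (axis j 1, 0)\<bar> \<le> \<Lambda>"
begin

definition c where "c = 2 * (M\<^sup>2 * (6 + F + 5 * s1)) + 16 * (1 / 8) powr (- 2 / 3) * M * (\<mu> + 1)\<^sup>2"
definition ae where "ae z = en z + crit z"
text \<open>The factor at the second point. With the time kernel its integral over \<open>z'\<close>
  is bounded uniformly in \<open>z\<close>, because the spatial integral of \<open>p\<close> is
  bounded at almost every time.\<close>

definition Th where "Th z z' = C * cubker \<mu> (qq z z') + 1 + p z'"
text \<open>The regularized and doubled form of the potential to be bounded; \<open>Rr\<close>
  majorizes the corresponding remainder.\<close>

definition Kp where "Kp z z' = et z z' * (W z * W z' * ker \<mu> (qq z z') * (p z * \<rho> z'))"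
definition Rr where "Rr z z' = et z z' * (indicator Q z * indicator Q z' * (ae z * Th z z'))"

lemma F_nonneg: "F \<ge> 0"
  using f[of undefined] norm_ge_zero[of "f undefined"] by linarith

lemma c_nonneg: "c \<ge> 0"
  unfolding c_def using F_nonneg s1 W_bounds(6) by (intro add_nonneg_nonneg mult_nonneg_nonneg) auto

lemma qq_pos: "qq z z' > 0" and qq_ge: "qq z z' \<ge> d\<^sup>2"
  unfolding qq_def using qd_pos[OF d] by (auto simp del: inner_diff_left inner_diff_right)

lemma qq_commute: "qq z z' = qq z' z"
  unfolding qq_def by (simp add: inner_diff_left inner_diff_right inner_commute)

lemma et_commute: "et z z' = et z' z"
proof -
  have "(snd z' - snd z) / h = - ((snd z - snd z') / h)" by (simp add: divide_inverse algebra_simps)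
  then show ?thesis unfolding et_def by (simp only: gs_minus)
qed

lemma ae_nonneg: "ae z \<ge> 0"
  unfolding ae_def using en_nonneg crit_nonneg by (simp add: add_nonneg_nonneg)

lemma Th_nonneg: "Th z z' \<ge> 0"
  unfolding Th_def using C(1) cubker_pos[OF qq_pos, of \<mu> z z'] p_nonneg[of z'] by simp

lemma pointwise_estimate:
  "Kp z z' / 2 + Kp z' z / 2 - c * (Rr z z' + Rr z' z) \<le> et z z' * Dd z z' + et z' z * Dd z' z"
proof (cases "z \<in> Q \<and> z' \<in> Q")
  \<comment> \<open>Off the cylinder the weight, the density, the pressure and the stress vanish, so
    both sides are 0.\<close>
  case False
  then have "\<rho> z = 0 \<and> p z = 0 \<and> S z = 0 \<or> \<rho> z' = 0 \<and> p z' = 0 \<and> S z' = 0"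
    using off_Q[of z] off_Q[of z'] S[of z] S[of z'] by auto
  moreover have "W z = 0 \<or> W z' = 0" 
    using False test_function_zero[OF W_test, of z] test_function_zero[OF W_test, of z'] unfolding Q_def by auto
  moreover have "z \<notin> Q \<Longrightarrow> \<rho> z = 0 \<and> p z = 0 \<and> S z = 0 \<and> W z = 0" "z' \<notin> Q \<Longrightarrow> \<rho> z' = 0 \<and> p z' = 0 \<and> S z' = 0 \<and> W z' = 0"
    using off_Q[of z] off_Q[of z'] S[of z] S[of z'] test_function_zero[OF W_test, of z] test_function_zero[OF W_test, of z'] unfolding Q_def by auto
  ultimately show ?thesis using False
    unfolding Kp_def Rr_def Dd_def dbl_def by (auto simp: indicator_def)
next
  case True
  define k where "k = ker \<mu> (qq z z')"
  have q1: "qq z z' \<le> 1 + R\<^sup>2"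
  proof -
    have "norm (fst z - fst z') < R" using True by (intro R) (auto simp: Q_def)
    then have "(norm (fst z - fst z'))\<^sup>2 \<le> R\<^sup>2" by (intro power_mono) auto
    moreover have "d\<^sup>2 \<le> 1" using d d1 by (simp add: power_le_one)
    ultimately show ?thesis unfolding qq_def power2_norm_eq_inner by linarith
  qed
  note C' = C(2)[OF qq_pos q1, THEN conjunct1] C(2)[OF qq_pos q1, THEN conjunct2]
  have zz: "(fst z - fst z') \<bullet> (fst z - fst z') \<le> qq z z'" unfolding qq_def by (rule qd_ge)
  define a where "a = (\<lambda>z. 1 + p z + \<rho> z * (norm (u z))\<^sup>2 + (norm (G z))\<^sup>2 + crit z)"
  have "W z * W z' * k * (p z * \<rho> z' + p z' * \<rho> z) / 2 - c * (a z * Th z z' + a z' * Th z' z)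
     \<le> dbl \<mu> (qq z z') (fst z - fst z') (W z) (dt W z) (grad_x W z) (\<rho> z) (p z) (u z) (S z) (f z) (W z') (dt W z') (grad_x W z') (\<rho> z') (u z')
     + dbl \<mu> (qq z z') (- (fst z - fst z')) (W z') (dt W z') (grad_x W z') (\<rho> z') (p z') (u z') (S z') (f z') (W z) (dt W z) (grad_x W z) (\<rho> z) (u z)"
    unfolding k_def Th_def qq_commute[of z' z]
    by (rule dbl_symmetrized_lower_bound[OF \<mu> qq_pos zz C(1) C' _ _ W_bounds(3) W_bounds(3) W_bounds(4) W_bounds(4)
         W_bounds(5) W_bounds(5) rho(1) rho(1) rho(2) rho(2) S norm_ge_zero S norm_ge_zero s1 f f])
       (auto simp: W_def a_def crit_def c_def)
  also have "\<dots> = Dd z z' + Dd z' z" unfolding Dd_def qq_commute[of z' z] by simp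
  finally have 1: "W z * W z' * k * (p z * \<rho> z' + p z' * \<rho> z) / 2 - c * (a z * Th z z' + a z' * Th z' z) \<le> Dd z z' + Dd z' z" .
  have ale: "a z \<le> ae z" "a z' \<le> ae z'"
    using True unfolding a_def ae_def en_def by auto
  have "a z * Th z z' + a z' * Th z' z \<le> ae z * Th z z' + ae z' * Th z' z"
    by (intro add_mono mult_right_mono ale Th_nonneg)
  then have "c * (a z * Th z z' + a z' * Th z' z) \<le> c * (ae z * Th z z' + ae z' * Th z' z)"
    by (rule mult_left_mono[OF _ c_nonneg])
  with 1 have "W z * W z' * k * (p z * \<rho> z' + p z' * \<rho> z) / 2 - c * (ae z * Th z z' + ae z' * Th z' z) \<le> Dd z z' + Dd z' z"
    by linarith
  then have 2: "et z z' * (W z * W z' * k * (p z * \<rho> z' + p z' * \<rho> z) / 2 - c * (ae z * Th z z' + ae z' * Th z' z)) \<le> et z z' * (Dd z z' + Dd z' z)"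
    by (rule mult_left_mono[OF _ et_bounds(1)])
  have "Kp z z' / 2 + Kp z' z / 2 - c * (Rr z z' + Rr z' z)
     = et z z' * (W z * W z' * k * (p z * \<rho> z' + p z' * \<rho> z) / 2 - c * (ae z * Th z z' + ae z' * Th z' z))"
    using True unfolding Kp_def Rr_def et_commute[of z' z] qq_commute[of z' z] k_def[symmetric]
    by (simp add: algebra_simps add_divide_distrib)
  moreover have "et z z' * (Dd z z' + Dd z' z) = et z z' * Dd z z' + et z' z * Dd z' z"
    unfolding et_commute[of z' z] by (simp add: algebra_simps)
  ultimately show ?thesis using 2 by linarith
qed

lemma ae_measurable [measurable]: "ae \<in> borel_measurable borel"
  unfolding ae_def[abs_def] by measurable

lemma ae_integral: "(\<integral>\<^sup>+z. ennreal (ae z) \<partial>lborel) \<le> ennreal (vol * T + E * T + E * T + E\<^sup>2 + (T + E\<^sup>2) * (E + 884736 * \<Lambda>^6))"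
proof -
  have "(\<integral>\<^sup>+z. ennreal (ae z) \<partial>lborel) = (\<integral>\<^sup>+z. ennreal (en z) + ennreal (crit z) \<partial>lborel)"
    unfolding ae_def by (intro nn_integral_cong ennreal_plus en_nonneg crit_nonneg)
  also have "\<dots> = (\<integral>\<^sup>+z. ennreal (en z) \<partial>lborel) + (\<integral>\<^sup>+z. ennreal (crit z) \<partial>lborel)"
    by (rule nn_integral_add) measurable
  also have "\<dots> \<le> ennreal (vol * T + E * T + E * T + E\<^sup>2) + ennreal ((T + E\<^sup>2) * (E + 884736 * \<Lambda>^6))"
    by (intro add_mono en_integral crit_integral Lam)
  also have "\<dots> = ennreal (vol * T + E * T + E * T + E\<^sup>2 + (T + E\<^sup>2) * (E + 884736 * \<Lambda>^6))"
    using vol(2) T E by (intro ennreal_plus[symmetric] add_nonneg_nonneg mult_nonneg_nonneg) auto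
  finally show ?thesis .
qed

lemma ae_integrable: "integrable lborel ae"
proof (rule integrableI_nonneg)
  show "(\<integral>\<^sup>+z. ennreal (ae z) \<partial>lborel) < \<infinity>" by (rule le_less_trans[OF ae_integral]) simp
qed (auto simp: ae_nonneg)

lemma joint_measurable [measurable]:
  assumes [measurable]: "a \<in> borel_measurable N" "b \<in> borel_measurable N"
  shows "(\<lambda>x. et (a x) (b x)) \<in> borel_measurable N" "(\<lambda>x. qq (a x) (b x)) \<in> borel_measurable N"
proof -
  show "(\<lambda>x. et (a x) (b x)) \<in> borel_measurable N" unfolding et_def by measurable
  show "(\<lambda>x. qq (a x) (b x)) \<in> borel_measurable N" unfolding qq_def by measurable
qed

lemma Kp_Rr_measurable [measurable]:
  assumes [measurable]: "a \<in> borel_measurable N" "b \<in> borel_measurable N"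
  shows "(\<lambda>x. Kp (a x) (b x)) \<in> borel_measurable N" "(\<lambda>x. Rr (a x) (b x)) \<in> borel_measurable N"
  unfolding Kp_def Rr_def Th_def by measurable

lemma Kp_nonneg: "Kp z z' \<ge> 0"
  unfolding Kp_def using et_bounds(1) W_bounds(1) p_nonneg rho(1) ker_pos[OF qq_pos, of \<mu> z z']
  by (intro mult_nonneg_nonneg) (auto intro: less_imp_le)

lemma Rr_nonneg: "Rr z z' \<ge> 0"
  unfolding Rr_def using et_bounds(1) ae_nonneg Th_nonneg by (intro mult_nonneg_nonneg) auto

lemma Kp_integrable: "integrable (lborel \<Otimes>\<^sub>M lborel) (\<lambda>(z, z'). Kp z z')"
proof (rule integrable_product_bound[OF en_integrable en_nonneg en_integrable en_nonneg])
  show "(\<lambda>(z, z'). Kp z z') \<in> borel_measurable (lborel \<Otimes>\<^sub>M lborel)" by measurable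
  fix z z'
  have d2: "d\<^sup>2 > 0" using d by simp
  have "Kp z z' \<le> 1 * (M * M * ker \<mu> (d\<^sup>2) * (en z * en z'))"
    unfolding Kp_def
    using \<mu> W_bounds p_nonneg rho(1) ker_pos[OF qq_pos, of \<mu> z z'] ker_pos[OF d2, of \<mu>] en_nonneg
    by (intro mult_mono et_bounds W_bounds en_dominates ker_antimono[OF _ d2 qq_ge] mult_nonneg_nonneg) (auto intro: less_imp_le)
  then show "\<bar>case (z, z') of (z, z') \<Rightarrow> Kp z z'\<bar> \<le> (M * M * ker \<mu> (d\<^sup>2)) * (en z * en z')"
    using Kp_nonneg[of z z'] by simp
qed

lemma Rr_integrable: "integrable (lborel \<Otimes>\<^sub>M lborel) (\<lambda>(z, z'). Rr z z')"
proof (rule integrable_product_bound[OF ae_integrable ae_nonneg en_integrable en_nonneg])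
  show "(\<lambda>(z, z'). Rr z z') \<in> borel_measurable (lborel \<Otimes>\<^sub>M lborel)" by measurable
  fix z z'
  define L where "L = C * cubker \<mu> (d\<^sup>2) + 1"
  have d2: "d\<^sup>2 > 0" using d by simp
  have L1: "L \<ge> 1" unfolding L_def using C(1) cubker_pos[OF d2, of \<mu>] by simp
  have "indicator Q z' * Th z z' \<le> L * en z'"
  proof (cases "z' \<in> Q")
    case True
    have "C * cubker \<mu> (qq z z') \<le> C * cubker \<mu> (d\<^sup>2)"
      using C(1) by (intro mult_left_mono cubker_antimono[OF d2 qq_ge \<mu>]) auto
    then have "Th z z' \<le> L + p z'" unfolding Th_def L_def by simp
    also have "\<dots> \<le> L + L * p z'" using mult_right_mono[OF L1 p_nonneg[of z']] by simp
    also have "\<dots> = L * (1 + p z')" by (simp add: algebra_simps)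
    also have "\<dots> \<le> L * en z'"
      using True rho(1)[of z'] L1 unfolding en_def by (intro mult_left_mono) auto
    finally show ?thesis using True by simp
  qed (use L1 en_nonneg in simp)
  then have 1: "ae z * (indicator Q z' * Th z z') \<le> ae z * (L * en z')" by (rule mult_left_mono[OF _ ae_nonneg])
  have 2: "et z z' * indicator Q z \<le> 1" using et_bounds[of z z'] by (simp add: indicator_def)
  have "Rr z z' = (et z z' * indicator Q z) * (ae z * (indicator Q z' * Th z z'))" unfolding Rr_def by simp
  also have "\<dots> \<le> 1 * (ae z * (L * en z'))"
    by (rule mult_mono[OF 2 1]) (simp_all add: ae_nonneg Th_nonneg)
  finally show "\<bar>case (z, z') of (z, z') \<Rightarrow> Rr z z'\<bar> \<le> L * (ae z * en z')" using Rr_nonneg[of z z'] by (simp add: mult_ac)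
qed

lemma integrated_estimate:
  "(\<integral>x. (case x of (z, z') \<Rightarrow> Kp z z') \<partial>(lborel \<Otimes>\<^sub>M lborel)) \<le> 2 * c * (\<integral>x. (case x of (z, z') \<Rightarrow> Rr z z') \<partial>(lborel \<Otimes>\<^sub>M lborel))"
proof -
  let ?MM = "lborel \<Otimes>\<^sub>M lborel :: (R4 \<times> R4) measure"
  have sw: "integrable ?MM (\<lambda>(z, z'). g z' z)" "(\<integral>x. (case x of (z, z') \<Rightarrow> g z' z) \<partial>?MM) = (\<integral>x. (case x of (z, z') \<Rightarrow> g z z') \<partial>?MM)"
    if "integrable ?MM (\<lambda>(z, z'). g z z')" for g :: "R4 \<Rightarrow> R4 \<Rightarrow> real"
    using lborel_pair.integrable_product_swap[OF that] lborel_pair.integral_product_swap[OF borel_measurable_integrable[OF that]] by simp_all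
  show ?thesis
  proof (rule integral_symmetrized_comparison[OF Kp_integrable sw(1)[OF Kp_integrable] Rr_integrable sw(1)[OF Rr_integrable]
        Dd_integral(1) sw(1)[OF Dd_integral(1)] _ sw(2)[OF Kp_integrable] sw(2)[OF Rr_integrable] Dd_integral(2)])
    show "(\<integral>x. (case x of (z, z') \<Rightarrow> et z' z * Dd z' z) \<partial>?MM) = 0"
      by (rule trans[OF sw(2)[OF Dd_integral(1)] Dd_integral(2)])
    fix x :: "R4 \<times> R4"
    show "(case x of (z, z') \<Rightarrow> Kp z z') / 2 + (case x of (z, z') \<Rightarrow> Kp z' z) / 2
       - c * ((case x of (z, z') \<Rightarrow> Rr z z') + (case x of (z, z') \<Rightarrow> Rr z' z))
      \<le> (case x of (z, z') \<Rightarrow> et z z' * Dd z z') + (case x of (z, z') \<Rightarrow> et z' z * Dd z' z)"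
      using pointwise_estimate[of "fst x" "snd x"] by (simp only: case_prod_unfold)
  qed
qed

text \<open>In space the kernel is integrated over the ball of radius \<open>R\<close>, which
  contains all differences of points of \<Omega>, and the pressure by its bound on time slices. Only
  the Gaussian in time is left, and it yields the factor \<open>h\<close>.\<close>

lemma Rr_inner:
  assumes z: "z \<in> Q"
  shows "(\<integral>\<^sup>+z'. ennreal (et z z' * (indicator Q z' * Th z z')) \<partial>lborel) \<le> ennreal (h * gmass TYPE(real) * (C * C\<kappa> + vol + E))"
proof -
  define x where "x = fst z"
  define t where "t = snd z"
  have x: "x \<in> \<Omega>" using z by (auto simp: Q_def x_def)
  define kb :: "R3 \<Rightarrow> ennreal" where "kb = (\<lambda>w. ennreal (cubker \<mu> (d\<^sup>2 + w \<bullet> w)) * indicator (ball 0 R) w)"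
  have kbm [measurable]: "kb \<in> borel_measurable borel"
    unfolding kb_def by (intro borel_measurable_times_ennreal borel_measurable_indicator) simp_all
  have inner: "AE s in lborel. (\<integral>\<^sup>+y. ennreal (et z (y, s) * (indicator Q (y, s) * Th z (y, s))) \<partial>lborel)
      \<le> ennreal (C * C\<kappa> + vol + E) * ennreal (gs ((t - s) / h))"
    using pE
  proof eventually_elim
    case (elim s)
    have k: "(\<integral>\<^sup>+y. kb (y - x) \<partial>lborel) \<le> ennreal C\<kappa>"
      using nn_integral_lborel_translate[OF kbm, of "- x"] C\<kappa>(2) unfolding kb_def by simp
    have [measurable]: "(\<lambda>y. p (y, s)) \<in> borel_measurable borel" by (rule slice_measurable) measurable
    have [measurable]: "\<Omega> \<in> sets borel" using \<Omega> by simp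
    have "(\<integral>\<^sup>+y. ennreal (et z (y, s) * (indicator Q (y, s) * Th z (y, s))) \<partial>lborel)
       \<le> (\<integral>\<^sup>+y. ennreal (gs ((t - s) / h)) * (ennreal C * (kb (y - x))
           + (indicator \<Omega> y + ennreal (p (y, s)))) \<partial>lborel)"
    proof (intro nn_integral_mono)
      fix y
      show "ennreal (et z (y, s) * (indicator Q (y, s) * Th z (y, s))) \<le> ennreal (gs ((t - s) / h)) * (ennreal C * (kb (y - x))
           + (indicator \<Omega> y + ennreal (p (y, s))))"
      proof (cases "(y, s) \<in> Q")
        case True
        then have y: "y \<in> \<Omega>" by (auto simp: Q_def)
        have b: "y - x \<in> ball 0 R" using R[OF y x] by simp
        have q: "qq z (y, s) = d\<^sup>2 + (y - x) \<bullet> (y - x)"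
          unfolding qq_def x_def by (simp add: inner_diff_left inner_diff_right inner_commute)
        have pos: "cubker \<mu> (d\<^sup>2 + (y - x) \<bullet> (y - x)) \<ge> 0" using cubker_pos[OF qd_pos[OF d], of \<mu> "y - x"] by simp
        have "ennreal (et z (y, s) * (indicator Q (y, s) * Th z (y, s)))
          = ennreal (gs ((t - s) / h)) * ennreal (C * cubker \<mu> (d\<^sup>2 + (y - x) \<bullet> (y - x)) + (1 + p (y, s)))"
          using True unfolding et_def Th_def q t_def by (simp add: ennreal_mult' add.assoc)
        also have "ennreal (C * cubker \<mu> (d\<^sup>2 + (y - x) \<bullet> (y - x)) + (1 + p (y, s)))
          = ennreal C * ennreal (cubker \<mu> (d\<^sup>2 + (y - x) \<bullet> (y - x))) + (1 + ennreal (p (y, s)))"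
          using C(1) pos p_nonneg[of "(y, s)"] by (simp add: ennreal_plus ennreal_mult)
        finally show ?thesis using y b by (simp add: kb_def)
      qed simp
    qed
    also have "\<dots> = ennreal (gs ((t - s) / h)) * (ennreal C * (\<integral>\<^sup>+y. kb (y - x) \<partial>lborel)
           + ((\<integral>\<^sup>+y. indicator \<Omega> y \<partial>lborel) + (\<integral>\<^sup>+y. ennreal (p (y, s)) \<partial>lborel)))"
    proof -
      have "(\<integral>\<^sup>+y. a * (b * g1 y + (g2 y + g3 y)) \<partial>lborel) = a * (b * (\<integral>\<^sup>+y. g1 y \<partial>lborel) + ((\<integral>\<^sup>+y. g2 y \<partial>lborel) + (\<integral>\<^sup>+y. g3 y \<partial>lborel)))"
        if [measurable]: "g1 \<in> borel_measurable borel" "g2 \<in> borel_measurable borel" "g3 \<in> borel_measurable borel"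
        for a b and g1 g2 g3 :: "R3 \<Rightarrow> ennreal"
        by (simp add: nn_integral_cmult nn_integral_add)
      then show ?thesis by measurable
    qed
    also have "\<dots> \<le> ennreal (gs ((t - s) / h)) * (ennreal C * ennreal C\<kappa> + (ennreal vol + ennreal E))"
      using \<Omega> by (intro mult_left_mono add_mono k elim) (auto simp: vol)
    also have "ennreal C * ennreal C\<kappa> + (ennreal vol + ennreal E) = ennreal (C * C\<kappa> + vol + E)"
      using C C\<kappa> vol(2) E by (simp add: ennreal_mult ennreal_plus add.assoc)
    finally show ?case by (simp add: mult.commute)
  qed
  have "(\<integral>\<^sup>+z'. ennreal (et z z' * (indicator Q z' * Th z z')) \<partial>lborel)
     = (\<integral>\<^sup>+s. \<integral>\<^sup>+y. ennreal (et z (y, s) * (indicator Q (y, s) * Th z (y, s))) \<partial>lborel \<partial>lborel)"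
    unfolding Th_def by (rule nn_integral_R4) measurable
  also have "\<dots> \<le> (\<integral>\<^sup>+s. ennreal (C * C\<kappa> + vol + E) * ennreal (gs ((t - s) / h)) \<partial>lborel)"
    by (intro nn_integral_mono_AE inner)
  also have "\<dots> = ennreal (C * C\<kappa> + vol + E) * ennreal (h * gmass TYPE(real))"
    unfolding nn_integral_time_kernel[OF h, of t, symmetric] by (rule nn_integral_cmult) measurable
  also have "\<dots> = ennreal (h * gmass TYPE(real) * (C * C\<kappa> + vol + E))"
    using h less_imp_le[OF gmass_pos[where 'a=real]] by (simp add: ennreal_mult'[symmetric] mult.commute)
  finally show ?thesis .
qed

text \<open>The bound is linear in \<open>h\<close>, and \<open>d\<close> enters it only through
  \<open>C\<kappa>\<close>, which can be chosen uniformly; hence both parameters can be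
  removed.\<close>

theorem doubled_potential_bound:
  "(\<integral>\<^sup>+z. \<integral>\<^sup>+z'. ennreal (Kp z z') \<partial>lborel \<partial>lborel)
    \<le> ennreal (2 * c * gmass TYPE(real) * (C * C\<kappa> + vol + E) * (vol * T + E * T + E * T + E\<^sup>2 + (T + E\<^sup>2) * (E + 884736 * \<Lambda>^6)) * h)"
proof -
  define B where "B = h * gmass TYPE(real) * (C * C\<kappa> + vol + E)"
  define A where "A = vol * T + E * T + E * T + E\<^sup>2 + (T + E\<^sup>2) * (E + 884736 * \<Lambda>^6)"
  have B0: "B \<ge> 0" unfolding B_def using h less_imp_le[OF gmass_pos[where 'a=real]] C C\<kappa> vol(2) E by simp
  have A0: "A \<ge> 0" unfolding A_def using vol(2) T E by simp
  have m1: "(\<lambda>x. ennreal (case x of (z, z') \<Rightarrow> Rr z z')) \<in> borel_measurable (lborel \<Otimes>\<^sub>M lborel)"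
    "(\<lambda>x. ennreal (case x of (z, z') \<Rightarrow> Kp z z')) \<in> borel_measurable (lborel \<Otimes>\<^sub>M lborel)" by measurable
  have "ennreal (\<integral>x. (case x of (z, z') \<Rightarrow> Rr z z') \<partial>(lborel \<Otimes>\<^sub>M lborel))
      = (\<integral>\<^sup>+x. ennreal (case x of (z, z') \<Rightarrow> Rr z z') \<partial>(lborel \<Otimes>\<^sub>M lborel))"
    by (rule nn_integral_eq_integral[symmetric, OF Rr_integrable]) (auto simp: Rr_nonneg)
  also have "\<dots> = (\<integral>\<^sup>+z. \<integral>\<^sup>+z'. ennreal (Rr z z') \<partial>lborel \<partial>lborel)"
    using lborel.nn_integral_fst[OF m1(1), symmetric] by simp
  also have "\<dots> \<le> (\<integral>\<^sup>+z. ennreal (ae z) * ennreal B \<partial>lborel)"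
  proof (intro nn_integral_mono)
    fix z
    show "(\<integral>\<^sup>+z'. ennreal (Rr z z') \<partial>lborel) \<le> ennreal (ae z) * ennreal B"
    proof (cases "z \<in> Q")
      case True
      have "(\<integral>\<^sup>+z'. ennreal (Rr z z') \<partial>lborel) = (\<integral>\<^sup>+z'. ennreal (ae z) * ennreal (et z z' * (indicator Q z' * Th z z')) \<partial>lborel)"
        using True unfolding Rr_def by (intro nn_integral_cong) (simp add: ennreal_mult'[OF ae_nonneg, symmetric] mult_ac)
      also have "\<dots> = ennreal (ae z) * (\<integral>\<^sup>+z'. ennreal (et z z' * (indicator Q z' * Th z z')) \<partial>lborel)"
        unfolding Th_def by (rule nn_integral_cmult) measurable
      also have "\<dots> \<le> ennreal (ae z) * ennreal B"
        unfolding B_def by (intro mult_left_mono Rr_inner True) auto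
      finally show ?thesis .
    qed (simp add: Rr_def)
  qed
  also have "\<dots> = (\<integral>\<^sup>+z. ennreal (ae z) \<partial>lborel) * ennreal B" by (rule nn_integral_multc) measurable
  also have "\<dots> \<le> ennreal A * ennreal B" unfolding A_def by (intro mult_right_mono ae_integral) auto
  finally have "ennreal (\<integral>x. (case x of (z, z') \<Rightarrow> Rr z z') \<partial>(lborel \<Otimes>\<^sub>M lborel)) \<le> ennreal (A * B)"
    using A0 B0 by (simp add: ennreal_mult)
  then have R: "(\<integral>x. (case x of (z, z') \<Rightarrow> Rr z z') \<partial>(lborel \<Otimes>\<^sub>M lborel)) \<le> A * B"
    using A0 B0 by (simp add: ennreal_le_iff)
  have "(\<integral>\<^sup>+z. \<integral>\<^sup>+z'. ennreal (Kp z z') \<partial>lborel \<partial>lborel) = (\<integral>\<^sup>+x. ennreal (case x of (z, z') \<Rightarrow> Kp z z') \<partial>(lborel \<Otimes>\<^sub>M lborel))"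
    using lborel.nn_integral_fst[OF m1(2)] by simp
  also have "\<dots> = ennreal (\<integral>x. (case x of (z, z') \<Rightarrow> Kp z z') \<partial>(lborel \<Otimes>\<^sub>M lborel))"
    by (rule nn_integral_eq_integral[OF Kp_integrable]) (auto simp: Kp_nonneg)
  also have "\<dots> \<le> ennreal (2 * c * (A * B))"
    using c_nonneg by (intro ennreal_leI order_trans[OF integrated_estimate] mult_left_mono R) auto
  also have "2 * c * (A * B) = 2 * c * gmass TYPE(real) * (C * C\<kappa> + vol + E) * A * h"
    unfolding B_def by (simp add: mult_ac)
  finally show ?thesis unfolding A_def .
qed

end

section \<open>Removal of the regularization\<close>

text \<open>Substituting s = t + h \<tau> makes the division by \<open>h\<close> an average over
  \<tau> with Gaussian weight. Along a subsequence V(y, t + h \<tau>) tends to V(y, t) for almost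
  every (y, t, \<tau>) by \<open>L1_mollify\<close>, the kernel converges off the diagonal, and
  Fatou's lemma gives the limit bound with the total mass of the Gaussian in front.\<close>

lemma potential_limit:
  fixes P V :: "R4 \<Rightarrow> real"
  assumes Pm [measurable]: "P \<in> borel_measurable borel" and P0: "\<And>z. P z \<ge> 0"
    and V: "integrable lborel V" and V0: "\<And>z. V z \<ge> 0" and \<mu>: "0 < \<mu>" and B: "B \<ge> 0"
    and bound: "\<And>d h. 0 < d \<Longrightarrow> d \<le> 1 \<Longrightarrow> h > 0 \<Longrightarrow>
      (\<integral>\<^sup>+z. \<integral>\<^sup>+z'. ennreal (gs ((snd z - snd z') / h) * (P z * V z' * ker \<mu> (d\<^sup>2 + (fst z - fst z') \<bullet> (fst z - fst z')))) \<partial>lborel \<partial>lborel) \<le> ennreal (B * h)"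
  shows "ennreal (gmass TYPE(real)) * (\<integral>\<^sup>+z. \<integral>\<^sup>+y. ennreal (P z * V (y, snd z) * ker \<mu> ((fst z - y) \<bullet> (fst z - y))) \<partial>lborel \<partial>lborel) \<le> ennreal B"
proof -
  have [measurable]: "V \<in> borel_measurable borel" using V by auto
  \<comment> \<open>One sequence serves for both parameters \<open>d\<close> and
    \<open>h\<close>.\<close>
  define e where "e = (\<lambda>n. 1 / real (Suc n))"
  have e: "e n > 0" "e n \<le> 1" for n by (auto simp: e_def)
  have elim0: "e \<longlonglongrightarrow> 0" unfolding e_def by (rule LIMSEQ_Suc[OF lim_1_over_n])
  define Tm where "Tm = (\<lambda>\<tau>::real. (0::R3, \<tau>))"
  have Tm: "bounded_linear Tm" unfolding Tm_def by (intro bounded_linear_Pair bounded_linear_zero bounded_linear_ident)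
  note mol = L1_mollify[OF V gs_integrable[where 'a=real] gs_nonneg Tm elim0]
  from tendsto_L1_AE_subseq[OF mol]
  obtain r :: "nat \<Rightarrow> nat" where r: "strict_mono r"
    and ae: "AE q in lborel \<Otimes>\<^sub>M lborel. (\<lambda>n. case q of (z, \<tau>) \<Rightarrow> (V (z + e (r n) *\<^sub>R Tm \<tau>) - V z) * gs \<tau>) \<longlonglongrightarrow> 0" by auto
  define w where "w = (\<lambda>d x y. ker \<mu> (d\<^sup>2 + (x - y) \<bullet> (x - y :: R3)))"
  have wm [measurable]: "(\<lambda>s. w d (f s) (g s)) \<in> borel_measurable N"
    if "f \<in> borel_measurable N" "g \<in> borel_measurable N" for d N and f g :: "'s \<Rightarrow> R3"
  proof -
    note [measurable] = that
    show ?thesis unfolding w_def by measurable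
  qed
  have w0: "w d x y \<ge> 0" for d x y
    unfolding w_def by (simp add: ker_def)
  define F where "F = (\<lambda>n x (q :: R4 \<times> real). gs (snd q) * (P (x, snd (fst q)) * V (fst (fst q), snd (fst q) + e n * snd q) * w (e n) x (fst (fst q))))"
  define F0 where "F0 = (\<lambda>x (q :: R4 \<times> real). gs (snd q) * (P (x, snd (fst q)) * V (fst q) * w 0 x (fst (fst q))))"
  have m4 [measurable]: "(\<lambda>s. g (a s, b s)) \<in> borel_measurable N"
    if "g \<in> borel_measurable borel" "a \<in> borel_measurable N" "b \<in> borel_measurable N" for g :: "R4 \<Rightarrow> real" and N :: "'s measure" and a b
    by (rule measurable_compose[OF borel_measurable_Pair[OF that(2,3)] that(1)])
  have Fm [measurable]: "(\<lambda>s. F n (a s) (b s, c s)) \<in> borel_measurable N" "(\<lambda>s. F0 (a s) (b s, c s)) \<in> borel_measurable N"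
    if [measurable]: "a \<in> borel_measurable N" "b \<in> borel_measurable N" "c \<in> borel_measurable N" for n a b c and N :: "'s measure"
  proof -
    show "(\<lambda>s. F n (a s) (b s, c s)) \<in> borel_measurable N" unfolding F_def fst_conv snd_conv by measurable
    show "(\<lambda>s. F0 (a s) (b s, c s)) \<in> borel_measurable N" unfolding F0_def fst_conv snd_conv by measurable
  qed
  have Fpm [measurable]: "(\<lambda>q. F n x q) \<in> borel_measurable (borel \<Otimes>\<^sub>M borel)" "(\<lambda>q. F0 x q) \<in> borel_measurable (borel \<Otimes>\<^sub>M borel)" for n x
  proof -
    have "(\<lambda>q. F n x (fst q, snd q)) \<in> borel_measurable (borel \<Otimes>\<^sub>M borel)" by measurable
    then show "(\<lambda>q. F n x q) \<in> borel_measurable (borel \<Otimes>\<^sub>M borel)" by simp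
    have "(\<lambda>q. F0 x (fst q, snd q)) \<in> borel_measurable (borel \<Otimes>\<^sub>M borel)" by measurable
    then show "(\<lambda>q. F0 x q) \<in> borel_measurable (borel \<Otimes>\<^sub>M borel)" by simp
  qed
  have split: "(\<integral>\<^sup>+q. ennreal (g q) \<partial>(lborel \<Otimes>\<^sub>M lborel)) = (\<integral>\<^sup>+y. \<integral>\<^sup>+t. \<integral>\<^sup>+\<tau>. ennreal (g ((y, t), \<tau>)) \<partial>lborel \<partial>lborel \<partial>lborel)"
    if [measurable]: "g \<in> borel_measurable (borel \<Otimes>\<^sub>M borel)" for g :: "R4 \<times> real \<Rightarrow> real"
  proof -
    have "(\<integral>\<^sup>+q. ennreal (g q) \<partial>(lborel \<Otimes>\<^sub>M lborel)) = (\<integral>\<^sup>+z. \<integral>\<^sup>+\<tau>. ennreal (g (z, \<tau>)) \<partial>lborel \<partial>lborel)"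
      by (rule lborel.nn_integral_fst[symmetric]) measurable
    also have "\<dots> = (\<integral>\<^sup>+y. \<integral>\<^sup>+t. \<integral>\<^sup>+\<tau>. ennreal (g ((y, t), \<tau>)) \<partial>lborel \<partial>lborel \<partial>lborel)"
      by (rule nn_integral_R4(2)) measurable
    finally show ?thesis .
  qed
  have step: "(\<integral>\<^sup>+x. \<integral>\<^sup>+q. ennreal (F n x q) \<partial>(lborel \<Otimes>\<^sub>M lborel) \<partial>lborel) \<le> ennreal B" for n
  proof -
    define H where "H = (\<lambda>z z'. gs ((snd z - snd z') / e n) * (P z * V z' * w (e n) (fst z) (fst z')))"
    have Hm [measurable]: "(\<lambda>s. H (a s, b s) (c s, k s)) \<in> borel_measurable N"
      if [measurable]: "a \<in> borel_measurable N" "b \<in> borel_measurable N" "c \<in> borel_measurable N" "k \<in> borel_measurable N" for a b c k and N :: "'s measure"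
      unfolding H_def fst_conv snd_conv by measurable
    have Hm2 [measurable]: "(\<lambda>z'. H z z') \<in> borel_measurable borel" for z
      unfolding H_def by measurable
    have Hm3 [measurable]: "(\<lambda>z. \<integral>\<^sup>+z'. ennreal (H z z') \<partial>lborel) \<in> borel_measurable borel"
    proof -
      have "(\<lambda>z. \<integral>\<^sup>+z'. ennreal (H z z') \<partial>lborel) \<in> borel_measurable lborel" unfolding H_def by measurable
      then show ?thesis by simp
    qed
    have "ennreal (e n) * (\<integral>\<^sup>+x. \<integral>\<^sup>+q. ennreal (F n x q) \<partial>(lborel \<Otimes>\<^sub>M lborel) \<partial>lborel)
        = (\<integral>\<^sup>+x. ennreal (e n) * (\<integral>\<^sup>+q. ennreal (F n x q) \<partial>(lborel \<Otimes>\<^sub>M lborel)) \<partial>lborel)"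
    proof (rule nn_integral_cmult[symmetric])
      show "(\<lambda>x. \<integral>\<^sup>+q. ennreal (F n x q) \<partial>(lborel \<Otimes>\<^sub>M lborel)) \<in> borel_measurable lborel"
        unfolding split[OF Fpm(1)] by measurable
    qed
    also have "\<dots> = (\<integral>\<^sup>+x. \<integral>\<^sup>+y. \<integral>\<^sup>+t. \<integral>\<^sup>+s. ennreal (H (x, t) (y, s)) \<partial>lborel \<partial>lborel \<partial>lborel \<partial>lborel)"
    proof (intro nn_integral_cong)
      fix x
      have "ennreal (e n) * (\<integral>\<^sup>+q. ennreal (F n x q) \<partial>(lborel \<Otimes>\<^sub>M lborel))
          = (\<integral>\<^sup>+y. \<integral>\<^sup>+t. ennreal (e n) * (\<integral>\<^sup>+\<tau>. ennreal (F n x ((y, t), \<tau>)) \<partial>lborel) \<partial>lborel \<partial>lborel)"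
        unfolding split[OF Fpm(1)]
        by (simp add: nn_integral_cmult)
      also have "\<dots> = (\<integral>\<^sup>+y. \<integral>\<^sup>+t. \<integral>\<^sup>+s. ennreal (H (x, t) (y, s)) \<partial>lborel \<partial>lborel \<partial>lborel)"
      proof (intro nn_integral_cong)
        fix y t
        have "(\<integral>\<^sup>+s. ennreal (H (x, t) (y, s)) \<partial>lborel) = ennreal \<bar>e n\<bar> * (\<integral>\<^sup>+\<tau>. ennreal (H (x, t) (y, t + e n * \<tau>)) \<partial>lborel)"
          by (rule nn_integral_real_affine) (use e[of n] in \<open>auto simp del: abs_of_pos\<close>)
        also have "\<dots> = ennreal (e n) * (\<integral>\<^sup>+\<tau>. ennreal (F n x ((y, t), \<tau>)) \<partial>lborel)"
          using e(1)[of n] by (simp add: H_def F_def)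
        finally show "ennreal (e n) * (\<integral>\<^sup>+\<tau>. ennreal (F n x ((y, t), \<tau>)) \<partial>lborel) = (\<integral>\<^sup>+s. ennreal (H (x, t) (y, s)) \<partial>lborel)" ..
      qed
      finally show "ennreal (e n) * (\<integral>\<^sup>+q. ennreal (F n x q) \<partial>(lborel \<Otimes>\<^sub>M lborel))
          = (\<integral>\<^sup>+y. \<integral>\<^sup>+t. \<integral>\<^sup>+s. ennreal (H (x, t) (y, s)) \<partial>lborel \<partial>lborel \<partial>lborel)" .
    qed
    also have "\<dots> = (\<integral>\<^sup>+x. \<integral>\<^sup>+t. \<integral>\<^sup>+y. \<integral>\<^sup>+s. ennreal (H (x, t) (y, s)) \<partial>lborel \<partial>lborel \<partial>lborel \<partial>lborel)"
      by (intro nn_integral_cong lborel_pair.Fubini') measurable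
    also have "\<dots> = (\<integral>\<^sup>+x. \<integral>\<^sup>+t. \<integral>\<^sup>+z'. ennreal (H (x, t) z') \<partial>lborel \<partial>lborel \<partial>lborel)"
      by (intro nn_integral_cong nn_integral_R4(2)[symmetric]) measurable
    also have "\<dots> = (\<integral>\<^sup>+z. \<integral>\<^sup>+z'. ennreal (H z z') \<partial>lborel \<partial>lborel)"
      by (rule nn_integral_R4(2)[symmetric]) measurable
    also have "\<dots> \<le> ennreal (B * e n)"
      unfolding H_def w_def by (rule bound) (use e in auto)
    also have "\<dots> = ennreal (e n) * ennreal B" using B e(1)[of n] by (simp add: ennreal_mult mult.commute)
    finally show ?thesis using e(1)[of n] by (subst (asm) ennreal_mult_le_mult_iff) auto
  qed
  have lower: "(\<integral>\<^sup>+q. ennreal (F0 x q) \<partial>(lborel \<Otimes>\<^sub>M lborel)) \<le> (\<integral>\<^sup>+q. liminf (\<lambda>n. ennreal (F (r n) x q)) \<partial>(lborel \<Otimes>\<^sub>M lborel))" for x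
    using ae
  proof (intro nn_integral_mono_AE, eventually_elim)
    case (elim q)
    obtain y t \<tau> where q: "q = ((y, t), \<tau>)" by (metis prod.exhaust)
    show ?case
    proof (cases "x = y")
      \<comment> \<open>On the diagonal \<open>ker \<mu> 0\<close> is 0 by the default value of
        \<open>0 powr (-1/2)\<close>, so the lower bound is trivial there.\<close>
      case True
      then have "F0 x q = 0" unfolding F0_def q w_def ker_def by simp
      then show ?thesis by simp
    next
      case False
      \<comment> \<open>The convergence is known after multiplication by the Gaussian weight, which
        is positive and can be divided out.\<close>
      have "(\<lambda>n. (V ((y, t) + e (r n) *\<^sub>R Tm \<tau>) - V (y, t)) * gs \<tau> / gs \<tau>) \<longlonglongrightarrow> 0 / gs \<tau>"
        using elim unfolding q by (intro tendsto_divide tendsto_const) (auto simp: gs_def)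
      then have "(\<lambda>n. V ((y, t) + e (r n) *\<^sub>R Tm \<tau>) - V (y, t)) \<longlonglongrightarrow> 0" by (simp add: gs_def)
      then have Vl: "(\<lambda>n. V (y, t + e (r n) * \<tau>)) \<longlonglongrightarrow> V (y, t)"
        unfolding Tm_def by (simp add: LIM_zero_iff)
      have pos: "(x - y) \<bullet> (x - y) > 0" using False by simp
      have "isCont (ker \<mu>) ((x - y) \<bullet> (x - y))" by (rule DERIV_isCont[OF ker_deriv[OF pos]])
      moreover have "(\<lambda>n. (e (r n))\<^sup>2 + (x - y) \<bullet> (x - y)) \<longlonglongrightarrow> 0\<^sup>2 + (x - y) \<bullet> (x - y)"
        using LIMSEQ_subseq_LIMSEQ[OF elim0 r] by (intro tendsto_intros) (simp add: o_def)
      ultimately have wl: "(\<lambda>n. w (e (r n)) x y) \<longlonglongrightarrow> w 0 x y"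
        unfolding w_def by (intro isCont_tendsto_compose[of _ "ker \<mu>"]) simp_all
      have "(\<lambda>n. F (r n) x q) \<longlonglongrightarrow> F0 x q"
        unfolding F_def F0_def q fst_conv snd_conv by (intro tendsto_intros Vl wl)
      then have "(\<lambda>n. ennreal (F (r n) x q)) \<longlonglongrightarrow> ennreal (F0 x q)" by (rule tendsto_ennrealI)
      then show ?thesis by (simp add: lim_imp_Liminf)
    qed
  qed
  have inF0: "(\<integral>\<^sup>+q. ennreal (F0 x q) \<partial>(lborel \<Otimes>\<^sub>M lborel)) = ennreal (gmass TYPE(real)) * (\<integral>\<^sup>+t. \<integral>\<^sup>+y. ennreal (P (x, t) * V (y, t) * w 0 x y) \<partial>lborel \<partial>lborel)" for x
  proof -
    have "(\<integral>\<^sup>+q. ennreal (F0 x q) \<partial>(lborel \<Otimes>\<^sub>M lborel)) = (\<integral>\<^sup>+y. \<integral>\<^sup>+t. \<integral>\<^sup>+\<tau>. ennreal (P (x, t) * V (y, t) * w 0 x y) * ennreal (gs (\<tau>::real)) \<partial>lborel \<partial>lborel \<partial>lborel)"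
      by (subst split[OF Fpm(2)], intro nn_integral_cong) (simp add: F0_def ennreal_mult'[symmetric] P0 V0 w0 mult_ac)
    also have "\<dots> = (\<integral>\<^sup>+y. \<integral>\<^sup>+t. ennreal (P (x, t) * V (y, t) * w 0 x y) * ennreal (gmass TYPE(real)) \<partial>lborel \<partial>lborel)"
      unfolding gmass_nn[symmetric] by (intro nn_integral_cong nn_integral_cmult) measurable
    also have "\<dots> = (\<integral>\<^sup>+t. \<integral>\<^sup>+y. ennreal (P (x, t) * V (y, t) * w 0 x y) * ennreal (gmass TYPE(real)) \<partial>lborel \<partial>lborel)"
      by (rule lborel_pair.Fubini') measurable
    also have "\<dots> = (\<integral>\<^sup>+t. (\<integral>\<^sup>+y. ennreal (P (x, t) * V (y, t) * w 0 x y) \<partial>lborel) * ennreal (gmass TYPE(real)) \<partial>lborel)"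
      by (intro nn_integral_cong nn_integral_multc) measurable
    also have "\<dots> = (\<integral>\<^sup>+t. \<integral>\<^sup>+y. ennreal (P (x, t) * V (y, t) * w 0 x y) \<partial>lborel \<partial>lborel) * ennreal (gmass TYPE(real))"
      by (rule nn_integral_multc) measurable
    finally show ?thesis by (simp add: mult.commute)
  qed
  have "ennreal (gmass TYPE(real)) * (\<integral>\<^sup>+z. \<integral>\<^sup>+y. ennreal (P z * V (y, snd z) * w 0 (fst z) y) \<partial>lborel \<partial>lborel)
     = ennreal (gmass TYPE(real)) * (\<integral>\<^sup>+x. \<integral>\<^sup>+t. \<integral>\<^sup>+y. ennreal (P (x, t) * V (y, t) * w 0 x y) \<partial>lborel \<partial>lborel \<partial>lborel)"
  proof -
    have "(\<lambda>z. \<integral>\<^sup>+y. ennreal (P z * V (y, snd z) * w 0 (fst z) y) \<partial>lborel) \<in> borel_measurable lborel" by measurable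
    then show ?thesis by (subst nn_integral_R4(2)) auto
  qed
  also have "\<dots> = (\<integral>\<^sup>+x. \<integral>\<^sup>+q. ennreal (F0 x q) \<partial>(lborel \<Otimes>\<^sub>M lborel) \<partial>lborel)"
    unfolding inF0 by (rule nn_integral_cmult[symmetric]) measurable
  also have "\<dots> \<le> (\<integral>\<^sup>+x. liminf (\<lambda>n. \<integral>\<^sup>+q. ennreal (F (r n) x q) \<partial>(lborel \<Otimes>\<^sub>M lborel)) \<partial>lborel)"
    by (intro nn_integral_mono order_trans[OF lower nn_integral_liminf]) (use Fpm(1) in simp)
  also have "\<dots> \<le> liminf (\<lambda>n. \<integral>\<^sup>+x. \<integral>\<^sup>+q. ennreal (F (r n) x q) \<partial>(lborel \<Otimes>\<^sub>M lborel) \<partial>lborel)"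
  proof (rule nn_integral_liminf)
    show "(\<lambda>x. \<integral>\<^sup>+q. ennreal (F (r n) x q) \<partial>(lborel \<Otimes>\<^sub>M lborel)) \<in> borel_measurable lborel" for n
      unfolding split[OF Fpm(1)] by measurable
  qed
  also have "\<dots> \<le> limsup (\<lambda>n. \<integral>\<^sup>+x. \<integral>\<^sup>+q. ennreal (F (r n) x q) \<partial>(lborel \<Otimes>\<^sub>M lborel) \<partial>lborel)"
    by (rule Liminf_le_Limsup) simp
  also have "\<dots> \<le> ennreal B" by (intro Limsup_bounded always_eventually allI step)
  finally show ?thesis unfolding w_def by simp
qed

text \<open>All constants are fixed from the domain, the cutoff, \<mu> and the bounds before a
  solution is introduced, which gives uniformity over all flows.\<close>

theorem weak_flow_potential_bound:
  assumes \<Omega>: "open \<Omega>" "bounded \<Omega>" and T: "T > 0" and E: "E \<ge> 0" and F: "F \<ge> 0" and s1: "s1 \<ge> 0"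
    and lam: "test_function (cylinder \<Omega> T) lam" and \<mu>: "0 < \<mu>" "\<mu> < 4/3"
  shows "\<exists>B\<ge>0. \<forall>\<rho> p u f S G. weak_flow \<Omega> T E F s1 lam \<rho> p u f S G \<longrightarrow>
    (\<integral>\<^sup>+z. \<integral>\<^sup>+y. ennreal (((lam z)\<^sup>2 * p z) * ((lam (y, snd z))\<^sup>2 * \<rho> (y, snd z)) * ker \<mu> ((fst z - y) \<bullet> (fst z - y))) \<partial>lborel \<partial>lborel) \<le> ennreal B"
proof -
  note W = test_function_square[OF lam]
  obtain M0 where M0: "M0 > 0" "\<And>z. norm ((lam z)\<^sup>2) \<le> M0" "\<And>z. norm (frechet_derivative (\<lambda>z. (lam z)\<^sup>2) (at z) (0, 1)) \<le> M0"
  proof -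
    show thesis using test_function_bounded[OF W, of "(0, 1)"] by (elim exE conjE) (rule that, auto)
  qed
  have "\<forall>j::3. \<exists>M>0. (\<forall>z. norm (frechet_derivative (\<lambda>z. (lam z)\<^sup>2) (at z) (axis j 1, 0)) \<le> M)"
  proof
    fix j :: 3
    show "\<exists>M>0. (\<forall>z. norm (frechet_derivative (\<lambda>z. (lam z)\<^sup>2) (at z) (axis j 1, 0)) \<le> M)"
      using test_function_bounded[OF W, of "(axis j 1, 0)"] by (elim exE conjE) (intro exI conjI)
  qed
  from choice[OF this] obtain Mj where
    Mj': "\<forall>j. Mj j > 0 \<and> (\<forall>z. norm (frechet_derivative (\<lambda>z. (lam z)\<^sup>2) (at z) (axis j 1, 0)) \<le> Mj j)" by (rule exE)
  note Mj = conjunct1[OF spec[OF Mj']] spec[OF conjunct2[OF spec[OF Mj']]]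
  have "\<forall>j::3. \<exists>M>0. (\<forall>z. norm (lam z) \<le> M) \<and> (\<forall>z. norm (frechet_derivative lam (at z) (axis j 1, 0)) \<le> M)"
    using test_function_bounded[OF lam] by (rule allI)
  from choice[OF this] obtain Lj where
    Lj': "\<forall>j. Lj j > 0 \<and> (\<forall>z. norm (lam z) \<le> Lj j) \<and> (\<forall>z. norm (frechet_derivative lam (at z) (axis j 1, 0)) \<le> Lj j)" by (rule exE)
  note Lj = conjunct1[OF spec[OF Lj']] spec[OF conjunct1[OF conjunct2[OF spec[OF Lj']]]] spec[OF conjunct2[OF conjunct2[OF spec[OF Lj']]]]
  define M where "M = M0 + (\<Sum>j\<in>UNIV. Mj j)"
  define \<Lambda> where "\<Lambda> = (\<Sum>j\<in>UNIV. Lj j)"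
  have M1: "(lam z)\<^sup>2 \<le> M" "\<bar>dt (\<lambda>z. (lam z)\<^sup>2) z\<bar> \<le> M" "norm (grad_x (\<lambda>z. (lam z)\<^sup>2) z) \<le> M" for z
  proof -
    have s: "(\<Sum>j\<in>UNIV. Mj j) \<ge> 0" by (intro sum_nonneg less_imp_le Mj)
    show "(lam z)\<^sup>2 \<le> M" "\<bar>dt (\<lambda>z. (lam z)\<^sup>2) z\<bar> \<le> M"
      using M0(2)[of z] M0(3)[of z] s unfolding M_def dt_def by auto
    have "norm (grad_x (\<lambda>z. (lam z)\<^sup>2) z) \<le> (\<Sum>j\<in>UNIV. \<bar>grad_x (\<lambda>z. (lam z)\<^sup>2) z $ j\<bar>)"
      by (rule norm_le_l1_cart)
    also have "\<dots> \<le> (\<Sum>j\<in>UNIV. Mj j)"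
      unfolding grad_x_def using Mj(2) by (intro sum_mono) simp
    finally show "norm (grad_x (\<lambda>z. (lam z)\<^sup>2) z) \<le> M" using M0(1) unfolding M_def by simp
  qed
  have Lle: "Lj j \<le> \<Lambda>" for j unfolding \<Lambda>_def by (rule member_le_sum) (auto intro: less_imp_le Lj)
  have Lam: "\<bar>lam z\<bar> \<le> \<Lambda>" "\<bar>frechet_derivative lam (at z) (axis j 1, 0)\<bar> \<le> \<Lambda>" for z j
    using Lj(2)[of z 1] Lj(3)[of z j] Lle[of 1] Lle[of j] by auto
  obtain R0 where R0: "R0 > 0" "\<And>x. x \<in> \<Omega> \<Longrightarrow> norm x \<le> R0" using \<Omega>(2) bounded_pos by blast
  define R where "R = 2 * R0 + 1"
  have R: "norm (x - y) < R" if "x \<in> \<Omega>" "y \<in> \<Omega>" for x y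
    using norm_triangle_ineq4[of x y] R0(2)[OF that(1)] R0(2)[OF that(2)] unfolding R_def by linarith
  have R1: "R \<ge> 1" unfolding R_def using R0 by simp
  have "1 + R\<^sup>2 > 0" by (simp add: add_pos_nonneg)
  from ker_le_cubker[OF this \<mu>(1)] obtain C0 where C0: "C0 > 0"
    "\<And>q. 0 < q \<Longrightarrow> q \<le> 1 + R\<^sup>2 \<Longrightarrow> lgw q powr (3 * \<mu>) \<le> C0 * cubker \<mu> q \<and> ker \<mu> q powr (3/2) \<le> C0 * cubker \<mu> q"
    by blast
  define C where "C = C0 + 1"
  have C1: "C \<ge> 1" using C0(1) by (simp add: C_def)
  have C: "lgw q powr (3 * \<mu>) \<le> C * cubker \<mu> q \<and> ker \<mu> q powr (3/2) \<le> C * cubker \<mu> q" if "0 < q" "q \<le> 1 + R\<^sup>2" for q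
    using C0(1) C0(2)[OF that] cubker_pos[OF that(1), of \<mu>] unfolding C_def by (auto simp: distrib_right)
  obtain C\<kappa> where C\<kappa>: "C\<kappa> > 0"
    "\<And>d::real. (\<integral>\<^sup>+z. ennreal (cubker \<mu> (d\<^sup>2 + z \<bullet> z)) * indicator (ball 0 R) (z::real^3) \<partial>lborel) \<le> ennreal C\<kappa>"
    using cubker_integral_ball[OF R1 \<mu>] by blast
  define c0 where "c0 = 2 * (M\<^sup>2 * (6 + F + 5 * s1)) + 16 * (1 / 8) powr (- 2 / 3) * M * (\<mu> + 1)\<^sup>2"
  define v0 where "v0 = measure lborel \<Omega>"
  define B where "B = 2 * c0 * (C * C\<kappa> + v0 + E) * (v0 * T + E * T + E * T + E\<^sup>2 + (T + E\<^sup>2) * (E + 884736 * \<Lambda>^6))"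
  have M_nonneg: "M \<ge> 0" using M1(1)[of undefined] zero_le_power2[of "lam undefined"] by linarith
  have L0: "\<Lambda> \<ge> 0" using Lam(1)[of undefined] by linarith
  have B0: "B \<ge> 0"
    unfolding B_def c0_def v0_def using M_nonneg F s1 C1 C\<kappa>(1) E T L0 \<mu> R1
    by (intro mult_nonneg_nonneg add_nonneg_nonneg) (auto simp: measure_nonneg)
  \<comment> \<open>The mass of the time Gaussian appears both in the doubled bound and in front of
    the limit, and cancels.\<close>
  define gm where "gm = gmass TYPE(real)"
  have gm: "gm > 0" unfolding gm_def by (rule gmass_pos)
  show ?thesis
  proof (intro exI[of _ B] conjI allI impI B0)
    fix \<rho> p :: "R4 \<Rightarrow> real" and u f :: "R4 \<Rightarrow> R3" and S G :: "R4 \<Rightarrow> real^3^3"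
    assume wf: "weak_flow \<Omega> T E F s1 lam \<rho> p u f S G"
    interpret weak_flow \<Omega> T E F s1 lam \<rho> p u f S G by (rule wf)
    have "ennreal gm * (\<integral>\<^sup>+z. \<integral>\<^sup>+y. ennreal (((lam z)\<^sup>2 * p z) * ((lam (y, snd z))\<^sup>2 * \<rho> (y, snd z)) * ker \<mu> ((fst z - y) \<bullet> (fst z - y))) \<partial>lborel \<partial>lborel)
        \<le> ennreal (B * gm)"
      unfolding gm_def
    proof (rule potential_limit[where P = "\<lambda>z. (lam z)\<^sup>2 * p z" and V = "\<lambda>z. (lam z)\<^sup>2 * \<rho> z"])
      show "(\<lambda>z. (lam z)\<^sup>2 * p z) \<in> borel_measurable borel" by measurable
      show "(lam z)\<^sup>2 * p z \<ge> 0" "(lam z)\<^sup>2 * \<rho> z \<ge> 0" for z using p_nonneg[of z] rho(1)[of z] by auto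
      show "integrable lborel (\<lambda>z. (lam z)\<^sup>2 * \<rho> z)"
      proof (rule Bochner_Integration.integrable_bound[OF integrable_mult_right[OF en_integrable, of M]])
        show "(\<lambda>z. (lam z)\<^sup>2 * \<rho> z) \<in> borel_measurable lborel" by measurable
        have "(lam z)\<^sup>2 * \<rho> z \<le> M * en z" for z
          using M1(1)[of z] en_dominates(2)[of z] rho(1)[of z] M_nonneg by (intro mult_mono) auto
        then show "AE z in lborel. norm ((lam z)\<^sup>2 * \<rho> z) \<le> norm (M * en z)"
          using rho(1) by (intro AE_I2) (auto intro: order_trans[OF _ abs_ge_self])
      qed
      show "B * gmass TYPE(real) \<ge> 0" using B0 gm unfolding gm_def by simp
      fix d h :: real assume d: "0 < d" "d \<le> 1" and h: "h > 0"
      have wd: "weak_flow_doubled \<Omega> T E F s1 lam \<rho> p u f S G \<mu> d h M"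
        by (intro weak_flow_doubled.intro wf weak_flow_doubled_axioms.intro \<mu> d(1) h M1)
      have we: "weak_flow_estimate \<Omega> T E F s1 lam \<rho> p u f S G \<mu> d h M R C C\<kappa> \<Lambda>"
        using C\<kappa>(1) by (intro weak_flow_estimate.intro wd weak_flow_estimate_axioms.intro d(2) R C1 C C\<kappa>(2) Lam) simp_all
      have Kp: "weak_flow_estimate.Kp lam \<rho> p \<mu> d h z z'
          = gs ((snd z - snd z') / h) * ((lam z)\<^sup>2 * p z * ((lam z')\<^sup>2 * \<rho> z') * ker \<mu> (d\<^sup>2 + (fst z - fst z') \<bullet> (fst z - fst z')))" for z z'
        unfolding weak_flow_estimate.Kp_def[OF we] weak_flow_doubled.et_def[OF wd] weak_flow_doubled.W_def[OF wd]
          weak_flow_doubled.qq_def[OF wd] by (simp only: mult_ac)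
      have "(\<integral>\<^sup>+z. \<integral>\<^sup>+z'. ennreal (gs ((snd z - snd z') / h) * ((lam z)\<^sup>2 * p z * ((lam z')\<^sup>2 * \<rho> z') * ker \<mu> (d\<^sup>2 + (fst z - fst z') \<bullet> (fst z - fst z')))) \<partial>lborel \<partial>lborel)
         \<le> ennreal (2 * c0 * gmass TYPE(real) * (C * C\<kappa> + v0 + E) * (v0 * T + E * T + E * T + E\<^sup>2 + (T + E\<^sup>2) * (E + 884736 * \<Lambda>^6)) * h)"
        using weak_flow_estimate.doubled_potential_bound[OF we]
        unfolding Kp weak_flow_estimate.c_def[OF we] weak_flow.vol_def[OF wf] c0_def v0_def .
      also have "\<dots> = ennreal (B * gmass TYPE(real) * h)" unfolding B_def by (simp only: mult_ac)
      finally show "(\<integral>\<^sup>+z. \<integral>\<^sup>+z'. ennreal (gs ((snd z - snd z') / h) * ((lam z)\<^sup>2 * p z * ((lam z')\<^sup>2 * \<rho> z') * ker \<mu> (d\<^sup>2 + (fst z - fst z') \<bullet> (fst z - fst z')))) \<partial>lborel \<partial>lborel)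
         \<le> ennreal (B * gmass TYPE(real) * h)" .
    qed (use \<mu> in auto)
    also have "ennreal (B * gm) = ennreal gm * ennreal B" using B0 gm by (simp add: ennreal_mult mult.commute)
    finally show "(\<integral>\<^sup>+z. \<integral>\<^sup>+y. ennreal (((lam z)\<^sup>2 * p z) * ((lam (y, snd z))\<^sup>2 * \<rho> (y, snd z)) * ker \<mu> ((fst z - y) \<bullet> (fst z - y))) \<partial>lborel \<partial>lborel) \<le> ennreal B"
      using gm by (subst (asm) ennreal_mult_le_mult_iff) auto
  qed
qed

section \<open>Borel representatives\<close>

text \<open>Solutions are Lebesgue measurable on the cylinder, whereas the product measure arguments
  work with Borel functions on the whole space. The representative is chosen componentwise, since
  the completion result concerns real functions.\<close>

lemma borel_representative:
  fixes g :: "'a::euclidean_space \<Rightarrow> 'b::euclidean_space"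
  assumes g: "g \<in> borel_measurable (lebesgue_on S)" and S [measurable]: "S \<in> sets borel"
  shows "\<exists>g'\<in>borel_measurable borel. (\<forall>z. z \<notin> S \<longrightarrow> g' z = 0) \<and> (AE z in lborel. z \<in> S \<longrightarrow> g' z = g z)"
proof -
  have g0: "(\<lambda>z. if z \<in> S then g z else 0) \<in> borel_measurable lebesgue"
    using S by (intro borel_measurable_if_I[OF g]) simp
  have "\<forall>b. \<exists>h\<in>borel_measurable lborel. AE z in lborel. (if z \<in> S then g z else 0) \<bullet> b = h z"
    by (intro allI completion_ex_borel_measurable_real borel_measurable_inner g0 borel_measurable_const)
  then obtain h where h: "\<And>b. h b \<in> borel_measurable lborel" "\<And>b. AE z in lborel. (if z \<in> S then g z else 0) \<bullet> b = h b z"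
    by metis
  have [measurable]: "h b \<in> borel_measurable borel" for b using h(1)[of b] by simp
  show ?thesis
  proof (intro bexI conjI)
    show "(\<lambda>z. indicat_real S z *\<^sub>R (\<Sum>b\<in>Basis. h b z *\<^sub>R b)) \<in> borel_measurable borel" by measurable
    have "AE z in lborel. \<forall>b\<in>Basis. (if z \<in> S then g z else 0) \<bullet> b = h b z"
      by (intro AE_finite_allI h(2)) simp
    then show "AE z in lborel. z \<in> S \<longrightarrow> indicat_real S z *\<^sub>R (\<Sum>b\<in>Basis. h b z *\<^sub>R b) = g z"
    proof eventually_elim
      case (elim z)
      show ?case
      proof
        assume z: "z \<in> S"
        have "(\<Sum>b\<in>Basis. h b z *\<^sub>R b) = (\<Sum>b\<in>Basis. (g z \<bullet> b) *\<^sub>R b)"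
          using elim z by (intro sum.cong) auto
        then show "indicat_real S z *\<^sub>R (\<Sum>b\<in>Basis. h b z *\<^sub>R b) = g z"
          using z by (simp add: euclidean_representation)
      qed
    qed
  qed auto
qed

lemma AE_lebesgue_on_iff:
  assumes "S \<in> sets borel"
  shows "(AE z in lebesgue_on S. P z) \<longleftrightarrow> (AE z in lborel. z \<in> S \<longrightarrow> P z)"
  using assms by (subst AE_restrict_space_iff) (auto simp: AE_completion_iff)

lemma nn_integral_lebesgue_on:
  assumes "S \<in> sets borel"
  shows "(\<integral>\<^sup>+z. g z \<partial>lebesgue_on S) = (\<integral>\<^sup>+z. g z * indicator S z \<partial>lborel)"
  using assms by (subst nn_integral_restrict_space) (auto simp: nn_integral_completion)

text \<open>The function \<open>g\<close> inherits its measurability from \<open>h\<close> through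
  equality almost everywhere, because Lebesgue measure is complete.\<close>

lemma integral_lebesgue_on:
  fixes g h :: "'a::euclidean_space \<Rightarrow> real"
  assumes S: "S \<in> sets borel" and h: "h \<in> borel_measurable borel" and off: "\<And>z. z \<notin> S \<Longrightarrow> h z = 0"
    and eq: "AE z in lborel. z \<in> S \<longrightarrow> h z = g z"
  shows "(\<integral>z. g z \<partial>lebesgue_on S) = (\<integral>z. h z \<partial>lborel)"
proof -
  have hl: "h \<in> borel_measurable lborel" using h by simp
  then have hL: "h \<in> borel_measurable lebesgue" by (rule measurable_completion)
  have ae: "AE z in lebesgue. h z = indicat_real S z *\<^sub>R g z"
    using eq by (subst AE_completion_iff, eventually_elim) (auto simp: off indicator_def)
  have "(\<integral>z. g z \<partial>lebesgue_on S) = (\<integral>z. indicat_real S z *\<^sub>R g z \<partial>lebesgue)"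
    using S by (intro integral_restrict_space) simp
  also have "\<dots> = (\<integral>z. h z \<partial>lebesgue)"
    by (rule integral_cong_AE[OF hL borel_measurable_AE[OF hL ae] ae, symmetric])
  also have "\<dots> = (\<integral>z. h z \<partial>lborel)" by (rule integral_completion[OF hl])
  finally show ?thesis .
qed

text \<open>Fubini for null sets with time as the outer variable: a statement valid almost
  everywhere in space-time holds on almost every time slice.\<close>

lemma AE_lborel_slice:
  fixes P :: "'a::euclidean_space \<times> 'b::euclidean_space \<Rightarrow> bool"
  assumes "AE z in lborel. P z"
  shows "AE t in lborel. AE x in lborel. P (x, t)"
proof -
  from AE_E3[OF assms] obtain N where N: "\<And>x. x \<notin> N \<Longrightarrow> P x" "N \<in> null_sets lborel" by auto
  have Ns [measurable]: "N \<in> sets (borel \<Otimes>\<^sub>M borel)" using null_setsD2[OF N(2)] by (subst borel_prod) simp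
  have "AE z in lborel \<Otimes>\<^sub>M lborel. z \<notin> N" unfolding lborel_prod by (rule AE_not_in[OF N(2)])
  then have "AE x in lborel. AE t in lborel. (x, t) \<notin> N" by (rule lborel_pair.AE_pair)
  moreover have "{z \<in> space (lborel \<Otimes>\<^sub>M lborel). (fst z, snd z) \<notin> N} \<in> sets (lborel \<Otimes>\<^sub>M lborel)"
    unfolding prod.collapse by measurable
  ultimately have "AE t in lborel. AE x in lborel. (x, t) \<notin> N"
    by (subst (asm) lborel_pair.AE_commute)
  then show ?thesis by (elim eventually_mono) (rule N(1))
qed

lemma AE_lborel_snd:
  assumes "AE t in lborel. P (t :: 'b::euclidean_space)"
  shows "AE z in lborel. P (snd (z :: 'a::euclidean_space \<times> 'b))"
proof -
  from AE_E3[OF assms] obtain N where N: "\<And>x. x \<notin> N \<Longrightarrow> P x" "N \<in> null_sets lborel" by auto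
  have [measurable]: "N \<in> sets borel" using N(2) by auto
  have "{z \<in> space (lborel \<Otimes>\<^sub>M lborel). snd (z :: 'a \<times> 'b) \<notin> N} \<in> sets (lborel \<Otimes>\<^sub>M lborel)"
    by measurable
  then have "AE z in lborel \<Otimes>\<^sub>M lborel. snd (z :: 'a \<times> 'b) \<notin> N"
    by (rule lborel_pair.AE_pair_measure) (simp only: snd_conv, intro AE_I2 AE_not_in[OF N(2)])
  then show ?thesis unfolding lborel_prod by (rule AE_mp) (intro AE_I2 impI N(1))
qed

section \<open>Translation of the energy norms and the weak equations to Borel data\<close>

lemma ennsqrt_le_iff: "0 \<le> E \<Longrightarrow> ennsqrt X \<le> ennreal E \<Longrightarrow> X \<le> ennreal (E\<^sup>2)"
  by (cases X) (auto simp: ennsqrt_def top_unique ennreal_le_iff real_sqrt_le_iff intro: sqrt_le_D)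

lemma norm_Linf_L1_AE:
  assumes "norm_Linf_L1 \<Omega> T g \<le> e"
  shows "AE t in lborel. t \<in> {0<..<T} \<longrightarrow> (\<integral>\<^sup>+x. ennreal \<bar>g (x, t)\<bar> \<partial>lebesgue_on \<Omega>) \<le> e"
proof -
  have "AE t in lebesgue_on {0<..<T}. (\<integral>\<^sup>+x. ennreal \<bar>g (x, t)\<bar> \<partial>lebesgue_on \<Omega>) \<le> norm_Linf_L1 \<Omega> T g"
    unfolding norm_Linf_L1_def by (rule esssup_AE)
  then show ?thesis
    using assms by (subst (asm) AE_lebesgue_on_iff) (auto elim!: eventually_mono)
qed

lemma stress_measurable [measurable]:
  assumes [measurable]: "g \<in> borel_measurable M"
  shows "(\<lambda>x. stress \<nu>1 \<nu>2 (g x)) \<in> borel_measurable M"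
proof -
  have "continuous_on UNIV (stress \<nu>1 \<nu>2)"
    unfolding stress_def transpose_def trace_def by (intro continuous_intros)
  from measurable_compose[OF assms borel_measurable_continuous_onI[OF this]] show ?thesis .
qed

lemma test_function_measurable:
  fixes \<phi> :: "'a::euclidean_space \<Rightarrow> 'b::real_normed_vector"
  assumes "test_function U \<phi>"
  shows "\<phi> \<in> borel_measurable borel" "(\<lambda>x. frechet_derivative \<phi> (at x) v) \<in> borel_measurable borel"
  by (intro borel_measurable_continuous_onI test_function_continuous[OF assms] test_function_deriv(2)[OF assms])+

lemma grad_measurable:
  shows "test_function U \<psi> \<Longrightarrow> grad_x \<psi> \<in> borel_measurable borel"
    and "test_function U \<xi> \<Longrightarrow> Grad_x \<xi> \<in> borel_measurable borel"
  unfolding grad_x_def Grad_x_def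
  by (intro borel_measurable_continuous_onI continuous_intros test_function_deriv(2); assumption)+

text \<open>Changing the solution on null sets leaves the integrals in the norms and weak equations
  unchanged, so all hypotheses carry over. The factor
  \<open>2 * \<bar>\<nu>1\<bar> + 4 * \<bar>\<nu>2\<bar>\<close> is that of
  \<open>norm_stress_le\<close>.\<close>

lemma weak_flow_representative:
  assumes \<Omega>: "open \<Omega>" "bounded \<Omega>" and T: "T > 0" and E: "E \<ge> 0" and F: "F \<ge> 0"
    and lam: "test_function (cylinder \<Omega> T) lam" and \<epsilon>: "\<epsilon> > 0"
    and fm: "f\<epsilon> \<in> borel_measurable (lebesgue_on (cylinder \<Omega> T))" and fF: "norm_Linf (cylinder \<Omega> T) f\<epsilon> \<le> ennreal F"
    and rm: "\<rho>\<epsilon> \<in> borel_measurable (lebesgue_on (cylinder \<Omega> T))" and r0: "AE z in lebesgue_on (cylinder \<Omega> T). \<rho>\<epsilon> z \<ge> 0"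
    and grad: "spatial_weak_gradient \<Omega> T u\<epsilon> Du\<epsilon>" and en: "energy_bound \<Omega> T m \<epsilon> E \<rho>\<epsilon> u\<epsilon> Du\<epsilon>"
    and mom: "momentum_equation \<Omega> T \<nu>1 \<nu>2 m \<epsilon> f\<epsilon> \<rho>\<epsilon> u\<epsilon> Du\<epsilon>" and cont: "continuity_equation \<Omega> T \<rho>\<epsilon> u\<epsilon>"
  obtains \<rho> p u f S G where "weak_flow \<Omega> T E F (2 * \<bar>\<nu>1\<bar> + 4 * \<bar>\<nu>2\<bar>) lam \<rho> p u f S G"
    "AE z in lborel. z \<in> cylinder \<Omega> T \<longrightarrow> \<rho> z = \<rho>\<epsilon> z"
proof -
  let ?Q = "cylinder \<Omega> T"
  have Om [measurable]: "\<Omega> \<in> sets borel" using \<Omega> by simp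
  have Q [measurable]: "?Q \<in> sets borel" using \<Omega> by (intro borel_open open_Times) auto
  have I [measurable]: "{0<..<T} \<in> sets borel" by simp
  from borel_representative[OF rm Q] obtain r where [measurable]: "r \<in> borel_measurable borel"
    and r: "\<And>z. z \<notin> ?Q \<Longrightarrow> r z = 0" "AE z in lborel. z \<in> ?Q \<longrightarrow> r z = \<rho>\<epsilon> z" by auto
  from borel_representative[OF fm Q] obtain g where [measurable]: "g \<in> borel_measurable borel"
    and g: "AE z in lborel. z \<in> ?Q \<longrightarrow> g z = f\<epsilon> z" by auto
  have "u\<epsilon> \<in> borel_measurable (lebesgue_on ?Q)" using grad unfolding spatial_weak_gradient_def by simp
  from borel_representative[OF this Q] obtain u where um [measurable]: "u \<in> borel_measurable borel"
    and u: "\<And>z. z \<notin> ?Q \<Longrightarrow> u z = 0" "AE z in lborel. z \<in> ?Q \<longrightarrow> u z = u\<epsilon> z" by auto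
  have "Du\<epsilon> \<in> borel_measurable (lebesgue_on ?Q)" using grad unfolding spatial_weak_gradient_def by simp
  from borel_representative[OF this Q] obtain G where Gm [measurable]: "G \<in> borel_measurable borel"
    and G: "\<And>z. z \<notin> ?Q \<Longrightarrow> G z = 0" "AE z in lborel. z \<in> ?Q \<longrightarrow> G z = Du\<epsilon> z" by auto
  \<comment> \<open>The truncations of the density here and of the force below alter null sets of
    the cylinder only, but make the sign and the bound hold at every point, as
    \<open>weak_flow\<close> demands.\<close>
  define \<rho> where "\<rho> = (\<lambda>z. max 0 (r z))"
  define p where "p = (\<lambda>z. \<rho> z powr (3/2) * P_eps m \<epsilon> \<rho> z)"
  define f where "f = (\<lambda>z. if norm (g z) \<le> F then g z else 0)"
  define S where "S = (\<lambda>z. stress \<nu>1 \<nu>2 (G z))"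
  have meas [measurable]: "\<rho> \<in> borel_measurable borel" "p \<in> borel_measurable borel" "f \<in> borel_measurable borel" "S \<in> borel_measurable borel"
    unfolding p_def P_eps_def \<rho>_def f_def S_def by measurable
  have off: "\<rho> z = 0 \<and> p z = 0 \<and> u z = 0 \<and> G z = 0" if "z \<notin> ?Q" for z
    using that r(1) u(1) G(1) by (simp add: \<rho>_def p_def)
  have Soff: "S z = 0" if "z \<notin> ?Q" for z
    using norm_stress_le[of \<nu>1 \<nu>2 "G z"] G(1)[OF that] by (simp add: S_def)
  have rho: "\<rho> z \<ge> 0" for z by (simp add: \<rho>_def)
  have P1: "P_eps m \<epsilon> \<rho> z \<ge> 1" for z using \<epsilon> by (simp add: P_eps_def)
  have p: "\<rho> z powr (3/2) \<le> p z" "p z \<ge> 0" for z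
    using mult_left_mono[OF P1[of z], of "\<rho> z powr (3/2)"] P1[of z] by (auto simp: p_def)
  have "AE z in lebesgue_on ?Q. ennreal (norm (f\<epsilon> z)) \<le> ennreal F"
    using esssup_AE[where M = "lebesgue_on ?Q" and f = "\<lambda>z. ennreal (norm (f\<epsilon> z))"] fF unfolding norm_Linf_def
    by (auto elim!: eventually_mono)
  then have fF': "AE z in lborel. z \<in> ?Q \<longrightarrow> norm (f\<epsilon> z) \<le> F"
    using F by (subst (asm) AE_lebesgue_on_iff[OF Q]) simp
  \<comment> \<open>The pressure is recorded also with an absolute value, the form in which
    \<open>norm_Linf_L1\<close> contains it.\<close>
  have all: "AE z in lborel. z \<in> ?Q \<longrightarrow> \<rho> z = \<rho>\<epsilon> z \<and> p z = \<rho>\<epsilon> z powr (3/2) * P_eps m \<epsilon> \<rho>\<epsilon> z \<and> p z = \<bar>\<rho>\<epsilon> z powr (3/2) * P_eps m \<epsilon> \<rho>\<epsilon> z\<bar>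
      \<and> \<rho>\<epsilon> z \<ge> 0 \<and> u z = u\<epsilon> z \<and> G z = Du\<epsilon> z \<and> S z = stress \<nu>1 \<nu>2 (Du\<epsilon> z) \<and> f z = f\<epsilon> z"
    using r(2) g u(2) G(2) fF' r0[unfolded AE_lebesgue_on_iff[OF Q]]
  proof eventually_elim
    case (elim z)
    show ?case
    proof
      assume z: "z \<in> ?Q"
      then have "\<rho> z = \<rho>\<epsilon> z" using elim by (simp add: \<rho>_def)
      moreover from this have "p z = \<rho>\<epsilon> z powr (3/2) * P_eps m \<epsilon> \<rho>\<epsilon> z" by (simp add: p_def P_eps_def)
      moreover from this have "p z = \<bar>\<rho>\<epsilon> z powr (3/2) * P_eps m \<epsilon> \<rho>\<epsilon> z\<bar>" using p(2)[of z] by simp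
      ultimately show "\<rho> z = \<rho>\<epsilon> z \<and> p z = \<rho>\<epsilon> z powr (3/2) * P_eps m \<epsilon> \<rho>\<epsilon> z \<and> p z = \<bar>\<rho>\<epsilon> z powr (3/2) * P_eps m \<epsilon> \<rho>\<epsilon> z\<bar>
      \<and> \<rho>\<epsilon> z \<ge> 0 \<and> u z = u\<epsilon> z \<and> G z = Du\<epsilon> z \<and> S z = stress \<nu>1 \<nu>2 (Du\<epsilon> z) \<and> f z = f\<epsilon> z"
        using elim z by (simp add: S_def f_def)
    qed
  qed
  note slices = AE_lborel_slice[OF all]
  have e1: "norm_Linf_L1 \<Omega> T (\<lambda>z. \<rho>\<epsilon> z powr (3/2) * P_eps m \<epsilon> \<rho>\<epsilon> z) \<le> ennreal E"
    and e2: "norm_Linf_L1 \<Omega> T (\<lambda>z. \<rho>\<epsilon> z * (norm (u\<epsilon> z))\<^sup>2) \<le> ennreal E"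
    and e3: "norm_L2_W12 \<Omega> T u\<epsilon> Du\<epsilon> \<le> ennreal E"
    using en unfolding energy_bound_def
    by (auto intro: order_trans[rotated] simp: add_increasing add_increasing2)
  have pE: "AE t in lborel. (\<integral>\<^sup>+x. ennreal (p (x, t)) \<partial>lborel) \<le> ennreal E"
    using norm_Linf_L1_AE[OF e1] slices
  proof eventually_elim
    case (elim t)
    show ?case
    proof (cases "t \<in> {0<..<T}")
      case True
      have "(\<integral>\<^sup>+x. ennreal (p (x, t)) \<partial>lborel) = (\<integral>\<^sup>+x. ennreal \<bar>\<rho>\<epsilon> (x, t) powr (3/2) * P_eps m \<epsilon> \<rho>\<epsilon> (x, t)\<bar> \<partial>lebesgue_on \<Omega>)"
        unfolding nn_integral_lebesgue_on[OF Om] using elim(2)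
        by (intro nn_integral_cong_AE, eventually_elim) (use True off in \<open>auto simp: indicator_def\<close>)
      then show ?thesis using elim(1) True by simp
    qed (use off in simp)
  qed
  have kE: "AE t in lborel. (\<integral>\<^sup>+x. ennreal (\<rho> (x, t) * (norm (u (x, t)))\<^sup>2) \<partial>lborel) \<le> ennreal E"
    using norm_Linf_L1_AE[OF e2] slices
  proof eventually_elim
    case (elim t)
    show ?case
    proof (cases "t \<in> {0<..<T}")
      case True
      have "(\<integral>\<^sup>+x. ennreal (\<rho> (x, t) * (norm (u (x, t)))\<^sup>2) \<partial>lborel) = (\<integral>\<^sup>+x. ennreal \<bar>\<rho>\<epsilon> (x, t) * (norm (u\<epsilon> (x, t)))\<^sup>2\<bar> \<partial>lebesgue_on \<Omega>)"
        unfolding nn_integral_lebesgue_on[OF Om] using elim(2)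
        by (intro nn_integral_cong_AE, eventually_elim) (use True off in \<open>auto simp: indicator_def\<close>)
      then show ?thesis using elim(1) True by simp
    qed (use off in simp)
  qed
  have wE: "(\<integral>\<^sup>+z. ennreal ((norm (u z))\<^sup>2 + (norm (G z))\<^sup>2) \<partial>lborel) \<le> ennreal (E\<^sup>2)"
  proof -
    have "(\<integral>\<^sup>+z. ennreal ((norm (u z))\<^sup>2 + (norm (G z))\<^sup>2) \<partial>lborel)
       = (\<integral>\<^sup>+t. \<integral>\<^sup>+x. ennreal ((norm (u (x, t)))\<^sup>2 + (norm (G (x, t)))\<^sup>2) \<partial>lborel \<partial>lborel)"
      by (rule nn_integral_R4) measurable
    also have "\<dots> = (\<integral>\<^sup>+t. (\<integral>\<^sup>+x. ennreal ((norm (u\<epsilon> (x, t)))\<^sup>2 + (norm (Du\<epsilon> (x, t)))\<^sup>2) \<partial>lebesgue_on \<Omega>) \<partial>lebesgue_on {0<..<T})"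
      unfolding nn_integral_lebesgue_on[OF I]
    proof (intro nn_integral_cong_AE, use slices in eventually_elim)
      case (elim t)
      show ?case
      proof (cases "t \<in> {0<..<T}")
        case True
        have "(\<integral>\<^sup>+x. ennreal ((norm (u (x, t)))\<^sup>2 + (norm (G (x, t)))\<^sup>2) \<partial>lborel)
          = (\<integral>\<^sup>+x. ennreal ((norm (u\<epsilon> (x, t)))\<^sup>2 + (norm (Du\<epsilon> (x, t)))\<^sup>2) \<partial>lebesgue_on \<Omega>)"
          unfolding nn_integral_lebesgue_on[OF Om] using elim
          by (intro nn_integral_cong_AE, eventually_elim) (use True off in \<open>auto simp: indicator_def\<close>)
        then show ?thesis using True by simp
      qed (use off in simp)
    qed
    finally show ?thesis using ennsqrt_le_iff[OF E] e3 unfolding norm_L2_W12_def by simp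
  qed
  have "AE t in lborel. t \<in> {0<..<T} \<longrightarrow> weak_gradient \<Omega> (\<lambda>x. u\<epsilon> (x, t)) (\<lambda>x. Du\<epsilon> (x, t))"
    using grad unfolding spatial_weak_gradient_def AE_lebesgue_on_iff[OF I] by simp
  then have weak: "AE t in lborel. t \<in> {0<..<T} \<longrightarrow> (\<forall>\<psi> i j. test_function \<Omega> \<psi> \<longrightarrow>
        (\<integral>x. indicator \<Omega> x * (u (x, t) $ i * frechet_derivative \<psi> (at x) (axis j 1)) \<partial>lborel)
        = - (\<integral>x. indicator \<Omega> x * (G (x, t) $ i $ j * \<psi> x) \<partial>lborel))"
    using slices
  proof (eventually_elim, intro impI allI)
    fix t i j and \<psi> :: "R3 \<Rightarrow> real"
    assume t: "t \<in> {0<..<T}" and \<psi>: "test_function \<Omega> \<psi>"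
      and w: "t \<in> {0<..<T} \<longrightarrow> weak_gradient \<Omega> (\<lambda>x. u\<epsilon> (x, t)) (\<lambda>x. Du\<epsilon> (x, t))"
      and sl: "AE x in lborel. (x, t) \<in> ?Q \<longrightarrow> \<rho> (x, t) = \<rho>\<epsilon> (x, t) \<and> p (x, t) = \<rho>\<epsilon> (x, t) powr (3/2) * P_eps m \<epsilon> \<rho>\<epsilon> (x, t) \<and> p (x, t) = \<bar>\<rho>\<epsilon> (x, t) powr (3/2) * P_eps m \<epsilon> \<rho>\<epsilon> (x, t)\<bar>
      \<and> \<rho>\<epsilon> (x, t) \<ge> 0 \<and> u (x, t) = u\<epsilon> (x, t) \<and> G (x, t) = Du\<epsilon> (x, t) \<and> S (x, t) = stress \<nu>1 \<nu>2 (Du\<epsilon> (x, t)) \<and> f (x, t) = f\<epsilon> (x, t)"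
    note [measurable] = test_function_measurable[OF \<psi>]
    have c [measurable]: "(\<lambda>x. (x, t)) \<in> borel_measurable borel"
      by (intro borel_measurable_continuous_onI continuous_intros)
    have [measurable]: "(\<lambda>x. u (x, t) $ i) \<in> borel_measurable borel" "(\<lambda>x. G (x, t) $ i $ j) \<in> borel_measurable borel"
      by (rule borel_measurable_continuous_on[OF _ measurable_compose[OF c um], of "\<lambda>v. v $ i"], intro continuous_intros,
          rule borel_measurable_continuous_on[OF _ measurable_compose[OF c Gm], of "\<lambda>A. A $ i $ j"], intro continuous_intros)
    have "(\<integral>x. u\<epsilon> (x, t) $ i * frechet_derivative \<psi> (at x) (axis j 1) \<partial>lebesgue_on \<Omega>)
        = (\<integral>x. indicator \<Omega> x * (u (x, t) $ i * frechet_derivative \<psi> (at x) (axis j 1)) \<partial>lborel)"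
    proof (rule integral_lebesgue_on[OF Om])
      show "AE x in lborel. x \<in> \<Omega> \<longrightarrow> indicator \<Omega> x * (u (x, t) $ i * frechet_derivative \<psi> (at x) (axis j 1))
         = u\<epsilon> (x, t) $ i * frechet_derivative \<psi> (at x) (axis j 1)"
        using sl by eventually_elim (use t in simp)
    qed (measurable, use \<Omega>(1) in simp_all)
    moreover have "(\<integral>x. Du\<epsilon> (x, t) $ i $ j * \<psi> x \<partial>lebesgue_on \<Omega>) = (\<integral>x. indicator \<Omega> x * (G (x, t) $ i $ j * \<psi> x) \<partial>lborel)"
    proof (rule integral_lebesgue_on[OF Om])
      show "AE x in lborel. x \<in> \<Omega> \<longrightarrow> indicator \<Omega> x * (G (x, t) $ i $ j * \<psi> x) = Du\<epsilon> (x, t) $ i $ j * \<psi> x"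
        using sl by eventually_elim (use t in simp)
    qed (measurable, use \<Omega>(1) in simp_all)
    ultimately show "(\<integral>x. indicator \<Omega> x * (u (x, t) $ i * frechet_derivative \<psi> (at x) (axis j 1)) \<partial>lborel)
        = - (\<integral>x. indicator \<Omega> x * (G (x, t) $ i $ j * \<psi> x) \<partial>lborel)"
      using w t \<psi> unfolding weak_gradient_def by simp
  qed
  have momentum: "(\<integral>z. \<rho> z * (u z \<bullet> dt \<xi> z) \<partial>lborel)
      + (\<integral>z. (\<rho> z *\<^sub>R tensor (u z) (u z) + p z *\<^sub>R mat 1 - S z) \<bullet> Grad_x \<xi> z \<partial>lborel)
      + (\<integral>z. \<rho> z * (f z \<bullet> \<xi> z) \<partial>lborel) = 0" if \<xi>: "test_function ?Q \<xi>" for \<xi>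
  proof -
    note [measurable] = test_function_measurable[OF \<xi>] grad_measurable(2)[OF \<xi>]
    have [measurable]: "dt \<xi> \<in> borel_measurable borel" unfolding dt_def by measurable
    have 1: "(\<integral>z. \<rho>\<epsilon> z * (u\<epsilon> z \<bullet> dt \<xi> z) \<partial>lebesgue_on ?Q) = (\<integral>z. \<rho> z * (u z \<bullet> dt \<xi> z) \<partial>lborel)"
      using all by (intro integral_lebesgue_on[OF Q], measurable, simp add: off, eventually_elim) simp
    have 2: "(\<integral>z. (\<rho>\<epsilon> z *\<^sub>R tensor (u\<epsilon> z) (u\<epsilon> z) + (\<rho>\<epsilon> z powr (3/2) * P_eps m \<epsilon> \<rho>\<epsilon> z) *\<^sub>R mat 1 - stress \<nu>1 \<nu>2 (Du\<epsilon> z)) \<bullet> Grad_x \<xi> z \<partial>lebesgue_on ?Q)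
       = (\<integral>z. (\<rho> z *\<^sub>R tensor (u z) (u z) + p z *\<^sub>R mat 1 - S z) \<bullet> Grad_x \<xi> z \<partial>lborel)"
      using all by (intro integral_lebesgue_on[OF Q], measurable, simp add: off Soff, eventually_elim) simp
    have 3: "(\<integral>z. \<rho>\<epsilon> z * (f\<epsilon> z \<bullet> \<xi> z) \<partial>lebesgue_on ?Q) = (\<integral>z. \<rho> z * (f z \<bullet> \<xi> z) \<partial>lborel)"
      using all by (intro integral_lebesgue_on[OF Q], measurable, simp add: off, eventually_elim) simp
    show ?thesis using mom[unfolded momentum_equation_def, rule_format, OF \<xi>] unfolding 1 2 3 .
  qed
  have continuity: "(\<integral>z. \<rho> z * dt \<psi> z + \<rho> z * (u z \<bullet> grad_x \<psi> z) \<partial>lborel) = 0" if \<psi>: "test_function ?Q \<psi>" for \<psi>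
  proof -
    note [measurable] = test_function_measurable[OF \<psi>] grad_measurable(1)[OF \<psi>]
    have [measurable]: "dt \<psi> \<in> borel_measurable borel" unfolding dt_def by measurable
    have "(\<integral>z. \<rho>\<epsilon> z * dt \<psi> z + \<rho>\<epsilon> z * (u\<epsilon> z \<bullet> grad_x \<psi> z) \<partial>lebesgue_on ?Q) = (\<integral>z. \<rho> z * dt \<psi> z + \<rho> z * (u z \<bullet> grad_x \<psi> z) \<partial>lborel)"
      using all by (intro integral_lebesgue_on[OF Q], measurable, simp add: off, eventually_elim) simp
    then show ?thesis using cont \<psi> unfolding continuity_equation_def by simp
  qed
  show thesis
  proof (rule that)
    show "weak_flow \<Omega> T E F (2 * \<bar>\<nu>1\<bar> + 4 * \<bar>\<nu>2\<bar>) lam \<rho> p u f S G"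
    proof (rule weak_flow.intro[OF \<Omega> T E _ lam meas(1,2) um meas(3,4) Gm off rho p(1) _ _ pE kE wE weak momentum continuity])
      show "norm (f z) \<le> F" for z using F by (simp add: f_def)
      show "norm (S z) \<le> (2 * \<bar>\<nu>1\<bar> + 4 * \<bar>\<nu>2\<bar>) * norm (G z)" for z unfolding S_def by (rule norm_stress_le)
    qed simp_all
    show "AE z in lborel. z \<in> ?Q \<longrightarrow> \<rho> z = \<rho>\<epsilon> z" using all by eventually_elim simp
  qed
qed

text \<open>The power 3/2 of l^4 is l^6: two powers form the weight \<open>l\<^sup>2\<close> of the
  doubled estimate, and the other four are bounded by \<open>L\<close>.\<close>

lemma powr_three_halves_le:
  fixes l r p :: real
  assumes "0 \<le> l" "l \<le> L" "0 \<le> r" "r powr (3/2) \<le> p"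
  shows "(l ^ 4 * r) powr (3/2) \<le> L ^ 4 * (l\<^sup>2 * p)"
proof (cases "l = 0")
  case False
  then have "l > 0" using assms(1) by simp
  have "(l ^ 4) powr (3/2) = (l powr 4) powr (3/2)" using powr_realpow[OF \<open>l > 0\<close>, of 4] by simp
  also have "\<dots> = l powr 6" by (simp add: powr_powr)
  also have "\<dots> = l ^ 6" using powr_realpow[OF \<open>l > 0\<close>, of 6] by simp
  also have "\<dots> = l ^ 4 * l\<^sup>2" using power_add[of l 4 2] by simp
  finally have "(l ^ 4) powr (3/2) = l ^ 4 * l\<^sup>2" .
  then have "(l ^ 4 * r) powr (3/2) = l ^ 4 * (l\<^sup>2 * r powr (3/2))"
    using assms(1,3) by (simp add: powr_mult)
  also have "\<dots> \<le> L ^ 4 * (l\<^sup>2 * p)"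
    using assms by (intro mult_mono[OF power_mono mult_left_mono]) auto
  finally show ?thesis .
qed simp

theorem proposition4p4:
  fixes \<Omega> :: "R3 set" and T \<nu>1 \<nu>2 E F \<mu> :: real
    and K :: "R4 set" and lam :: "R4 \<Rightarrow> real"
  assumes "bounded_C2_domain \<Omega>" and "T > 0"
    and "\<nu>1 > 0" and "\<nu>1 + \<nu>2 \<ge> 0"
    and "E \<ge> 0" and "F \<ge> 0"
    and "compact K" and "K \<subseteq> cylinder \<Omega> T"
    and "test_function (cylinder \<Omega> T) lam" and "\<And>z. lam z \<ge> 0"
    and "\<exists>U. open U \<and> K \<subseteq> U \<and> (\<forall>z\<in>U. lam z = 1)"
    and "0 < \<mu>" and "\<mu> < 4/3"
  shows "\<exists>c>0. \<forall>m \<epsilon> (f :: R4 \<Rightarrow> R3) (\<rho>\<epsilon> :: R4 \<Rightarrow> real) (u\<epsilon> :: R4 \<Rightarrow> R3) (Du\<epsilon> :: R4 \<Rightarrow> real^3^3).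
      m > 1 \<longrightarrow> 0 < \<epsilon> \<longrightarrow> \<epsilon> \<le> 1 \<longrightarrow>
      f \<in> borel_measurable (lebesgue_on (cylinder \<Omega> T)) \<longrightarrow>
      norm_Linf (cylinder \<Omega> T) f = ennreal F \<longrightarrow>
      \<rho>\<epsilon> \<in> borel_measurable (lebesgue_on (cylinder \<Omega> T)) \<longrightarrow>
      (AE z in lebesgue_on (cylinder \<Omega> T). \<rho>\<epsilon> z \<ge> 0) \<longrightarrow>
      spatial_weak_gradient \<Omega> T u\<epsilon> Du\<epsilon> \<longrightarrow>
      energy_bound \<Omega> T m \<epsilon> E \<rho>\<epsilon> u\<epsilon> Du\<epsilon> \<longrightarrow>
      momentum_equation \<Omega> T \<nu>1 \<nu>2 m \<epsilon> f \<rho>\<epsilon> u\<epsilon> Du\<epsilon> \<longrightarrow>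
      continuity_equation \<Omega> T \<rho>\<epsilon> u\<epsilon> \<longrightarrow>
      (let \<rho> = localized_density \<Omega> T lam \<rho>\<epsilon> in
        (\<integral>\<^sup>+(x, t). ennreal (\<rho> (x, t) powr (3/2)) *
            (\<integral>\<^sup>+y. ennreal ((\<bar>ln (norm (x - y))\<bar> powr \<mu> + 1) / norm (x - y) * \<rho> (y, t)) \<partial>lebesgue)
          \<partial>lebesgue) \<le> ennreal c)"
proof -
  let ?Q = "cylinder \<Omega> T"
  have \<Omega>: "open \<Omega>" "bounded \<Omega>" using assms(1) by (auto simp: bounded_C2_domain_def)
  note T = \<open>T > 0\<close> and E = \<open>E \<ge> 0\<close> and F = \<open>F \<ge> 0\<close> and lam = \<open>test_function ?Q lam\<close> and \<mu> = \<open>0 < \<mu>\<close> \<open>\<mu> < 4/3\<close>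
  have "0 \<le> 2 * \<bar>\<nu>1\<bar> + 4 * \<bar>\<nu>2\<bar>" by simp
  from weak_flow_potential_bound[OF \<Omega> T E F this lam \<mu>] obtain B where B: "B \<ge> 0"
    and bound: "\<forall>\<rho> p u f S G. weak_flow \<Omega> T E F (2 * \<bar>\<nu>1\<bar> + 4 * \<bar>\<nu>2\<bar>) lam \<rho> p u f S G \<longrightarrow>
      (\<integral>\<^sup>+z. \<integral>\<^sup>+y. ennreal (((lam z)\<^sup>2 * p z) * ((lam (y, snd z))\<^sup>2 * \<rho> (y, snd z)) * ker \<mu> ((fst z - y) \<bullet> (fst z - y))) \<partial>lborel \<partial>lborel) \<le> ennreal B"
    by (elim exE conjE)
  from test_function_bounded[OF lam, of 0] obtain L where L: "L > 0" "\<And>z. \<bar>lam z\<bar> \<le> L"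
    unfolding real_norm_def by blast
  obtain R0 where R0: "R0 > 0" "\<And>x. x \<in> \<Omega> \<Longrightarrow> norm x \<le> R0" using \<Omega>(2) bounded_pos by blast
  have R: "norm (x - y) \<le> 2 * R0" if "x \<in> \<Omega>" "y \<in> \<Omega>" for x y
    using norm_triangle_ineq4[of x y] R0(2)[OF that(1)] R0(2)[OF that(2)] by linarith
  have "2 * R0 > 0" using R0 by simp
  from log_kernel_le_ker[OF this \<mu>(1)] obtain C where C: "C > 0"
    "\<And>r. 0 < r \<Longrightarrow> r \<le> 2 * R0 \<Longrightarrow> (\<bar>ln r\<bar> powr \<mu> + 1) / r \<le> C * ker \<mu> (r\<^sup>2)" by auto
  define k where "k = (\<lambda>x y :: R3. (\<bar>ln (norm (x - y))\<bar> powr \<mu> + 1) / norm (x - y))"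
  define w where "w = (\<lambda>x y :: R3. ker \<mu> ((x - y) \<bullet> (x - y)))"
  have k0: "k x y \<ge> 0" for x y unfolding k_def by (intro divide_nonneg_nonneg add_nonneg_nonneg) auto
  have w0: "w x y \<ge> 0" for x y unfolding w_def by (simp add: ker_def)
  have kw: "k x y \<le> C * w x y" if "x \<in> \<Omega>" "y \<in> \<Omega>" for x y
  proof (cases "x = y")
    case False
    then show ?thesis using C(2)[of "norm (x - y)"] R[OF that] by (simp add: k_def w_def power2_norm_eq_inner)
  qed (use C(1) w0 in \<open>simp add: k_def\<close>)
  have wm [measurable]: "(\<lambda>s. w (a s) (b s)) \<in> borel_measurable N"
    if "a \<in> borel_measurable N" "b \<in> borel_measurable N" for N :: "'s measure" and a b
  proof -
    note [measurable] = that
    show ?thesis unfolding w_def by measurable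
  qed
  have m4 [measurable]: "(\<lambda>s. g (a s, b s)) \<in> borel_measurable N"
    if "g \<in> borel_measurable borel" "a \<in> borel_measurable N" "b \<in> borel_measurable N"
    for g :: "R4 \<Rightarrow> real" and N :: "'s measure" and a b
    by (rule measurable_compose[OF borel_measurable_Pair[OF that(2,3)] that(1)])
  \<comment> \<open>Six powers of \<open>L\<close>: four from \<open>powr_three_halves_le\<close> at
    \<open>z\<close>, and two from lowering the factor \<open>lam ^ 4\<close> inside the potential
    to \<open>lam\<^sup>2\<close>. The summand 1 makes \<open>c\<close> positive.\<close>
  define c where "c = C * L ^ 6 * B + 1"
  have "c > 0" unfolding c_def using C(1) L(1) B by (simp add: add_nonneg_pos)
  then show ?thesis
  proof (intro exI[of _ c] conjI allI impI)
    fix m \<epsilon> :: real and f\<epsilon> :: "R4 \<Rightarrow> R3" and \<rho>\<epsilon> :: "R4 \<Rightarrow> real" and u\<epsilon> :: "R4 \<Rightarrow> R3" and Du\<epsilon> :: "R4 \<Rightarrow> real^3^3"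
    assume \<epsilon>: "0 < \<epsilon>" and fm: "f\<epsilon> \<in> borel_measurable (lebesgue_on ?Q)" and fF: "norm_Linf ?Q f\<epsilon> = ennreal F"
      and rm: "\<rho>\<epsilon> \<in> borel_measurable (lebesgue_on ?Q)" and r0: "AE z in lebesgue_on ?Q. \<rho>\<epsilon> z \<ge> 0"
      and sol: "spatial_weak_gradient \<Omega> T u\<epsilon> Du\<epsilon>" "energy_bound \<Omega> T m \<epsilon> E \<rho>\<epsilon> u\<epsilon> Du\<epsilon>"
        "momentum_equation \<Omega> T \<nu>1 \<nu>2 m \<epsilon> f\<epsilon> \<rho>\<epsilon> u\<epsilon> Du\<epsilon>" "continuity_equation \<Omega> T \<rho>\<epsilon> u\<epsilon>"
    obtain \<rho> p u f S G where wf: "weak_flow \<Omega> T E F (2 * \<bar>\<nu>1\<bar> + 4 * \<bar>\<nu>2\<bar>) lam \<rho> p u f S G"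
      and eq: "AE z in lborel. z \<in> ?Q \<longrightarrow> \<rho> z = \<rho>\<epsilon> z"
      using weak_flow_representative[OF \<Omega> T E F lam \<epsilon> fm eq_refl[OF fF] rm r0 sol] .
    have [measurable]: "\<rho> \<in> borel_measurable borel" "p \<in> borel_measurable borel"
      using weak_flow.m(1,2)[OF wf] by simp_all
    note [measurable] = test_function_measurable(1)[OF lam]
    have \<rho>: "\<rho> z \<ge> 0" "\<rho> z powr (3/2) \<le> p z" for z using weak_flow.rho[OF wf] by auto
    have p0: "p z \<ge> 0" for z using \<rho>(2)[of z] powr_ge_zero order_trans by blast
    define l where "l = localized_density \<Omega> T lam \<rho>\<epsilon>"
    have leq: "AE z in lborel. l z = lam z ^ 4 * \<rho> z"
      using eq
    proof eventually_elim
      case (elim z)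
      show ?case
      proof (cases "z \<in> ?Q")
        case True
        then show ?thesis using elim unfolding l_def localized_density_def zero_ext_def by simp
      next
        case False
        then show ?thesis
          using test_function_zero[OF lam False] unfolding l_def localized_density_def zero_ext_def by simp
      qed
    qed
    define J where "J = (\<lambda>z. \<integral>\<^sup>+y. ennreal (((lam z)\<^sup>2 * p z) * ((lam (y, snd z))\<^sup>2 * \<rho> (y, snd z)) * w (fst z) y) \<partial>lborel)"
    have "(\<lambda>z. J z) \<in> borel_measurable lborel" unfolding J_def by measurable
    then have Jm: "J \<in> borel_measurable lborel" by simp
    have "(\<integral>\<^sup>+(x, t). ennreal (l (x, t) powr (3/2)) * (\<integral>\<^sup>+y. ennreal (k x y * l (y, t)) \<partial>lebesgue) \<partial>lebesgue)
        = (\<integral>\<^sup>+(x, t). ennreal (l (x, t) powr (3/2)) * (\<integral>\<^sup>+y. ennreal (k x y * l (y, t)) \<partial>lborel) \<partial>lborel)"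
      by (simp only: nn_integral_completion)
    also have "\<dots> \<le> (\<integral>\<^sup>+z. ennreal (C * L ^ 6) * J z \<partial>lborel)"
    proof (rule nn_integral_mono_AE)
      show "AE z in lborel. (case z of (x, t) \<Rightarrow> ennreal (l (x, t) powr (3/2)) * (\<integral>\<^sup>+y. ennreal (k x y * l (y, t)) \<partial>lborel)) \<le> ennreal (C * L ^ 6) * J z"
        \<comment> \<open>The inner integral runs over the time slice through \<open>z\<close>, so
          the formula for \<open>l\<close> is needed also at almost every \<open>y\<close> at that
          time.\<close>
        using leq AE_lborel_snd[OF AE_lborel_slice[OF leq]]
      proof eventually_elim
        case (elim z)
        obtain x t where z: "z = (x, t)" by fastforce
        show ?case
        proof (cases "z \<in> ?Q")
          case False
          then have "l (x, t) = 0" unfolding z l_def localized_density_def zero_ext_def by auto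
          then show ?thesis unfolding z by simp
        next
          case True
          then have x: "x \<in> \<Omega>" by (simp add: z)
          have "(\<integral>\<^sup>+y. ennreal (k x y * l (y, t)) \<partial>lborel)
              \<le> (\<integral>\<^sup>+y. ennreal (C * L\<^sup>2) * ennreal (((lam (y, t))\<^sup>2 * \<rho> (y, t)) * w x y) \<partial>lborel)"
            using elim(2) unfolding z snd_conv
          proof (intro nn_integral_mono_AE, eventually_elim)
            case (elim y)
            have "k x y * l (y, t) \<le> C * L\<^sup>2 * (((lam (y, t))\<^sup>2 * \<rho> (y, t)) * w x y)"
            proof (cases "y \<in> \<Omega>")
              case False
              then show ?thesis using test_function_zero[OF lam, of "(y, t)"] by (simp add: elim)
            next
              case True
              have "(lam (y, t))\<^sup>2 \<le> L\<^sup>2" using power_mono[OF L(2)[of "(y, t)"], of 2] by simp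
              then have "(lam (y, t))\<^sup>2 * ((lam (y, t))\<^sup>2 * \<rho> (y, t)) \<le> L\<^sup>2 * ((lam (y, t))\<^sup>2 * \<rho> (y, t))"
                using \<rho>(1) by (intro mult_right_mono) auto
              then have "l (y, t) \<le> L\<^sup>2 * ((lam (y, t))\<^sup>2 * \<rho> (y, t))"
                unfolding elim by (simp add: power2_eq_square power4_eq_xxxx mult.assoc)
              then have "k x y * l (y, t) \<le> C * w x y * (L\<^sup>2 * ((lam (y, t))\<^sup>2 * \<rho> (y, t)))"
                by (rule mult_mono[OF kw[OF x True]]) (use C(1) w0 \<rho>(1) in \<open>auto simp: elim\<close>)
              then show ?thesis by (simp add: mult_ac)
            qed
            then have "ennreal (k x y * l (y, t)) \<le> ennreal (C * L\<^sup>2 * (((lam (y, t))\<^sup>2 * \<rho> (y, t)) * w x y))"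
              by (rule ennreal_leI)
            also have "\<dots> = ennreal (C * L\<^sup>2) * ennreal (((lam (y, t))\<^sup>2 * \<rho> (y, t)) * w x y)"
              by (rule ennreal_mult') (use C(1) in simp)
            finally show ?case .
          qed
          also have "\<dots> = ennreal (C * L\<^sup>2) * (\<integral>\<^sup>+y. ennreal (((lam (y, t))\<^sup>2 * \<rho> (y, t)) * w x y) \<partial>lborel)"
            by (rule nn_integral_cmult) measurable
          finally have 1: "(\<integral>\<^sup>+y. ennreal (k x y * l (y, t)) \<partial>lborel) \<le> \<dots>" .
          have 2: "ennreal (l z powr (3/2)) \<le> ennreal (L ^ 4 * ((lam z)\<^sup>2 * p z))"
            unfolding elim(1) using assms(10)[of z] L(2)[of z] \<rho>[of z] by (intro ennreal_leI powr_three_halves_le) auto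
          have "ennreal (l z powr (3/2)) * (\<integral>\<^sup>+y. ennreal (k x y * l (y, t)) \<partial>lborel)
             \<le> ennreal (L ^ 4 * ((lam z)\<^sup>2 * p z)) * (ennreal (C * L\<^sup>2) * (\<integral>\<^sup>+y. ennreal (((lam (y, t))\<^sup>2 * \<rho> (y, t)) * w x y) \<partial>lborel))"
            by (rule mult_mono[OF 2 1]) auto
          also have "\<dots> = ennreal (C * L ^ 6) * (ennreal ((lam z)\<^sup>2 * p z) * (\<integral>\<^sup>+y. ennreal (((lam (y, t))\<^sup>2 * \<rho> (y, t)) * w x y) \<partial>lborel))"
          proof -
            have "ennreal (C * L ^ 6) = ennreal (L ^ 4) * ennreal (C * L\<^sup>2)"
              using C(1) L(1) by (simp add: ennreal_mult[symmetric] power_add[of L 4 2, simplified])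
            moreover have "ennreal (L ^ 4 * ((lam z)\<^sup>2 * p z)) = ennreal (L ^ 4) * ennreal ((lam z)\<^sup>2 * p z)"
              using L(1) by (intro ennreal_mult') simp
            ultimately show ?thesis by (simp only: mult_ac)
          qed
          also have "ennreal ((lam z)\<^sup>2 * p z) * (\<integral>\<^sup>+y. ennreal (((lam (y, t))\<^sup>2 * \<rho> (y, t)) * w x y) \<partial>lborel)
              = (\<integral>\<^sup>+y. ennreal ((lam z)\<^sup>2 * p z) * ennreal (((lam (y, t))\<^sup>2 * \<rho> (y, t)) * w x y) \<partial>lborel)"
            by (rule nn_integral_cmult[symmetric]) measurable
          also have "\<dots> = J z"
            unfolding J_def z fst_conv snd_conv using p0[of "(x, t)"]
            by (intro nn_integral_cong) (simp add: ennreal_mult'[symmetric] mult.assoc)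
          finally show ?thesis unfolding z by simp
        qed
      qed
    qed
    also have "\<dots> = ennreal (C * L ^ 6) * (\<integral>\<^sup>+z. J z \<partial>lborel)" by (rule nn_integral_cmult[OF Jm])
    also have "\<dots> \<le> ennreal (C * L ^ 6) * ennreal B"
      using bound[rule_format, OF wf] unfolding J_def w_def by (rule mult_left_mono) simp
    also have "\<dots> \<le> ennreal c"
      using C(1) L(1) B unfolding c_def by (simp add: ennreal_mult'[symmetric] ennreal_leI)
    finally show "let \<rho> = localized_density \<Omega> T lam \<rho>\<epsilon> in
        (\<integral>\<^sup>+(x, t). ennreal (\<rho> (x, t) powr (3/2)) *
            (\<integral>\<^sup>+y. ennreal ((\<bar>ln (norm (x - y))\<bar> powr \<mu> + 1) / norm (x - y) * \<rho> (y, t)) \<partial>lebesgue)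
          \<partial>lebesgue) \<le> ennreal c"
      unfolding Let_def l_def k_def .
  qed
qed

end
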